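(* Let $(M,g)$ be either (i) a revolution manifold with boundary, of dimension $n\ge2$, endowed with the densities $\sigma_j(r)=e^{-jr^2}$; or (ii) a closed revolution manifold of dimension $n\ge2$, endowed with the densities $\sigma_j(r)=e^{-j\,h_j(r)^2}$, where $\alpha\ge1$ is a fixed number with $\frac{(n-1)\alpha^2}{16}-2\alpha R\ge2$, $r_j=R-\frac1{\alpha j}$, $h_j(r)=r$ for $0\le r\le r_j$ and $h_j(r)=r-\frac{\alpha j}{2}(r-r_j)^2$ for $r_j\le r\le R$. Then there are positive constants $A$ and $B$, depending on $M$ but not on $j$, such that for all sufficiently large integers $j$, $$A\,\frac{\Vert\sigma_j\Vert_{\frac n{n-2}}}{\Vert\sigma_j\Vert_1}\le\lambda_2(L_{\sigma_j})\le B\,\frac{\Vert\sigma_j\Vert_{\frac n{n-2}}}{\Vert\sigma_j\Vert_1}.$$ Moreover, $\lambda_2(L_{\sigma_j})$ tends to infinity with a linear growth as $j\to\infty$.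
   Context: A revolution manifold with boundary of dimension $n$ is a Riemannian manifold $(M,g)$ with a distinguished point $N$ such that $(M\setminus\{N\},g)$ is isometric to $(0,R]\times\mathbb S^{n-1}$ with the metric $dr^2+\theta^2(r)g_{\mathbb S^{n-1}}$, where $0<R<\infty$, $g_{\mathbb S^{n-1}}$ is the standard metric, and $\theta$ is smooth on $[0,R]$, positive on $(0,R]$, with $\theta(0)=\theta''(0)=0$, $\theta'(0)=1$. A closed revolution manifold of dimension $n$ is a compact Riemannian manifold $(M,g)$ without boundary, with two distinguished points $N,S$ such that $(M\setminus\{N,S\},g)$ is isometric to $(0,R)\times\mathbb S^{n-1}$ with metric $dr^2+\theta^2(r)g_{\mathbb S^{n-1}}$, where $\theta:[0,R]\to\mathbb R$ is smooth, positive on $(0,R)$, with $\theta(0)=\theta(R)=0$, $\theta'(0)=-\theta'(R)=1$, $\theta''(0)=\theta''(R)=0$. In both cases $N$ corresponds to $r=0$. For a positive density $\sigma=e^{-f}$, $L_\sigma=\Delta_g+\nabla f\cdot\nabla$ with $\Delta_g=-\mathrm{div}_g\nabla$, with Neumann boundary conditions if $\partial M\neq\emptyset$; it is self-adjoint on $L^2(\sigma\,dv_g)$ with eigenvalues $0=\lambda_1(L_\sigma)<\lambda_2(L_\sigma)\le\cdots$; equivalently $\lambda_k(L_\sigma)$ is the min-max over $k$-dimensional subspaces of $H^1(M)$ of $\int_M|\nabla u|^2\sigma\,dv_g/\int_Mu^2\sigma\,dv_g$. $\Vert\cdot\Vert_p$ is the $L^p$ norm with respect to $dv_g$, with the convention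 $\Vert\sigma\Vert_{\frac n{n-2}}=\Vert\sigma\Vert_\infty$ if $n=2$. "Linear growth" means that $\lambda_2(L_{\sigma_j})$ is bounded between two positive constant multiples of $j$ (constants independent of $j$) for all large $j$. *)

theory Defs
  imports "HOL-Analysis.Analysis" "HOL-Probability.Essential_Supremum"
begin

section \<open>Smooth functions\<close>

text \<open>The set \<^term>\<open>U\<close> is meant to be open here.\<close>

primrec Ck_on :: "nat \<Rightarrow> 'a::euclidean_space set \<Rightarrow> ('a \<Rightarrow> 'b::real_normed_vector) \<Rightarrow> bool" where
  "Ck_on 0 U f \<longleftrightarrow> continuous_on U f"
| "Ck_on (Suc k) U f \<longleftrightarrow> (\<forall>x\<in>U. f differentiable at x) \<and>
     (\<forall>v. Ck_on k U (\<lambda>x. frechet_derivative f (at x) v))"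

text \<open>On a set that need not be open, smoothness means that the function extends, locally
  around every point of the set, to a smooth function on an open set.\<close>

definition smooth_on :: "'a::euclidean_space set \<Rightarrow> ('a \<Rightarrow> 'b::real_normed_vector) \<Rightarrow> bool" where
  "smooth_on S f \<longleftrightarrow> (\<forall>x\<in>S. \<exists>U F. open U \<and> x \<in> U \<and> (\<forall>k. Ck_on k U F) \<and> (\<forall>y\<in>S \<inter> U. F y = f y))"


section \<open>Riemannian manifolds with boundary\<close>

text \<open>The dimension of the manifold is \<^term>\<open>CARD('n)\<close>. A chart carries its domain, its coordinate
  map, and the matrix \<open>(g\<^sub>i\<^sub>j)\<close> of the metric as a function of the coordinates.\<close>

record ('p, 'n) rchart =
  cdom :: "'p set"
  coord :: "'p \<Rightarrow> real^'n"
  gmat :: "real^'n \<Rightarrow> real^'n^'n"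

abbreviation cimg :: "('p, 'n::finite) rchart \<Rightarrow> (real^'n) set" where
  "cimg c \<equiv> coord c ` cdom c"

definition cinv :: "('p, 'n::finite) rchart \<Rightarrow> real^'n \<Rightarrow> 'p" where
  "cinv c = inv_into (cdom c) (coord c)"

text \<open>The image of a chart is relatively open in a closed half-space \<open>{x. a \<bullet> x \<le> b}\<close>.
  The choice \<open>a = 0\<close>, \<open>b = 0\<close> gives the whole space, i.e. the interior charts.\<close>

definition is_rchart :: "'p::topological_space set \<Rightarrow> ('p, 'n::finite) rchart \<Rightarrow> bool" where
  "is_rchart M c \<longleftrightarrow>
     openin (top_of_set M) (cdom c) \<and>
     (\<exists>a b. openin (top_of_set {x. a \<bullet> x \<le> b}) (cimg c)) \<and>
     homeomorphism (cdom c) (cimg c) (coord c) (cinv c) \<and>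
     smooth_on (cimg c) (gmat c) \<and>
     (\<forall>x\<in>cimg c. transpose (gmat c x) = gmat c x \<and> (\<forall>v. v \<noteq> 0 \<longrightarrow> 0 < v \<bullet> (gmat c x *v v)))"

definition rcompatible :: "('p, 'n::finite) rchart \<Rightarrow> ('p, 'n) rchart \<Rightarrow> bool" where
  "rcompatible c c' \<longleftrightarrow>
     (let S = coord c ` (cdom c \<inter> cdom c'); \<tau> = coord c' \<circ> cinv c in
        smooth_on S \<tau> \<and>
        (\<forall>x\<in>S. \<forall>D. (\<tau> has_derivative D) (at x within S) \<longrightarrow>
           (\<forall>v w. v \<bullet> (gmat c x *v w) = D v \<bullet> (gmat c' (\<tau> x) *v D w))))"

definition riemannian_atlas :: "'p::topological_space set \<Rightarrow> ('p, 'n::finite) rchart set \<Rightarrow> bool" where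
  "riemannian_atlas M \<A> \<longleftrightarrow>
     (\<Union>c\<in>\<A>. cdom c) = M \<and> (\<forall>c\<in>\<A>. is_rchart M c) \<and> (\<forall>c\<in>\<A>. \<forall>c'\<in>\<A>. rcompatible c c')"

text \<open>The manifold is given by a subset \<^term>\<open>M\<close> of a second countable Hausdorff space and a
  maximal atlas, so that the smooth structure and the metric are both recorded in \<^term>\<open>\<A>\<close>.\<close>

definition riemannian_manifold ::
    "'p::{t2_space, second_countable_topology} set \<Rightarrow> ('p, 'n::finite) rchart set \<Rightarrow> bool" where
  "riemannian_manifold M \<A> \<longleftrightarrow>
     riemannian_atlas M \<A> \<and> (\<forall>c. riemannian_atlas M (insert c \<A>) \<longrightarrow> c \<in> \<A>)"

definition without_boundary :: "('p, 'n::finite) rchart set \<Rightarrow> bool" where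
  "without_boundary \<A> \<longleftrightarrow> (\<forall>c\<in>\<A>. open (cimg c))"

text \<open>The Riemannian measure \<open>dv\<^sub>g\<close> is the unique Borel measure on \<^term>\<open>M\<close> that has density
  \<open>sqrt (det (g\<^sub>i\<^sub>j))\<close> with respect to Lebesgue measure in every chart.\<close>

definition riemannian_volume ::
    "'p::topological_space set \<Rightarrow> ('p, 'n::finite) rchart set \<Rightarrow> 'p measure \<Rightarrow> bool" where
  "riemannian_volume M \<A> \<mu> \<longleftrightarrow>
     space \<mu> = M \<and> sets \<mu> = sets (restrict_space borel M) \<and>
     (\<forall>c\<in>\<A>. distr (restrict_space \<mu> (cdom c)) borel (coord c) =
        density lborel (\<lambda>x. indicator (cimg c) x * ennreal (sqrt (det (gmat c x)))))"

definition smooth_fun :: "('p, 'n::finite) rchart set \<Rightarrow> ('p \<Rightarrow> real) \<Rightarrow> bool" where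
  "smooth_fun \<A> u \<longleftrightarrow> (\<forall>c\<in>\<A>. smooth_on (cimg c) (u \<circ> cinv c))"

text \<open>Components \<open>g\<^sup>i\<^sup>j \<partial>\<^sub>j u\<close> of the gradient in the chart \<^term>\<open>c\<close> at the point with
  coordinates \<^term>\<open>x\<close> (one-sided derivatives at the boundary).\<close>

definition grad_coord :: "('p, 'n::finite) rchart \<Rightarrow> ('p \<Rightarrow> real) \<Rightarrow> real^'n \<Rightarrow> real^'n" where
  "grad_coord c u x =
     matrix_inv (gmat c x) *v
       (\<chi> i. frechet_derivative (u \<circ> cinv c) (at x within cimg c) (axis i 1))"

text \<open>\<open>|\<nabla>u|\<^sup>2\<close> at the point \<^term>\<open>p\<close>; it does not depend on the chart chosen around \<^term>\<open>p\<close>.\<close>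

definition grad_norm_sq :: "('p, 'n::finite) rchart set \<Rightarrow> ('p \<Rightarrow> real) \<Rightarrow> 'p \<Rightarrow> real" where
  "grad_norm_sq \<A> u p =
     (let c = (SOME c. c \<in> \<A> \<and> p \<in> cdom c); x = coord c p; X = grad_coord c u x
      in X \<bullet> (gmat c x *v X))"


section \<open>The Sobolev space and the eigenvalues\<close>

text \<open>\<open>H\<^sup>1(M)\<close>, for compact \<^term>\<open>M\<close>, is the completion of the smooth functions on \<^term>\<open>M\<close>
  (up to the boundary) for the norm \<open>(\<integral> u\<^sup>2 + |\<nabla>u|\<^sup>2)\<^sup>1\<^sup>/\<^sup>2\<close>. An element is represented by its
  limit \<^term>\<open>u\<close> in \<open>L\<^sup>2(M)\<close> together with a Cauchy sequence \<^term>\<open>v\<close> of smooth functions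
  converging to it; the sequence determines the gradient of \<^term>\<open>u\<close> as the limit of the \<open>\<nabla>v\<^sub>m\<close>.\<close>

definition H1 ::
    "('p, 'n::finite) rchart set \<Rightarrow> 'p measure \<Rightarrow> (('p \<Rightarrow> real) \<times> (nat \<Rightarrow> 'p \<Rightarrow> real)) set" where
  "H1 \<A> \<mu> = {(u, v).
     u \<in> borel_measurable \<mu> \<and> integrable \<mu> (\<lambda>p. (u p)\<^sup>2) \<and>
     (\<forall>m. smooth_fun \<A> (v m)) \<and>
     (\<lambda>m. \<integral>p. (v m p - u p)\<^sup>2 \<partial>\<mu>) \<longlonglongrightarrow> 0 \<and>
     (\<forall>\<epsilon>>0. \<exists>m0. \<forall>m\<ge>m0. \<forall>l\<ge>m0. (\<integral>p. grad_norm_sq \<A> (\<lambda>q. v m q - v l q) p \<partial>\<mu>) < \<epsilon>)}"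

text \<open>\<open>\<integral>|\<nabla>u|\<^sup>2\<sigma> dv\<^sub>g / \<integral>u\<^sup>2\<sigma> dv\<^sub>g\<close> for the element \<open>(u, v)\<close> of \<open>H\<^sup>1(M)\<close>.\<close>

definition rayleigh ::
    "('p, 'n::finite) rchart set \<Rightarrow> 'p measure \<Rightarrow> ('p \<Rightarrow> real) \<Rightarrow>
       ('p \<Rightarrow> real) \<times> (nat \<Rightarrow> 'p \<Rightarrow> real) \<Rightarrow> real" where
  "rayleigh \<A> \<mu> \<sigma> = (\<lambda>(u, v).
     lim (\<lambda>m. \<integral>p. grad_norm_sq \<A> (v m) p * \<sigma> p \<partial>\<mu>) / (\<integral>p. (u p)\<^sup>2 * \<sigma> p \<partial>\<mu>))"

definition lin_comb ::
    "nat \<Rightarrow> (nat \<Rightarrow> real) \<Rightarrow> (nat \<Rightarrow> ('p \<Rightarrow> real) \<times> (nat \<Rightarrow> 'p \<Rightarrow> real)) \<Rightarrow>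
       ('p \<Rightarrow> real) \<times> (nat \<Rightarrow> 'p \<Rightarrow> real)" where
  "lin_comb k a w = (\<lambda>p. \<Sum>i<k. a i * fst (w i) p, \<lambda>m p. \<Sum>i<k. a i * snd (w i) m p)"

text \<open>The \<^term>\<open>k\<close>-dimensional subspaces of \<open>H\<^sup>1(M)\<close> are given by bases
  \<open>w 0, \<dots>, w (k - 1)\<close>, i.e. families that are linearly independent up to null sets.\<close>

definition H1_basis ::
    "('p, 'n::finite) rchart set \<Rightarrow> 'p measure \<Rightarrow> nat \<Rightarrow>
       (nat \<Rightarrow> ('p \<Rightarrow> real) \<times> (nat \<Rightarrow> 'p \<Rightarrow> real)) \<Rightarrow> bool" where
  "H1_basis \<A> \<mu> k w \<longleftrightarrow>
     (\<forall>i<k. w i \<in> H1 \<A> \<mu>) \<and>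
     (\<forall>a. (AE p in \<mu>. fst (lin_comb k a w) p = 0) \<longrightarrow> (\<forall>i<k. a i = 0))"

text \<open>\<open>\<lambda>\<^sub>k(L\<^sub>\<sigma>)\<close>, numbered from \<open>k = 1\<close>.\<close>

definition eigenvalue ::
    "('p, 'n::finite) rchart set \<Rightarrow> 'p measure \<Rightarrow> ('p \<Rightarrow> real) \<Rightarrow> nat \<Rightarrow> real" where
  "eigenvalue \<A> \<mu> \<sigma> k =
     (INF w\<in>{w. H1_basis \<A> \<mu> k w}.
        SUP a\<in>{a. \<exists>i<k. a i \<noteq> 0}. rayleigh \<A> \<mu> \<sigma> (lin_comb k a w))"

definition Lp_norm :: "real \<Rightarrow> 'p measure \<Rightarrow> ('p \<Rightarrow> real) \<Rightarrow> real" where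
  "Lp_norm q \<mu> f = (\<integral>p. \<bar>f p\<bar> powr q \<partial>\<mu>) powr (1 / q)"

definition Linf_norm :: "'p measure \<Rightarrow> ('p \<Rightarrow> real) \<Rightarrow> real" where
  "Linf_norm \<mu> f = real_of_ereal (esssup \<mu> (\<lambda>p. ereal \<bar>f p\<bar>))"

definition crit_norm :: "nat \<Rightarrow> 'p measure \<Rightarrow> ('p \<Rightarrow> real) \<Rightarrow> real" where
  "crit_norm n \<mu> f = (if n = 2 then Linf_norm \<mu> f else Lp_norm (real n / (real n - 2)) \<mu> f)"


section \<open>Revolution manifolds\<close>

abbreviation cyl :: "real set \<Rightarrow> (real \<times> (real^'n::finite)) set" where
  "cyl I \<equiv> I \<times> sphere 0 1"

text \<open>\<^term>\<open>\<Phi>\<close> is an isometry of \<open>I \<times> S\<^sup>n\<^sup>-\<^sup>1\<close>, with the metric \<open>dr\<^sup>2 + \<theta>(r)\<^sup>2 g\<^sub>S\<close>, onto the part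
  \<^term>\<open>P\<close> of the manifold. The sphere is the unit sphere of \<open>\<real>\<^sup>n\<close>; the tangent vectors of the
  product at \<open>(r, \<omega>)\<close> are the pairs \<open>(s, w)\<close> with \<open>w \<bullet> \<omega> = 0\<close>. The derivative \<^term>\<open>D\<close> is
  determined only on these vectors.\<close>

definition warped_isometry ::
    "('p::topological_space, 'n::finite) rchart set \<Rightarrow> (real \<Rightarrow> real) \<Rightarrow> real set \<Rightarrow>
       (real \<times> (real^'n) \<Rightarrow> 'p) \<Rightarrow> 'p set \<Rightarrow> bool" where
  "warped_isometry \<A> \<theta> I \<Phi> P \<longleftrightarrow>
     bij_betw \<Phi> (cyl I) P \<and> continuous_on (cyl I) \<Phi> \<and>
     (\<forall>c\<in>\<A>. smooth_on (cyl I \<inter> \<Phi> -` cdom c) (coord c \<circ> \<Phi>)) \<and>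
     (\<forall>c\<in>\<A>. smooth_on (coord c ` (cdom c \<inter> P)) (inv_into (cyl I) \<Phi> \<circ> cinv c)) \<and>
     (\<forall>c\<in>\<A>. \<forall>(r, \<omega>)\<in>cyl I \<inter> \<Phi> -` cdom c. \<forall>D.
        ((coord c \<circ> \<Phi>) has_derivative D) (at (r, \<omega>) within cyl I \<inter> \<Phi> -` cdom c) \<longrightarrow>
        (\<forall>s w s' w'. w \<bullet> \<omega> = 0 \<longrightarrow> w' \<bullet> \<omega> = 0 \<longrightarrow>
           D (s, w) \<bullet> (gmat c (coord c (\<Phi> (r, \<omega>))) *v D (s', w')) = s * s' + (\<theta> r)\<^sup>2 * (w \<bullet> w')))"

text \<open>The point \<^term>\<open>N\<close> corresponds to \<open>r = 0\<close>.\<close>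

definition pole_at_zero ::
    "real set \<Rightarrow> (real \<times> (real^'n::finite) \<Rightarrow> 'p::topological_space) \<Rightarrow> 'p \<Rightarrow> bool" where
  "pole_at_zero I \<Phi> N \<longleftrightarrow>
     (\<forall>U. open U \<and> N \<in> U \<longrightarrow> (\<exists>\<delta>>0. \<forall>(r, \<omega>)\<in>cyl I. r < \<delta> \<longrightarrow> \<Phi> (r, \<omega>) \<in> U))"

text \<open>A revolution manifold with boundary is automatically compact: the isometry controls it away
  from \<^term>\<open>N\<close>, and \<^term>\<open>N\<close> has a compact neighbourhood. Compactness is recorded because
  \<open>H1\<close> is meant for compact manifolds.\<close>

definition revolution_manifold_boundary ::
    "'p::{t2_space, second_countable_topology} set \<Rightarrow> ('p, 'n::finite) rchart set \<Rightarrow> 'p \<Rightarrow>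
       real \<Rightarrow> (real \<Rightarrow> real) \<Rightarrow> (real \<times> (real^'n) \<Rightarrow> 'p) \<Rightarrow> bool" where
  "revolution_manifold_boundary M \<A> N R \<theta> \<Phi> \<longleftrightarrow>
     riemannian_manifold M \<A> \<and> compact M \<and> N \<in> M \<and> 0 < R \<and>
     smooth_on {0..R} \<theta> \<and> (\<forall>r\<in>{0<..R}. 0 < \<theta> r) \<and> \<theta> 0 = 0 \<and>
     (\<exists>\<theta>'. (\<forall>r\<in>{0..R}. (\<theta> has_real_derivative \<theta>' r) (at r within {0..R})) \<and> \<theta>' 0 = 1 \<and>
        (\<theta>' has_real_derivative 0) (at 0 within {0..R})) \<and>
     warped_isometry \<A> \<theta> {0<..R} \<Phi> (M - {N}) \<and> pole_at_zero {0<..R} \<Phi> N"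

definition closed_revolution_manifold ::
    "'p::{t2_space, second_countable_topology} set \<Rightarrow> ('p, 'n::finite) rchart set \<Rightarrow> 'p \<Rightarrow> 'p \<Rightarrow>
       real \<Rightarrow> (real \<Rightarrow> real) \<Rightarrow> (real \<times> (real^'n) \<Rightarrow> 'p) \<Rightarrow> bool" where
  "closed_revolution_manifold M \<A> N S R \<theta> \<Phi> \<longleftrightarrow>
     riemannian_manifold M \<A> \<and> compact M \<and> without_boundary \<A> \<and>
     N \<in> M \<and> S \<in> M \<and> N \<noteq> S \<and> 0 < R \<and>
     smooth_on {0..R} \<theta> \<and> (\<forall>r\<in>{0<..<R}. 0 < \<theta> r) \<and> \<theta> 0 = 0 \<and> \<theta> R = 0 \<and>
     (\<exists>\<theta>'. (\<forall>r\<in>{0..R}. (\<theta> has_real_derivative \<theta>' r) (at r within {0..R})) \<and> \<theta>' 0 = 1 \<and> - \<theta>' R = 1 \<and>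
        (\<theta>' has_real_derivative 0) (at 0 within {0..R}) \<and>
        (\<theta>' has_real_derivative 0) (at R within {0..R})) \<and>
     warped_isometry \<A> \<theta> {0<..<R} \<Phi> (M - {N, S}) \<and> pole_at_zero {0<..<R} \<Phi> N"

text \<open>The coordinate \<open>r\<close> as a function on \<^term>\<open>M\<close>, with \<open>r = 0\<close> at \<^term>\<open>N\<close> and, in the closed
  case, \<open>r = R\<close> at \<^term>\<open>S\<close>.\<close>

definition radius_boundary ::
    "'p \<Rightarrow> real \<Rightarrow> (real \<times> (real^'n::finite) \<Rightarrow> 'p) \<Rightarrow> 'p \<Rightarrow> real" where
  "radius_boundary N R \<Phi> p = (if p = N then 0 else fst (inv_into (cyl {0<..R}) \<Phi> p))"

definition radius_closed ::
    "'p \<Rightarrow> 'p \<Rightarrow> real \<Rightarrow> (real \<times> (real^'n::finite) \<Rightarrow> 'p) \<Rightarrow> 'p \<Rightarrow> real" where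
  "radius_closed N S R \<Phi> p =
     (if p = N then 0 else if p = S then R else fst (inv_into (cyl {0<..<R}) \<Phi> p))"

definition h_fun :: "real \<Rightarrow> real \<Rightarrow> nat \<Rightarrow> real \<Rightarrow> real" where
  "h_fun \<alpha> R j r =
     (let r\<^sub>j = R - 1 / (\<alpha> * real j)
      in if r \<le> r\<^sub>j then r else r - \<alpha> * real j / 2 * (r - r\<^sub>j)\<^sup>2)"

end

theory Submission
  imports Defs
begin

text \<open>Writing \<open>x = r \<omega>\<close> identifies \<^term>\<open>M\<close> without its poles with a punctured ball of
  \<open>\<real>\<^sup>n\<close>, with volume density \<open>(\<theta>(r) / r)\<^sup>n\<^sup>-\<^sup>1\<close> and a metric that near the origin is comparable to
  the Euclidean one. For the lower bound, \<open>r\<^sup>2\<close> is a Lyapunov function: with \<open>w = \<sigma>\<^sub>j \<theta>\<^sup>n\<^sup>-\<^sup>1\<close> one has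
  \<open>r w' \<le> (C - \<epsilon> j r\<^sup>2) w\<close>, and even \<open>r w' \<le> (- 2 - \<epsilon> j r\<^sup>2) w\<close> outside the ball of radius
  \<open>K / sqrt j\<close>. Integration by parts along rays then controls \<open>\<integral>(u - c)\<^sup>2 \<sigma>\<^sub>j\<close> by
  \<open>1 / j\<close> times the energy and by the mass of \<open>(u - c)\<^sup>2\<close> in that ball, where the weight is
  comparable to a constant and the Euclidean Poincare inequality at scale \<open>j\<^sup>-\<^sup>1\<^sup>/\<^sup>2\<close> applies;
  hence \<open>\<lambda>\<^sub>2 \<ge> lo * j\<close>. In the closed case the cut-off of \<open>h\<^sub>j\<close> only matters within \<open>1 / (\<alpha> j)\<close> of
  \<^term>\<open>S\<close>, where \<open>\<theta>'\<close> is close to \<open>- 1\<close> and \<open>\<theta> = O(1 / j)\<close>, so that the drift of \<open>\<theta>\<^sup>n\<^sup>-\<^sup>1\<close>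
  alone is sufficient. Two bumps supported in disjoint annuli of radius about \<open>j\<^sup>-\<^sup>1\<^sup>/\<^sup>2\<close> give
  \<open>\<lambda>\<^sub>2 \<le> up * j\<close>, and since \<open>\<parallel>\<sigma>\<^sub>j\<parallel>\<^sub>1\<close> is of order \<open>j\<^sup>-\<^sup>n\<^sup>/\<^sup>2\<close>, the quotient of the norms is of order
  \<open>j\<close> as well.\<close>

section \<open>Polar coordinates in Euclidean space\<close>

text \<open>A Lyapunov inequality along rays cannot compare different directions. It is therefore
  proved for \<open>U - c\<close> with an arbitrary constant \<open>c\<close>; one \<open>c\<close>
  has to serve all rays, and it is supplied by the inequality on the small ball. There the origin is
  removed, because the polar map is controlled away from the poles; in dimension at least two almost
  all segments miss this point. The drift \<open>- 2\<close> has the following origin. The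
  derivative of \<open>r v^2 w\<close> contains \<open>v^2 w\<close> itself, which consumes one
  unit; the remaining unit is the integral to be estimated. The term \<open>- e r^2\<close> absorbs
  the mixed product \<open>2 r v v' w\<close> at the price of \<open>(1 / e) v'^2 w\<close>, so that
  \<open>e\<close> of order \<open>j\<close> produces the factor \<open>1 / j\<close>. The metric
  enters through quadratic forms: the squared gradient norm is the least constant in a
  Cauchy-Schwarz bound for the differential, a description that does not depend on charts and that
  passes directly to polar coordinates.\<close>

lemma nn_integral_scaleR:
  fixes f :: "'a::euclidean_space \<Rightarrow> ennreal"
  assumes [measurable]: "f \<in> borel_measurable borel" and c: "0 < c"
  shows "(\<integral>\<^sup>+x. f x \<partial>lborel) = ennreal (c ^ DIM('a)) * (\<integral>\<^sup>+x. f (c *\<^sub>R x) \<partial>lborel)"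
proof -
  have "(lborel::'a measure) = density (distr lborel borel (\<lambda>x. 0 + c *\<^sub>R x)) (\<lambda>_. ennreal (\<bar>c\<bar> ^ DIM('a)))"
    using c lborel_affine[of c "0::'a"] by simp
  then have "(\<integral>\<^sup>+x. f x \<partial>lborel)
      = (\<integral>\<^sup>+x. f x \<partial>(density (distr lborel borel (\<lambda>x. 0 + c *\<^sub>R x)) (\<lambda>_. ennreal (\<bar>c\<bar> ^ DIM('a)))))"
    by simp
  also have "\<dots> = (\<integral>\<^sup>+x. ennreal (\<bar>c\<bar> ^ DIM('a)) * f x \<partial>(distr lborel borel (\<lambda>x::'a. 0 + c *\<^sub>R x)))"
    by (subst nn_integral_density) auto
  also have "\<dots> = (\<integral>\<^sup>+x. ennreal (\<bar>c\<bar> ^ DIM('a)) * f (c *\<^sub>R x) \<partial>lborel)"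
    by (subst nn_integral_distr) auto
  also have "\<dots> = ennreal (c ^ DIM('a)) * (\<integral>\<^sup>+x. f (c *\<^sub>R x) \<partial>lborel)"
    using c by (simp add: nn_integral_cmult)
  finally show ?thesis .
qed

text \<open>In the polar formula this is the integral over the auxiliary variable
  \<open>t > norm x\<close>; its value cancels the factor \<open>norm x ^ n\<close>.\<close>

lemma nn_integral_inverse_power_Suc:
  assumes a: "0 < a" and n: "0 < n"
  shows "(\<integral>\<^sup>+t. ennreal (real n * inverse (t ^ Suc n)) * indicator {a..} t \<partial>lborel) = ennreal (inverse (a ^ n))"
proof -
  have *: "((\<lambda>t. - inverse (t ^ n)) has_real_derivative real n * inverse (t ^ Suc n)) (at t)" if "a \<le> t" for t
  proof -
    have "t \<noteq> 0" using that a by auto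
    then have "((\<lambda>t. - inverse (t ^ n)) has_real_derivative real n * t ^ (n - Suc 0) * inverse (t ^ n) * inverse (t ^ n)) (at t)"
      by (auto intro!: derivative_eq_intros simp: field_simps)
    moreover have "real n * t ^ (n - Suc 0) * inverse (t ^ n) * inverse (t ^ n) = real n * inverse (t ^ Suc n)"
      using n \<open>t \<noteq> 0\<close> by (cases n) (auto simp: field_simps)
    ultimately show ?thesis by simp
  qed
  have lim: "((\<lambda>t. - inverse (t ^ n)) \<longlongrightarrow> (- 0 :: real)) at_top"
    using n by (intro tendsto_minus tendsto_inverse_0_at_top filterlim_pow_at_top filterlim_ident)
  have "(\<integral>\<^sup>+t. ennreal (real n * inverse (t ^ Suc n)) * indicator {a..} t \<partial>lborel) = ennreal (- 0 - (- inverse (a ^ n)))"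
    using a by (intro nn_integral_FTC_atLeast[where F = "\<lambda>t. - inverse (t ^ n)"] * lim) auto
  then show ?thesis by simp
qed

text \<open>The substitution \<open>r = norm y * t\<close> makes the argument of \<open>F\<close>
  linear in \<open>y\<close>; for fixed \<open>t\<close> the integral in \<open>y\<close> can then
  be transformed by a dilation.\<close>

lemma nn_integral_ray_scale:
  fixes F :: "'a::euclidean_space \<Rightarrow> ennreal"
  assumes [measurable]: "F \<in> borel_measurable borel" and y: "y \<noteq> 0" and n: "0 < n"
  shows "(\<integral>\<^sup>+r. indicator {0<..} r * ennreal (real n * r ^ (n - 1)) * F ((r / norm y) *\<^sub>R y) \<partial>lborel)
       = (\<integral>\<^sup>+t. indicator {0<..} t * ennreal (real n * norm y ^ n * t ^ (n - 1)) * F (t *\<^sub>R y) \<partial>lborel)"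
proof -
  let ?c = "norm y"
  have c: "?c > 0" using y by simp
  have pw: "?c * ?c ^ (n - 1) = ?c ^ n" using n by (cases n) auto
  have ind: "indicator {0<..} (?c * t) = (indicator {0<..} t :: ennreal)" for t
    using c by (auto simp: indicator_def zero_less_mult_iff)
  have "(\<integral>\<^sup>+r. indicator {0<..} r * ennreal (real n * r ^ (n - 1)) * F ((r / norm y) *\<^sub>R y) \<partial>lborel)
     = ?c * (\<integral>\<^sup>+t. indicator {0<..} (0 + ?c * t) * ennreal (real n * (0 + ?c * t) ^ (n - 1)) * F (((0 + ?c * t) / norm y) *\<^sub>R y) \<partial>lborel)"
    using c by (subst nn_integral_real_affine[where c = ?c and t = 0]) auto
  also have "\<dots> = (\<integral>\<^sup>+t. ennreal ?c * (indicator {0<..} (0 + ?c * t) * ennreal (real n * (0 + ?c * t) ^ (n - 1)) * F (((0 + ?c * t) / norm y) *\<^sub>R y)) \<partial>lborel)"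
    by (rule nn_integral_cmult[symmetric]) measurable
  also have "\<dots> = (\<integral>\<^sup>+t. indicator {0<..} t * ennreal (real n * norm y ^ n * t ^ (n - 1)) * F (t *\<^sub>R y) \<partial>lborel)"
  proof (rule nn_integral_cong)
    fix t :: real
    have e: "ennreal ?c * ennreal (real n * (?c * t) ^ (n - 1)) = ennreal (real n * norm y ^ n * t ^ (n - 1))"
      unfolding pw[symmetric] using c by (simp add: ennreal_mult'[symmetric] power_mult_distrib mult_ac)
    have q: "0 + ?c * t = ?c * t" "(?c * t) / norm y = t" using c by auto
    show "ennreal ?c * (indicator {0<..} (0 + ?c * t) * ennreal (real n * (0 + ?c * t) ^ (n - 1)) * F (((0 + ?c * t) / norm y) *\<^sub>R y))
        = indicator {0<..} t * ennreal (real n * norm y ^ n * t ^ (n - 1)) * F (t *\<^sub>R y)"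
      unfolding q ind e[symmetric] by (simp only: mult_ac)
  qed
  finally show ?thesis .
qed

text \<open>Polar coordinates without surface measure: the point \<^term>\<open>y\<close> of the unit ball only
  serves to pick the direction \<open>y / |y|\<close>.\<close>

lemma nn_integral_polar:
  fixes F :: "'a::euclidean_space \<Rightarrow> ennreal"
  assumes [measurable]: "F \<in> borel_measurable borel"
  shows "(\<integral>\<^sup>+x. F x \<partial>lborel) =
    (\<integral>\<^sup>+y. indicator (ball 0 1 - {0}) y *
       (\<integral>\<^sup>+r. indicator {0<..} r * ennreal (real DIM('a) * r ^ (DIM('a) - 1)) * F ((r / norm y) *\<^sub>R y) \<partial>lborel) \<partial>lborel)"
proof -
  let ?n = "DIM('a)"
  define B where "B = ball 0 1 - {0 :: 'a}"
  have [measurable]: "B \<in> sets borel" unfolding B_def by simp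
  have n: "0 < ?n" by simp
  have "(\<integral>\<^sup>+y. indicator B y *
       (\<integral>\<^sup>+r. indicator {0<..} r * ennreal (real ?n * r ^ (?n - 1)) * F ((r / norm y) *\<^sub>R y) \<partial>lborel) \<partial>lborel)
     = (\<integral>\<^sup>+y. \<integral>\<^sup>+t. indicator B y * (indicator {0<..} t * ennreal (real ?n * norm y ^ ?n * t ^ (?n - 1)) * F (t *\<^sub>R y)) \<partial>lborel \<partial>lborel)"
  proof (rule nn_integral_cong)
    fix y :: 'a
    show "indicator B y * (\<integral>\<^sup>+r. indicator {0<..} r * ennreal (real ?n * r ^ (?n - 1)) * F ((r / norm y) *\<^sub>R y) \<partial>lborel)
      = (\<integral>\<^sup>+t. indicator B y * (indicator {0<..} t * ennreal (real ?n * norm y ^ ?n * t ^ (?n - 1)) * F (t *\<^sub>R y)) \<partial>lborel)"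
    proof (cases "y \<in> B")
      case True
      then show ?thesis unfolding B_def
        using nn_integral_ray_scale[OF assms _ n, of y] by (simp only: indicator_simps) simp
    next
      case False
      then show ?thesis by simp
    qed
  qed
  also have "\<dots> = (\<integral>\<^sup>+t. \<integral>\<^sup>+y. indicator B y * (indicator {0<..} t * ennreal (real ?n * norm y ^ ?n * t ^ (?n - 1)) * F (t *\<^sub>R y)) \<partial>lborel \<partial>lborel)"
    apply (rule lborel_pair.Fubini') apply measurable done
  \<comment> \<open>For fixed \<open>t\<close> substitute \<open>x = t y\<close>. The unit ball
    becomes \<open>norm x < t\<close>, and the powers of \<open>t\<close> combine to
    \<open>t ^ (n - 1) / t ^ n / t ^ n\<close>: one division comes from the volume, the other from
    \<open>norm y ^ n\<close>.\<close>
  also have "\<dots> = (\<integral>\<^sup>+t. \<integral>\<^sup>+x. (indicator (- {0}) x * F x * ennreal (norm x ^ ?n)) * (indicator {0<..} (t - norm x) * ennreal (real ?n * inverse (t ^ Suc ?n))) \<partial>lborel \<partial>lborel)"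
  proof (rule nn_integral_cong)
    fix t :: real
    show "(\<integral>\<^sup>+y. indicator B y * (indicator {0<..} t * ennreal (real ?n * norm y ^ ?n * t ^ (?n - 1)) * F (t *\<^sub>R y)) \<partial>lborel)
      = (\<integral>\<^sup>+x. (indicator (- {0}) x * F x * ennreal (norm x ^ ?n)) * (indicator {0<..} (t - norm x) * ennreal (real ?n * inverse (t ^ Suc ?n))) \<partial>lborel)"
    proof (cases "0 < t")
      case False
      then have "\<not> norm x < t" for x :: 'a by (smt (verit) norm_ge_zero)
      with False show ?thesis by simp
    next
      case True
      have "(\<integral>\<^sup>+x. (indicator (- {0}) x * F x * ennreal (norm x ^ ?n)) * (indicator {0<..} (t - norm x) * ennreal (real ?n * inverse (t ^ Suc ?n))) \<partial>lborel)
        = ennreal (t ^ ?n) * (\<integral>\<^sup>+x. (indicator (- {0}) (t *\<^sub>R x) * F (t *\<^sub>R x) * ennreal (norm (t *\<^sub>R x) ^ ?n)) * (indicator {0<..} (t - norm (t *\<^sub>R x)) * ennreal (real ?n * inverse (t ^ Suc ?n))) \<partial>(lborel :: 'a measure))"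
        by (rule nn_integral_scaleR[OF _ True]) measurable
      also have "\<dots> = (\<integral>\<^sup>+x. ennreal (t ^ ?n) * ((indicator (- {0}) (t *\<^sub>R x) * F (t *\<^sub>R x) * ennreal (norm (t *\<^sub>R x) ^ ?n)) * (indicator {0<..} (t - norm (t *\<^sub>R x)) * ennreal (real ?n * inverse (t ^ Suc ?n)))) \<partial>(lborel :: 'a measure))"
        by (rule nn_integral_cmult[symmetric]) measurable
      also have "\<dots> = (\<integral>\<^sup>+y. indicator B y * (indicator {0<..} t * ennreal (real ?n * norm y ^ ?n * t ^ (?n - 1)) * F (t *\<^sub>R y)) \<partial>lborel)"
      proof (rule nn_integral_cong)
        fix x :: 'a
        have i: "indicator (- {0}) (t *\<^sub>R x) * indicator {0<..} (t - norm (t *\<^sub>R x)) = (indicator B x :: ennreal)"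
          using True by (auto simp: indicator_def B_def)
        have "t ^ ?n * (norm (t *\<^sub>R x) ^ ?n * (real ?n * inverse (t ^ Suc ?n))) = real ?n * norm x ^ ?n * t ^ (?n - 1)"
        proof -
          obtain m where m: "?n = Suc m" using n by (metis gr0_implies_Suc)
          show ?thesis unfolding m using True by (simp add: power_mult_distrib field_simps)
        qed
        then have e: "ennreal (t ^ ?n) * (ennreal (norm (t *\<^sub>R x) ^ ?n) * ennreal (real ?n * inverse (t ^ Suc ?n))) = ennreal (real ?n * norm x ^ ?n * t ^ (?n - 1))"
          using True by (subst ennreal_mult'[symmetric], simp, subst ennreal_mult'[symmetric], simp, simp)
        have "ennreal (t ^ ?n) * ((indicator (- {0}) (t *\<^sub>R x) * F (t *\<^sub>R x) * ennreal (norm (t *\<^sub>R x) ^ ?n)) * (indicator {0<..} (t - norm (t *\<^sub>R x)) * ennreal (real ?n * inverse (t ^ Suc ?n))))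
          = (indicator (- {0}) (t *\<^sub>R x) * indicator {0<..} (t - norm (t *\<^sub>R x))) * F (t *\<^sub>R x) * (ennreal (t ^ ?n) * (ennreal (norm (t *\<^sub>R x) ^ ?n) * ennreal (real ?n * inverse (t ^ Suc ?n))))"
          by (simp only: mult_ac)
        also have "\<dots> = indicator B x * (indicator {0<..} t * ennreal (real ?n * norm x ^ ?n * t ^ (?n - 1)) * F (t *\<^sub>R x))"
          unfolding i e using True by (simp add: mult_ac)
        finally show "ennreal (t ^ ?n) * ((indicator (- {0}) (t *\<^sub>R x) * F (t *\<^sub>R x) * ennreal (norm (t *\<^sub>R x) ^ ?n)) * (indicator {0<..} (t - norm (t *\<^sub>R x)) * ennreal (real ?n * inverse (t ^ Suc ?n))))
          = indicator B x * (indicator {0<..} t * ennreal (real ?n * norm x ^ ?n * t ^ (?n - 1)) * F (t *\<^sub>R x))" .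
      qed
      finally show ?thesis ..
    qed
  qed
  also have "\<dots> = (\<integral>\<^sup>+x. \<integral>\<^sup>+t. (indicator (- {0}) x * F x * ennreal (norm x ^ ?n)) * (indicator {0<..} (t - norm x) * ennreal (real ?n * inverse (t ^ Suc ?n))) \<partial>lborel \<partial>lborel)"
    apply (rule lborel_pair.Fubini') apply measurable done
  \<comment> \<open>Away from the origin, a null set, the integral over \<open>t\<close> equals
    \<open>inverse (norm x ^ n)\<close>.\<close>
  also have "\<dots> = (\<integral>\<^sup>+x. F x \<partial>lborel)"
  proof (rule nn_integral_cong_AE)
    have *: "(\<integral>\<^sup>+t. (indicator (- {0}) x * F x * ennreal (norm x ^ ?n)) * (indicator {0<..} (t - norm x) * ennreal (real ?n * inverse (t ^ Suc ?n))) \<partial>lborel) = F x" if "x \<noteq> 0" for x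
    proof -
      have "(\<integral>\<^sup>+t. (indicator (- {0}) x * F x * ennreal (norm x ^ ?n)) * (indicator {0<..} (t - norm x) * ennreal (real ?n * inverse (t ^ Suc ?n))) \<partial>lborel)
        = (indicator (- {0}) x * F x * ennreal (norm x ^ ?n)) * (\<integral>\<^sup>+t. (indicator {0<..} (t - norm x) * ennreal (real ?n * inverse (t ^ Suc ?n))) \<partial>lborel)"
        by (rule nn_integral_cmult) measurable
      also have "(\<integral>\<^sup>+t. (indicator {0<..} (t - norm x) * ennreal (real ?n * inverse (t ^ Suc ?n))) \<partial>lborel)
         = (\<integral>\<^sup>+t. ennreal (real ?n * inverse (t ^ Suc ?n)) * indicator {norm x..} t \<partial>lborel)"
        by (rule nn_integral_cong_AE, rule AE_mp[OF AE_lborel_singleton[of "norm x"]]) (auto simp: indicator_def)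
      also have "\<dots> = ennreal (inverse (norm x ^ ?n))"
        using that by (intro nn_integral_inverse_power_Suc) auto
      finally show ?thesis
        using that by (simp add: mult.assoc ennreal_mult'[symmetric])
    qed
    show "AE x in lborel. (\<integral>\<^sup>+t. (indicator (- {0}) x * F x * ennreal (norm x ^ ?n)) * (indicator {0<..} (t - norm x) * ennreal (real ?n * inverse (t ^ Suc ?n))) \<partial>lborel) = F x"
      by (rule eventually_mono[OF AE_lborel_singleton[of "0::'a"]]) (rule *)
  qed
  finally show ?thesis unfolding B_def ..
qed

section \<open>Weighted Poincare inequality in a ball\<close>

text \<open>Links the two integrals in use: the fundamental theorem of calculus is applied to the
  gauge integral, the estimates concern the nonnegative Lebesgue integral. Boundedness on a compact
  interval makes both finite and equal.\<close>

lemma bounded_borel_has_integral: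
  fixes g :: "real \<Rightarrow> real"
  assumes [measurable]: "g \<in> borel_measurable borel"
    and g: "\<And>t. t \<in> {a..b} \<Longrightarrow> 0 \<le> g t \<and> g t \<le> C"
  obtains I where "(g has_integral I) {a..b}" "0 \<le> I"
    "(\<integral>\<^sup>+t. indicator {a..b} t * ennreal (g t) \<partial>lborel) = ennreal I"
proof -
  have int: "integrable lborel (\<lambda>t. indicator {a..b} t *\<^sub>R g t)"
  proof (rule Bochner_Integration.integrable_bound)
    show "integrable lborel (\<lambda>t. indicator {a..b} t *\<^sub>R C)"
      by (intro integrable_scaleR_left integrable_real_indicator) (auto simp: emeasure_lborel_Icc_eq)
    show "AE t in lborel. norm (indicator {a..b} t *\<^sub>R g t) \<le> norm (indicator {a..b} t *\<^sub>R C)"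
      using g by (auto split: split_indicator intro!: AE_I2) (smt (verit))
  qed measurable
  then have si: "set_integrable lborel {a..b} g" by (simp add: set_integrable_def)
  let ?I = "\<integral>t. indicator {a..b} t *\<^sub>R g t \<partial>lborel"
  have "(g has_integral ?I) {a..b}"
    using set_borel_integral_eq_integral[OF si] by (simp add: has_integral_iff set_lebesgue_integral_def)
  moreover have "0 \<le> ?I"
    using g by (intro integral_nonneg_AE AE_I2) (auto split: split_indicator)
  moreover have "(\<integral>\<^sup>+t. indicator {a..b} t * ennreal (g t) \<partial>lborel) = ennreal ?I"
  proof -
    have "(\<integral>\<^sup>+t. indicator {a..b} t * ennreal (g t) \<partial>lborel) = (\<integral>\<^sup>+t. ennreal (indicator {a..b} t *\<^sub>R g t) \<partial>lborel)"
      by (intro nn_integral_cong) (auto split: split_indicator)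
    also have "\<dots> = ennreal ?I"
      using g by (intro nn_integral_eq_integral int AE_I2) (auto split: split_indicator)
    finally show ?thesis .
  qed
  ultimately show ?thesis using that by blast
qed

text \<open>With \<open>c = U y - U x\<close>, integrate
  \<open>2 c \<phi>' \<le> c^2 + \<phi>'^2\<close> along the segment after replacing the last term
  by its bound. The left side becomes \<open>2 c^2\<close>. In this way \<open>\<phi>'\<close>
  enters linearly, and the only other function integrated is the dominating Borel function
  \<open>g\<close>.\<close>

lemma difference_square_le_segment_integral:
  fixes U :: "'a::euclidean_space \<Rightarrow> real"
  assumes seg: "\<And>t. t \<in> {0..1} \<Longrightarrow> x + t *\<^sub>R (y - x) \<in> S"
    and der: "\<And>z. z \<in> S \<Longrightarrow> (U has_derivative D z) (at z)"
    and bnd: "\<And>z v. z \<in> S \<Longrightarrow> (D z v)\<^sup>2 \<le> K * (norm v)\<^sup>2 * G z"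
    and G[measurable]: "G \<in> borel_measurable borel"
    and Gb: "\<And>z. 0 \<le> G z \<and> G z \<le> C" and K: "0 \<le> K"
  shows "ennreal ((U x - U y)\<^sup>2) \<le> (\<integral>\<^sup>+t. indicator {0..1} t * ennreal (K * (norm (y - x))\<^sup>2 * G (x + t *\<^sub>R (y - x))) \<partial>lborel)"
proof -
  define \<phi>' where "\<phi>' t = D (x + t *\<^sub>R (y - x)) (y - x)" for t
  define g where "g t = K * (norm (y - x))\<^sup>2 * G (x + t *\<^sub>R (y - x))" for t :: real
  have [measurable]: "g \<in> borel_measurable borel" unfolding g_def by measurable
  have "0 \<le> g t \<and> g t \<le> K * (norm (y - x))\<^sup>2 * C" for t
    unfolding g_def using Gb K by (auto intro!: mult_left_mono)
  then obtain I where I: "(g has_integral I) {0..1}" "0 \<le> I"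
    "(\<integral>\<^sup>+t. indicator {0..1} t * ennreal (g t) \<partial>lborel) = ennreal I"
    using bounded_borel_has_integral[of g 0 1 "K * (norm (y - x))\<^sup>2 * C"] by auto
  have "((\<lambda>t. U (x + t *\<^sub>R (y - x))) has_vector_derivative \<phi>' t) (at t within {0..1})" if "t \<in> {0..1}" for t
  proof -
    have "((\<lambda>t. U (x + t *\<^sub>R (y - x))) has_derivative (\<lambda>h. D (x + t *\<^sub>R (y - x)) (h *\<^sub>R (y - x)))) (at t within {0..1})"
      by (rule has_derivative_compose[of "\<lambda>t. x + t *\<^sub>R (y - x)" "\<lambda>h. h *\<^sub>R (y - x)" t "{0..1}" U, OF _ der[OF seg[OF that]]])
        (auto intro!: derivative_eq_intros)
    moreover have "linear (D (x + t *\<^sub>R (y - x)))"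
      using der[OF seg[OF that]] has_derivative_linear by blast
    ultimately show ?thesis
      by (simp add: has_vector_derivative_def \<phi>'_def linear_scale)
  qed
  then have ftc: "(\<phi>' has_integral (U y - U x)) {0..1}"
    using fundamental_theorem_of_calculus[of 0 1 "\<lambda>t. U (x + t *\<^sub>R (y - x))" \<phi>'] by simp
  let ?c = "U y - U x"
  have "((\<lambda>t. 2 * ?c * \<phi>' t) has_integral (2 * ?c * ?c)) {0..1}"
    using ftc by (rule has_integral_mult_right)
  moreover have "((\<lambda>t. ?c\<^sup>2 + g t) has_integral (?c\<^sup>2 + I)) {0..1}"
    using has_integral_add[OF has_integral_const_real[of "?c\<^sup>2" 0 1] I(1)] by simp
  moreover have "2 * ?c * \<phi>' t \<le> ?c\<^sup>2 + g t" if "t \<in> {0..1}" for t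
  proof -
    have "(\<phi>' t)\<^sup>2 \<le> g t" unfolding \<phi>'_def g_def by (rule bnd[OF seg[OF that]])
    moreover have "2 * ?c * \<phi>' t \<le> ?c\<^sup>2 + (\<phi>' t)\<^sup>2" by (rule sum_squares_bound)
    ultimately show ?thesis by linarith
  qed
  ultimately have "2 * ?c * ?c \<le> ?c\<^sup>2 + I" by (rule has_integral_le)
  then have "(U x - U y)\<^sup>2 \<le> I" by (simp add: power2_eq_square algebra_simps)
  then show ?thesis using I by (simp add: g_def ennreal_leI)
qed

text \<open>The truncation at \<open>a\<close>, \<open>b\<close> is removed by letting \<open>a \<rightarrow> 0\<close>, where the boundary term
  \<open>r v\<^sup>2 w\<close> vanishes, and \<open>b \<rightarrow> R\<close>, where it has a good sign.\<close>

lemma radial_lyapunov_inequality: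
  fixes v w g :: "real \<Rightarrow> real"
  assumes [measurable]: "v \<in> borel_measurable borel" "w \<in> borel_measurable borel" "g \<in> borel_measurable borel"
    and fin: "finite E" and \<rho>: "0 < \<rho>" "\<rho> < R" and e: "0 < e" and C: "0 \<le> C"
    and v: "\<And>r. 0 < r \<Longrightarrow> r < R \<Longrightarrow> (v has_real_derivative v' r) (at r)"
    and vb: "\<And>r. 0 < r \<Longrightarrow> r < R \<Longrightarrow> \<bar>v r\<bar> \<le> Cv"
    and w: "continuous_on {0<..<R} w"
      "\<And>r. 0 < r \<Longrightarrow> r < R \<Longrightarrow> r \<notin> E \<Longrightarrow> (w has_real_derivative w' r) (at r)"
    and wb: "\<And>r. 0 < r \<Longrightarrow> r < R \<Longrightarrow> 0 < w r \<and> w r \<le> Cw"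
    and gb: "\<And>r. 0 < r \<Longrightarrow> r < R \<Longrightarrow> (v' r)\<^sup>2 \<le> g r \<and> g r \<le> Cg"
    and L1: "\<And>r. 0 < r \<Longrightarrow> r < \<rho> \<Longrightarrow> r \<notin> E \<Longrightarrow> r * w' r \<le> (C - e * r\<^sup>2) * w r"
    and L2: "\<And>r. \<rho> \<le> r \<Longrightarrow> r < R \<Longrightarrow> r \<notin> E \<Longrightarrow> r * w' r \<le> (- 2 - e * r\<^sup>2) * w r"
  shows "(\<integral>\<^sup>+r. indicator {\<rho>..<R} r * ennreal ((v r)\<^sup>2 * w r) \<partial>lborel)
    \<le> ennreal (1 + C) * (\<integral>\<^sup>+r. indicator {0<..<\<rho>} r * ennreal ((v r)\<^sup>2 * w r) \<partial>lborel)
      + ennreal (1 / e) * (\<integral>\<^sup>+r. indicator {0<..<R} r * ennreal (g r * w r) \<partial>lborel)"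
    (is "?L \<le> ?X")
proof -
  have Cw: "0 \<le> Cw" using wb[of "\<rho>"] \<rho> by auto
  define p where "p r = (1 + C) * (indicator {..<\<rho>} r * ((v r)\<^sup>2 * w r))" for r
  define q where "q r = (1 / e) * (g r * w r)" for r
  define s where "s r = indicator {\<rho>..} r * ((v r)\<^sup>2 * w r)" for r
  have [measurable]: "p \<in> borel_measurable borel" "q \<in> borel_measurable borel" "s \<in> borel_measurable borel"
    unfolding p_def q_def s_def by measurable
  have v2: "0 \<le> (v r)\<^sup>2 * w r \<and> (v r)\<^sup>2 * w r \<le> Cv\<^sup>2 * Cw" if "0 < r" "r < R" for r
    using wb[OF that] abs_le_square_iff[of "v r" Cv] vb[OF that] by (auto intro!: mult_mono)
  have gw: "0 \<le> g r * w r \<and> g r * w r \<le> Cg * Cw" if "0 < r" "r < R" for r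
    using wb[OF that] gb[OF that] Cw by (auto intro!: mult_mono mult_nonneg_nonneg) (meson order_trans zero_le_power2)+
  have step: "(\<integral>\<^sup>+r. indicator {a..b} r * ennreal (s r) \<partial>lborel) \<le> ?X + ennreal (a * ((v a)\<^sup>2 * w a))"
    if ab: "0 < a" "a \<le> b" "b < R" for a b
  proof -
    have "0 \<le> p r \<and> p r \<le> (1 + C) * (Cv\<^sup>2 * Cw)" "0 \<le> q r \<and> q r \<le> (1 / e) * (Cg * Cw)" "0 \<le> s r \<and> s r \<le> Cv\<^sup>2 * Cw"
      if "r \<in> {a..b}" for r
      using v2[of r] gw[of r] that ab e C Cw unfolding p_def q_def s_def
      by (auto split: split_indicator intro!: mult_left_mono divide_right_mono)
    note b = this
    obtain Ip where Ip: "(p has_integral Ip) {a..b}" "0 \<le> Ip" "(\<integral>\<^sup>+t. indicator {a..b} t * ennreal (p t) \<partial>lborel) = ennreal Ip"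
      using bounded_borel_has_integral[of p a b, OF _ b(1)] by auto
    obtain Iq where Iq: "(q has_integral Iq) {a..b}" "0 \<le> Iq" "(\<integral>\<^sup>+t. indicator {a..b} t * ennreal (q t) \<partial>lborel) = ennreal Iq"
      using bounded_borel_has_integral[of q a b, OF _ b(2)] by auto
    obtain Is where Is: "(s has_integral Is) {a..b}" "0 \<le> Is" "(\<integral>\<^sup>+t. indicator {a..b} t * ennreal (s t) \<partial>lborel) = ennreal Is"
      using bounded_borel_has_integral[of s a b, OF _ b(3)] by auto
    define f where "f r = r * ((v r)\<^sup>2 * w r)" for r
    define f' where "f' r = (v r)\<^sup>2 * w r + r * (2 * v r * v' r * w r + (v r)\<^sup>2 * w' r)" for r
    \<comment> \<open>At the endpoints and on \<open>E\<close> the value is set to the majorant, so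
      that the comparison with \<open>p + q - s\<close> holds on the whole interval; the fundamental
      theorem tolerates a finite exceptional set.\<close>
    define f'' where "f'' r = (if r \<in> {a<..<b} - E then f' r else p r + q r - s r)" for r
    have "(f has_real_derivative f' r) (at r)" if "0 < r" "r < R" "r \<notin> E" for r
      unfolding f_def f'_def using v[OF that(1,2)] w(2)[OF that]
      by (auto intro!: derivative_eq_intros simp: algebra_simps)
    then have "(f has_vector_derivative f'' r) (at r)" if "r \<in> {a<..<b} - E" for r
      using that ab by (auto simp: f''_def has_real_derivative_iff_has_vector_derivative)
    moreover have "continuous_on {a..b} f"
    proof -
      have "continuous_on {a..b} v"
        using v ab by (intro continuous_at_imp_continuous_on ballI DERIV_isCont) (rule v, auto)
      moreover have "continuous_on {a..b} w"
        using w(1) ab by (auto intro: continuous_on_subset)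
      ultimately show ?thesis unfolding f_def by (intro continuous_intros)
    qed
    ultimately have "(f'' has_integral (f b - f a)) {a..b}"
      using fin ab by (intro fundamental_theorem_of_calculus_interior_strong[of E]) auto
    moreover have "((\<lambda>r. p r + q r - s r) has_integral (Ip + Iq - Is)) {a..b}"
      by (intro has_integral_diff has_integral_add Ip Iq Is)
    moreover have "f'' r \<le> p r + q r - s r" if "r \<in> {a..b}" for r
    proof (cases "r \<in> {a<..<b} - E")
      case False
      then show ?thesis unfolding f''_def by (simp only: if_False order_refl)
    next
      case True
      then have r: "0 < r" "r < R" "r \<notin> E" using ab by auto
      \<comment> \<open>This is \<open>(e r v - v')^2 \<ge> 0\<close> divided by \<open>e\<close>;
        the term \<open>e r^2 v^2\<close> is the one that \<open>L1\<close> and \<open>L2\<close>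
        are designed to absorb.\<close>
      have "2 * r * v r * v' r \<le> e * r\<^sup>2 * (v r)\<^sup>2 + (1 / e) * (v' r)\<^sup>2"
      proof -
        have "0 \<le> (e * r * v r - v' r)\<^sup>2 / e" using e by simp
        also have "\<dots> = e * r\<^sup>2 * (v r)\<^sup>2 + (1 / e) * (v' r)\<^sup>2 - 2 * r * v r * v' r"
          using e by (simp add: power2_eq_square field_simps)
        finally show ?thesis by simp
      qed
      also have "(1 / e) * (v' r)\<^sup>2 \<le> (1 / e) * g r"
        using e gb[OF r(1,2)] by (intro mult_left_mono) auto
      finally have "2 * r * v r * v' r * w r \<le> (e * r\<^sup>2 * (v r)\<^sup>2 + (1 / e) * g r) * w r"
        using wb[OF r(1,2)] by (intro mult_right_mono) auto
      then have 1: "f' r \<le> (v r)\<^sup>2 * (w r + e * r\<^sup>2 * w r + r * w' r) + q r"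
        unfolding f'_def q_def by (simp add: algebra_simps)
      show ?thesis
      proof (cases "r < \<rho>")
        case True
        have "(v r)\<^sup>2 * (w r + e * r\<^sup>2 * w r + r * w' r) \<le> (v r)\<^sup>2 * ((1 + C) * w r)"
          using L1[OF r(1) True r(3)] by (intro mult_left_mono) (auto simp: algebra_simps)
        also have "\<dots> = p r" using True by (simp add: p_def)
        finally show ?thesis using 1 True \<open>r \<in> {a<..<b} - E\<close> by (simp add: f''_def s_def)
      next
        case False
        have "(v r)\<^sup>2 * (w r + e * r\<^sup>2 * w r + r * w' r) \<le> (v r)\<^sup>2 * (- w r)"
          using L2[OF _ r(2,3)] False by (intro mult_left_mono) (auto simp: algebra_simps)
        also have "\<dots> = - s r" using False by (simp add: s_def)
        finally show ?thesis using 1 False \<open>r \<in> {a<..<b} - E\<close> by (simp add: f''_def p_def)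
      qed
    qed
    ultimately have "f b - f a \<le> Ip + Iq - Is" by (rule has_integral_le)
    moreover have "0 \<le> f b" using v2[of b] ab by (simp add: f_def)
    ultimately have "Is \<le> Ip + Iq + f a" by simp
    then have "ennreal Is \<le> ennreal (Ip + Iq + f a)" by (rule ennreal_leI)
    also have "\<dots> = ennreal Ip + ennreal Iq + ennreal (f a)"
      using Ip(2) Iq(2) v2[of a] ab by (simp add: f_def)
    also have "ennreal Ip \<le> ennreal (1 + C) * (\<integral>\<^sup>+r. indicator {0<..<\<rho>} r * ennreal ((v r)\<^sup>2 * w r) \<partial>lborel)"
    proof -
      have "ennreal Ip \<le> (\<integral>\<^sup>+r. ennreal (1 + C) * (indicator {0<..<\<rho>} r * ennreal ((v r)\<^sup>2 * w r)) \<partial>lborel)"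
        unfolding Ip(3)[symmetric] using C ab
        by (intro nn_integral_mono) (auto split: split_indicator simp: p_def ennreal_mult')
      then show ?thesis by (simp add: nn_integral_cmult)
    qed
    also have "ennreal Iq \<le> ennreal (1 / e) * (\<integral>\<^sup>+r. indicator {0<..<R} r * ennreal (g r * w r) \<partial>lborel)"
    proof -
      have "ennreal Iq \<le> (\<integral>\<^sup>+r. ennreal (1 / e) * (indicator {0<..<R} r * ennreal (g r * w r)) \<partial>lborel)"
        unfolding Iq(3)[symmetric] using e ab
        by (intro nn_integral_mono) (auto split: split_indicator simp: q_def simp flip: ennreal_mult')
      then show ?thesis by (simp add: nn_integral_cmult)
    qed
    finally show ?thesis unfolding Is(3) f_def by (simp add: add_right_mono)
  qed
  have le: "(\<integral>\<^sup>+r. indicator {\<rho>..b} r * ennreal ((v r)\<^sup>2 * w r) \<partial>lborel) \<le> ?X" if b: "\<rho> \<le> b" "b < R" for b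
  proof (rule ennreal_le_epsilon)
    fix d :: real assume d: "0 < d"
    \<comment> \<open>Makes the boundary term at \<open>a\<close> at most \<open>d\<close>, since
      \<open>v^2 w\<close> is bounded by \<open>Cv^2 * Cw\<close>; the added 1 keeps the denominator
      positive.\<close>
    define a where "a = min \<rho> (d / (Cv\<^sup>2 * Cw + 1))"
    have P: "0 < Cv\<^sup>2 * Cw + 1" using Cw by (simp add: add_nonneg_pos)
    have a: "0 < a" "a \<le> \<rho>" "a \<le> d / (Cv\<^sup>2 * Cw + 1)" using d \<rho> P by (auto simp: a_def)
    have "a * ((v a)\<^sup>2 * w a) \<le> d / (Cv\<^sup>2 * Cw + 1) * (Cv\<^sup>2 * Cw + 1)"
      using v2[of a] a \<rho> by (intro mult_mono) auto
    also have "\<dots> = d" using P by simp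
    finally have "a * ((v a)\<^sup>2 * w a) \<le> d" .
    moreover have "(\<integral>\<^sup>+r. indicator {\<rho>..b} r * ennreal ((v r)\<^sup>2 * w r) \<partial>lborel) \<le> (\<integral>\<^sup>+r. indicator {a..b} r * ennreal (s r) \<partial>lborel)"
      using a by (intro nn_integral_mono) (auto split: split_indicator simp: s_def)
    moreover note step[of a b]
    ultimately show "(\<integral>\<^sup>+r. indicator {\<rho>..b} r * ennreal ((v r)\<^sup>2 * w r) \<partial>lborel) \<le> ?X + ennreal d"
      using a b by (smt (verit) add_left_mono ennreal_leI order_trans)
  qed
  \<comment> \<open>An increasing sequence that starts at \<open>\<rho>\<close> and tends to
    \<open>R\<close>; monotone convergence then replaces the truncation by \<open>R\<close>.\<close>
  define b where "b n = R - (R - \<rho>) / real (Suc n)" for n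
  have bR: "b n < R" "\<rho> \<le> b n" for n
  proof -
    show "b n < R" using \<rho> by (simp add: b_def)
    have "(R - \<rho>) / real (Suc n) \<le> (R - \<rho>) / 1" using \<rho> by (intro divide_left_mono) auto
    then show "\<rho> \<le> b n" by (simp add: b_def)
  qed
  have "?L = (SUP n. \<integral>\<^sup>+r. indicator {\<rho>..b n} r * ennreal ((v r)\<^sup>2 * w r) \<partial>lborel)"
  proof -
    have U: "(\<Union>n. {\<rho>..b n}) = {\<rho>..<R}"
    proof (intro equalityI subsetI)
      fix x assume x: "x \<in> {\<rho>..<R}"
      have "(\<lambda>n. (R - \<rho>) / real (Suc n)) \<longlonglongrightarrow> 0"
        using tendsto_mult[OF tendsto_const[of "R - \<rho>"] LIMSEQ_inverse_real_of_nat] by (simp add: divide_inverse)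
      then have "b \<longlonglongrightarrow> R - 0" unfolding b_def by (intro tendsto_intros)
      then have "eventually (\<lambda>n. x < b n) sequentially" using x by (intro order_tendstoD(1)[of b R]) auto
      then obtain n where "x < b n" by (auto simp: eventually_sequentially)
      then show "x \<in> (\<Union>n. {\<rho>..b n})" using x by (auto intro: less_imp_le)
    qed (use bR in \<open>auto intro: le_less_trans\<close>)
    have inc: "incseq (\<lambda>n. {\<rho>..b n})"
    proof (intro incseq_SucI)
      fix n
      have "(R - \<rho>) / real (Suc (Suc n)) \<le> (R - \<rho>) / real (Suc n)"
        using \<rho> by (intro divide_left_mono) auto
      then show "{\<rho>..b n} \<subseteq> {\<rho>..b (Suc n)}" by (auto simp: b_def)
    qed
    have "?L = (\<integral>\<^sup>+r. ennreal ((v r)\<^sup>2 * w r) * indicator (\<Union>n. {\<rho>..b n}) r \<partial>lborel)"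
      by (simp add: U mult.commute)
    also have "\<dots> = (SUP n. \<integral>\<^sup>+r. ennreal ((v r)\<^sup>2 * w r) * indicator {\<rho>..b n} r \<partial>lborel)"
      using SUP_emeasure_incseq[of "\<lambda>n. {\<rho>..b n}" "density lborel (\<lambda>r. ennreal ((v r)\<^sup>2 * w r))"] inc
      by (simp add: emeasure_density image_subset_iff)
    finally show ?thesis by (simp add: mult.commute)
  qed
  also have "\<dots> \<le> ?X" using le bR by (intro SUP_least) auto
  finally show ?thesis .
qed

section \<open>Euclidean Poincare inequality on a punctured ball\<close>

lemma AE_segment_avoids_zero:
  fixes x :: "'a::euclidean_space"
  assumes "2 \<le> DIM('a)" and "x \<noteq> 0"
  shows "AE y in lborel. \<forall>t\<in>{0..1}. x + t *\<^sub>R (y - x) \<noteq> 0"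
proof -
  \<comment> \<open>If the segment from \<open>x\<close> to \<open>y\<close> meets the origin, then
    \<open>y\<close> is a multiple of \<open>x\<close>; the line through \<open>x\<close> is a null
    set once the dimension exceeds one.\<close>
  have "dim (span {x}) < DIM('a)"
    using assms by (simp add: dim_singleton)
  then have "negligible (span {x})" by (rule negligible_lowdim)
  moreover have "span {x} \<in> sets lborel" by (simp add: closed_span borel_closed)
  ultimately have "span {x} \<in> null_sets lborel"
    by (simp add: negligible_iff_null_sets null_sets_def emeasure_completion)
  then show ?thesis
  proof (rule AE_I'[of "span {x}"], intro subsetI)
    fix y assume "y \<in> {y \<in> space lborel. \<not> (\<forall>t\<in>{0..1}. x + t *\<^sub>R (y - x) \<noteq> 0)}"
    then obtain t where t: "0 \<le> t" "t \<le> 1" "x + t *\<^sub>R (y - x) = 0" by auto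
    then have "t \<noteq> 0" using assms by auto
    have "t *\<^sub>R y = (t - 1) *\<^sub>R x" using t(3) by (simp add: algebra_simps add_eq_0_iff)
    then have "y = ((t - 1) / t) *\<^sub>R x"
      using \<open>t \<noteq> 0\<close> by (metis divideR_right scaleR_scaleR divide_inverse_commute)
    then show "y \<in> span {x}" by (metis span_base span_scale singletonI)
  qed
qed

text \<open>The map that sends \<open>x\<close> to \<open>y + s (x - y)\<close> contracts by the
  ratio \<open>s\<close> and maps a convex set containing \<open>y\<close> into itself; its Jacobian
  costs \<open>1 / s ^ n\<close>, at most \<open>2 ^ n\<close> because
  \<open>s \<ge> 1 / 2\<close>.\<close>

lemma nn_integral_convex_combination_le:
  fixes G :: "'a::euclidean_space \<Rightarrow> ennreal"
  assumes [measurable]: "G \<in> borel_measurable borel" and S[measurable]: "S \<in> sets borel"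
    and "convex S" and "y \<in> S" and s: "1 / 2 \<le> s" "s \<le> 1"
  shows "(\<integral>\<^sup>+x. indicator S x * G (y + s *\<^sub>R (x - y)) \<partial>lborel)
      \<le> 2 ^ DIM('a) * (\<integral>\<^sup>+z. indicator S z * G z \<partial>lborel)"
proof -
  define a where "a = (1 - s) *\<^sub>R y"
  have sa: "y + s *\<^sub>R (x - y) = s *\<^sub>R x + a" for x by (simp add: a_def algebra_simps)
  have "(\<integral>\<^sup>+x. indicator S x * G (y + s *\<^sub>R (x - y)) \<partial>lborel)
      \<le> (\<integral>\<^sup>+x. indicator S (s *\<^sub>R x + a) * G (s *\<^sub>R x + a) \<partial>lborel)"
  proof (rule nn_integral_mono)
    fix x
    have "s *\<^sub>R x + a \<in> S" if "x \<in> S"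
      using convexD[OF \<open>convex S\<close> that \<open>y \<in> S\<close>, of s "1 - s"] s by (simp add: a_def)
    then show "indicator S x * G (y + s *\<^sub>R (x - y)) \<le> indicator S (s *\<^sub>R x + a) * G (s *\<^sub>R x + a)"
      unfolding sa by (auto split: split_indicator)
  qed
  also have "\<dots> \<le> ennreal (2 ^ DIM('a) * s ^ DIM('a)) * (\<integral>\<^sup>+x. indicator S (s *\<^sub>R x + a) * G (s *\<^sub>R x + a) \<partial>lborel)"
  proof -
    have "1 ^ DIM('a) \<le> (2 * s) ^ DIM('a)" using s by (intro power_mono) auto
    then have "(1::ennreal) \<le> ennreal (2 ^ DIM('a) * s ^ DIM('a))"
      unfolding ennreal_1[symmetric] by (intro ennreal_leI) (simp add: power_mult_distrib)
    then show ?thesis using mult_right_mono[of 1 _ "\<integral>\<^sup>+x. indicator S (s *\<^sub>R x + a) * G (s *\<^sub>R x + a) \<partial>lborel"] by simp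
  qed
  also have "\<dots> = 2 ^ DIM('a) * (ennreal (s ^ DIM('a)) * (\<integral>\<^sup>+x. indicator S (s *\<^sub>R x + a) * G (s *\<^sub>R x + a) \<partial>lborel))"
    using s by (simp add: ennreal_mult' mult.assoc ennreal_power[symmetric])
  also have "ennreal (s ^ DIM('a)) * (\<integral>\<^sup>+x. indicator S (s *\<^sub>R x + a) * G (s *\<^sub>R x + a) \<partial>lborel)
     = (\<integral>\<^sup>+x. indicator S (x + a) * G (x + a) \<partial>lborel)"
    using s by (intro nn_integral_scaleR[symmetric]) auto
  also have "\<dots> = (\<integral>\<^sup>+x. indicator S x * G x \<partial>lborel)"
  proof -
    have "(\<integral>\<^sup>+x. indicator S x * G x \<partial>(lborel :: 'a measure)) = (\<integral>\<^sup>+x. indicator S x * G x \<partial>(distr lborel borel ((+) a)))"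
      by (simp add: lborel_distr_plus)
    also have "\<dots> = (\<integral>\<^sup>+x. indicator S (x + a) * G (x + a) \<partial>lborel)"
      by (subst nn_integral_distr) (auto simp: add.commute)
    finally show ?thesis ..
  qed
  finally show ?thesis .
qed

text \<open>Punctured balls are enough in dimension at least two, since almost every segment avoids
  the origin.\<close>

lemma punctured_ball_double_integral:
  fixes U :: "'a::euclidean_space \<Rightarrow> real"
  assumes dim: "2 \<le> DIM('a)" and \<rho>: "0 < \<rho>"
    and der: "\<And>z. z \<in> ball 0 \<rho> - {0} \<Longrightarrow> (U has_derivative D z) (at z)"
    and bnd: "\<And>z v. z \<in> ball 0 \<rho> - {0} \<Longrightarrow> (D z v)\<^sup>2 \<le> K * (norm v)\<^sup>2 * G z"
    and G[measurable]: "G \<in> borel_measurable borel"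
    and Gb: "\<And>z. 0 \<le> G z \<and> G z \<le> C" and K: "0 \<le> K"
    and [measurable]: "U \<in> borel_measurable borel"
  shows "(\<integral>\<^sup>+x. indicator (ball 0 \<rho>) x * (\<integral>\<^sup>+y. indicator (ball 0 \<rho>) y * ennreal ((U x - U y)\<^sup>2) \<partial>lborel) \<partial>lborel)
    \<le> ennreal (4 * \<rho>\<^sup>2 * K * 2 ^ DIM('a)) * emeasure lborel (ball (0::'a) \<rho>) * (\<integral>\<^sup>+z. indicator (ball 0 \<rho>) z * ennreal (G z) \<partial>lborel)"
proof -
  define S where "S = ball (0::'a) \<rho>"
  have S[measurable]: "S \<in> sets borel" and cS: "convex S" unfolding S_def by auto
  define V where "V = emeasure lborel S"
  define I where "I = (\<integral>\<^sup>+z. indicator S z * ennreal (G z) \<partial>lborel)"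
  \<comment> \<open>One jointly measurable function of all three variables, so that the order of
    integration can be changed freely.\<close>
  define H where "H x y t = indicator S x * (indicator S y * (indicator {0..1} t * ennreal (G (x + t *\<^sub>R (y - x)))))" for x y :: 'a and t :: real
  have seg: "x + t *\<^sub>R (y - x) \<in> S" if "x \<in> S" "y \<in> S" "t \<in> {0..1}" for x y t
    using convexD[OF cS that(1,2), of "1 - t" t] that(3) by (simp add: algebra_simps)
  have "(\<integral>\<^sup>+x. indicator S x * (\<integral>\<^sup>+y. indicator S y * ennreal ((U x - U y)\<^sup>2) \<partial>lborel) \<partial>lborel)
     \<le> (\<integral>\<^sup>+x. \<integral>\<^sup>+y. \<integral>\<^sup>+t. ennreal (4 * \<rho>\<^sup>2 * K) * H x y t \<partial>lborel \<partial>lborel \<partial>lborel)"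
  proof (rule nn_integral_mono_AE, rule eventually_mono[OF AE_lborel_singleton[of "0::'a"]])
    fix x :: 'a assume x: "x \<noteq> 0"
    have "indicator S x * (\<integral>\<^sup>+y. indicator S y * ennreal ((U x - U y)\<^sup>2) \<partial>lborel)
      = (\<integral>\<^sup>+y. indicator S x * (indicator S y * ennreal ((U x - U y)\<^sup>2)) \<partial>lborel)"
      by (rule nn_integral_cmult[symmetric]) measurable
    also have "\<dots> \<le> (\<integral>\<^sup>+y. \<integral>\<^sup>+t. ennreal (4 * \<rho>\<^sup>2 * K) * H x y t \<partial>lborel \<partial>lborel)"
    proof (rule nn_integral_mono_AE, rule eventually_mono[OF AE_segment_avoids_zero[OF dim x]])
      fix y assume y: "\<forall>t\<in>{0..1}. x + t *\<^sub>R (y - x) \<noteq> 0"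
      show "indicator S x * (indicator S y * ennreal ((U x - U y)\<^sup>2)) \<le> (\<integral>\<^sup>+t. ennreal (4 * \<rho>\<^sup>2 * K) * H x y t \<partial>lborel)"
      proof (cases "x \<in> S \<and> y \<in> S")
        case False
        then show ?thesis by auto
      next
        case True
        have "norm (y - x) \<le> norm y + norm x" by (rule norm_triangle_ineq4)
        also have "\<dots> \<le> 2 * \<rho>" using True by (simp add: S_def)
        finally have "(norm (y - x))\<^sup>2 \<le> (2 * \<rho>)\<^sup>2" by (intro power_mono) auto
        then have n: "K * (norm (y - x))\<^sup>2 \<le> 4 * \<rho>\<^sup>2 * K"
          using K by (simp add: power_mult_distrib mult.commute mult_left_mono)
        have "ennreal ((U x - U y)\<^sup>2) \<le> (\<integral>\<^sup>+t. indicator {0..1} t * ennreal (K * (norm (y - x))\<^sup>2 * G (x + t *\<^sub>R (y - x))) \<partial>lborel)"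
          using seg[of x y] y True
          by (intro difference_square_le_segment_integral[where S = "S - {0}" and D = D and C = C] der bnd G Gb K)
            (auto simp: S_def)
        also have "\<dots> \<le> (\<integral>\<^sup>+t. ennreal (4 * \<rho>\<^sup>2 * K) * H x y t \<partial>lborel)"
          using True Gb n K
          by (intro nn_integral_mono) (auto simp: H_def ennreal_mult[symmetric] intro!: ennreal_leI mult_right_mono split: split_indicator)
        finally show ?thesis using True by simp
      qed
    qed
    finally show "indicator S x * (\<integral>\<^sup>+y. indicator S y * ennreal ((U x - U y)\<^sup>2) \<partial>lborel)
      \<le> (\<integral>\<^sup>+y. \<integral>\<^sup>+t. ennreal (4 * \<rho>\<^sup>2 * K) * H x y t \<partial>lborel \<partial>lborel)" .
  qed
  also have "\<dots> = ennreal (4 * \<rho>\<^sup>2 * K) * (\<integral>\<^sup>+x. \<integral>\<^sup>+y. \<integral>\<^sup>+t. H x y t \<partial>lborel \<partial>lborel \<partial>lborel)"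
  proof -
    have "(\<integral>\<^sup>+t. ennreal (4 * \<rho>\<^sup>2 * K) * H x y t \<partial>lborel) = ennreal (4 * \<rho>\<^sup>2 * K) * (\<integral>\<^sup>+t. H x y t \<partial>lborel)" for x y
      unfolding H_def by (rule nn_integral_cmult) measurable
    moreover have "(\<integral>\<^sup>+y. ennreal (4 * \<rho>\<^sup>2 * K) * (\<integral>\<^sup>+t. H x y t \<partial>lborel) \<partial>lborel)
      = ennreal (4 * \<rho>\<^sup>2 * K) * (\<integral>\<^sup>+y. \<integral>\<^sup>+t. H x y t \<partial>lborel \<partial>lborel)" for x
      unfolding H_def by (rule nn_integral_cmult) measurable
    moreover have "(\<integral>\<^sup>+x. ennreal (4 * \<rho>\<^sup>2 * K) * (\<integral>\<^sup>+y. \<integral>\<^sup>+t. H x y t \<partial>lborel \<partial>lborel) \<partial>lborel)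
      = ennreal (4 * \<rho>\<^sup>2 * K) * (\<integral>\<^sup>+x. \<integral>\<^sup>+y. \<integral>\<^sup>+t. H x y t \<partial>lborel \<partial>lborel \<partial>lborel)"
      unfolding H_def by (rule nn_integral_cmult) measurable
    ultimately show ?thesis by simp
  qed
  also have "(\<integral>\<^sup>+x. \<integral>\<^sup>+y. \<integral>\<^sup>+t. H x y t \<partial>lborel \<partial>lborel \<partial>lborel) = (\<integral>\<^sup>+t. \<integral>\<^sup>+x. \<integral>\<^sup>+y. H x y t \<partial>lborel \<partial>lborel \<partial>lborel)"
  proof -
    have "(\<integral>\<^sup>+y. \<integral>\<^sup>+t. H x y t \<partial>lborel \<partial>lborel) = (\<integral>\<^sup>+t. \<integral>\<^sup>+y. H x y t \<partial>lborel \<partial>lborel)" for x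
      unfolding H_def by (rule lborel_pair.Fubini') measurable
    moreover have "(\<integral>\<^sup>+x. \<integral>\<^sup>+t. \<integral>\<^sup>+y. H x y t \<partial>lborel \<partial>lborel \<partial>lborel) = (\<integral>\<^sup>+t. \<integral>\<^sup>+x. \<integral>\<^sup>+y. H x y t \<partial>lborel \<partial>lborel \<partial>lborel)"
      unfolding H_def by (rule lborel_pair.Fubini') measurable
    ultimately show ?thesis by simp
  qed
  also have "\<dots> \<le> (\<integral>\<^sup>+t. indicator {0..1} t * (V * (2 ^ DIM('a) * I)) \<partial>(lborel :: real measure))"
  proof (rule nn_integral_mono)
    fix t :: real
    show "(\<integral>\<^sup>+x. \<integral>\<^sup>+y. H x y t \<partial>lborel \<partial>lborel) \<le> indicator {0..1} t * (V * (2 ^ DIM('a) * I))"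
    proof (cases "t \<in> {0..1}")
      case False
      then show ?thesis by (simp add: H_def)
    next
      case t: True
      \<comment> \<open>The point \<open>x + t (y - x)\<close> depends on \<open>y\<close> with
        factor \<open>t\<close> and on \<open>x\<close> with factor \<open>1 - t\<close>. One of the
        two is at least \<open>1 / 2\<close>; integrating first in that variable keeps the Jacobian
        bounded uniformly in \<open>t\<close>.\<close>
      show ?thesis
      proof (cases "1 / 2 \<le> t")
        case True
        have "(\<integral>\<^sup>+x. \<integral>\<^sup>+y. H x y t \<partial>lborel \<partial>lborel) \<le> (\<integral>\<^sup>+x. (2 ^ DIM('a) * I) * indicator S x \<partial>lborel)"
        proof (rule nn_integral_mono)
          fix x
          show "(\<integral>\<^sup>+y. H x y t \<partial>lborel) \<le> (2 ^ DIM('a) * I) * indicator S x"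
            using nn_integral_convex_combination_le[OF _ S cS, of "\<lambda>z. ennreal (G z)" x t] True t
            by (cases "x \<in> S") (auto simp: H_def I_def)
        qed
        also have "\<dots> = V * (2 ^ DIM('a) * I)"
          by (subst nn_integral_cmult_indicator) (auto simp: V_def mult.commute)
        finally show ?thesis using t by simp
      next
        case False
        have "(\<integral>\<^sup>+x. \<integral>\<^sup>+y. H x y t \<partial>lborel \<partial>lborel) = (\<integral>\<^sup>+y. \<integral>\<^sup>+x. H x y t \<partial>lborel \<partial>lborel)"
          unfolding H_def by (rule lborel_pair.Fubini') measurable
        also have "\<dots> \<le> (\<integral>\<^sup>+x. (2 ^ DIM('a) * I) * indicator S x \<partial>lborel)"
        proof (rule nn_integral_mono)
          fix y :: 'a
          have e: "x + t *\<^sub>R (y - x) = y + (1 - t) *\<^sub>R (x - y)" for x by (simp add: algebra_simps)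
          show "(\<integral>\<^sup>+x. H x y t \<partial>lborel) \<le> (2 ^ DIM('a) * I) * indicator S y"
            using nn_integral_convex_combination_le[OF _ S cS, of "\<lambda>z. ennreal (G z)" y "1 - t"] False t
            by (cases "y \<in> S") (auto simp: H_def I_def e)
        qed
        also have "\<dots> = V * (2 ^ DIM('a) * I)"
          by (subst nn_integral_cmult_indicator) (auto simp: V_def mult.commute)
        finally show ?thesis using t by simp
      qed
    qed
  qed
  also have "\<dots> = V * (2 ^ DIM('a) * I)"
    by (subst mult.commute, subst nn_integral_cmult_indicator) auto
  finally have "(\<integral>\<^sup>+x. indicator S x * (\<integral>\<^sup>+y. indicator S y * ennreal ((U x - U y)\<^sup>2) \<partial>lborel) \<partial>lborel)
    \<le> ennreal (4 * \<rho>\<^sup>2 * K) * (V * (2 ^ DIM('a) * I))"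
    by (simp add: mult_left_mono)
  also have "\<dots> = ennreal (4 * \<rho>\<^sup>2 * K * 2 ^ DIM('a)) * V * I"
    using K by (simp add: ennreal_mult mult_ac ennreal_power[symmetric])
  finally show ?thesis unfolding S_def V_def I_def .
qed

text \<open>Used to pick a reference point: if every value on \<open>S\<close> exceeded
  \<open>c\<close>, the integral would exceed \<open>c\<close> times the measure of
  \<open>S\<close>. Finiteness of \<open>c\<close> allows it to be subtracted.\<close>

lemma exists_le_average:
  fixes f :: "'a \<Rightarrow> ennreal"
  assumes [measurable]: "f \<in> borel_measurable M" "S \<in> sets M"
    and V: "emeasure M S \<noteq> 0" "emeasure M S \<noteq> \<infinity>"
    and le: "(\<integral>\<^sup>+x. indicator S x * f x \<partial>M) \<le> emeasure M S * c" and c: "c \<noteq> \<infinity>"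
  obtains y where "y \<in> S" "f y \<le> c"
proof (rule ccontr)
  assume *: "\<not> thesis"
  have gt: "c < f y" if "y \<in> S" for y using that * \<open>\<And>y. y \<in> S \<Longrightarrow> f y \<le> c \<Longrightarrow> thesis\<close> by (meson not_le)
  have "(\<integral>\<^sup>+x. indicator S x * f x \<partial>M) = (\<integral>\<^sup>+x. c * indicator S x + indicator S x * (f x - c) \<partial>M)"
    using gt by (intro nn_integral_cong) (auto split: split_indicator simp: less_imp_le add.commute[of c] diff_add_cancel_ennreal)
  also have "\<dots> = c * emeasure M S + (\<integral>\<^sup>+x. indicator S x * (f x - c) \<partial>M)"
    by (subst nn_integral_add) (auto simp: nn_integral_cmult_indicator)
  finally have "c * emeasure M S + (\<integral>\<^sup>+x. indicator S x * (f x - c) \<partial>M) \<le> c * emeasure M S + 0"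
    using le by (simp add: mult.commute)
  then have "(\<integral>\<^sup>+x. indicator S x * (f x - c) \<partial>M) = 0"
    using V c by (subst (asm) ennreal_add_left_cancel_le) (auto simp: ennreal_mult_eq_top_iff)
  then have "AE x in M. indicator S x * (f x - c) = 0"
    by (subst (asm) nn_integral_0_iff_AE) auto
  then have "AE x in M. x \<notin> S"
    by eventually_elim (use gt in \<open>auto split: split_indicator_asm simp: diff_eq_0_iff_ennreal dest!: leD\<close>)
  then have "emeasure M S = 0" by (subst (asm) AE_iff_measurable[of S]) (use sets.sets_into_space[of S M] in auto)
  then show False using V by simp
qed

text \<open>The constant is a value \<open>U y\<close>, taken at a point where the inner integral of
  the double integral does not exceed its average over the ball.\<close>

lemma punctured_ball_poincare:
  fixes U :: "'a::euclidean_space \<Rightarrow> real"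
  assumes dim: "2 \<le> DIM('a)" and \<rho>: "0 < \<rho>"
    and der: "\<And>z. z \<in> ball 0 \<rho> - {0} \<Longrightarrow> (U has_derivative D z) (at z)"
    and bnd: "\<And>z v. z \<in> ball 0 \<rho> - {0} \<Longrightarrow> (D z v)\<^sup>2 \<le> K * (norm v)\<^sup>2 * G z"
    and G[measurable]: "G \<in> borel_measurable borel"
    and Gb: "\<And>z. 0 \<le> G z \<and> G z \<le> C" and K: "0 \<le> K"
    and [measurable]: "U \<in> borel_measurable borel"
  obtains c where "(\<integral>\<^sup>+x. indicator (ball 0 \<rho>) x * ennreal ((U x - c)\<^sup>2) \<partial>lborel)
    \<le> ennreal (4 * \<rho>\<^sup>2 * K * 2 ^ DIM('a)) * (\<integral>\<^sup>+z. indicator (ball 0 \<rho>) z * ennreal (G z) \<partial>lborel)"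
proof -
  let ?M = "lborel :: 'a measure"
  define S where "S = ball (0::'a) \<rho>"
  have [measurable]: "S \<in> sets borel" unfolding S_def by simp
  define f where "f y = (\<integral>\<^sup>+x. indicator S x * ennreal ((U x - U y)\<^sup>2) \<partial>lborel)" for y
  let ?I = "\<integral>\<^sup>+z. indicator S z * ennreal (G z) \<partial>lborel"
  have [measurable]: "f \<in> borel_measurable lborel" unfolding f_def by measurable
  have fin: "emeasure ?M S \<noteq> \<infinity>" using emeasure_lborel_ball_finite[of "0::'a" \<rho>] unfolding S_def by (metis infinity_ennreal_def less_irrefl)
  have "?I \<le> (\<integral>\<^sup>+z. ennreal C * indicator S z \<partial>lborel)"
    using Gb by (intro nn_integral_mono) (auto split: split_indicator intro: ennreal_leI)
  also have "\<dots> = ennreal C * emeasure ?M S" by (subst nn_integral_cmult_indicator) auto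
  also have "\<dots> < \<infinity>" using fin by (auto simp: ennreal_mult_less_top less_top)
  finally have I: "?I \<noteq> \<infinity>" by simp
  show ?thesis
  proof (rule exists_le_average[of f ?M S "ennreal (4 * \<rho>\<^sup>2 * K * 2 ^ DIM('a)) * ?I"])
    show "emeasure ?M S \<noteq> 0"
      using \<rho> open_not_negligible[of S] by (auto simp: S_def  negligible_iff_null_sets null_sets_def emeasure_completion)
    show "ennreal (4 * \<rho>\<^sup>2 * K * 2 ^ DIM('a)) * ?I \<noteq> \<infinity>" using I by (auto simp: ennreal_mult_eq_top_iff)
    have "(\<integral>\<^sup>+x. indicator S x * f x \<partial>lborel) = (\<integral>\<^sup>+x. indicator S x * (\<integral>\<^sup>+y. indicator S y * ennreal ((U x - U y)\<^sup>2) \<partial>lborel) \<partial>lborel)"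
      unfolding f_def by (simp add: power2_commute)
    also have "\<dots> \<le> ennreal (4 * \<rho>\<^sup>2 * K * 2 ^ DIM('a)) * emeasure ?M S * ?I"
      unfolding S_def
      by (rule punctured_ball_double_integral[OF dim \<rho> der bnd G Gb K]) auto
    finally show "(\<integral>\<^sup>+x. indicator S x * f x \<partial>lborel) \<le> emeasure ?M S * (ennreal (4 * \<rho>\<^sup>2 * K * 2 ^ DIM('a)) * ?I)"
      by (simp add: mult_ac)
  qed (use fin that in \<open>auto simp: f_def S_def\<close>)
qed

section \<open>Lyapunov and Poincare inequalities with a radial weight\<close>

lemma nn_integral_polar_weight:
  fixes f :: "'a::euclidean_space \<Rightarrow> real"
  assumes [measurable]: "f \<in> borel_measurable borel" "w \<in> borel_measurable borel" "A \<in> sets borel"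
    and A: "A \<subseteq> {0<..}"
    and pos: "\<And>x. norm x \<in> A \<Longrightarrow> 0 \<le> f x" "\<And>r. r \<in> A \<Longrightarrow> 0 \<le> w r"
  shows "(\<integral>\<^sup>+x. indicator A (norm x) * ennreal (f x * (w (norm x) / norm x ^ (DIM('a) - 1))) \<partial>lborel)
    = (\<integral>\<^sup>+y. indicator (ball 0 1 - {0}) y *
        (ennreal (real DIM('a)) * (\<integral>\<^sup>+r. indicator A r * ennreal (f ((r / norm y) *\<^sub>R y) * w r) \<partial>lborel)) \<partial>lborel)"
proof -
  let ?n = "DIM('a)"
  have "(\<integral>\<^sup>+x. indicator A (norm x) * ennreal (f x * (w (norm x) / norm x ^ (?n - 1))) \<partial>lborel)
    = (\<integral>\<^sup>+y. indicator (ball 0 1 - {0}) y * (\<integral>\<^sup>+r. indicator {0<..} r * ennreal (real ?n * r ^ (?n - 1)) *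
        (indicator A (norm ((r / norm y) *\<^sub>R y)) * ennreal (f ((r / norm y) *\<^sub>R y) * (w (norm ((r / norm y) *\<^sub>R y)) / norm ((r / norm y) *\<^sub>R y) ^ (?n - 1)))) \<partial>lborel) \<partial>lborel)"
    by (rule nn_integral_polar) measurable
  also have "\<dots> = (\<integral>\<^sup>+y. indicator (ball 0 1 - {0}) y *
        (ennreal (real ?n) * (\<integral>\<^sup>+r. indicator A r * ennreal (f ((r / norm y) *\<^sub>R y) * w r) \<partial>lborel)) \<partial>lborel)"
  proof (rule nn_integral_cong)
    fix y :: 'a
    show "indicator (ball 0 1 - {0}) y * (\<integral>\<^sup>+r. indicator {0<..} r * ennreal (real ?n * r ^ (?n - 1)) *
        (indicator A (norm ((r / norm y) *\<^sub>R y)) * ennreal (f ((r / norm y) *\<^sub>R y) * (w (norm ((r / norm y) *\<^sub>R y)) / norm ((r / norm y) *\<^sub>R y) ^ (?n - 1)))) \<partial>lborel)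
      = indicator (ball 0 1 - {0}) y * (ennreal (real ?n) * (\<integral>\<^sup>+r. indicator A r * ennreal (f ((r / norm y) *\<^sub>R y) * w r) \<partial>lborel))"
    proof (cases "y = 0")
      case True
      then show ?thesis by simp
    next
      case False
      have "(\<integral>\<^sup>+r. indicator {0<..} r * ennreal (real ?n * r ^ (?n - 1)) *
        (indicator A (norm ((r / norm y) *\<^sub>R y)) * ennreal (f ((r / norm y) *\<^sub>R y) * (w (norm ((r / norm y) *\<^sub>R y)) / norm ((r / norm y) *\<^sub>R y) ^ (?n - 1)))) \<partial>lborel)
        = (\<integral>\<^sup>+r. ennreal (real ?n) * (indicator A r * ennreal (f ((r / norm y) *\<^sub>R y) * w r)) \<partial>lborel)"
      proof (rule nn_integral_cong)
        fix r :: real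
        show "indicator {0<..} r * ennreal (real ?n * r ^ (?n - 1)) *
          (indicator A (norm ((r / norm y) *\<^sub>R y)) * ennreal (f ((r / norm y) *\<^sub>R y) * (w (norm ((r / norm y) *\<^sub>R y)) / norm ((r / norm y) *\<^sub>R y) ^ (?n - 1))))
          = ennreal (real ?n) * (indicator A r * ennreal (f ((r / norm y) *\<^sub>R y) * w r))"
        proof (cases "0 < r")
          case False
          then show ?thesis using A by (auto split: split_indicator)
        next
          case True
          then have nr: "norm ((r / norm y) *\<^sub>R y) = r" using \<open>y \<noteq> 0\<close> by simp
          show ?thesis
          proof (cases "r \<in> A")
            case False
            then show ?thesis unfolding nr by simp
          next
            case rA: True
            \<comment> \<open>The denominator \<open>norm x ^ (n - 1)\<close> in the weight is there
              to cancel the polar Jacobian; on each ray the plain density \<open>w\<close>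
              remains.\<close>
            have "ennreal (real ?n * r ^ (?n - 1)) * ennreal (f ((r / norm y) *\<^sub>R y) * (w r / r ^ (?n - 1)))
              = ennreal (real ?n) * ennreal (f ((r / norm y) *\<^sub>R y) * w r)"
              using True pos(1)[of "(r / norm y) *\<^sub>R y"] pos(2)[OF rA] rA nr
              by (subst (1 2) ennreal_mult[symmetric]) (auto simp: field_simps)
            then show ?thesis unfolding nr using True rA by simp
          qed
        qed
      qed
      also have "\<dots> = ennreal (real ?n) * (\<integral>\<^sup>+r. indicator A r * ennreal (f ((r / norm y) *\<^sub>R y) * w r) \<partial>lborel)"
        by (rule nn_integral_cmult) measurable
      finally show ?thesis by simp
    qed
  qed
  finally show ?thesis .
qed

text \<open>The one-dimensional inequality for \<open>U - c\<close> on every ray, integrated over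
  the directions. Only the radial derivative of \<open>U\<close> is involved, and \<open>c\<close>
  is common to all rays.\<close>

lemma ball_lyapunov_inequality:
  fixes U :: "'a::euclidean_space \<Rightarrow> real" and w :: "real \<Rightarrow> real"
  defines "W \<equiv> \<lambda>x::'a. w (norm x) / norm x ^ (DIM('a) - 1)"
  assumes [measurable]: "U \<in> borel_measurable borel" "w \<in> borel_measurable borel" "G \<in> borel_measurable borel"
    and fin: "finite E" and \<rho>: "0 < \<rho>" "\<rho> < R" and e: "0 < e" and C: "0 \<le> C"
    and der: "\<And>x. 0 < norm x \<Longrightarrow> norm x < R \<Longrightarrow> (U has_derivative D x) (at x)"
    and Ub: "\<And>x. 0 < norm x \<Longrightarrow> norm x < R \<Longrightarrow> \<bar>U x\<bar> \<le> Cv"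
    and w: "continuous_on {0<..<R} w"
      "\<And>r. 0 < r \<Longrightarrow> r < R \<Longrightarrow> r \<notin> E \<Longrightarrow> (w has_real_derivative w' r) (at r)"
    and wb: "\<And>r. 0 < r \<Longrightarrow> r < R \<Longrightarrow> 0 < w r \<and> w r \<le> Cw"
    and gb: "\<And>x. 0 < norm x \<Longrightarrow> norm x < R \<Longrightarrow> (D x ((1 / norm x) *\<^sub>R x))\<^sup>2 \<le> G x \<and> G x \<le> Cg"
    and L1: "\<And>r. 0 < r \<Longrightarrow> r < \<rho> \<Longrightarrow> r \<notin> E \<Longrightarrow> r * w' r \<le> (C - e * r\<^sup>2) * w r"
    and L2: "\<And>r. \<rho> \<le> r \<Longrightarrow> r < R \<Longrightarrow> r \<notin> E \<Longrightarrow> r * w' r \<le> (- 2 - e * r\<^sup>2) * w r"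
  shows "(\<integral>\<^sup>+x. indicator {\<rho>..<R} (norm x) * ennreal ((U x - c)\<^sup>2 * W x) \<partial>lborel)
    \<le> ennreal (1 + C) * (\<integral>\<^sup>+x. indicator {0<..<\<rho>} (norm x) * ennreal ((U x - c)\<^sup>2 * W x) \<partial>lborel)
      + ennreal (1 / e) * (\<integral>\<^sup>+x. indicator {0<..<R} (norm x) * ennreal (G x * W x) \<partial>lborel)"
proof -
  define B where "B = ball 0 1 - {0 :: 'a}"
  have [measurable]: "B \<in> sets borel" unfolding B_def by simp
  define p q s where "p y = (\<integral>\<^sup>+r. indicator {\<rho>..<R} r * ennreal ((U ((r / norm y) *\<^sub>R y) - c)\<^sup>2 * w r) \<partial>lborel)"
    and "q y = (\<integral>\<^sup>+r. indicator {0<..<\<rho>} r * ennreal ((U ((r / norm y) *\<^sub>R y) - c)\<^sup>2 * w r) \<partial>lborel)"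
    and "s y = (\<integral>\<^sup>+r. indicator {0<..<R} r * ennreal (G ((r / norm y) *\<^sub>R y) * w r) \<partial>lborel)" for y :: 'a
  have [measurable]: "p \<in> borel_measurable borel" "q \<in> borel_measurable borel" "s \<in> borel_measurable borel"
    unfolding p_def q_def s_def by measurable
  have G0: "0 \<le> G x" if "0 < norm x" "norm x < R" for x
    using gb[OF that] by (meson order_trans zero_le_power2)
  have le: "p y \<le> ennreal (1 + C) * q y + ennreal (1 / e) * s y" if "y \<noteq> 0" for y
  proof -
    define \<omega> where "\<omega> = (1 / norm y) *\<^sub>R y"
    have \<omega>: "norm \<omega> = 1" using that by (simp add: \<omega>_def)
    have r: "(r / norm y) *\<^sub>R y = r *\<^sub>R \<omega>" for r by (simp add: \<omega>_def)
    show ?thesis unfolding p_def q_def s_def r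
    proof (rule radial_lyapunov_inequality[OF _ _ _ fin \<rho> e C _ _ w wb _ L1 L2])
      fix r assume r: "0 < r" "r < R"
      have n: "norm (r *\<^sub>R \<omega>) = r" using \<omega> r by simp
      have "((\<lambda>r. U (r *\<^sub>R \<omega>)) has_derivative (\<lambda>h. D (r *\<^sub>R \<omega>) (h *\<^sub>R \<omega>))) (at r)"
        by (rule has_derivative_compose[of "\<lambda>r. r *\<^sub>R \<omega>" "\<lambda>h. h *\<^sub>R \<omega>" r UNIV U, OF _ der])
          (use r n in \<open>auto intro!: derivative_eq_intros\<close>)
      moreover have "linear (D (r *\<^sub>R \<omega>))"
        using der[of "r *\<^sub>R \<omega>"] r n by (auto intro: has_derivative_linear)
      ultimately have "((\<lambda>r. U (r *\<^sub>R \<omega>)) has_real_derivative D (r *\<^sub>R \<omega>) \<omega>) (at r)"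
        by (simp add: has_field_derivative_def linear_scale mult.commute[of _ "D _ _"] mult_commute_abs)
      then show "((\<lambda>r. U (r *\<^sub>R \<omega>) - c) has_real_derivative D (r *\<^sub>R \<omega>) \<omega>) (at r)"
        by (auto intro!: derivative_eq_intros)
      show "\<bar>U (r *\<^sub>R \<omega>) - c\<bar> \<le> Cv + \<bar>c\<bar>" using Ub[of "r *\<^sub>R \<omega>"] r n by auto
      have "(1 / norm (r *\<^sub>R \<omega>)) *\<^sub>R r *\<^sub>R \<omega> = \<omega>" unfolding n using r by simp
      then show "(D (r *\<^sub>R \<omega>) \<omega>)\<^sup>2 \<le> G (r *\<^sub>R \<omega>) \<and> G (r *\<^sub>R \<omega>) \<le> Cg"
        using gb[of "r *\<^sub>R \<omega>"] r n by auto
    qed auto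
  qed
  have wn: "0 \<le> w r" if "0 < r" "r < R" for r using wb[OF that] by auto
  have "(\<integral>\<^sup>+x. indicator {\<rho>..<R} (norm x) * ennreal ((U x - c)\<^sup>2 * W x) \<partial>lborel)
    = (\<integral>\<^sup>+y. indicator B y * (ennreal (real DIM('a)) * p y) \<partial>lborel)"
    unfolding W_def p_def B_def using \<rho> by (intro nn_integral_polar_weight) (auto intro!: wn)
  also have "\<dots> \<le> (\<integral>\<^sup>+y. ennreal (1 + C) * (indicator B y * (ennreal (real DIM('a)) * q y)) + ennreal (1 / e) * (indicator B y * (ennreal (real DIM('a)) * s y)) \<partial>lborel)"
  proof (rule nn_integral_mono)
    fix y
    show "indicator B y * (ennreal (real DIM('a)) * p y) \<le> ennreal (1 + C) * (indicator B y * (ennreal (real DIM('a)) * q y)) + ennreal (1 / e) * (indicator B y * (ennreal (real DIM('a)) * s y))"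
    proof (cases "y \<in> B")
      case True
      then have "ennreal (real DIM('a)) * p y \<le> ennreal (real DIM('a)) * (ennreal (1 + C) * q y + ennreal (1 / e) * s y)"
        by (intro mult_left_mono le) (auto simp: B_def)
      then show ?thesis using True by (simp add: distrib_left mult_ac)
    qed simp
  qed
  also have "\<dots> = ennreal (1 + C) * (\<integral>\<^sup>+y. indicator B y * (ennreal (real DIM('a)) * q y) \<partial>lborel) + ennreal (1 / e) * (\<integral>\<^sup>+y. indicator B y * (ennreal (real DIM('a)) * s y) \<partial>lborel)"
    by (subst nn_integral_add) (auto simp: nn_integral_cmult)
  also have "(\<integral>\<^sup>+y. indicator B y * (ennreal (real DIM('a)) * q y) \<partial>lborel) = (\<integral>\<^sup>+x. indicator {0<..<\<rho>} (norm x) * ennreal ((U x - c)\<^sup>2 * W x) \<partial>lborel)"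
    unfolding W_def q_def B_def using \<rho> by (intro nn_integral_polar_weight[symmetric]) (auto intro!: wn)
  also have "(\<integral>\<^sup>+y. indicator B y * (ennreal (real DIM('a)) * s y) \<partial>lborel) = (\<integral>\<^sup>+x. indicator {0<..<R} (norm x) * ennreal (G x * W x) \<partial>lborel)"
    unfolding W_def s_def B_def by (intro nn_integral_polar_weight[symmetric]) (auto intro!: wn G0)
  finally show ?thesis .
qed

text \<open>The constant found for the unweighted inequality on the ball of radius
  \<open>\<rho>\<close> serves everywhere. Inside, \<open>W\<close> lies between \<open>a\<close>
  and \<open>b\<close>, which costs \<open>b / a\<close>; outside, the mass is at most
  \<open>1 + C\<close> times the inner mass plus the energy divided by \<open>e\<close>. Adding the
  inner mass itself gives \<open>2 + C\<close>.\<close>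

lemma weighted_ball_poincare:
  fixes U :: "'a::euclidean_space \<Rightarrow> real" and w :: "real \<Rightarrow> real"
  defines "W \<equiv> \<lambda>x::'a. w (norm x) / norm x ^ (DIM('a) - 1)"
  assumes dim: "2 \<le> DIM('a)"
    and [measurable]: "U \<in> borel_measurable borel" "w \<in> borel_measurable borel" "G \<in> borel_measurable borel"
    and fin: "finite E" and \<rho>: "0 < \<rho>" "\<rho> < R" and e: "0 < e" and C: "0 \<le> C"
    and der: "\<And>x. 0 < norm x \<Longrightarrow> norm x < R \<Longrightarrow> (U has_derivative D x) (at x)"
    and Ub: "\<And>x. 0 < norm x \<Longrightarrow> norm x < R \<Longrightarrow> \<bar>U x\<bar> \<le> Cv"
    and w: "continuous_on {0<..<R} w"
      "\<And>r. 0 < r \<Longrightarrow> r < R \<Longrightarrow> r \<notin> E \<Longrightarrow> (w has_real_derivative w' r) (at r)"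
    and wb: "\<And>r. 0 < r \<Longrightarrow> r < R \<Longrightarrow> 0 < w r \<and> w r \<le> Cw"
    and Gb: "\<And>x. 0 \<le> G x \<and> G x \<le> Cg"
    and rad: "\<And>x. 0 < norm x \<Longrightarrow> norm x < R \<Longrightarrow> (D x ((1 / norm x) *\<^sub>R x))\<^sup>2 \<le> G x"
    and full: "\<And>x v. 0 < norm x \<Longrightarrow> norm x < \<rho> \<Longrightarrow> (D x v)\<^sup>2 \<le> K * (norm v)\<^sup>2 * G x" and K: "0 \<le> K"
    and L1: "\<And>r. 0 < r \<Longrightarrow> r < \<rho> \<Longrightarrow> r \<notin> E \<Longrightarrow> r * w' r \<le> (C - e * r\<^sup>2) * w r"
    and L2: "\<And>r. \<rho> \<le> r \<Longrightarrow> r < R \<Longrightarrow> r \<notin> E \<Longrightarrow> r * w' r \<le> (- 2 - e * r\<^sup>2) * w r"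
    and ab: "0 < a" "0 < b" "\<And>x. 0 < norm x \<Longrightarrow> norm x < \<rho> \<Longrightarrow> a \<le> W x \<and> W x \<le> b"
  obtains c where "(\<integral>\<^sup>+x. indicator {0<..<R} (norm x) * ennreal ((U x - c)\<^sup>2 * W x) \<partial>lborel)
    \<le> ennreal ((2 + C) * (b / a * (4 * \<rho>\<^sup>2 * K * 2 ^ DIM('a))) + 1 / e) * (\<integral>\<^sup>+x. indicator {0<..<R} (norm x) * ennreal (G x * W x) \<partial>lborel)"
proof -
  let ?P = "4 * \<rho>\<^sup>2 * K * 2 ^ DIM('a)"
  let ?I = "\<integral>\<^sup>+x. indicator {0<..<R} (norm x) * ennreal (G x * W x) \<partial>lborel"
  have [measurable]: "W \<in> borel_measurable borel" unfolding W_def by measurable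
  have P: "0 \<le> ?P" using K by simp
  obtain c where c: "(\<integral>\<^sup>+x. indicator (ball 0 \<rho>) x * ennreal ((U x - c)\<^sup>2) \<partial>lborel)
    \<le> ennreal ?P * (\<integral>\<^sup>+z. indicator (ball 0 \<rho>) z * ennreal (G z) \<partial>lborel)"
    by (rule punctured_ball_poincare[OF dim \<rho>(1), of U D K G Cg])
      (use \<rho> der full Gb K in auto)
  have near: "(\<integral>\<^sup>+x. indicator {0<..<\<rho>} (norm x) * ennreal ((U x - c)\<^sup>2 * W x) \<partial>lborel) \<le> ennreal (b / a * ?P) * ?I"
  proof -
    have "(\<integral>\<^sup>+x. indicator {0<..<\<rho>} (norm x) * ennreal ((U x - c)\<^sup>2 * W x) \<partial>lborel)
      \<le> (\<integral>\<^sup>+x. ennreal b * (indicator (ball 0 \<rho>) x * ennreal ((U x - c)\<^sup>2)) \<partial>lborel)"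
      using ab by (intro nn_integral_mono)
        (auto split: split_indicator simp: ennreal_mult'[symmetric] mult.commute[of b] intro!: ennreal_leI mult_left_mono)
    also have "\<dots> = ennreal b * (\<integral>\<^sup>+x. indicator (ball 0 \<rho>) x * ennreal ((U x - c)\<^sup>2) \<partial>lborel)"
      by (rule nn_integral_cmult, intro borel_measurable_times_ennreal borel_measurable_indicator) (simp, measurable)
    also have "\<dots> \<le> ennreal b * (ennreal ?P * (\<integral>\<^sup>+z. indicator (ball 0 \<rho>) z * ennreal (G z) \<partial>lborel))"
      by (intro mult_left_mono c) simp
    also have "(\<integral>\<^sup>+z. indicator (ball 0 \<rho>) z * ennreal (G z) \<partial>lborel) \<le> (\<integral>\<^sup>+x. ennreal (1 / a) * (indicator {0<..<R} (norm x) * ennreal (G x * W x)) \<partial>lborel)"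
    proof (rule nn_integral_mono_AE, rule eventually_mono[OF AE_lborel_singleton[of "0::'a"]])
      fix x :: 'a assume "x \<noteq> 0"
      show "indicator (ball 0 \<rho>) x * ennreal (G x) \<le> ennreal (1 / a) * (indicator {0<..<R} (norm x) * ennreal (G x * W x))"
      proof (cases "norm x < \<rho>")
        case True
        have "G x = (1 / a) * (G x * a)" using ab by simp
        also have "\<dots> \<le> (1 / a) * (G x * W x)"
          using ab(3)[of x] True \<open>x \<noteq> 0\<close> ab(1) Gb[of x] by (intro mult_left_mono) auto
        finally have "ennreal (G x) \<le> ennreal (1 / a) * ennreal (G x * W x)"
          using ab by (subst ennreal_mult'[symmetric]) (auto intro: ennreal_leI)
        then show ?thesis using True \<rho> \<open>x \<noteq> 0\<close> by simp
      qed simp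
    qed
    also have "(\<integral>\<^sup>+x. ennreal (1 / a) * (indicator {0<..<R} (norm x) * ennreal (G x * W x)) \<partial>lborel) = ennreal (1 / a) * ?I"
      by (rule nn_integral_cmult) measurable
    finally show ?thesis
      using ab P by (simp add: mult.assoc[symmetric] ennreal_mult[symmetric] mult_left_mono)
  qed
  have split: "(\<integral>\<^sup>+x. indicator {0<..<R} (norm x) * ennreal ((U x - c)\<^sup>2 * W x) \<partial>lborel)
     = (\<integral>\<^sup>+x. indicator {0<..<\<rho>} (norm x) * ennreal ((U x - c)\<^sup>2 * W x) + indicator {\<rho>..<R} (norm x) * ennreal ((U x - c)\<^sup>2 * W x) \<partial>lborel)"
    using \<rho> by (intro nn_integral_cong) (auto split: split_indicator)
  also have "\<dots> = (\<integral>\<^sup>+x. indicator {0<..<\<rho>} (norm x) * ennreal ((U x - c)\<^sup>2 * W x) \<partial>lborel) + (\<integral>\<^sup>+x. indicator {\<rho>..<R} (norm x) * ennreal ((U x - c)\<^sup>2 * W x) \<partial>lborel)"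
    by (rule nn_integral_add) measurable
  also have "\<dots> \<le> (\<integral>\<^sup>+x. indicator {0<..<\<rho>} (norm x) * ennreal ((U x - c)\<^sup>2 * W x) \<partial>lborel) +
     (ennreal (1 + C) * (\<integral>\<^sup>+x. indicator {0<..<\<rho>} (norm x) * ennreal ((U x - c)\<^sup>2 * W x) \<partial>lborel) + ennreal (1 / e) * ?I)"
    unfolding W_def
    by (intro add_left_mono ball_lyapunov_inequality[OF _ _ _ fin \<rho> e C der Ub w wb _ L1 L2]) (use rad Gb in auto)
  also have "\<dots> = ennreal (2 + C) * (\<integral>\<^sup>+x. indicator {0<..<\<rho>} (norm x) * ennreal ((U x - c)\<^sup>2 * W x) \<partial>lborel) + ennreal (1 / e) * ?I"
  proof -
    have "ennreal (2 + C) = 1 + ennreal (1 + C)" using C by (simp add: ennreal_plus[symmetric] del: ennreal_plus flip: ennreal_1)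
    then show ?thesis by (simp add: distrib_right add.assoc)
  qed
  also have "\<dots> \<le> ennreal (2 + C) * (ennreal (b / a * ?P) * ?I) + ennreal (1 / e) * ?I"
    by (intro add_right_mono mult_left_mono near) simp
  also have "\<dots> = ennreal ((2 + C) * (b / a * ?P) + 1 / e) * ?I"
  proof -
    have "ennreal ((2 + C) * (b / a * ?P) + 1 / e) = ennreal (2 + C) * ennreal (b / a * ?P) + ennreal (1 / e)"
      using C P ab e by (subst ennreal_plus, simp, simp, subst ennreal_mult) auto
    then show ?thesis by (simp add: distrib_right mult.assoc)
  qed
  finally show ?thesis by (rule that)
qed

section \<open>Change of variables\<close>

text \<open>The library states the change of variables formula for index types that are well-ordered.
  The type \<open>'n idx\<close> is a well-ordered copy of \<open>'n\<close>, used to transport it to all finite index types.\<close>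

typedef (overloaded) ('n::finite) idx = "{i::nat. i < CARD('n)}"
  by (rule exI[of _ 0]) simp

instance idx :: (finite) finite
proof
  have "finite ((Abs_idx :: nat \<Rightarrow> 'a idx) ` {i::nat. i < CARD('a)})" by simp
  then show "finite (UNIV :: 'a idx set)"
    by (simp add: type_definition.Abs_image[OF type_definition_idx])
qed

instantiation idx :: (finite) wellorder
begin

definition less_eq_idx :: "'a idx \<Rightarrow> 'a idx \<Rightarrow> bool" where
  "less_eq_idx i j \<longleftrightarrow> Rep_idx i \<le> Rep_idx j"

definition less_idx :: "'a idx \<Rightarrow> 'a idx \<Rightarrow> bool" where
  "less_idx i j \<longleftrightarrow> Rep_idx i < Rep_idx j"

instance
proof
  fix P :: "'a idx \<Rightarrow> bool" and a :: "'a idx"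
  assume *: "\<And>x. (\<And>y. y < x \<Longrightarrow> P y) \<Longrightarrow> P x"
  show "P a"
    by (induction a rule: measure_induct_rule[of Rep_idx]) (auto intro: * simp: less_idx_def)
qed (auto simp: less_eq_idx_def less_idx_def Rep_idx_inject)

end

lemma idx_bij: "\<exists>b :: 'n::finite idx \<Rightarrow> 'n. bij b"
proof -
  have "card (UNIV :: 'n idx set) = card {i::nat. i < CARD('n)}"
    using type_definition.card[OF type_definition_idx] by blast
  then show ?thesis by (intro finite_same_card_bij) auto
qed

text \<open>Conjugation with \<open>b\<close> is a bijection between the two permutation groups and
  preserves signs.\<close>

lemma det_reindex:
  fixes A :: "real^'n::finite^'n" and b :: "'m::finite \<Rightarrow> 'n"
  assumes b: "bij b"
  shows "det (\<chi> i j. A $ b i $ b j) = det A"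
proof -
  let ?f = "map_permutation (UNIV :: 'm set) b"
  have inj: "inj b" and im: "b ` UNIV = UNIV" using b by (auto simp: bij_def)
  have f: "?f p = b \<circ> p \<circ> inv b" for p
    by (simp add: map_permutation_def restrict_id_def im fun_eq_iff)
  have bij: "bij_betw ?f {p. p permutes UNIV} {q. q permutes (UNIV :: 'n set)}"
  proof (rule bij_betwI[where g = "\<lambda>q. inv b \<circ> q \<circ> b"])
    have iff: "p permutes UNIV \<longleftrightarrow> bij p" for p :: "'c \<Rightarrow> 'c"
      by (metis UNIV_I bij_imp_permutes permutes_bij)
    show "?f \<in> {p. p permutes UNIV} \<rightarrow> {q. q permutes UNIV}"
      using b by (auto simp: f iff intro!: bij_comp bij_imp_bij_inv)
    show "(\<lambda>q. inv b \<circ> q \<circ> b) \<in> {q. q permutes UNIV} \<rightarrow> {p. p permutes UNIV}"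
      using b by (auto simp: iff intro!: bij_comp bij_imp_bij_inv)
    show "inv b \<circ> ?f p \<circ> b = p" for p
      by (auto simp: f fun_eq_iff inv_f_f[OF inj])
    show "?f (inv b \<circ> q \<circ> b) = q" for q
      using b by (auto simp: f fun_eq_iff bij_is_surj surj_f_inv_f)
  qed
  have "det A = (\<Sum>p\<in>{p. p permutes (UNIV :: 'm set)}. of_int (sign (?f p)) * (\<Prod>i\<in>UNIV. A $ i $ ?f p i))"
    unfolding det_def by (rule sum.reindex_bij_betw[OF bij, symmetric])
  also have "\<dots> = (\<Sum>p\<in>{p. p permutes (UNIV :: 'm set)}. of_int (sign p) * (\<Prod>i\<in>UNIV. A $ b i $ b (p i)))"
  proof (rule sum.cong)
    fix p assume p: "p \<in> {p. p permutes (UNIV :: 'm set)}"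
    have "sign (?f p) = sign p" using p inj by (intro sign_map_permutation) auto
    moreover have "(\<Prod>i\<in>UNIV. A $ i $ ?f p i) = (\<Prod>i\<in>UNIV. A $ b i $ ?f p (b i))"
      by (rule prod.reindex_bij_betw[OF b, symmetric])
    ultimately show "of_int (sign (?f p)) * (\<Prod>i\<in>UNIV. A $ i $ ?f p i) = of_int (sign p) * (\<Prod>i\<in>UNIV. A $ b i $ b (p i))"
      by (simp add: f inv_f_f[OF inj])
  qed simp
  also have "\<dots> = det (\<chi> i j. A $ b i $ b j)" by (simp add: det_def)
  finally show ?thesis ..
qed

lemma prod_Basis_vec: "(\<Prod>b\<in>Basis. (x :: real^'n) \<bullet> b) = (\<Prod>i\<in>UNIV. x $ i)"
proof -
  have "(\<Prod>b\<in>Basis. x \<bullet> b) = (\<Prod>b\<in>(\<lambda>i. axis i 1) ` UNIV. x \<bullet> b)"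
    by (rule prod.cong) (auto simp: Basis_vec_def)
  also have "\<dots> = (\<Prod>i\<in>UNIV. x \<bullet> axis i 1)"
    by (subst prod.reindex) (auto simp: inj_on_def axis_eq_axis)
  finally show ?thesis by (simp add: cart_eq_inner_axis)
qed

text \<open>A permutation of the coordinates maps boxes to boxes with the same side lengths, and
  Lebesgue measure is determined by its values on boxes.\<close>

lemma distr_lborel_reindex:
  fixes c :: "'n::finite \<Rightarrow> 'm::finite"
  assumes c: "bij c"
  shows "distr lborel borel (\<lambda>y :: real^'m. \<chi> k. y $ c k) = (lborel :: (real^'n) measure)"
proof (rule lborel_eqI[symmetric])
  let ?P = "\<lambda>y :: real^'m. (\<chi> k. y $ c k) :: real^'n"
  have lin: "linear ?P" by (auto intro!: linearI simp: vec_eq_iff)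
  have [measurable]: "?P \<in> borel_measurable borel"
    using lin by (intro borel_measurable_continuous_onI linear_continuous_on linear_conv_bounded_linear[THEN iffD1])
  fix l u :: "real^'n" assume lu: "\<And>b. b \<in> Basis \<Longrightarrow> l \<bullet> b \<le> u \<bullet> b"
  have lu': "l $ k \<le> u $ k" for k
    using lu[of "axis k 1"] by (simp add: cart_eq_inner_axis axis_in_Basis_iff)
  define l' u' where "l' = (\<chi> i. l $ inv c i)" and "u' = (\<chi> i. u $ inv c i)"
  have "?P -` box l u = box l' u'"
  proof (rule set_eqI)
    fix y
    have "y \<in> ?P -` box l u \<longleftrightarrow> (\<forall>k. l $ k < y $ c k \<and> y $ c k < u $ k)" by (simp add: mem_box_cart)
    also have "\<dots> \<longleftrightarrow> (\<forall>i. l $ inv c i < y $ i \<and> y $ i < u $ inv c i)"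
      using c by (metis bij_inv_eq_iff)
    also have "\<dots> \<longleftrightarrow> y \<in> box l' u'" by (simp add: mem_box_cart l'_def u'_def)
    finally show "y \<in> ?P -` box l u \<longleftrightarrow> y \<in> box l' u'" .
  qed
  then have "emeasure (distr lborel borel ?P) (box l u) = emeasure lborel (box l' u')"
    by (subst emeasure_distr) auto
  also have "\<dots> = (\<Prod>b\<in>Basis. (u' - l') \<bullet> b)"
    using lu' by (intro emeasure_lborel_box) (auto simp: Basis_vec_def inner_axis l'_def u'_def)
  also have "(\<Prod>b\<in>Basis. (u' - l') \<bullet> b) = (\<Prod>b\<in>Basis. (u - l) \<bullet> b)"
    unfolding prod_Basis_vec
    using prod.reindex_bij_betw[OF bij_imp_bij_inv[OF c], of "\<lambda>k. (u - l) $ k"] by (simp add: l'_def u'_def)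
  finally show "emeasure (distr lborel borel ?P) (box l u) = (\<Prod>b\<in>Basis. (u - l) \<bullet> b)" .
qed simp

text \<open>Translates between nonnegative integrals and the form in which the change of variables
  is available: an equivalence, for each real \<open>b\<close>, of being absolutely integrable with
  integral \<open>b\<close>.\<close>

lemma nn_integral_eq_iff_absolutely_integrable:
  fixes q :: "'a::euclidean_space \<Rightarrow> real"
  assumes [measurable]: "q \<in> borel_measurable borel" "A \<in> sets borel"
    and q: "\<And>x. x \<in> A \<Longrightarrow> 0 \<le> q x" and b: "0 \<le> b"
  shows "(\<integral>\<^sup>+x. indicator A x * ennreal (q x) \<partial>lborel) = ennreal b \<longleftrightarrow>
    q absolutely_integrable_on A \<and> integral A q = b"
proof -
  let ?q = "\<lambda>x. indicator A x *\<^sub>R q x"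
  have nn: "(\<integral>\<^sup>+x. indicator A x * ennreal (q x) \<partial>lborel) = (\<integral>\<^sup>+x. ennreal (?q x) \<partial>lborel)"
    by (intro nn_integral_cong) (auto split: split_indicator)
  have q0: "AE x in lborel. 0 \<le> ?q x" using q by (auto split: split_indicator)
  have ai: "q absolutely_integrable_on A \<longleftrightarrow> integrable lborel ?q"
    by (simp add: set_integrable_def integrable_completion)
  have I: "integral A q = integral\<^sup>L lborel ?q" if "integrable lborel ?q"
  proof -
    have "set_integrable lebesgue A q" using that ai by simp
    then have "integral A q = (LINT x:A|lebesgue. q x)" by (rule set_lebesgue_integral_eq_integral(2)[symmetric])
    also have "\<dots> = integral\<^sup>L lborel ?q" by (simp add: set_lebesgue_integral_def integral_completion)
    finally show ?thesis .
  qed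
  show ?thesis
  proof
    assume *: "(\<integral>\<^sup>+x. indicator A x * ennreal (q x) \<partial>lborel) = ennreal b"
    have int: "integrable lborel ?q"
      using * q0 by (intro integrableI_nn_integral_finite[of _ _ b]) (auto simp: nn)
    moreover have "integral\<^sup>L lborel ?q = b"
      using * q0 b by (intro integral_eq_nn_integral[THEN trans]) (auto simp: nn)
    ultimately show "q absolutely_integrable_on A \<and> integral A q = b" using ai I by simp
  next
    assume "q absolutely_integrable_on A \<and> integral A q = b"
    then show "(\<integral>\<^sup>+x. indicator A x * ennreal (q x) \<partial>lborel) = ennreal b"
      using ai I q0 nn by (simp add: nn_integral_eq_integral)
  qed
qed

text \<open>The function \<open>q\<close> represents the pulled-back density: its values are
  prescribed on \<open>A\<close>, and its Borel measurability is assumed, which takes the place of a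
  measurability proof for the Jacobian.\<close>

lemma nn_integral_change_of_variables_wellorder:
  fixes T :: "real^'m::{finite,wellorder} \<Rightarrow> real^'m::_"
  assumes A[measurable]: "A \<in> sets borel" and TA[measurable]: "T ` A \<in> sets borel"
    and der: "\<And>x. x \<in> A \<Longrightarrow> (T has_derivative T' x) (at x within A)"
    and inj: "inj_on T A"
    and [measurable]: "f \<in> borel_measurable borel" "q \<in> borel_measurable borel"
    and f: "\<And>y. y \<in> T ` A \<Longrightarrow> 0 \<le> f y"
    and q: "\<And>x. x \<in> A \<Longrightarrow> q x = \<bar>det (matrix (T' x))\<bar> * f (T x)"
  shows "(\<integral>\<^sup>+y. indicator (T ` A) y * ennreal (f y) \<partial>lborel) = (\<integral>\<^sup>+x. indicator A x * ennreal (q x) \<partial>lborel)"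
proof -
  have q0: "0 \<le> q x" if "x \<in> A" for x using that f q by simp
  have Al: "A \<in> sets lebesgue" using A by simp
  have cov: "q absolutely_integrable_on A \<and> integral A q = b \<longleftrightarrow> f absolutely_integrable_on (T ` A) \<and> integral (T ` A) f = b" for b
  proof -
    have "(\<lambda>x. \<bar>det (matrix (T' x))\<bar> *\<^sub>R vec (f (T x)) :: real ^ 1) absolutely_integrable_on A \<and>
           integral A (\<lambda>x. \<bar>det (matrix (T' x))\<bar> *\<^sub>R vec (f (T x))) = (vec b :: real ^ 1)
         \<longleftrightarrow> (\<lambda>x. vec (f x) :: real ^ 1) absolutely_integrable_on (T ` A) \<and>
           integral (T ` A) (\<lambda>x. vec (f x)) = (vec b :: real ^ 1)"
      by (rule has_absolute_integral_change_of_variables[OF Al der inj])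
    then have "(\<lambda>x. \<bar>det (matrix (T' x))\<bar> * f (T x)) absolutely_integrable_on A \<and>
           integral A (\<lambda>x. \<bar>det (matrix (T' x))\<bar> * f (T x)) = b
         \<longleftrightarrow> f absolutely_integrable_on (T ` A) \<and> integral (T ` A) f = b"
      by (simp add: absolutely_integrable_on_1_iff integral_on_1_eq)
    moreover have "(\<lambda>x. \<bar>det (matrix (T' x))\<bar> * f (T x)) absolutely_integrable_on A \<longleftrightarrow> q absolutely_integrable_on A"
      by (intro set_integrable_cong) (auto simp: q)
    moreover have "integral A (\<lambda>x. \<bar>det (matrix (T' x))\<bar> * f (T x)) = integral A q"
      by (intro integral_cong) (auto simp: q)
    ultimately show ?thesis by simp
  qed
  have iff: "(\<integral>\<^sup>+y. indicator (T ` A) y * ennreal (f y) \<partial>lborel) = ennreal b \<longleftrightarrow>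
    (\<integral>\<^sup>+x. indicator A x * ennreal (q x) \<partial>lborel) = ennreal b" if "0 \<le> b" for b
    using cov[of b] nn_integral_eq_iff_absolutely_integrable[of f "T ` A" b] nn_integral_eq_iff_absolutely_integrable[of q A b] f q0 that
    by auto
  show ?thesis
  proof (cases "\<integral>\<^sup>+x. indicator A x * ennreal (q x) \<partial>lborel")
    case (real b)
    then show ?thesis using iff[of b] by simp
  next
    \<comment> \<open>The other integral cannot be a finite \<open>b\<close>, since the equivalence
      would then give both integrals the value \<open>b\<close>.\<close>
    case top
    then show ?thesis
      by (cases "\<integral>\<^sup>+y. indicator (T ` A) y * ennreal (f y) \<partial>lborel") (use iff in auto)
  qed
qed

lemma indicator_vimage: "indicator (f -` S) x = indicator S (f x)"
  by (simp add: indicator_def)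

text \<open>Conjugation with the coordinate permutations \<open>P\<close> and \<open>Q\<close>,
  which preserve Lebesgue measure and leave the Jacobian determinant unchanged.\<close>

lemma nn_integral_change_of_variables:
  fixes T :: "real^'n::finite \<Rightarrow> real^'n"
  assumes A[measurable]: "A \<in> sets borel" and TA[measurable]: "T ` A \<in> sets borel"
    and der: "\<And>x. x \<in> A \<Longrightarrow> (T has_derivative T' x) (at x within A)"
    and inj: "inj_on T A"
    and [measurable]: "f \<in> borel_measurable borel" "q \<in> borel_measurable borel"
    and f: "\<And>y. y \<in> T ` A \<Longrightarrow> 0 \<le> f y"
    and q: "\<And>x. x \<in> A \<Longrightarrow> q x = \<bar>det (matrix (T' x))\<bar> * f (T x)"
  shows "(\<integral>\<^sup>+y. indicator (T ` A) y * ennreal (f y) \<partial>lborel) = (\<integral>\<^sup>+x. indicator A x * ennreal (q x) \<partial>lborel)"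
proof -
  obtain b :: "'n idx \<Rightarrow> 'n" where b: "bij b" using idx_bij by blast
  define P :: "real^'n \<Rightarrow> real^'n idx" where "P x = (\<chi> i. x $ b i)" for x
  define Q :: "real^'n idx \<Rightarrow> real^'n" where "Q y = (\<chi> k. y $ inv b k)" for y
  have PQ[simp]: "P (Q y) = y" "Q (P x) = x" for x y
    using b by (auto simp: P_def Q_def vec_eq_iff bij_is_inj bij_is_surj surj_f_inv_f)
  have lP: "bounded_linear P" and lQ: "bounded_linear Q"
    by (auto simp: P_def[abs_def] Q_def[abs_def] linear_conv_bounded_linear[symmetric] vec_eq_iff intro!: linearI)
  have [measurable]: "P \<in> borel_measurable borel" "Q \<in> borel_measurable borel"
    using lP lQ by (auto intro!: borel_measurable_continuous_onI linear_continuous_on)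
  have PA: "P ` X = Q -` X" for X
  proof (intro equalityI subsetI)
    fix y assume "y \<in> Q -` X"
    then have "P (Q y) \<in> P ` X" by blast
    then show "y \<in> P ` X" by simp
  qed auto
  have PAm: "P ` X \<in> sets borel" if "X \<in> sets borel" for X
    unfolding PA using that measurable_sets[of Q borel borel X] by simp
  have tr: "(\<integral>\<^sup>+x. g x \<partial>lborel) = (\<integral>\<^sup>+y. g (Q y) \<partial>lborel)" if [measurable]: "g \<in> borel_measurable borel" for g :: "real^'n \<Rightarrow> ennreal"
    using distr_lborel_reindex[OF bij_imp_bij_inv[OF b]] nn_integral_distr[of Q lborel borel g]
    by (simp add: Q_def[abs_def, symmetric])
  have im: "(\<lambda>y. P (T (Q y))) ` P ` A = P ` T ` A" by (auto simp: image_image)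
  have "(\<integral>\<^sup>+y. indicator ((\<lambda>y. P (T (Q y))) ` P ` A) y * ennreal (f (Q y)) \<partial>lborel)
     = (\<integral>\<^sup>+y. indicator (P ` A) y * ennreal (q (Q y)) \<partial>lborel)"
  proof (rule nn_integral_change_of_variables_wellorder[where T' = "\<lambda>y h. P (T' (Q y) (Q h))"])
    show "inj_on (\<lambda>y. P (T (Q y))) (P ` A)"
      using inj by (auto simp: inj_on_def) (metis PQ(2))
    show "(\<lambda>y. P (T (Q y))) ` P ` A \<in> sets borel" unfolding im by (rule PAm[OF TA])
    show "P ` A \<in> sets borel" by (rule PAm[OF A])
    show "(\<lambda>y. f (Q y)) \<in> borel_measurable borel" "(\<lambda>y. q (Q y)) \<in> borel_measurable borel"
      by measurable
    show "0 \<le> f (Q y)" if "y \<in> (\<lambda>y. P (T (Q y))) ` P ` A" for y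
      using that f unfolding im by (metis PQ(2) imageE)
    fix y assume "y \<in> P ` A"
    then have yA: "Q y \<in> A" by auto
    have "((\<lambda>y. T (Q y)) has_derivative (\<lambda>h. T' (Q y) (Q h))) (at y within P ` A)"
    proof (rule has_derivative_in_compose2[of A T T'])
      show "Q ` P ` A \<subseteq> A" by auto
      show "(Q has_derivative Q) (at y within P ` A)" using lQ by (rule bounded_linear_imp_has_derivative)
    qed (use \<open>y \<in> P ` A\<close> der in auto)
    then show "((\<lambda>y. P (T (Q y))) has_derivative (\<lambda>h. P (T' (Q y) (Q h)))) (at y within P ` A)"
      by (rule bounded_linear.has_derivative[OF lP])
    have "matrix (\<lambda>h. P (T' (Q y) (Q h))) = (\<chi> i j. matrix (T' (Q y)) $ b i $ b j)"
    proof -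
      have "Q (axis j 1) = axis (b j) 1" for j
      proof -
        have "inv b k = j \<longleftrightarrow> k = b j" for k using b by (metis bij_inv_eq_iff)
        then show ?thesis by (auto simp: Q_def vec_eq_iff axis_def)
      qed
      then show ?thesis by (simp add: matrix_def P_def)
    qed
    then have "det (matrix (\<lambda>h. P (T' (Q y) (Q h)))) = det (matrix (T' (Q y)))"
      using det_reindex[OF b] by simp
    then show "q (Q y) = \<bar>det (matrix (\<lambda>h. P (T' (Q y) (Q h))))\<bar> * f (Q (P (T (Q y))))"
      using q[OF yA] by simp
  qed
  moreover have "(\<integral>\<^sup>+y. indicator (T ` A) y * ennreal (f y) \<partial>lborel) = (\<integral>\<^sup>+y. indicator (P ` T ` A) y * ennreal (f (Q y)) \<partial>lborel)"
    by (subst tr, measurable) (simp only: PA indicator_vimage)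
  moreover have "(\<integral>\<^sup>+x. indicator A x * ennreal (q x) \<partial>lborel) = (\<integral>\<^sup>+y. indicator (P ` A) y * ennreal (q (Q y)) \<partial>lborel)"
    by (subst tr, measurable) (simp only: PA indicator_vimage)
  ultimately show ?thesis unfolding im by simp
qed

section \<open>Determinants of warped metrics\<close>

lemma inner_transpose_matrix: "v \<bullet> (transpose A *v u) = (A *v v) \<bullet> u" for A :: "real^'n::finite^'m::finite"
  by (metis dot_lmul_matrix vector_transpose_matrix)

text \<open>An orthogonal matrix that takes a basis vector to \<open>\<omega>\<close> diagonalises
  the form: the eigenvalue is 1 in the direction \<open>\<omega>\<close>, and \<open>s^2\<close> on
  its orthogonal complement of dimension \<open>n - 1\<close>.\<close>

lemma det_rank_one_perturbation:
  fixes G :: "real^'n::finite^'n"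
  assumes \<omega>: "norm \<omega> = 1"
    and G: "\<And>v w. v \<bullet> (G *v w) = (\<omega> \<bullet> v) * (\<omega> \<bullet> w) + s\<^sup>2 * (v \<bullet> w - (\<omega> \<bullet> v) * (\<omega> \<bullet> w))"
  shows "det G = (s ^ (CARD('n) - 1))\<^sup>2"
proof -
  obtain k :: 'n where True by auto
  obtain Q where Q: "orthogonal_matrix Q" "Q *v axis k 1 = \<omega>"
    using orthogonal_matrix_exists_basis[OF \<omega>, of k] by metis
  define D where "D = transpose Q ** G ** Q"
  have QQ: "(Q *v v) \<bullet> (Q *v w) = v \<bullet> w" for v w
    using Q(1) orthogonal_transformation_matrix[of "(*v) Q"]
    by (simp add: orthogonal_transformation_def)
  have om: "\<omega> \<bullet> (Q *v axis i 1) = (if i = k then 1 else 0)" for i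
    unfolding Q(2)[symmetric] QQ by (auto simp: inner_axis_axis)
  have "D $ i $ j = (if i = j then (if i = k then 1 else s\<^sup>2) else 0)" for i j
  proof -
    have "D $ i $ j = axis i 1 \<bullet> (D *v axis j 1)"
      by (simp add: matrix_vector_mult_basis inner_axis' column_def)
    also have "\<dots> = (Q *v axis i 1) \<bullet> (G *v (Q *v axis j 1))"
      by (simp add: D_def matrix_vector_mul_assoc[symmetric] inner_transpose_matrix del: transpose_matrix_vector)
    also have "\<dots> = (if i = j then (if i = k then 1 else s\<^sup>2) else 0)"
      unfolding G om QQ by (auto simp: inner_axis_axis)
    finally show ?thesis .
  qed
  then have "det D = (\<Prod>i\<in>UNIV. if i = k then 1 else s\<^sup>2)"
    by (subst det_diagonal) (auto intro!: prod.cong)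
  also have "\<dots> = (\<Prod>i\<in>UNIV - {k}. s\<^sup>2)"
    by (subst prod.remove[of _ k]) (auto intro!: prod.cong)
  also have "\<dots> = (s ^ (CARD('n) - 1))\<^sup>2" by (simp add: card_Diff_singleton power_mult[symmetric] mult.commute)
  finally have "det D = (s ^ (CARD('n) - 1))\<^sup>2" .
  moreover have "det D = (det Q)\<^sup>2 * det G"
    by (simp add: D_def det_mul det_transpose power2_eq_square)
  moreover have "(det Q)\<^sup>2 = 1" using det_orthogonal_matrix[OF Q(1)] by auto
  ultimately show ?thesis by simp
qed

text \<open>Source of the volume density: for \<open>L\<close> the derivative of the polar map in a
  chart with metric matrix \<open>g\<close>, the pulled-back matrix has the determinant just
  computed, and determinants multiply.\<close>

lemma abs_det_of_isometry:
  fixes L :: "real^'n::finite \<Rightarrow> real^'n" and g :: "real^'n^'n"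
  assumes L: "linear L" and \<omega>: "norm \<omega> = 1" and s: "0 \<le> s"
    and iso: "\<And>v w. L v \<bullet> (g *v L w) = (\<omega> \<bullet> v) * (\<omega> \<bullet> w) + s\<^sup>2 * (v \<bullet> w - (\<omega> \<bullet> v) * (\<omega> \<bullet> w))"
  shows "\<bar>det (matrix L)\<bar> * sqrt (det g) = s ^ (CARD('n) - 1)"
proof -
  define G where "G = transpose (matrix L) ** g ** matrix L"
  have "v \<bullet> (G *v w) = L v \<bullet> (g *v L w)" for v w
    using L by (simp add: G_def matrix_vector_mul_assoc[symmetric] inner_transpose_matrix matrix_works del: transpose_matrix_vector)
  then have "det G = (s ^ (CARD('n) - 1))\<^sup>2"
    using iso by (intro det_rank_one_perturbation[OF \<omega>]) auto
  moreover have "det G = (det (matrix L))\<^sup>2 * det g"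
    by (simp add: G_def det_mul det_transpose power2_eq_square)
  ultimately have "sqrt ((det (matrix L))\<^sup>2 * det g) = sqrt ((s ^ (CARD('n) - 1))\<^sup>2)" by simp
  then show ?thesis using s by (simp add: real_sqrt_mult)
qed

section \<open>Smooth functions on subsets of Euclidean space\<close>

lemma Ck_on_cong:
  assumes "open U" and "\<And>x. x \<in> U \<Longrightarrow> f x = g x" and "Ck_on k U f"
  shows "Ck_on k U g"
  using assms(2,3)
proof (induction k arbitrary: f g)
  case 0
  then show ?case using continuous_on_cong[of U U f g] by simp
next
  case (Suc k)
  have der: "(g has_derivative frechet_derivative f (at x)) (at x)" if "x \<in> U" for x
  proof (rule has_derivative_transform_within_open[OF _ \<open>open U\<close> that])
    show "(f has_derivative frechet_derivative f (at x)) (at x)"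
      using Suc.prems(2) that by (simp add: frechet_derivative_works)
  qed (use Suc.prems(1) in auto)
  then have eq: "frechet_derivative g (at x) = frechet_derivative f (at x)" if "x \<in> U" for x
    using that by (metis frechet_derivative_at)
  show ?case unfolding Ck_on.simps
  proof (intro conjI allI ballI)
    show "g differentiable at x" if "x \<in> U" for x using der[OF that] by (rule differentiableI)
    show "Ck_on k U (\<lambda>x. frechet_derivative g (at x) v)" for v
      by (rule Suc.IH[of "\<lambda>x. frechet_derivative f (at x) v"]) (use eq Suc.prems(2) in simp_all)
  qed
qed

text \<open>Lets the derivative be given by a formula instead of \<open>frechet_derivative\<close>;
  the inductions for the closure properties rest on it.\<close>

lemma Ck_on_SucI:
  assumes "open U" and der: "\<And>x. x \<in> U \<Longrightarrow> (f has_derivative f' x) (at x)"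
    and "\<And>v. Ck_on k U (\<lambda>x. f' x v)"
  shows "Ck_on (Suc k) U f"
proof -
  have "frechet_derivative f (at x) = f' x" if "x \<in> U" for x
    using der[OF that] by (metis frechet_derivative_at)
  then have "Ck_on k U (\<lambda>x. frechet_derivative f (at x) v)" for v
    using assms(3)[of v] by (rule_tac Ck_on_cong[OF assms(1), of "\<lambda>x. f' x v"]) auto
  then show ?thesis using der by (auto intro: differentiableI)
qed

lemma Ck_on_Suc_has_derivative:
  "Ck_on (Suc k) U f \<Longrightarrow> x \<in> U \<Longrightarrow> (f has_derivative frechet_derivative f (at x)) (at x)"
  by (simp add: frechet_derivative_works)

lemma Ck_on_SucD: "Ck_on (Suc k) U f \<Longrightarrow> Ck_on k U f"
proof (induction k arbitrary: f)
  case 0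
  then show ?case
    by (auto intro!: continuous_at_imp_continuous_on differentiable_imp_continuous_within)
next
  case (Suc k)
  then show ?case by (metis Ck_on.simps(2))
qed

lemma Ck_on_subset: "Ck_on k U f \<Longrightarrow> V \<subseteq> U \<Longrightarrow> Ck_on k V f"
  by (induction k arbitrary: f) (auto intro: continuous_on_subset)

lemma Ck_on_const: "open U \<Longrightarrow> Ck_on k U (\<lambda>x. c)"
proof (induction k arbitrary: c)
  case (Suc k)
  show ?case by (rule Ck_on_SucI[OF Suc.prems, of _ "\<lambda>x h. 0"]) (auto intro: Suc)
qed simp

lemma Ck_on_add: "open U \<Longrightarrow> Ck_on k U f \<Longrightarrow> Ck_on k U g \<Longrightarrow> Ck_on k U (\<lambda>x. f x + g x)"
proof (induction k arbitrary: f g)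
  case (Suc k)
  show ?case
    using Suc.prems by (intro Ck_on_SucI[OF Suc.prems(1), of _ "\<lambda>x h. frechet_derivative f (at x) h + frechet_derivative g (at x) h"]
        has_derivative_add Ck_on_Suc_has_derivative Suc.IH) auto
qed (auto intro: continuous_on_add)

lemma Ck_on_bounded_linear: "open U \<Longrightarrow> bounded_linear L \<Longrightarrow> Ck_on k U f \<Longrightarrow> Ck_on k U (\<lambda>x. L (f x))"
proof (induction k arbitrary: f)
  case 0
  then show ?case by (auto intro: bounded_linear.continuous_on)
next
  case (Suc k)
  show ?case
    using Suc.prems by (intro Ck_on_SucI[OF Suc.prems(1), of _ "\<lambda>x h. L (frechet_derivative f (at x) h)"]
        bounded_linear.has_derivative[OF Suc.prems(2)] Ck_on_Suc_has_derivative Suc.IH) auto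
qed

lemma Ck_on_mult:
  fixes f g :: "'a::euclidean_space \<Rightarrow> real"
  shows "open U \<Longrightarrow> Ck_on k U f \<Longrightarrow> Ck_on k U g \<Longrightarrow> Ck_on k U (\<lambda>x. f x * g x)"
proof (induction k arbitrary: f g)
  case (Suc k)
  note D = Suc.prems(2,3)[THEN Ck_on_SucD]
  show ?case
    using Suc.prems D by (intro Ck_on_SucI[OF Suc.prems(1), of _ "\<lambda>x h. f x * frechet_derivative g (at x) h + frechet_derivative f (at x) h * g x"]
        has_derivative_mult Ck_on_Suc_has_derivative Ck_on_add Suc.IH) auto
qed (auto intro: continuous_on_mult)

text \<open>For a real outer function the chain rule is a product of functions of the same kind, so
  the induction closes with \<open>Ck_on_mult\<close>; it has to generalise over both
  functions.\<close>

lemma Ck_on_compose_real: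
  fixes g :: "'a::euclidean_space \<Rightarrow> real" and \<eta> :: "real \<Rightarrow> real"
  shows "open U \<Longrightarrow> Ck_on k UNIV \<eta> \<Longrightarrow> Ck_on k U g \<Longrightarrow> Ck_on k U (\<lambda>x. \<eta> (g x))"
proof (induction k arbitrary: \<eta> g)
  case 0
  then show ?case using continuous_on_compose2[of UNIV \<eta> U g] by simp
next
  case (Suc k)
  note D = Suc.prems(3)[THEN Ck_on_SucD]
  let ?d = "\<lambda>t. frechet_derivative \<eta> (at t) 1"
  have lin: "frechet_derivative \<eta> (at t) h = ?d t * h" for t h
  proof -
    have "linear (frechet_derivative \<eta> (at t))"
      using Ck_on_Suc_has_derivative[OF Suc.prems(2)] by (auto intro: has_derivative_linear)
    then show ?thesis using linear_scale[of _ h 1] by fastforce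
  qed
  show ?case
  proof (rule Ck_on_SucI[OF Suc.prems(1), of _ "\<lambda>x h. ?d (g x) * frechet_derivative g (at x) h"])
    fix x assume x: "x \<in> U"
    have "((\<lambda>x. \<eta> (g x)) has_derivative (\<lambda>h. frechet_derivative \<eta> (at (g x)) (frechet_derivative g (at x) h))) (at x)"
      by (rule has_derivative_compose[OF Ck_on_Suc_has_derivative[OF Suc.prems(3) x] Ck_on_Suc_has_derivative[OF Suc.prems(2)]]) simp
    then show "((\<lambda>x. \<eta> (g x)) has_derivative (\<lambda>h. ?d (g x) * frechet_derivative g (at x) h)) (at x)"
      by (subst (asm) lin)
  next
    fix v
    show "Ck_on k U (\<lambda>x. ?d (g x) * frechet_derivative g (at x) v)"
      using Suc.prems D by (intro Ck_on_mult Suc.IH[of ?d]) auto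
  qed
qed

text \<open>The power \<open>m\<close> is there for induction: derivatives of these functions are
  linear combinations of members of the same family. For \<open>m = 0\<close> it is the classical
  flat function \<open>exp (- 1 / t)\<close>.\<close>

definition flat_exp :: "nat \<Rightarrow> real \<Rightarrow> real" where
  "flat_exp m t = (if 0 < t then inverse t ^ m * exp (- inverse t) else 0)"

lemma flat_exp_tendsto_0: "(flat_exp m \<longlongrightarrow> 0) (at 0)"
proof -
  have "((\<lambda>t. inverse t ^ m / exp (inverse t)) \<longlongrightarrow> (0::real)) (at_right 0)"
    by (rule filterlim_compose[OF tendsto_power_div_exp_0 filterlim_inverse_at_top_right])
  then have "(flat_exp m \<longlongrightarrow> 0) (at_right 0)"
    by (rule Lim_transform_eventually) (auto simp: eventually_at_right_field flat_exp_def exp_minus divide_inverse intro!: exI[of _ 1])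
  moreover have "(flat_exp m \<longlongrightarrow> 0) (at_left 0)"
    by (rule Lim_transform_eventually[OF tendsto_const]) (auto simp: eventually_at_left_field flat_exp_def intro!: exI[of _ "-1"])
  ultimately show ?thesis by (simp add: filterlim_at_split)
qed

lemma flat_exp_has_derivative:
  "(flat_exp m has_real_derivative flat_exp (m + 2) t - real m * flat_exp (m + 1) t) (at t)"
proof -
  consider "0 < t" | "t < 0" | "t = 0" by linarith
  then show ?thesis
  proof cases
    case 1
    have "((\<lambda>t. inverse t ^ m * exp (- inverse t)) has_real_derivative
        (real m * inverse t ^ (m - Suc 0) * (- (inverse t * 1 * inverse t))) * exp (- inverse t) + inverse t ^ m * (exp (- inverse t) * (inverse t * 1 * inverse t))) (at t)"
      using 1 by (auto intro!: derivative_eq_intros simp: algebra_simps)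
    moreover have "(real m * inverse t ^ (m - Suc 0) * (- (inverse t * 1 * inverse t))) * exp (- inverse t) + inverse t ^ m * (exp (- inverse t) * (inverse t * 1 * inverse t))
       = flat_exp (m + 2) t - real m * flat_exp (m + 1) t"
      using 1 by (cases m) (auto simp: flat_exp_def algebra_simps power2_eq_square)
    ultimately have "((\<lambda>t. inverse t ^ m * exp (- inverse t)) has_real_derivative flat_exp (m + 2) t - real m * flat_exp (m + 1) t) (at t)"
      by simp
    then show ?thesis
      by (rule has_field_derivative_transform_within_open[of _ _ _ "{0<..}"]) (use 1 in \<open>auto simp: flat_exp_def\<close>)
  next
    case 2
    have "((\<lambda>t. 0) has_real_derivative 0) (at t)" by simp
    then have "(flat_exp m has_real_derivative 0) (at t)"
      by (rule has_field_derivative_transform_within_open[of _ _ _ "{..<0}"]) (use 2 in \<open>auto simp: flat_exp_def\<close>)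
    then show ?thesis using 2 by (simp add: flat_exp_def)
  next
    case 3
    \<comment> \<open>At the origin the difference quotient is itself
      \<open>flat_exp (Suc m)\<close>, which tends to 0.\<close>
    have "((\<lambda>h. (flat_exp m (0 + h) - flat_exp m 0) / h) \<longlongrightarrow> 0) (at 0)"
      by (rule Lim_transform_eventually[OF flat_exp_tendsto_0[of "Suc m"]])
        (auto simp: eventually_at_filter flat_exp_def field_simps)
    then show ?thesis using 3 by (simp add: DERIV_def flat_exp_def)
  qed
qed

lemma Ck_on_flat_exp: "Ck_on k UNIV (flat_exp m)"
proof (induction k arbitrary: m)
  case 0
  then show ?case
    using flat_exp_has_derivative by (auto intro!: continuous_at_imp_continuous_on DERIV_isCont)
next
  case (Suc k)
  show ?case
  proof (rule Ck_on_SucI[of _ _ "\<lambda>t h. (flat_exp (m + 2) t + (- real m) * flat_exp (m + 1) t) * h"])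
    show "(flat_exp m has_derivative (\<lambda>h. (flat_exp (m + 2) t + (- real m) * flat_exp (m + 1) t) * h)) (at t)" for t
      using flat_exp_has_derivative[of m t] by (simp add: has_field_derivative_def)
    show "Ck_on k UNIV (\<lambda>t. (flat_exp (m + 2) t + (- real m) * flat_exp (m + 1) t) * v)" for v
      by (intro Ck_on_mult Ck_on_add Ck_on_const Suc) auto
  qed simp
qed

text \<open>A rescaled product of flat functions of \<open>t - 1\<close> and \<open>2 - t\<close>.
  The plateau of height at least 1 will bound the mass of test functions from below, and
  \<open>L\<close> their gradients from above.\<close>

lemma smooth_bump_exists:
  obtains \<beta> :: "real \<Rightarrow> real" and L where "\<And>k. Ck_on k UNIV \<beta>"
    "\<And>t. t \<le> 1 \<or> 2 \<le> t \<Longrightarrow> \<beta> t = 0" "\<And>t. 5 / 4 \<le> t \<Longrightarrow> t \<le> 7 / 4 \<Longrightarrow> 1 \<le> \<beta> t"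
    "0 < L" "\<And>t. \<exists>d. (\<beta> has_real_derivative d) (at t) \<and> \<bar>d\<bar> \<le> L"
proof -
  define b where "b t = flat_exp 0 (t + (- 1)) * flat_exp 0 ((- 1) * t + 2)" for t
  have Ckid: "Ck_on k UNIV (\<lambda>t::real. t)" for k
  proof (cases k)
    case (Suc m)
    show ?thesis unfolding Suc by (rule Ck_on_SucI[of _ _ "\<lambda>x h. h"]) (auto intro!: Ck_on_const)
  qed auto
  have Ckb: "Ck_on k UNIV b" for k
    unfolding b_def
    by (rule Ck_on_mult; (rule Ck_on_compose_real[OF _ Ck_on_flat_exp])?; (intro Ck_on_mult Ck_on_add Ck_on_const Ckid)?; simp)
  define d where "d t = frechet_derivative b (at t) 1" for t
  have db: "(b has_real_derivative d t) (at t)" for t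
  proof -
    have D: "(b has_derivative frechet_derivative b (at t)) (at t)"
      using Ck_on_Suc_has_derivative[OF Ckb[of 1, unfolded One_nat_def]] by simp
    then have "frechet_derivative b (at t) h = d t * h" for h
      using linear_scale[OF has_derivative_linear[OF D], of h 1] by (simp add: d_def mult.commute)
    then have "frechet_derivative b (at t) = (*) (d t)" by (simp add: fun_eq_iff)
    then show ?thesis using D by (simp add: has_field_derivative_def)
  qed
  have cd: "continuous_on UNIV d"
    using Ckb[of 1] by (auto simp: d_def[abs_def])
  have b0: "b t = 0" if "t \<le> 1 \<or> 2 \<le> t" for t using that by (auto simp: b_def flat_exp_def)
  have d0: "d t = 0" if "t < 1 \<or> 2 < t" for t
  proof -
    have "((\<lambda>t. 0) has_real_derivative 0) (at t)" by simp
    then have "(b has_real_derivative 0) (at t)"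
      by (rule has_field_derivative_transform_within_open[of _ _ _ "{..<1} \<union> {2<..}"]) (use that in \<open>auto simp: b0\<close>)
    then show ?thesis using db DERIV_unique by blast
  qed
  \<comment> \<open>Continuity bounds the derivative on the compact interval that carries the bump;
    outside of it the derivative vanishes.\<close>
  have "bounded (d ` {1..2})"
    using cd by (intro compact_imp_bounded compact_continuous_image) (auto intro: continuous_on_subset)
  then obtain L0 where L0: "\<And>t. t \<in> {1..2} \<Longrightarrow> \<bar>d t\<bar> \<le> L0" by (fastforce simp: bounded_iff)
  have L0': "\<bar>d t\<bar> \<le> \<bar>L0\<bar>" for t
    using L0[of t] d0[of t] by (cases "t \<in> {1..2}") fastforce+
  \<comment> \<open>On the plateau \<open>t - 1\<close> and \<open>2 - t\<close> are at least
    \<open>1 / 4\<close>, hence each of the two exponential factors is at least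
    \<open>exp (- 4)\<close>.\<close>
  define c where "c = exp (-8 :: real)"
  have c: "0 < c" by (simp add: c_def)
  have bc: "c \<le> b t" if "5 / 4 \<le> t" "t \<le> 7 / 4" for t
  proof -
    have "inverse (t - 1) \<le> 4" "inverse (2 - t) \<le> 4"
      using that le_imp_inverse_le[of "1/4" "t - 1"] le_imp_inverse_le[of "1/4" "2 - t"] by auto
    then have "exp (-4) * exp (-4) \<le> exp (- inverse (t - 1)) * exp (- inverse (2 - t))"
      by (intro mult_mono) auto
    then show ?thesis using that by (simp add: b_def c_def flat_exp_def exp_add[symmetric])
  qed
  show ?thesis
  proof (rule that[of "\<lambda>t. inverse c * b t" "inverse c * \<bar>L0\<bar> + 1"])
    show "Ck_on k UNIV (\<lambda>t. inverse c * b t)" for k by (intro Ck_on_mult Ck_on_const Ckb) auto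
    show "1 \<le> inverse c * b t" if "5 / 4 \<le> t" "t \<le> 7 / 4" for t
      using bc[OF that] c by (simp add: field_simps)
    show "\<exists>d'. ((\<lambda>t. inverse c * b t) has_real_derivative d') (at t) \<and> \<bar>d'\<bar> \<le> inverse c * \<bar>L0\<bar> + 1" for t
    proof (intro exI conjI)
      show "((\<lambda>t. inverse c * b t) has_real_derivative inverse c * d t) (at t)"
        using db by (intro DERIV_cmult)
      show "\<bar>inverse c * d t\<bar> \<le> inverse c * \<bar>L0\<bar> + 1"
      proof -
        have "\<bar>inverse c * d t\<bar> = inverse c * \<bar>d t\<bar>" using c by (simp add: abs_mult)
        also have "\<dots> \<le> inverse c * \<bar>L0\<bar>" using L0'[of t] c by (intro mult_left_mono) auto
        finally show ?thesis by linarith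
      qed
    qed
    show "0 < inverse c * \<bar>L0\<bar> + 1" using c by (simp add: add_nonneg_pos)
  qed (simp add: b0)
qed

section \<open>Gradients in charts\<close>

text \<open>Also at a boundary point, each basis vector or its negative points into the half-space,
  and small steps in one sense along every basis direction determine a derivative.\<close>

lemma has_derivative_unique_halfspace:
  fixes f :: "'a::euclidean_space \<Rightarrow> 'b::real_normed_vector"
  assumes op: "openin (top_of_set {x. a \<bullet> x \<le> b}) S" and x: "x \<in> S"
    and D: "(f has_derivative D) (at x within S)" "(f has_derivative D') (at x within S)"
  shows "D = D'"
proof (rule frechet_derivative_unique_within[OF D])
  obtain W where W: "open W" "S = {x. a \<bullet> x \<le> b} \<inter> W" using op by (auto simp: openin_open)
  obtain e0 where e0: "0 < e0" "ball x e0 \<subseteq> W" using W x by (meson IntD2 open_contains_ball)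
  fix i :: 'a and e :: real assume i: "i \<in> Basis" and e: "0 < e"
  define d where "d = (if a \<bullet> i \<le> 0 then min e e0 / 2 else - (min e e0 / 2))"
  have d: "0 < \<bar>d\<bar>" "\<bar>d\<bar> < e" "\<bar>d\<bar> < e0" using e e0 by (auto simp: d_def)
  have "d * (a \<bullet> i) \<le> 0" using e e0 by (auto simp: d_def mult_nonneg_nonpos mult_nonpos_nonneg)
  then have "a \<bullet> (x + d *\<^sub>R i) \<le> b" using x W by (auto simp: inner_add_right)
  moreover have "x + d *\<^sub>R i \<in> W" using e0 d i by (auto simp: dist_norm subset_iff)
  ultimately show "\<exists>d. 0 < \<bar>d\<bar> \<and> \<bar>d\<bar> < e \<and> x + d *\<^sub>R i \<in> S" using d W by auto
qed

text \<open>The derivative of a local smooth extension is continuous on an open set; this yields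
  derivatives within \<open>S\<close> that vary continuously up to the boundary.\<close>

lemma smooth_on_C1:
  assumes "smooth_on S f" and "x \<in> S"
  obtains W E where "open W" "x \<in> W"
    "\<And>y. y \<in> S \<inter> W \<Longrightarrow> (f has_derivative E y) (at y within S)"
    "\<And>v. continuous_on W (\<lambda>y. E y v)"
proof -
  obtain W F where W: "open W" "x \<in> W" "\<forall>k. Ck_on k W F" "\<forall>y\<in>S \<inter> W. F y = f y"
    using assms unfolding smooth_on_def by meson
  have F: "Ck_on (Suc 0) W F" using W(3) by blast
  show ?thesis
  proof (rule that[OF W(1,2), of "\<lambda>y. frechet_derivative F (at y)"])
    fix y assume y: "y \<in> S \<inter> W"
    then obtain e where e: "0 < e" "ball y e \<subseteq> W" using W(1) by (meson IntD2 open_contains_ball)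
    have "(F has_derivative frechet_derivative F (at y)) (at y within S)"
      using Ck_on_Suc_has_derivative[OF F, of y] y by (auto intro: has_derivative_at_withinI)
    then show "(f has_derivative frechet_derivative F (at y)) (at y within S)"
    proof (rule has_derivative_transform_within[OF _ e(1)])
      show "F x' = f x'" if "x' \<in> S" "dist x' y < e" for x'
        using that e W(4) by (auto simp: dist_commute subset_iff)
    qed (use y in auto)
  qed (use F in auto)
qed

lemma smooth_on_imp_continuous_on: "smooth_on S f \<Longrightarrow> continuous_on S f"
  unfolding continuous_on_eq_continuous_within
  by (metis IntI has_derivative_continuous smooth_on_C1)

lemma smooth_on_add:
  assumes "smooth_on S f" "smooth_on S g" shows "smooth_on S (\<lambda>x. f x + g x)"
  unfolding smooth_on_def
proof
  fix x assume x: "x \<in> S"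
  obtain U F where U: "open U" "x \<in> U" "\<forall>k. Ck_on k U F" "\<forall>y\<in>S \<inter> U. F y = f y"
    using assms(1) x unfolding smooth_on_def by meson
  obtain V G where V: "open V" "x \<in> V" "\<forall>k. Ck_on k V G" "\<forall>y\<in>S \<inter> V. G y = g y"
    using assms(2) x unfolding smooth_on_def by meson
  show "\<exists>U F. open U \<and> x \<in> U \<and> (\<forall>k. Ck_on k U F) \<and> (\<forall>y\<in>S \<inter> U. F y = f y + g y)"
    by (rule exI[of _ "U \<inter> V"], rule exI[of _ "\<lambda>x. F x + G x"])
      (use U V in \<open>auto intro!: Ck_on_add intro: Ck_on_subset\<close>)
qed

lemma smooth_on_scale:
  fixes f :: "'a::euclidean_space \<Rightarrow> real"
  assumes "smooth_on S f" shows "smooth_on S (\<lambda>x. c * f x)"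
  unfolding smooth_on_def
proof
  fix x assume x: "x \<in> S"
  obtain U F where U: "open U" "x \<in> U" "\<forall>k. Ck_on k U F" "\<forall>y\<in>S \<inter> U. F y = f y"
    using assms x unfolding smooth_on_def by meson
  show "\<exists>U F. open U \<and> x \<in> U \<and> (\<forall>k. Ck_on k U F) \<and> (\<forall>y\<in>S \<inter> U. F y = c * f y)"
    by (rule exI[of _ U], rule exI[of _ "\<lambda>x. c * F x"])
      (use U in \<open>auto intro!: Ck_on_mult Ck_on_const\<close>)
qed

section \<open>Positive definite matrices and gradients in one chart\<close>

definition posdef :: "real^'n::finite^'n \<Rightarrow> bool" where
  "posdef g \<longleftrightarrow> transpose g = g \<and> (\<forall>v. v \<noteq> 0 \<longrightarrow> 0 < v \<bullet> (g *v v))"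

lemma posdef_nonneg: "posdef g \<Longrightarrow> 0 \<le> v \<bullet> (g *v v)"
  by (cases "v = 0") (auto simp: posdef_def less_imp_le)

lemma posdef_sym: "posdef g \<Longrightarrow> v \<bullet> (g *v w) = w \<bullet> (g *v v)"
  using inner_transpose_matrix[of v g w] unfolding posdef_def by (metis inner_commute)

lemma posdef_Cauchy_Schwarz:
  assumes g: "posdef g" shows "(v \<bullet> (g *v w))\<^sup>2 \<le> (v \<bullet> (g *v v)) * (w \<bullet> (g *v w))"
proof (cases "v = 0")
  case False
  then have a: "0 < v \<bullet> (g *v v)" using g by (simp add: posdef_def)
  \<comment> \<open>The minimiser of the quadratic polynomial obtained by applying the form to
    \<open>w - t v\<close>.\<close>
  define t where "t = (v \<bullet> (g *v w)) / (v \<bullet> (g *v v))"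
  have "0 \<le> (w - t *\<^sub>R v) \<bullet> (g *v (w - t *\<^sub>R v))" by (rule posdef_nonneg[OF g])
  also have "\<dots> = w \<bullet> (g *v w) - 2 * t * (v \<bullet> (g *v w)) + t\<^sup>2 * (v \<bullet> (g *v v))"
    by (simp add: matrix_vector_mult_diff_distrib matrix_vector_mult_scaleR inner_diff_left inner_diff_right
        posdef_sym[OF g, of w v] power2_eq_square algebra_simps)
  also have "\<dots> = w \<bullet> (g *v w) - (v \<bullet> (g *v w))\<^sup>2 / (v \<bullet> (g *v v))"
    using a by (simp add: t_def power2_eq_square field_simps)
  finally show ?thesis using a by (simp add: field_simps)
qed simp

lemma posdef_det_nonzero:
  assumes "posdef g" shows "det g \<noteq> 0"
proof -
  have "v = 0" if "g *v v = 0" for v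
    using assms that by (metis inner_zero_right less_irrefl posdef_def)
  then have "\<exists>B. B ** g = mat 1" using matrix_left_invertible_ker by blast
  then show ?thesis using invertible_left_inverse invertible_det_nz by blast
qed

lemma invertible_matrix_inv_right: "invertible A \<Longrightarrow> A ** matrix_inv A = mat 1"
  unfolding matrix_inv_def invertible_def by (rule someI2_ex) auto

lemma posdef_matrix_inv: "posdef g \<Longrightarrow> g *v (matrix_inv g *v e) = e"
  using posdef_det_nonzero[of g] invertible_matrix_inv_right[of g]
  by (simp add: matrix_vector_mul_assoc invertible_det_nz)

text \<open>The coordinates of the differential of \<open>u\<close>; \<open>grad_coord\<close> is
  this covector with its index raised.\<close>

definition dcov :: "('p, 'n::finite) rchart \<Rightarrow> ('p \<Rightarrow> real) \<Rightarrow> real^'n \<Rightarrow> real^'n" where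
  "dcov c u x = (\<chi> i. frechet_derivative (u \<circ> cinv c) (at x within cimg c) (axis i 1))"

text \<open>The squared gradient norm in a given chart, whereas \<open>grad_norm_sq\<close> selects
  some chart by choice; \<open>grad_norm_sq_chart\<close> identifies the two.\<close>

definition chart_gnorm :: "('p, 'n::finite) rchart \<Rightarrow> ('p \<Rightarrow> real) \<Rightarrow> real^'n \<Rightarrow> real" where
  "chart_gnorm c u x = grad_coord c u x \<bullet> (gmat c x *v grad_coord c u x)"

context
  fixes M :: "'p::topological_space set" and c :: "('p, 'n::finite) rchart"
  assumes chart: "is_rchart M c"
begin

lemma chart_halfspace: obtains a b where "openin (top_of_set {x. a \<bullet> x \<le> b}) (cimg c)"
  using chart by (auto simp: is_rchart_def)

lemma chart_posdef: "x \<in> cimg c \<Longrightarrow> posdef (gmat c x)"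
  using chart by (auto simp: is_rchart_def posdef_def)

lemma chart_cinv: "p \<in> cdom c \<Longrightarrow> cinv c (coord c p) = p"
  using chart by (auto simp: is_rchart_def homeomorphism_def)

lemma chart_coord: "x \<in> cimg c \<Longrightarrow> coord c (cinv c x) = x" "x \<in> cimg c \<Longrightarrow> cinv c x \<in> cdom c"
  using chart by (auto simp: is_rchart_def homeomorphism_def)

text \<open>Overlaps of charts are again relatively open in a half-space, so that derivatives there
  are unique.\<close>

lemma chart_image_openin:
  assumes "openin (top_of_set M) W"
  obtains a b where "openin (top_of_set {x. a \<bullet> x \<le> b}) (coord c ` (cdom c \<inter> W))"
proof -
  obtain a b where ab: "openin (top_of_set {x. a \<bullet> x \<le> b}) (cimg c)" by (rule chart_halfspace)
  have "openin (top_of_set (cdom c)) (cdom c \<inter> W)"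
    using assms openin_imp_subset[of "top_of_set M" "cdom c"] chart by (auto simp: is_rchart_def openin_open)
  moreover have "homeomorphism (cdom c) (cimg c) (coord c) (cinv c)" using chart by (simp add: is_rchart_def)
  ultimately have "openin (top_of_set (cimg c)) (coord c ` (cdom c \<inter> W))"
    by (rule homeomorphism_imp_open_map[rotated])
  then have "openin (top_of_set {x. a \<bullet> x \<le> b}) (coord c ` (cdom c \<inter> W))" using ab by (rule openin_trans)
  then show ?thesis by (rule that)
qed

context
  fixes u :: "'p \<Rightarrow> real"
  assumes sm: "smooth_on (cimg c) (u \<circ> cinv c)"
begin

lemma dcov_unique:
  assumes "x \<in> cimg c" and D: "((u \<circ> cinv c) has_derivative D) (at x within cimg c)"
  shows "D v = dcov c u x \<bullet> v"
proof -
  obtain a b where ab: "openin (top_of_set {x. a \<bullet> x \<le> b}) (cimg c)" by (rule chart_halfspace)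
  have "frechet_derivative (u \<circ> cinv c) (at x within cimg c) = D"
    using has_derivative_unique_halfspace[OF ab assms(1) _ D] D
    by (metis differentiableI frechet_derivative_works)
  then have d: "dcov c u x = (\<chi> i. D (axis i 1))" by (simp add: dcov_def)
  have lin: "linear D" using D by (rule has_derivative_linear)
  have "D v = D (\<Sum>i\<in>UNIV. v $ i *s axis i 1)" by (simp add: basis_expansion)
  also have "\<dots> = (\<Sum>i\<in>UNIV. v $ i * D (axis i 1))"
    using lin by (simp add: linear_sum linear_scale scalar_mult_eq_scaleR)
  also have "\<dots> = dcov c u x \<bullet> v" by (simp add: d inner_vec_def mult.commute)
  finally show ?thesis .
qed

lemma dcov_has_derivative:
  assumes "x \<in> cimg c"
  shows "((u \<circ> cinv c) has_derivative (\<lambda>v. dcov c u x \<bullet> v)) (at x within cimg c)"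
proof -
  obtain W E where "x \<in> W" "\<And>y. y \<in> cimg c \<inter> W \<Longrightarrow> ((u \<circ> cinv c) has_derivative E y) (at y within cimg c)"
    using smooth_on_C1[OF sm assms] by metis
  then have "((u \<circ> cinv c) has_derivative E x) (at x within cimg c)" using assms by auto
  moreover have "E x = (\<lambda>v. dcov c u x \<bullet> v)" using dcov_unique[OF assms calculation] by (simp add: fun_eq_iff)
  ultimately show ?thesis by simp
qed

lemma continuous_on_dcov: "continuous_on (cimg c) (dcov c u)"
  unfolding continuous_on_eq_continuous_within
proof
  fix x assume x: "x \<in> cimg c"
  obtain W E where W: "open W" "x \<in> W"
    "\<And>y. y \<in> cimg c \<inter> W \<Longrightarrow> ((u \<circ> cinv c) has_derivative E y) (at y within cimg c)"
    "\<And>v. continuous_on W (\<lambda>y. E y v)"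
    using smooth_on_C1[OF sm x] by metis
  have "E y v = dcov c u y \<bullet> v" if "y \<in> cimg c \<inter> W" for y v
    using dcov_unique[OF _ W(3)[OF that]] that by auto
  then have eq: "dcov c u y = (\<chi> i. E y (axis i 1))" if "y \<in> cimg c \<inter> W" for y
    using that by (simp add: vec_eq_iff inner_axis)
  have "continuous_on W (\<lambda>y. (\<chi> i. E y (axis i 1)) :: real^'n)"
    by (intro continuous_on_vec_lambda W(4))
  then have "continuous (at x) (\<lambda>y. (\<chi> i. E y (axis i 1)) :: real^'n)"
    using W by (simp add: continuous_on_eq_continuous_at)
  then have c1: "continuous (at x within cimg c) (\<lambda>y. (\<chi> i. E y (axis i 1)) :: real^'n)"
    by (rule continuous_at_imp_continuous_at_within)
  obtain e where e: "0 < e" "ball x e \<subseteq> W" using W by (meson open_contains_ball)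
  show "continuous (at x within cimg c) (dcov c u)"
    by (rule continuous_transform_within[OF c1 e(1) x])
      (use e eq in \<open>auto simp: dist_commute subset_iff\<close>)
qed

lemma gmat_grad_coord: "x \<in> cimg c \<Longrightarrow> gmat c x *v grad_coord c u x = dcov c u x"
  by (simp add: grad_coord_def dcov_def posdef_matrix_inv[OF chart_posdef])

lemma chart_gnorm_eq: "x \<in> cimg c \<Longrightarrow> chart_gnorm c u x = dcov c u x \<bullet> grad_coord c u x"
  by (simp add: chart_gnorm_def gmat_grad_coord inner_commute)

lemma chart_gnorm_nonneg: "x \<in> cimg c \<Longrightarrow> 0 \<le> chart_gnorm c u x"
  by (simp add: chart_gnorm_def posdef_nonneg[OF chart_posdef])

lemma chart_gnorm_ge:
  "x \<in> cimg c \<Longrightarrow> (dcov c u x \<bullet> v)\<^sup>2 \<le> chart_gnorm c u x * (v \<bullet> (gmat c x *v v))"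
  using posdef_Cauchy_Schwarz[OF chart_posdef, of x "grad_coord c u x" v]
    posdef_sym[OF chart_posdef, of x "grad_coord c u x" v]
  by (simp add: chart_gnorm_def gmat_grad_coord inner_commute)

text \<open>Inserting the gradient for \<open>v\<close> turns the hypothesis into
  \<open>G^2 \<le> k G\<close>, where \<open>G\<close> is the squared norm. Together with
  \<open>chart_gnorm_ge\<close> this makes \<open>G\<close> the least constant in the Cauchy-Schwarz
  bound for the differential, a description free of coordinates.\<close>

lemma chart_gnorm_le:
  assumes x: "x \<in> cimg c" and k: "0 \<le> k"
    and le: "\<And>v. (dcov c u x \<bullet> v)\<^sup>2 \<le> k * (v \<bullet> (gmat c x *v v))"
  shows "chart_gnorm c u x \<le> k"
proof -
  have "chart_gnorm c u x * chart_gnorm c u x \<le> k * chart_gnorm c u x"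
    using le[of "grad_coord c u x"] unfolding chart_gnorm_eq[OF x, symmetric] chart_gnorm_def[symmetric]
    by (simp add: power2_eq_square)
  then show ?thesis using chart_gnorm_nonneg[OF x] k by (metis mult_le_cancel_right order_le_less not_le)
qed

lemma continuous_on_chart_gnorm: "continuous_on (cimg c) (chart_gnorm c u)"
proof -
  have "continuous_on (cimg c) (gmat c)" using chart by (simp add: is_rchart_def smooth_on_imp_continuous_on)
  then have g: "continuous_on (cimg c) (\<lambda>x. gmat c x $ i $ j)" for i j by (intro continuous_intros)
  have d: "continuous_on (cimg c) (\<lambda>x. dcov c u x $ i)" for i using continuous_on_dcov by (intro continuous_intros)
  \<comment> \<open>Cramer's rule writes the gradient as a vector of quotients of determinants,
    whose continuity is evident.\<close>
  define X where "X x = (\<chi> k. det (\<chi> i j. if j = k then dcov c u x $ i else gmat c x $ i $ j) / det (gmat c x))" for x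
  have X: "grad_coord c u x = X x" if "x \<in> cimg c" for x
    using gmat_grad_coord[OF that] cramer[OF posdef_det_nonzero[OF chart_posdef[OF that]]] by (simp add: X_def)
  have cX: "continuous_on (cimg c) X"
    unfolding X_def
  proof (intro continuous_on_vec_lambda continuous_on_divide ballI)
    fix k :: 'n
    have "continuous_on (cimg c) (\<lambda>x. if j = k then dcov c u x $ i else gmat c x $ i $ j)" for i j
      using g d by (cases "j = k") auto
    then show "continuous_on (cimg c) (\<lambda>x. det (\<chi> i j. if j = k then dcov c u x $ i else gmat c x $ i $ j))"
      unfolding det_def by (simp add: continuous_on_sum continuous_on_prod continuous_on_mult)
    show "continuous_on (cimg c) (\<lambda>x. det (gmat c x))"
      unfolding det_def by (intro continuous_intros g)
  qed (use posdef_det_nonzero[OF chart_posdef] in auto)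
  have "continuous_on (cimg c) (\<lambda>x. dcov c u x \<bullet> X x)"
    using cX continuous_on_dcov by (intro continuous_intros)
  then show ?thesis
    by (rule continuous_on_cong[THEN iffD1, rotated 2]) (simp_all add: chart_gnorm_eq X)
qed

end

end

text \<open>The derivative of the transition map is isometric for the two metric matrices and
  carries one coordinate differential of \<open>u\<close> to the other. A constant that bounds the
  second differential therefore bounds the first, and minimality gives the inequality; equality
  follows by exchanging the charts.\<close>

lemma chart_gnorm_independent_le:
  fixes c c' :: "('p::topological_space, 'n::finite) rchart"
  assumes ch: "is_rchart M c" "is_rchart M c'" and comp: "rcompatible c c'"
    and sm: "smooth_on (cimg c) (u \<circ> cinv c)" "smooth_on (cimg c') (u \<circ> cinv c')"
    and p: "p \<in> cdom c" "p \<in> cdom c'"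
  shows "chart_gnorm c u (coord c p) \<le> chart_gnorm c' u (coord c' p)"
proof (rule chart_gnorm_le[OF ch(1) sm(1)])
  let ?S = "coord c ` (cdom c \<inter> cdom c')" and ?\<tau> = "coord c' \<circ> cinv c" and ?x = "coord c p"
  have xS: "?x \<in> ?S" using p by auto
  have \<tau>x: "?\<tau> ?x = coord c' p" using p ch by (simp add: chart_cinv)
  have "openin (top_of_set M) (cdom c')" using ch(2) by (simp add: is_rchart_def)
  then obtain a b where ab: "openin (top_of_set {x. a \<bullet> x \<le> b}) ?S"
    by (rule chart_image_openin[OF ch(1)])
  have \<tau>: "smooth_on ?S ?\<tau>" using comp by (simp add: rcompatible_def Let_def)
  obtain E W where "?x \<in> W" "\<And>y. y \<in> ?S \<inter> W \<Longrightarrow> (?\<tau> has_derivative E y) (at y within ?S)"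
    using smooth_on_C1[OF \<tau> xS] by metis
  then have D: "(?\<tau> has_derivative E ?x) (at ?x within ?S)" using xS by auto
  let ?D = "E ?x"
  have iso: "v \<bullet> (gmat c ?x *v w) = ?D v \<bullet> (gmat c' (coord c' p) *v ?D w)" for v w
    using comp D xS unfolding rcompatible_def Let_def \<tau>x[symmetric] by blast
  have e1: "((u \<circ> cinv c) has_derivative (\<lambda>v. dcov c u ?x \<bullet> v)) (at ?x within ?S)"
    by (rule has_derivative_subset[OF dcov_has_derivative[OF ch(1) sm(1)]]) (use p in auto)
  have "((\<lambda>y. (u \<circ> cinv c') (?\<tau> y)) has_derivative (\<lambda>v. dcov c' u (coord c' p) \<bullet> ?D v)) (at ?x within ?S)"
  proof (rule has_derivative_in_compose[OF D])
    have "?\<tau> ` ?S \<subseteq> cimg c'" using chart_cinv[OF ch(1)] by auto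
    then show "((u \<circ> cinv c') has_derivative (\<lambda>v. dcov c' u (coord c' p) \<bullet> v)) (at (?\<tau> ?x) within ?\<tau> ` ?S)"
      unfolding \<tau>x using p by (intro has_derivative_subset[OF dcov_has_derivative[OF ch(2) sm(2)]]) auto
  qed
  moreover have "(u \<circ> cinv c') (?\<tau> y) = (u \<circ> cinv c) y" if "y \<in> ?S" for y
    using that chart_cinv[OF ch(1)] chart_cinv[OF ch(2)] by auto
  ultimately have e2: "((u \<circ> cinv c) has_derivative (\<lambda>v. dcov c' u (coord c' p) \<bullet> ?D v)) (at ?x within ?S)"
    using has_derivative_transform[OF xS, of "u \<circ> cinv c" "\<lambda>y. (u \<circ> cinv c') (?\<tau> y)"] by auto
  have eq: "dcov c u ?x \<bullet> v = dcov c' u (coord c' p) \<bullet> ?D v" for v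
    using has_derivative_unique_halfspace[OF ab xS e1 e2] by (rule fun_cong)
  show "(dcov c u ?x \<bullet> v)\<^sup>2 \<le> chart_gnorm c' u (coord c' p) * (v \<bullet> (gmat c ?x *v v))" for v
    unfolding eq iso by (rule chart_gnorm_ge[OF ch(2) sm(2)]) (use p in auto)
  show "0 \<le> chart_gnorm c' u (coord c' p)" using p by (intro chart_gnorm_nonneg[OF ch(2) sm(2)]) auto
qed (use p in auto)

lemma grad_norm_sq_chart:
  assumes at: "riemannian_atlas M \<A>" and sm: "smooth_fun \<A> u" and c: "c \<in> \<A>" "p \<in> cdom c"
  shows "grad_norm_sq \<A> u p = chart_gnorm c u (coord c p)"
proof -
  define c0 where "c0 = (SOME c. c \<in> \<A> \<and> p \<in> cdom c)"
  have c0: "c0 \<in> \<A>" "p \<in> cdom c0"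
    using someI[of "\<lambda>c. c \<in> \<A> \<and> p \<in> cdom c" c] c by (auto simp: c0_def)
  have "grad_norm_sq \<A> u p = chart_gnorm c0 u (coord c0 p)"
    by (simp add: grad_norm_sq_def Let_def c0_def[symmetric] chart_gnorm_def)
  also have "\<dots> = chart_gnorm c u (coord c p)"
    using c c0 at sm unfolding riemannian_atlas_def smooth_fun_def
    by (intro antisym chart_gnorm_independent_le[of M]) auto
  finally show ?thesis .
qed

lemma atlas_chart_at: "riemannian_atlas M \<A> \<Longrightarrow> p \<in> M \<Longrightarrow> \<exists>c\<in>\<A>. p \<in> cdom c \<and> is_rchart M c"
  unfolding riemannian_atlas_def by blast

section \<open>Gradients as functions on the manifold\<close>

lemma continuous_on_via_charts:
  fixes f :: "'p::topological_space \<Rightarrow> 'b::topological_space"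
  assumes at: "riemannian_atlas M \<A>"
    and f: "\<And>c. c \<in> \<A> \<Longrightarrow> is_rchart M c \<Longrightarrow> continuous_on (cdom c) f"
  shows "continuous_on M f"
proof -
  have "(f \<longlongrightarrow> f x) (at x within M)" if x: "x \<in> M" for x
  proof -
    obtain c where c: "c \<in> \<A>" "x \<in> cdom c" "is_rchart M c" using atlas_chart_at[OF at x] by blast
    then obtain W where W: "open W" "cdom c = M \<inter> W" by (auto simp: is_rchart_def openin_open)
    have "at x within M = at x within (M \<inter> W)"
      by (rule at_within_nhd[of _ W]) (use W c in auto)
    then show ?thesis using f[OF c(1,3)] c(2) W by (simp add: continuous_on_def)
  qed
  then show ?thesis by (simp add: continuous_on_def)
qed

lemma smooth_fun_continuous_on:
  assumes at: "riemannian_atlas M \<A>" and sm: "smooth_fun \<A> u"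
  shows "continuous_on M u"
proof (rule continuous_on_via_charts[OF at])
  fix c assume c: "c \<in> \<A>" "is_rchart M c"
  have "smooth_on (cimg c) (u \<circ> cinv c)" using sm c by (simp add: smooth_fun_def)
  then have "continuous_on (cimg c) (u \<circ> cinv c)" by (rule smooth_on_imp_continuous_on)
  moreover have "continuous_on (cdom c) (coord c)" using c by (simp add: is_rchart_def homeomorphism_def)
  ultimately have "continuous_on (cdom c) ((u \<circ> cinv c) \<circ> coord c)" by (rule continuous_on_compose[rotated])
  then show "continuous_on (cdom c) u"
    using chart_cinv[OF c(2)] continuous_on_cong[of "cdom c" "cdom c" "(u \<circ> cinv c) \<circ> coord c" u] by simp
qed

lemma continuous_on_grad_norm_sq:
  assumes at: "riemannian_atlas M \<A>" and sm: "smooth_fun \<A> u"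
  shows "continuous_on M (grad_norm_sq \<A> u)"
proof (rule continuous_on_via_charts[OF at])
  fix c assume c: "c \<in> \<A>" "is_rchart M c"
  have "continuous_on (cimg c) (chart_gnorm c u)"
    using sm c by (intro continuous_on_chart_gnorm[OF c(2)]) (simp add: smooth_fun_def)
  moreover have "continuous_on (cdom c) (coord c)" using c by (simp add: is_rchart_def homeomorphism_def)
  ultimately have "continuous_on (cdom c) (\<lambda>p. chart_gnorm c u (coord c p))"
    by (rule continuous_on_compose2) simp
  then show "continuous_on (cdom c) (grad_norm_sq \<A> u)"
    using grad_norm_sq_chart[OF at sm c(1)] continuous_on_cong[of "cdom c" "cdom c" "grad_norm_sq \<A> u" "\<lambda>p. chart_gnorm c u (coord c p)"] by simp
qed

lemma grad_norm_sq_nonneg: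
  assumes "riemannian_atlas M \<A>" "smooth_fun \<A> u" "p \<in> M"
  shows "0 \<le> grad_norm_sq \<A> u p"
proof -
  obtain c where c: "c \<in> \<A>" "p \<in> cdom c" "is_rchart M c" using atlas_chart_at assms by blast
  then show ?thesis
    using assms by (auto simp: grad_norm_sq_chart[OF assms(1,2) c(1,2)] smooth_fun_def intro!: chart_gnorm_nonneg)
qed

lemma smooth_fun_scale: "smooth_fun \<A> u \<Longrightarrow> smooth_fun \<A> (\<lambda>p. a * u p)"
  unfolding smooth_fun_def using smooth_on_scale by (fastforce simp: o_def)

lemma smooth_fun_add: "smooth_fun \<A> u \<Longrightarrow> smooth_fun \<A> v \<Longrightarrow> smooth_fun \<A> (\<lambda>p. u p + v p)"
  unfolding smooth_fun_def using smooth_on_add by (fastforce simp: o_def)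

lemma grad_norm_sq_scale:
  assumes at: "riemannian_atlas M \<A>" and sm: "smooth_fun \<A> u" and p: "p \<in> M"
  shows "grad_norm_sq \<A> (\<lambda>p. a * u p) p = a\<^sup>2 * grad_norm_sq \<A> u p"
proof -
  obtain c where c: "c \<in> \<A>" "p \<in> cdom c" "is_rchart M c" using atlas_chart_at at p by blast
  let ?x = "coord c p"
  have x: "?x \<in> cimg c" using c by auto
  have smc: "smooth_on (cimg c) (u \<circ> cinv c)" "smooth_on (cimg c) ((\<lambda>p. a * u p) \<circ> cinv c)"
    using sm smooth_fun_scale[OF sm, of a] c by (auto simp: smooth_fun_def)
  have "(((\<lambda>p. a * u p) \<circ> cinv c) has_derivative (\<lambda>v. a * (dcov c u ?x \<bullet> v))) (at ?x within cimg c)"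
    using has_derivative_mult_right[OF dcov_has_derivative[OF c(3) smc(1) x], of a] by (simp add: o_def)
  from dcov_unique[OF c(3) smc(2) x this] have "dcov c (\<lambda>p. a * u p) ?x \<bullet> v = (a *\<^sub>R dcov c u ?x) \<bullet> v" for v
    by simp
  then have "dcov c (\<lambda>p. a * u p) ?x = a *\<^sub>R dcov c u ?x" using vector_eq_rdot by blast
  then have "grad_coord c (\<lambda>p. a * u p) ?x = a *\<^sub>R grad_coord c u ?x"
    by (simp add: grad_coord_def dcov_def[symmetric] matrix_vector_mult_scaleR)
  then show ?thesis
    using c(1,2) sm by (simp add: grad_norm_sq_chart[OF at _ c(1,2)] smooth_fun_scale chart_gnorm_def
        matrix_vector_mult_scaleR power2_eq_square)
qed

text \<open>Young's inequality with a free parameter: a small \<open>e\<close> keeps the first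
  factor close to 1, which is what comparing limits of energies requires.\<close>

lemma grad_norm_sq_add_le:
  assumes at: "riemannian_atlas M \<A>" and sm: "smooth_fun \<A> u" "smooth_fun \<A> w" and p: "p \<in> M" and e: "0 < e"
  shows "grad_norm_sq \<A> (\<lambda>p. u p + w p) p \<le> (1 + e) * grad_norm_sq \<A> u p + (1 + 1 / e) * grad_norm_sq \<A> w p"
proof -
  obtain c where c: "c \<in> \<A>" "p \<in> cdom c" "is_rchart M c" using atlas_chart_at at p by blast
  let ?x = "coord c p"
  have x: "?x \<in> cimg c" using c by auto
  have smc: "smooth_on (cimg c) (u \<circ> cinv c)" "smooth_on (cimg c) (w \<circ> cinv c)" "smooth_on (cimg c) ((\<lambda>p. u p + w p) \<circ> cinv c)"
    using sm smooth_fun_add[OF sm] c by (auto simp: smooth_fun_def)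
  have "(((\<lambda>p. u p + w p) \<circ> cinv c) has_derivative (\<lambda>v. dcov c u ?x \<bullet> v + dcov c w ?x \<bullet> v)) (at ?x within cimg c)"
    using has_derivative_add[OF dcov_has_derivative[OF c(3) smc(1) x] dcov_has_derivative[OF c(3) smc(2) x]] by (simp add: o_def)
  from dcov_unique[OF c(3) smc(3) x this] have "dcov c (\<lambda>p. u p + w p) ?x \<bullet> v = (dcov c u ?x + dcov c w ?x) \<bullet> v" for v
    by (simp add: inner_add_left)
  then have "dcov c (\<lambda>p. u p + w p) ?x = dcov c u ?x + dcov c w ?x" using vector_eq_rdot by blast
  then have X: "grad_coord c (\<lambda>p. u p + w p) ?x = grad_coord c u ?x + grad_coord c w ?x"
    by (simp add: grad_coord_def dcov_def[symmetric] matrix_vector_right_distrib)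
  let ?X = "grad_coord c u ?x" and ?Y = "grad_coord c w ?x" and ?g = "gmat c ?x"
  have g: "posdef ?g" by (rule chart_posdef[OF c(3) x])
  have "0 \<le> (e *\<^sub>R ?X - ?Y) \<bullet> (?g *v (e *\<^sub>R ?X - ?Y)) / e" using posdef_nonneg[OF g] e by simp
  also have "\<dots> = e * (?X \<bullet> (?g *v ?X)) + (1 / e) * (?Y \<bullet> (?g *v ?Y)) - 2 * (?X \<bullet> (?g *v ?Y))"
    using e by (simp add: matrix_vector_mult_diff_distrib matrix_vector_mult_scaleR inner_diff_left inner_diff_right
        posdef_sym[OF g, of ?Y ?X] field_simps)
  finally have "(?X + ?Y) \<bullet> (?g *v (?X + ?Y)) \<le> (1 + e) * (?X \<bullet> (?g *v ?X)) + (1 + 1 / e) * (?Y \<bullet> (?g *v ?Y))"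
    by (simp add: matrix_vector_right_distrib inner_add_left inner_add_right posdef_sym[OF g, of ?Y ?X] distrib_right)
  then show ?thesis
    using c(1,2) sm by (simp add: grad_norm_sq_chart[OF at _ c(1,2)] smooth_fun_add chart_gnorm_def X)
qed

section \<open>Warped products over an interval\<close>

definition polar_map :: "(real \<times> (real^'n::finite) \<Rightarrow> 'p) \<Rightarrow> real^'n \<Rightarrow> 'p" where
  "polar_map \<Phi> x = \<Phi> (norm x, sgn x)"

text \<open>The warped metric in ball coordinates, with \<open>s = \<theta>(r) / r\<close>: radial
  vectors keep their Euclidean length, tangential ones are stretched by \<open>s\<close>.\<close>

definition polar_form :: "real \<Rightarrow> 'a::real_inner \<Rightarrow> 'a \<Rightarrow> 'a \<Rightarrow> real" where
  "polar_form s x v w = (sgn x \<bullet> v) * (sgn x \<bullet> w) + s\<^sup>2 * (v \<bullet> w - (sgn x \<bullet> v) * (sgn x \<bullet> w))"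

lemma has_derivative_norm_sgn:
  fixes x :: "'a::real_inner"
  assumes "x \<noteq> 0"
  shows "((\<lambda>x. (norm x, sgn x)) has_derivative
    (\<lambda>v. (sgn x \<bullet> v, (1 / norm x) *\<^sub>R (v - (sgn x \<bullet> v) *\<^sub>R sgn x)))) (at x)"
proof -
  have n: "(norm has_derivative (\<lambda>v. sgn x \<bullet> v)) (at x)"
    using has_derivative_norm[OF assms] by (simp add: inner_commute)
  have "((\<lambda>x. inverse (norm x)) has_derivative (\<lambda>v. - (inverse (norm x) * (sgn x \<bullet> v) * inverse (norm x)))) (at x)"
    by (rule Deriv.has_derivative_inverse[OF _ n]) (use assms in simp)
  from has_derivative_scaleR[OF this has_derivative_ident]
  have "((\<lambda>x. inverse (norm x) *\<^sub>R x) has_derivative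
     (\<lambda>v. inverse (norm x) *\<^sub>R v + (- (inverse (norm x) * (sgn x \<bullet> v) * inverse (norm x))) *\<^sub>R x)) (at x)" .
  moreover have "inverse (norm x) *\<^sub>R v + (- (inverse (norm x) * (sgn x \<bullet> v) * inverse (norm x))) *\<^sub>R x
     = (1 / norm x) *\<^sub>R (v - (sgn x \<bullet> v) *\<^sub>R sgn x)" for v
    by (simp add: sgn_div_norm divide_inverse algebra_simps)
  ultimately have "(sgn has_derivative (\<lambda>v. (1 / norm x) *\<^sub>R (v - (sgn x \<bullet> v) *\<^sub>R sgn x))) (at x)"
    by (simp add: sgn_div_norm[abs_def])
  then show ?thesis by (intro has_derivative_Pair n)
qed

text \<open>The second component of the derivative of \<open>(norm x, sgn x)\<close> is orthogonal
  to \<open>sgn x\<close>, hence among the vectors for which \<open>warped_isometry\<close>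
  prescribes the metric; its factor \<open>1 / norm x\<close> turns \<open>\<theta>(r)\<close> into
  \<open>\<theta>(r) / r\<close>.\<close>

lemma polar_map_chart_derivative:
  fixes \<Phi> :: "real \<times> (real^'n::finite) \<Rightarrow> 'p::topological_space"
  assumes wi: "warped_isometry \<A> \<theta> I \<Phi> P" and I: "I \<subseteq> {0<..}" and c: "c \<in> \<A>"
  defines "V \<equiv> {x. norm x \<in> I \<and> polar_map \<Phi> x \<in> cdom c}"
  assumes x: "x \<in> V"
  obtains L where "((coord c \<circ> polar_map \<Phi>) has_derivative L) (at x within V)"
    "\<And>v w. L v \<bullet> (gmat c (coord c (polar_map \<Phi> x)) *v L w) = polar_form (\<theta> (norm x) / norm x) x v w"
proof -
  let ?Z = "cyl I \<inter> \<Phi> -` cdom c" and ?q = "\<lambda>x :: real^'n. (norm x, sgn x)"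
  have nx: "0 < norm x" using x I by (auto simp: V_def)
  then have x0: "x \<noteq> 0" by auto
  have qV: "?q ` V \<subseteq> ?Z" using I by (auto simp: V_def polar_map_def norm_sgn subset_iff)
  have qx: "?q x \<in> ?Z" using qV x by blast
  have "smooth_on ?Z (coord c \<circ> \<Phi>)" using wi c by (simp add: warped_isometry_def)
  from smooth_on_C1[OF this qx] obtain E W where "?q x \<in> W"
    "\<And>y. y \<in> ?Z \<inter> W \<Longrightarrow> ((coord c \<circ> \<Phi>) has_derivative E y) (at y within ?Z)" by metis
  then have D: "((coord c \<circ> \<Phi>) has_derivative E (?q x)) (at (?q x) within ?Z)" using qx by blast
  let ?D = "E (?q x)" and ?r = "\<lambda>v. (1 / norm x) *\<^sub>R (v - (sgn x \<bullet> v) *\<^sub>R sgn x)"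
  have iso: "?D (s, w) \<bullet> (gmat c (coord c (polar_map \<Phi> x)) *v ?D (s', w')) = s * s' + (\<theta> (norm x))\<^sup>2 * (w \<bullet> w')"
    if "w \<bullet> sgn x = 0" "w' \<bullet> sgn x = 0" for s w s' w'
    using wi c qx D that unfolding warped_isometry_def polar_map_def by blast
  have ss: "sgn x \<bullet> sgn x = 1" using x0 by (simp add: dot_square_norm norm_sgn)
  have t: "?r v \<bullet> sgn x = 0" for v
    by (simp add: inner_diff_left ss inner_commute[of "sgn x" v])
  have rr: "?r v \<bullet> ?r w = (v \<bullet> w - (sgn x \<bullet> v) * (sgn x \<bullet> w)) / (norm x)\<^sup>2" for v w
  proof -
    have "(v - (sgn x \<bullet> v) *\<^sub>R sgn x) \<bullet> (w - (sgn x \<bullet> w) *\<^sub>R sgn x) = v \<bullet> w - (sgn x \<bullet> v) * (sgn x \<bullet> w)"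
      by (simp add: inner_diff_left inner_diff_right ss inner_commute[of v "sgn x"])
    then show ?thesis by (simp add: power2_eq_square)
  qed
  show ?thesis
  proof (rule that)
    have "((\<lambda>y. (coord c \<circ> \<Phi>) (?q y)) has_derivative (\<lambda>v. ?D (sgn x \<bullet> v, ?r v))) (at x within V)"
      by (rule has_derivative_in_compose[OF has_derivative_at_withinI[OF has_derivative_norm_sgn[OF x0]] has_derivative_subset[OF D qV]])
    then show "((coord c \<circ> polar_map \<Phi>) has_derivative (\<lambda>v. ?D (sgn x \<bullet> v, ?r v))) (at x within V)"
      by (simp add: polar_map_def o_def)
    show "?D (sgn x \<bullet> v, ?r v) \<bullet> (gmat c (coord c (polar_map \<Phi> x)) *v ?D (sgn x \<bullet> w, ?r w)) = polar_form (\<theta> (norm x) / norm x) x v w" for v w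
      unfolding iso[OF t t] rr polar_form_def by (simp add: power_divide)
  qed
qed

lemma continuous_on_det: "continuous_on S A \<Longrightarrow> continuous_on S (\<lambda>x. det (A x :: real^'n::finite^'n))"
  unfolding det_def by (intro continuous_intros)

text \<open>Common frame for both kinds of revolution manifold: \<open>F\<close> is the set of
  poles, and \<open>I\<close> is \<open>(0, R]\<close> or \<open>(0, R)\<close>.\<close>

locale warped =
  fixes M :: "'p::{t2_space, second_countable_topology} set" and \<A> :: "('p, 'n::finite) rchart set"
    and \<mu> :: "'p measure" and \<theta> :: "real \<Rightarrow> real" and I :: "real set"
    and \<Phi> :: "real \<times> (real^'n) \<Rightarrow> 'p" and F :: "'p set" and R :: real
  assumes atlas: "riemannian_atlas M \<A>" and vol: "riemannian_volume M \<A> \<mu>"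
    and wi: "warped_isometry \<A> \<theta> I \<Phi> (M - F)" and F: "finite F" "F \<subseteq> M"
    and I: "{0<..<R} \<subseteq> I" "I \<subseteq> {0<..R}" and R: "0 < R"
    and \<theta>: "\<And>r. r \<in> I \<Longrightarrow> 0 < \<theta> r" "continuous_on I \<theta>"
begin

abbreviation "Z \<equiv> {x :: real^'n. norm x \<in> I}"

lemma I_pos: "r \<in> I \<Longrightarrow> 0 < r" using I by auto

lemma I_borel[measurable]: "I \<in> sets borel"
proof -
  have "I = {0<..<R} \<or> I = {0<..R}" using I R by (auto simp: less_eq_real_def) (metis antisym_conv2 greaterThanAtMost_iff greaterThanLessThan_iff less_eq_real_def subsetD)+
  then show ?thesis by auto
qed

lemma Z_borel[measurable]: "Z \<in> sets borel"
proof -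
  have "norm -` I \<inter> space borel \<in> sets (borel :: (real^'n) measure)"
    by (rule measurable_sets[of norm borel borel]) auto
  then show ?thesis by (simp add: vimage_def)
qed

definition inv_polar :: "'p \<Rightarrow> real^'n" where
  "inv_polar p = fst (inv_into (cyl I) \<Phi> p) *\<^sub>R snd (inv_into (cyl I) \<Phi> p)"

lemma bij_\<Phi>: "bij_betw \<Phi> (cyl I) (M - F)" using wi by (simp add: warped_isometry_def)

lemma polar_map_in: "x \<in> Z \<Longrightarrow> polar_map \<Phi> x \<in> M - F"
  using bij_betwE[OF bij_\<Phi>] I_pos by (fastforce simp: polar_map_def norm_sgn)

lemma inv_polar_polar_map: "x \<in> Z \<Longrightarrow> inv_polar (polar_map \<Phi> x) = x"
proof -
  assume x: "x \<in> Z"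
  then have "(norm x, sgn x) \<in> cyl I" using I_pos by (fastforce simp: norm_sgn)
  then have "inv_into (cyl I) \<Phi> (\<Phi> (norm x, sgn x)) = (norm x, sgn x)"
    using bij_\<Phi> by (intro inv_into_f_f) (auto simp: bij_betw_def)
  moreover have "x \<noteq> 0" using x I_pos[of "norm x"] by auto
  ultimately show ?thesis by (simp add: inv_polar_def polar_map_def sgn_div_norm)
qed

lemma inv_into_mem: "p \<in> M - F \<Longrightarrow> inv_into (cyl I) \<Phi> p \<in> cyl I \<and> \<Phi> (inv_into (cyl I) \<Phi> p) = p"
  using bij_\<Phi> by (metis bij_betw_imp_surj_on f_inv_into_f inv_into_into)

lemma norm_inv_polar: "p \<in> M - F \<Longrightarrow> norm (inv_polar p) = fst (inv_into (cyl I) \<Phi> p)"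
  using inv_into_mem[of p] I_pos by (auto simp: inv_polar_def) (metis abs_of_pos fst_conv mem_Sigma_iff norm_scaleR)

lemma polar_map_inv_polar: "p \<in> M - F \<Longrightarrow> polar_map \<Phi> (inv_polar p) = p \<and> inv_polar p \<in> Z"
proof -
  assume p: "p \<in> M - F"
  obtain r \<omega> where e: "inv_into (cyl I) \<Phi> p = (r, \<omega>)" by force
  then have r: "r \<in> I" "norm \<omega> = 1" "\<Phi> (r, \<omega>) = p" using inv_into_mem[OF p] by auto
  then have "0 < r" using I_pos by auto
  then have "norm (r *\<^sub>R \<omega>) = r" "sgn (r *\<^sub>R \<omega>) = \<omega>" using r by (auto simp: sgn_scaleR sgn_div_norm)
  then show ?thesis using r by (simp add: inv_polar_def e polar_map_def)
qed

lemma polar_map_inj: "inj_on (polar_map \<Phi>) Z"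
  by (rule inj_on_inverseI[of _ inv_polar]) (rule inv_polar_polar_map)

lemma continuous_on_polar_map: "continuous_on Z (polar_map \<Phi>)"
proof -
  have "continuous_on Z (\<lambda>x. (norm x, sgn x))"
    using I_pos by (intro continuous_at_imp_continuous_on ballI has_derivative_continuous[OF has_derivative_norm_sgn]) fastforce
  moreover have "continuous_on (cyl I) \<Phi>" using wi by (simp add: warped_isometry_def)
  moreover have "(\<lambda>x. (norm x, sgn x)) ` Z \<subseteq> cyl I" using I_pos by (fastforce simp: norm_sgn)
  ultimately show ?thesis
    unfolding polar_map_def using continuous_on_compose2[of "cyl I" \<Phi> Z "\<lambda>x. (norm x, sgn x)"] by blast
qed

text \<open>The Jacobian of ball coordinates with respect to Lebesgue measure. The indicator makes
  it Borel on the whole space, as \<open>\<theta>\<close> is controlled on \<open>I\<close>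
  only.\<close>

definition dens :: "real^'n \<Rightarrow> real" where
  "dens x = (indicator I (norm x) * \<theta> (norm x) / norm x) ^ (CARD('n) - 1)"

lemma \<theta>_measurable[measurable]: "(\<lambda>r. indicator I r * \<theta> r) \<in> borel_measurable borel"
  using borel_measurable_continuous_on_indicator[OF _ \<theta>(2)] I_borel by (simp add: real_scaleR_def)

lemma dens_measurable[measurable]: "dens \<in> borel_measurable borel"
proof -
  have "(\<lambda>x::real^'n. (indicator I (norm x) * \<theta> (norm x)) / norm x) \<in> borel_measurable borel"
    by (intro borel_measurable_divide measurable_compose[OF _ \<theta>_measurable]) auto
  then show ?thesis unfolding dens_def[abs_def] by measurable
qed

definition D :: "(real^'n) measure" where
  "D = density lborel (\<lambda>x. indicator Z x * ennreal (dens x))"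

lemma space_\<mu>: "space \<mu> = M" and sets_\<mu>: "sets \<mu> = sets (restrict_space borel M)"
  using vol by (auto simp: riemannian_volume_def)

lemma openin_sets: "openin (top_of_set M) W \<Longrightarrow> W \<in> sets \<mu>"
  by (auto simp: sets_\<mu> openin_open sets_restrict_space)

lemma chart: "c \<in> \<A> \<Longrightarrow> is_rchart M c" using atlas by (simp add: riemannian_atlas_def)

lemma openin_P: "openin (top_of_set M) (M - F)"
proof -
  have "closed F" using F by (intro finite_imp_closed)
  then show ?thesis by (auto simp: openin_open intro!: exI[of _ "- F"])
qed

lemma coord_measurable: 
  assumes c: "c \<in> \<A>" shows "coord c \<in> borel_measurable (restrict_space \<mu> (cdom c))"
proof -
  have "continuous_on (cdom c) (coord c)" using chart[OF c] by (simp add: is_rchart_def homeomorphism_def)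
  then have "coord c \<in> borel_measurable (restrict_space borel (cdom c))" by (rule borel_measurable_continuous_on_restrict)
  moreover have "sets (restrict_space \<mu> (cdom c)) = sets (restrict_space borel (cdom c))"
  proof -
    have "cdom c \<subseteq> M" using chart[OF c] by (auto simp: is_rchart_def dest: openin_imp_subset)
    then have "cdom c \<inter> M = cdom c" by auto
    then show ?thesis by (simp add: sets_restrict_space sets_\<mu> image_image Int_assoc[symmetric])
  qed
  ultimately show ?thesis using measurable_cong_sets by blast
qed

lemma halfspace_openin_borel:
  fixes S :: "(real^'n) set"
  assumes "openin (top_of_set {x. a \<bullet> x \<le> b}) S" shows "S \<in> sets borel"
proof -
  obtain W where "open W" "S = {x. a \<bullet> x \<le> b} \<inter> W" using assms by (auto simp: openin_open)
  then show ?thesis using closed_halfspace_le[of a b] by (auto intro!: sets.Int borel_closed borel_open)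
qed

lemma chart_emeasure:
  assumes c: "c \<in> \<A>" and Y[measurable]: "Y \<in> sets borel"
  shows "emeasure \<mu> (coord c -` Y \<inter> cdom c) = (\<integral>\<^sup>+y. indicator Y y * ennreal (indicator (cimg c) y * sqrt (det (gmat c y))) \<partial>lborel)"
proof -
  have cd: "cdom c \<in> sets \<mu>" using chart[OF c] by (intro openin_sets) (simp add: is_rchart_def)
  have sp: "space (restrict_space \<mu> (cdom c)) = cdom c"
    using sets.sets_into_space[OF cd] by (auto simp: space_restrict_space)
  have [measurable]: "cimg c \<in> sets borel" using chart_halfspace[OF chart[OF c]] halfspace_openin_borel by metis
  have cg: "continuous_on (cimg c) (\<lambda>y. sqrt (det (gmat c y)))"
  proof -
    have "continuous_on (cimg c) (gmat c)" using chart[OF c] by (simp add: is_rchart_def smooth_on_imp_continuous_on)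
    then have "continuous_on (cimg c) (\<lambda>x. det (gmat c x))" by (rule continuous_on_det)
    then show ?thesis by (intro continuous_intros)
  qed
  then have [measurable]: "(\<lambda>y. indicator (cimg c) y * sqrt (det (gmat c y))) \<in> borel_measurable borel"
    using borel_measurable_continuous_on_indicator[of "cimg c" "\<lambda>y. sqrt (det (gmat c y))"] by (simp add: real_scaleR_def)
  have eq: "(\<lambda>y. indicator (cimg c) y * ennreal (sqrt (det (gmat c y)))) = (\<lambda>y. ennreal (indicator (cimg c) y * sqrt (det (gmat c y))))"
    by (auto simp: fun_eq_iff indicator_def)
  have "emeasure \<mu> (coord c -` Y \<inter> cdom c) = emeasure (restrict_space \<mu> (cdom c)) (coord c -` Y \<inter> cdom c)"
    using cd by (subst emeasure_restrict_space) auto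
  also have "\<dots> = emeasure (distr (restrict_space \<mu> (cdom c)) borel (coord c)) Y"
    using sp coord_measurable[OF c] by (subst emeasure_distr) auto
  also have "\<dots> = emeasure (density lborel (\<lambda>y. indicator (cimg c) y * ennreal (sqrt (det (gmat c y))))) Y"
    using vol c by (simp add: riemannian_volume_def)
  also have "\<dots> = (\<integral>\<^sup>+y. indicator Y y * ennreal (indicator (cimg c) y * sqrt (det (gmat c y))) \<partial>lborel)"
  proof -
    have "(\<lambda>y. ennreal (indicator (cimg c) y * sqrt (det (gmat c y)))) \<in> borel_measurable lborel" by measurable
    from emeasure_density[OF this, of Y] show ?thesis unfolding eq by (simp add: mult.commute)
  qed
  finally show ?thesis .
qed

lemma emeasure_singleton: "p \<in> M \<Longrightarrow> emeasure \<mu> {p} = 0"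
proof -
  assume "p \<in> M"
  then obtain c where c: "c \<in> \<A>" "p \<in> cdom c" "is_rchart M c" using atlas_chart_at[OF atlas] by blast
  have "coord c -` {coord c p} \<inter> cdom c = {p}" using c(2) chart_cinv[OF c(3)] by (auto, metis)
  then have "emeasure \<mu> {p} = (\<integral>\<^sup>+y. indicator {coord c p} y * ennreal (indicator (cimg c) y * sqrt (det (gmat c y))) \<partial>lborel)"
    using chart_emeasure[OF c(1), of "{coord c p}"] by simp
  also have "\<dots> = (\<integral>\<^sup>+y. 0 \<partial>(lborel :: (real^'n) measure))"
    by (rule nn_integral_cong_AE, rule eventually_mono[OF AE_lborel_singleton[of "coord c p"]]) auto
  finally show ?thesis by simp
qed

section \<open>The Riemannian measure in ball coordinates\<close>

definition V :: "('p, 'n) rchart \<Rightarrow> (real^'n) set" where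
  "V c = {x. norm x \<in> I \<and> polar_map \<Phi> x \<in> cdom c}"

lemma polar_map_measurable: "polar_map \<Phi> \<in> measurable (restrict_space borel Z) \<mu>"
proof -
  have "polar_map \<Phi> \<in> borel_measurable (restrict_space borel Z)"
    by (rule borel_measurable_continuous_on_restrict[OF continuous_on_polar_map])
  then have "polar_map \<Phi> \<in> measurable (restrict_space borel Z) (restrict_space borel M)"
    using polar_map_in by (intro measurable_restrict_space2) (auto simp: space_restrict_space)
  then show ?thesis using measurable_cong_sets[OF refl sets_\<mu>] by blast
qed

lemma polar_vimage_borel: "X \<in> sets \<mu> \<Longrightarrow> {x \<in> Z. polar_map \<Phi> x \<in> X} \<in> sets borel"
proof -
  assume "X \<in> sets \<mu>"
  then have "polar_map \<Phi> -` X \<inter> space (restrict_space borel Z) \<in> sets (restrict_space borel Z)"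
    by (rule measurable_sets[OF polar_map_measurable])
  then have "polar_map \<Phi> -` X \<inter> Z \<in> sets borel"
    using Z_borel by (subst (asm) sets_restrict_space_iff) (auto simp: space_restrict_space)
  moreover have "polar_map \<Phi> -` X \<inter> Z = {x \<in> Z. polar_map \<Phi> x \<in> X}" by auto
  ultimately show ?thesis by simp
qed

lemma V_borel: "c \<in> \<A> \<Longrightarrow> V c \<in> sets borel"
  using polar_vimage_borel[of "cdom c"] openin_sets[of "cdom c"] chart[of c]
  by (auto simp: V_def is_rchart_def)

text \<open>The change of variables formula for the coordinate expression \<open>T\<close> of the
  polar map, on a Borel set whose image lies in one chart domain.\<close>

lemma emeasure_polar_image_chart:
  assumes c: "c \<in> \<A>" and B[measurable]: "B \<in> sets borel" and BV: "B \<subseteq> V c"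
  shows "polar_map \<Phi> ` B \<in> sets \<mu> \<and> emeasure \<mu> (polar_map \<Phi> ` B) = emeasure D B"
proof -
  define T where "T = coord c \<circ> polar_map \<Phi>"
  define S where "S = coord c ` (cdom c \<inter> (M - F))"
  note ch = chart[OF c]
  have BZ: "B \<subseteq> Z" using BV by (auto simp: V_def)
  \<comment> \<open>Written in this way, the image under \<open>T\<close> is a preimage under the
    continuous inverse map, hence Borel.\<close>
  have TB: "T ` B = {y \<in> S. inv_polar (cinv c y) \<in> B}"
  proof (intro equalityI subsetI)
    fix y assume "y \<in> T ` B"
    then obtain x where x: "x \<in> B" "y = coord c (polar_map \<Phi> x)" by (auto simp: T_def)
    then have "polar_map \<Phi> x \<in> cdom c \<inter> (M - F)" using BV BZ polar_map_in by (auto simp: V_def)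
    then show "y \<in> {y \<in> S. inv_polar (cinv c y) \<in> B}"
      using x BZ inv_polar_polar_map[of x] by (auto simp: S_def chart_cinv[OF ch])
  next
    fix y assume "y \<in> {y \<in> S. inv_polar (cinv c y) \<in> B}"
    then obtain p where p: "p \<in> cdom c" "p \<in> M - F" "y = coord c p" "inv_polar (cinv c y) \<in> B" by (auto simp: S_def)
    then have "inv_polar p \<in> B" by (simp add: chart_cinv[OF ch])
    then show "y \<in> T ` B" using polar_map_inv_polar[OF p(2)] p(3) by (auto simp: T_def intro!: image_eqI[of _ _ "inv_polar p"])
  qed
  have TBm: "T ` B \<in> sets borel"
  proof -
    obtain a b where "openin (top_of_set {x. a \<bullet> x \<le> b}) S"
      using chart_image_openin[OF ch openin_P] unfolding S_def by metis
    then have Sb: "S \<in> sets borel" by (rule halfspace_openin_borel)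
    have "smooth_on S (inv_into (cyl I) \<Phi> \<circ> cinv c)" using wi c by (simp add: warped_isometry_def S_def)
    then have "continuous_on S (inv_into (cyl I) \<Phi> \<circ> cinv c)" by (rule smooth_on_imp_continuous_on)
    moreover have "continuous_on S (\<lambda>y. fst (h y) *\<^sub>R snd (h y))" if "continuous_on S h" for h :: "real^'n \<Rightarrow> real \<times> (real^'n)"
      using that by (intro continuous_intros)
    ultimately have "continuous_on S (\<lambda>y. fst ((inv_into (cyl I) \<Phi> \<circ> cinv c) y) *\<^sub>R snd ((inv_into (cyl I) \<Phi> \<circ> cinv c) y))"
      by blast
    then have "(\<lambda>y. inv_polar (cinv c y)) \<in> borel_measurable (restrict_space borel S)"
      unfolding inv_polar_def by (intro borel_measurable_continuous_on_restrict) simp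
    from measurable_sets[OF this B] have "(\<lambda>y. inv_polar (cinv c y)) -` B \<inter> S \<in> sets borel"
      using Sb by (subst (asm) sets_restrict_space_iff) (auto simp: space_restrict_space)
    moreover have "(\<lambda>y. inv_polar (cinv c y)) -` B \<inter> S = T ` B" by (auto simp: TB)
    ultimately show ?thesis by simp
  qed
  have im: "coord c -` (T ` B) \<inter> cdom c = polar_map \<Phi> ` B"
  proof (intro equalityI subsetI)
    fix p assume "p \<in> coord c -` (T ` B) \<inter> cdom c"
    then obtain x where x: "x \<in> B" "coord c p = coord c (polar_map \<Phi> x)" "p \<in> cdom c" by (auto simp: T_def)
    then have "p = polar_map \<Phi> x" using chart_cinv[OF ch] BV by (metis (mono_tags, lifting) V_def mem_Collect_eq subsetD)
    then show "p \<in> polar_map \<Phi> ` B" using x by auto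
  qed (use BV in \<open>auto simp: T_def V_def\<close>)
  have "\<forall>x\<in>B. \<exists>L. (T has_derivative L) (at x within B) \<and>
     (\<forall>v w. L v \<bullet> (gmat c (T x) *v L w) = polar_form (\<theta> (norm x) / norm x) x v w)"
  proof
    fix x assume "x \<in> B"
    then have "x \<in> {x. norm x \<in> I \<and> polar_map \<Phi> x \<in> cdom c}" using BV by (auto simp: V_def)
    moreover have "I \<subseteq> {0<..}" using I_pos by auto
    ultimately obtain L where
      L: "((coord c \<circ> polar_map \<Phi>) has_derivative L) (at x within {x. norm x \<in> I \<and> polar_map \<Phi> x \<in> cdom c})"
      "\<And>v w. L v \<bullet> (gmat c (coord c (polar_map \<Phi> x)) *v L w) = polar_form (\<theta> (norm x) / norm x) x v w"
      using polar_map_chart_derivative[OF wi _ c] by blast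
    show "\<exists>L. (T has_derivative L) (at x within B) \<and>
     (\<forall>v w. L v \<bullet> (gmat c (T x) *v L w) = polar_form (\<theta> (norm x) / norm x) x v w)"
      using has_derivative_subset[OF L(1) BV[unfolded V_def]] L(2) unfolding T_def o_apply by blast
  qed
  then obtain L where L: "\<And>x. x \<in> B \<Longrightarrow> (T has_derivative L x) (at x within B)"
    "\<And>x v w. x \<in> B \<Longrightarrow> L x v \<bullet> (gmat c (T x) *v L x w) = polar_form (\<theta> (norm x) / norm x) x v w"
    by metis
  let ?f = "\<lambda>y. indicator (cimg c) y * sqrt (det (gmat c y))"
  have Tc: "T x \<in> cimg c" if "x \<in> B" for x using that BV by (auto simp: T_def V_def)
  have q: "dens x = \<bar>det (matrix (L x))\<bar> * ?f (T x)" if x: "x \<in> B" for x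
  proof -
    have xI: "norm x \<in> I" "x \<noteq> 0" using x BZ I_pos[of "norm x"] by auto
    have "\<bar>det (matrix (L x))\<bar> * sqrt (det (gmat c (T x))) = (\<theta> (norm x) / norm x) ^ (CARD('n) - 1)"
    proof (rule abs_det_of_isometry)
      show "linear (L x)" using L(1)[OF x] by (rule has_derivative_linear)
      show "norm (sgn x) = 1" using xI by (simp add: norm_sgn)
      show "0 \<le> \<theta> (norm x) / norm x" using \<theta>(1)[OF xI(1)] by simp
    qed (use L(2)[OF x] in \<open>auto simp: polar_form_def\<close>)
    then show ?thesis using Tc[OF x] xI by (simp add: dens_def)
  qed
  \<comment> \<open>The sign of the root is read off from the identity \<open>q\<close>: the
    positive \<open>dens\<close> is a nonnegative factor times this root, so the root cannot be
    negative.\<close>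
  have f0: "0 \<le> ?f y" if "y \<in> T ` B" for y
  proof -
    from that obtain x where x: "x \<in> B" "y = T x" by (elim imageE) blast
    then have xI: "norm x \<in> I" "x \<noteq> 0" using BZ I_pos[of "norm x"] by auto
    have "0 < dens x" using \<theta>(1)[OF xI(1)] xI by (simp add: dens_def)
    then have "0 < \<bar>det (matrix (L x))\<bar> * ?f y" using q[OF x(1)] x(2) by simp
    then show ?thesis by (metis abs_ge_zero less_eq_real_def mult_nonneg_nonpos not_le)
  qed
  have "polar_map \<Phi> ` B \<in> sets \<mu>"
  proof -
    have "coord c -` (T ` B) \<inter> space (restrict_space \<mu> (cdom c)) \<in> sets (restrict_space \<mu> (cdom c))"
      by (rule measurable_sets[OF coord_measurable[OF c] TBm])
    moreover have cd: "cdom c \<in> sets \<mu>" using ch by (intro openin_sets) (simp add: is_rchart_def)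
    moreover have "space (restrict_space \<mu> (cdom c)) = cdom c"
      using sets.sets_into_space[OF cd] by (auto simp: space_restrict_space)
    ultimately show ?thesis unfolding im[symmetric] by (simp add: sets_restrict_space_iff)
  qed
  moreover have "emeasure \<mu> (polar_map \<Phi> ` B) = emeasure D B"
  proof -
    have [measurable]: "?f \<in> borel_measurable borel"
    proof -
      have "continuous_on (cimg c) (gmat c)" using ch by (simp add: is_rchart_def smooth_on_imp_continuous_on)
      then have "continuous_on (cimg c) (\<lambda>x. det (gmat c x))" by (rule continuous_on_det)
      then have "continuous_on (cimg c) (\<lambda>x. sqrt (det (gmat c x)))" by (intro continuous_intros)
      moreover have "cimg c \<in> sets borel" using chart_halfspace[OF ch] halfspace_openin_borel by metis
      ultimately show ?thesis
        using borel_measurable_continuous_on_indicator[of "cimg c" "\<lambda>y. sqrt (det (gmat c y))"] by (simp add: real_scaleR_def)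
    qed
    have "emeasure \<mu> (polar_map \<Phi> ` B) = (\<integral>\<^sup>+y. indicator (T ` B) y * ennreal (?f y) \<partial>lborel)"
      using chart_emeasure[OF c TBm] by (simp add: im)
    also have "\<dots> = (\<integral>\<^sup>+x. indicator B x * ennreal (dens x) \<partial>lborel)"
    proof (rule nn_integral_change_of_variables[OF B TBm L(1) _ _ dens_measurable f0 q])
      show "inj_on T B"
        using BV polar_map_inj chart_cinv[OF ch] unfolding T_def inj_on_def V_def
        by (smt (verit) comp_apply mem_Collect_eq subset_iff)
    qed auto
    also have "\<dots> = emeasure D B"
      unfolding D_def using BZ by (subst emeasure_density) (auto intro!: nn_integral_cong simp: indicator_def)
    finally show ?thesis .
  qed
  ultimately show ?thesis ..
qed

lemma countable_charts:
  assumes "M \<noteq> {}"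
  obtains c :: "nat \<Rightarrow> ('p, 'n) rchart" where "\<And>k. c k \<in> \<A>" "(\<Union>k. cdom (c k)) = M"
proof -
  have op: "openin (top_of_set M) S" if "S \<in> cdom ` \<A>" for S
    using that chart by (auto simp: is_rchart_def)
  obtain \<C> where C: "\<C> \<subseteq> cdom ` \<A>" "countable \<C>" "\<Union>\<C> = \<Union>(cdom ` \<A>)"
    using Lindelof_openin[of "cdom ` \<A>" M] op by metis
  have UM: "\<Union>(cdom ` \<A>) = M" using atlas by (simp add: riemannian_atlas_def)
  then have Cne: "\<C> \<noteq> {}" using C assms by auto
  have "\<exists>c\<in>\<A>. from_nat_into \<C> k = cdom c" for k
    using from_nat_into[OF Cne, of k] C(1) by auto
  then obtain c where c: "\<And>k. c k \<in> \<A>" "\<And>k. from_nat_into \<C> k = cdom (c k)" by metis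
  have "(\<Union>k. cdom (c k)) = M"
    using C(2,3) Cne UM c(2) range_from_nat_into[OF Cne C(2)] by (metis (no_types, lifting) image_cong)
  with c(1) show ?thesis by (rule that)
qed

lemma polar_image_sets:
  assumes B: "B \<in> sets borel" and BZ: "B \<subseteq> Z"
  shows "polar_map \<Phi> ` B \<in> sets \<mu>"
proof (cases "B = {}")
  case False
  then have "M \<noteq> {}" using polar_map_in BZ by blast
  then obtain c :: "nat \<Rightarrow> ('p, 'n) rchart" where c: "\<And>k. c k \<in> \<A>" "(\<Union>k. cdom (c k)) = M"
    using countable_charts by metis
  have "B = (\<Union>k. B \<inter> V (c k))" using c(2) BZ polar_map_in by (auto simp: V_def)
  then have "polar_map \<Phi> ` B = (\<Union>k. polar_map \<Phi> ` (B \<inter> V (c k)))" by (metis image_UN)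
  also have "\<dots> \<in> sets \<mu>"
  proof (intro sets.countable_UN, safe)
    fix k
    show "polar_map \<Phi> ` (B \<inter> V (c k)) \<in> sets \<mu>"
      using emeasure_polar_image_chart[OF c(1) sets.Int[OF B V_borel[OF c(1)]], of k k] by simp
  qed
  finally show ?thesis .
qed simp

text \<open>Countably many charts cover \<open>M\<close>. Splitting \<open>B\<close> into disjoint
  pieces, each mapped into one chart domain, reduces the claim to single charts; injectivity of the
  polar map keeps the images disjoint.\<close>

lemma emeasure_polar_image:
  assumes B: "B \<in> sets borel" and BZ: "B \<subseteq> Z"
  shows "emeasure \<mu> (polar_map \<Phi> ` B) = emeasure D B"
proof -
  show ?thesis
  proof (cases "B = {}")
    case False
    then obtain x0 where "x0 \<in> B" by auto
    then have "M \<noteq> {}" using polar_map_in[of x0] BZ by auto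
    then obtain c :: "nat \<Rightarrow> ('p, 'n) rchart" where c: "\<And>k. c k \<in> \<A>" and cov: "(\<Union>k. cdom (c k)) = M"
      using countable_charts by metis
    define X where "X k = disjointed (\<lambda>k. B \<inter> V (c k)) k" for k
    have Xb: "X k \<in> sets borel" for k
      unfolding X_def using B V_borel[OF c(1)] sets.range_disjointed_sets[of "\<lambda>k. B \<inter> V (c k)" borel] by auto
    have XV: "X k \<subseteq> V (c k)" for k unfolding X_def using disjointed_subset[of "\<lambda>k. B \<inter> V (c k)" k] by auto
    have XB: "(\<Union>k. X k) = B"
      unfolding X_def UN_disjointed_eq using cov BZ polar_map_in by (auto simp: V_def)
    have dj: "disjoint_family X" unfolding X_def by (rule disjoint_family_disjointed)
    have imd: "disjoint_family (\<lambda>k. polar_map \<Phi> ` X k)"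
    proof -
      have "inj_on (polar_map \<Phi>) B" using polar_map_inj BZ by (rule inj_on_subset)
      then show ?thesis using dj XB unfolding disjoint_family_on_def
        by (metis UNIV_I UN_upper image_empty inj_on_image_Int)
    qed
    have e: "polar_map \<Phi> ` X k \<in> sets \<mu>" "emeasure \<mu> (polar_map \<Phi> ` X k) = emeasure D (X k)" for k
      using emeasure_polar_image_chart[OF c(1) Xb XV] by auto
    have "emeasure \<mu> (polar_map \<Phi> ` B) = emeasure \<mu> (\<Union>k. polar_map \<Phi> ` X k)"
      by (simp add: XB[symmetric] image_UN)
    also have "\<dots> = (\<Sum>k. emeasure \<mu> (polar_map \<Phi> ` X k))"
      using e imd by (intro suminf_emeasure[symmetric]) auto
    also have "\<dots> = (\<Sum>k. emeasure D (X k))" by (simp add: e)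
    also have "\<dots> = emeasure D (\<Union>k. X k)"
      using Xb dj by (intro suminf_emeasure) (auto simp: D_def)
    finally show ?thesis by (simp add: XB)
  qed simp
qed

text \<open>The poles form a null set, so the measure is determined by the part that the polar map
  covers.\<close>

lemma emeasure_\<mu>:
  assumes X: "X \<in> sets \<mu>"
  shows "emeasure \<mu> X = emeasure D {x \<in> Z. polar_map \<Phi> x \<in> X}"
proof -
  have XM: "X \<subseteq> M" using sets.sets_into_space[OF X] by (simp add: space_\<mu>)
  have P: "M - F \<in> sets \<mu>" by (rule openin_sets[OF openin_P])
  have "F \<in> null_sets \<mu>"
  proof -
    have "{p} \<in> null_sets \<mu>" if "p \<in> F" for p
    proof -
      have "{p} \<in> sets \<mu>" using that F by (auto simp: sets_\<mu> sets_restrict_space intro!: image_eqI[of _ _ "{p}"])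
      then show ?thesis using emeasure_singleton[of p] F that by (auto simp: null_sets_def)
    qed
    then have "(\<Union>p\<in>F. {p}) \<in> null_sets \<mu>" using F by (intro null_sets.finite_UN) auto
    then show ?thesis by simp
  qed
  then have "emeasure \<mu> X = emeasure \<mu> (X - F)" using X by (simp add: emeasure_Diff_null_set)
  also have "X - F = polar_map \<Phi> ` {x \<in> Z. polar_map \<Phi> x \<in> X}"
  proof (intro equalityI subsetI)
    fix p assume "p \<in> X - F"
    then show "p \<in> polar_map \<Phi> ` {x \<in> Z. polar_map \<Phi> x \<in> X}"
      using polar_map_inv_polar[of p] XM by (auto intro!: image_eqI[of _ _ "inv_polar p"])
  qed (use polar_map_in in auto)
  also have "emeasure \<mu> \<dots> = emeasure D {x \<in> Z. polar_map \<Phi> x \<in> X}"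
    by (rule emeasure_polar_image[OF polar_vimage_borel[OF X]]) auto
  finally show ?thesis .
qed

text \<open>The sphere of radius \<open>R\<close> is a Lebesgue null set; hence one formula covers a
  boundary at \<open>r = R\<close> and a second pole there.\<close>

lemma nn_integral_\<mu>:
  assumes [measurable]: "f \<in> borel_measurable \<mu>"
  shows "(\<integral>\<^sup>+p. f p \<partial>\<mu>) = (\<integral>\<^sup>+x. indicator {0<..<R} (norm x) * (f (polar_map \<Phi> x) * ennreal ((\<theta> (norm x) / norm x) ^ (CARD('n) - 1))) \<partial>lborel)"
proof -
  let ?DZ = "restrict_space D Z"
  have sD: "sets D = sets borel" by (simp add: D_def)
  have mp[measurable]: "polar_map \<Phi> \<in> measurable ?DZ \<mu>"
    using polar_map_measurable measurable_cong_sets[OF sets_restrict_space_cong[OF sD] refl] by blast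
  have ZD: "Z \<inter> space D \<in> sets D" using Z_borel by (simp add: D_def)
  have eqm: "\<mu> = distr ?DZ \<mu> (polar_map \<Phi>)"
  proof (rule measure_eqI)
    fix X assume X: "X \<in> sets \<mu>"
    have "emeasure (distr ?DZ \<mu> (polar_map \<Phi>)) X = emeasure ?DZ (polar_map \<Phi> -` X \<inter> space ?DZ)"
      using X by (subst emeasure_distr) auto
    also have "polar_map \<Phi> -` X \<inter> space ?DZ = {x \<in> Z. polar_map \<Phi> x \<in> X}"
      by (auto simp: space_restrict_space D_def)
    also have "emeasure ?DZ \<dots> = emeasure D {x \<in> Z. polar_map \<Phi> x \<in> X}"
      using ZD by (subst emeasure_restrict_space) auto
    finally show "emeasure \<mu> X = emeasure (distr ?DZ \<mu> (polar_map \<Phi>)) X" using emeasure_\<mu>[OF X] by simp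
  qed simp
  have fp: "(\<lambda>x. f (polar_map \<Phi> x)) \<in> borel_measurable ?DZ" by measurable
  have fm[measurable]: "(\<lambda>x. f (polar_map \<Phi> x) * indicator Z x) \<in> borel_measurable borel"
    using fp borel_measurable_restrict_space_iff_ennreal[OF ZD, of "\<lambda>x. f (polar_map \<Phi> x)"]
    by (simp add: measurable_cong_sets[OF sD refl])
  have "(\<integral>\<^sup>+p. f p \<partial>\<mu>) = (\<integral>\<^sup>+p. f p \<partial>(distr ?DZ \<mu> (polar_map \<Phi>)))" using eqm by simp
  also have "\<dots> = (\<integral>\<^sup>+x. f (polar_map \<Phi> x) \<partial>?DZ)"
    by (rule nn_integral_distr[OF mp]) measurable
  also have "\<dots> = (\<integral>\<^sup>+x. f (polar_map \<Phi> x) * indicator Z x \<partial>D)"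
    by (rule nn_integral_restrict_space[OF ZD])
  also have "\<dots> = (\<integral>\<^sup>+x. (indicator Z x * ennreal (dens x)) * (f (polar_map \<Phi> x) * indicator Z x) \<partial>lborel)"
    unfolding D_def by (rule nn_integral_density) (auto simp: fm)
  also have "\<dots> = (\<integral>\<^sup>+x. indicator {0<..<R} (norm x) * (f (polar_map \<Phi> x) * ennreal ((\<theta> (norm x) / norm x) ^ (CARD('n) - 1))) \<partial>lborel)"
  proof (rule nn_integral_cong_AE)
    have "negligible (sphere (0 :: real^'n) R)" by (rule negligible_sphere)
    then have "sphere (0 :: real^'n) R \<in> null_sets lborel"
      by (auto simp: negligible_iff_null_sets null_sets_def emeasure_completion)
    then have "AE x in lborel. x \<notin> sphere (0 :: real^'n) R" by (rule AE_not_in)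
    then show "AE x in lborel. (indicator Z x * ennreal (dens x)) * (f (polar_map \<Phi> x) * indicator Z x)
      = indicator {0<..<R} (norm x) * (f (polar_map \<Phi> x) * ennreal ((\<theta> (norm x) / norm x) ^ (CARD('n) - 1)))"
    proof eventually_elim
      case (elim x)
      then have "norm x \<in> I \<longleftrightarrow> norm x \<in> {0<..<R}" using I by (auto simp: less_le)
      then show ?case by (auto simp: indicator_def dens_def mult.commute)
    qed
  qed
  finally show ?thesis .
qed

end

section \<open>Bounds for the second eigenvalue\<close>

text \<open>Meant for \<open>q\<close> the energies along a sequence and \<open>d\<close> the
  energies of differences; it takes the place of the triangle inequality for the square root of the
  energy.\<close>

lemma quasi_subadditive_convergent:
  fixes q :: "nat \<Rightarrow> real"
  assumes q0: "\<And>m. 0 \<le> q m"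
    and d0: "\<And>m l. 0 \<le> d m l"
    and le: "\<And>m l e. 0 < e \<Longrightarrow> q m \<le> (1 + e) * q l + (1 + 1 / e) * d m l"
    and cau: "\<And>\<epsilon>. 0 < \<epsilon> \<Longrightarrow> \<exists>m0. \<forall>m\<ge>m0. \<forall>l\<ge>m0. d m l < \<epsilon>"
  shows "convergent q"
proof -
  obtain m1 where m1: "\<And>m l. m \<ge> m1 \<Longrightarrow> l \<ge> m1 \<Longrightarrow> d m l < 1" using cau[of 1] by auto
  \<comment> \<open>The hypothesis \<open>le\<close> with parameter 1 bounds the tail by
    \<open>2 * q m1 + 2\<close>.\<close>
  define K where "K = 2 * q m1 + 3"
  have K: "q m \<le> K" if "m \<ge> m1" for m
    using le[of 1 m m1] m1[OF that order_refl] by (simp add: K_def)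
  have K0: "0 < K" using q0[of m1] by (simp add: K_def)
  have "Cauchy q"
  proof (rule metric_CauchyI)
    fix \<epsilon> :: real assume \<epsilon>: "0 < \<epsilon>"
    \<comment> \<open>Makes \<open>e * q l\<close> at most \<open>\<epsilon> / 2\<close> on the
      tail; afterwards \<open>\<delta>\<close> compensates the large factor
      \<open>1 + 1 / e\<close>.\<close>
    define e where "e = \<epsilon> / (2 * K)"
    have e: "0 < e" "e * K = \<epsilon> / 2" using \<epsilon> K0 by (auto simp: e_def)
    have e1: "0 < 1 + 1 / e" using e by (simp add: add_pos_pos)
    have "x * (\<epsilon> / (2 * x)) = \<epsilon> / 2" if "0 < x" for x using that by simp
    with e1 \<epsilon> obtain \<delta> where \<delta>: "0 < \<delta>" "(1 + 1 / e) * \<delta> = \<epsilon> / 2"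
      by (metis divide_pos_pos mult_pos_pos zero_less_numeral)
    obtain m0 where m0: "\<And>m l. m \<ge> m0 \<Longrightarrow> l \<ge> m0 \<Longrightarrow> d m l < \<delta>" using cau[OF \<delta>(1)] by auto
    have "q m - q l < \<epsilon>" if "m \<ge> max m0 m1" "l \<ge> max m0 m1" for m l
    proof -
      have "q m - q l \<le> e * q l + (1 + 1 / e) * d m l" using le[OF e(1), of m l] by (simp add: algebra_simps)
      also have "e * q l \<le> e * K" using K[of l] that e by (intro mult_left_mono) auto
      also have "(1 + 1 / e) * d m l < (1 + 1 / e) * \<delta>"
        using m0[of m l] that e1 by (intro mult_strict_left_mono) auto
      finally show ?thesis unfolding e(2) \<delta>(2) by simp
    qed
    then show "\<exists>M. \<forall>m\<ge>M. \<forall>n\<ge>M. dist (q m) (q n) < \<epsilon>"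
      by (intro exI[of _ "max m0 m1"]) (auto simp: dist_real_def abs_less_iff)
  qed
  then show ?thesis by (rule Cauchy_convergent)
qed

text \<open>Because \<open>\<sigma> \<le> 1\<close>, weighted integrals are dominated by unweighted
  ones, and the sequences that define \<open>H1\<close> are Cauchy for the weighted energy as
  well.\<close>

locale weighted_manifold =
  fixes M :: "'p::{t2_space, second_countable_topology} set" and \<A> :: "('p, 'n::finite) rchart set"
    and \<mu> :: "'p measure" and \<sigma> :: "'p \<Rightarrow> real"
  assumes atlas: "riemannian_atlas M \<A>" and compact: "compact M"
    and space_\<mu>: "space \<mu> = M" and sets_\<mu>: "sets \<mu> = sets (restrict_space borel M)"
    and fin: "finite_measure \<mu>" and \<sigma>_measurable[measurable]: "\<sigma> \<in> borel_measurable \<mu>"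
    and \<sigma>: "\<And>p. p \<in> M \<Longrightarrow> 0 < \<sigma> p \<and> \<sigma> p \<le> 1"
begin

lemma continuous_measurable:
  fixes f :: "'p \<Rightarrow> real"
  shows "continuous_on M f \<Longrightarrow> f \<in> borel_measurable \<mu>"
  using borel_measurable_continuous_on_restrict[of M f] measurable_cong_sets[OF sets_\<mu> refl] by blast

lemma continuous_bounded:
  fixes f :: "'p \<Rightarrow> real"
  assumes "continuous_on M f" obtains C where "0 \<le> C" "\<And>p. p \<in> M \<Longrightarrow> \<bar>f p\<bar> \<le> C"
proof -
  have "bounded (f ` M)" using compact_continuous_image[OF assms compact] by (rule compact_imp_bounded)
  then obtain B where "\<And>p. p \<in> M \<Longrightarrow> \<bar>f p\<bar> \<le> B" by (auto simp: bounded_iff)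
  then show ?thesis using that[of "\<bar>B\<bar>"] by fastforce
qed

lemma bounded_integrable:
  fixes f :: "'p \<Rightarrow> real"
  assumes "f \<in> borel_measurable \<mu>" "\<And>p. p \<in> M \<Longrightarrow> \<bar>f p\<bar> \<le> C"
  shows "integrable \<mu> f"
  using assms by (intro finite_measure.integrable_const_bound[OF fin, of _ C]) (auto simp: space_\<mu>)

lemma integrable_\<sigma>: "integrable \<mu> f \<Longrightarrow> integrable \<mu> (\<lambda>p. f p * \<sigma> p)" for f :: "'p \<Rightarrow> real"
proof (rule Bochner_Integration.integrable_bound[of \<mu> f])
  show "AE p in \<mu>. norm (f p * \<sigma> p) \<le> norm (f p)"
  proof (rule AE_I2)
    fix p assume "p \<in> space \<mu>"
    then have "\<bar>f p\<bar> * \<bar>\<sigma> p\<bar> \<le> \<bar>f p\<bar> * 1" using \<sigma>[of p] by (intro mult_left_mono) (auto simp: space_\<mu>)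
    then show "norm (f p * \<sigma> p) \<le> norm (f p)" by (simp add: abs_mult)
  qed
qed auto

lemma smooth_measurable: "smooth_fun \<A> u \<Longrightarrow> u \<in> borel_measurable \<mu>"
  by (intro continuous_measurable smooth_fun_continuous_on[OF atlas])

lemma gns_measurable: "smooth_fun \<A> u \<Longrightarrow> grad_norm_sq \<A> u \<in> borel_measurable \<mu>"
  by (intro continuous_measurable continuous_on_grad_norm_sq[OF atlas])

lemma gns_integrable: "smooth_fun \<A> u \<Longrightarrow> integrable \<mu> (grad_norm_sq \<A> u)"
  using continuous_bounded[OF continuous_on_grad_norm_sq[OF atlas]] bounded_integrable gns_measurable by metis

lemma smooth_sq_integrable: "smooth_fun \<A> u \<Longrightarrow> integrable \<mu> (\<lambda>p. (u p)\<^sup>2)"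
proof -
  assume u: "smooth_fun \<A> u"
  have "continuous_on M (\<lambda>p. (u p)\<^sup>2)" using smooth_fun_continuous_on[OF atlas u] by (intro continuous_intros)
  then show ?thesis using continuous_bounded bounded_integrable continuous_measurable by metis
qed

lemma sq_integrable_add:
  fixes f g :: "'p \<Rightarrow> real"
  assumes [measurable]: "f \<in> borel_measurable \<mu>" "g \<in> borel_measurable \<mu>"
    and int: "integrable \<mu> (\<lambda>p. (f p)\<^sup>2)" "integrable \<mu> (\<lambda>p. (g p)\<^sup>2)"
  shows "integrable \<mu> (\<lambda>p. (f p + g p)\<^sup>2)"
proof (rule Bochner_Integration.integrable_bound)
  show "integrable \<mu> (\<lambda>p. 2 * (f p)\<^sup>2 + 2 * (g p)\<^sup>2)" using int by auto
  show "AE p in \<mu>. norm ((f p + g p)\<^sup>2) \<le> norm (2 * (f p)\<^sup>2 + 2 * (g p)\<^sup>2)"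
  proof (rule AE_I2)
    fix p
    have "0 \<le> (f p - g p)\<^sup>2" "0 \<le> (f p + g p)\<^sup>2" by simp_all
    then show "norm ((f p + g p)\<^sup>2) \<le> norm (2 * (f p)\<^sup>2 + 2 * (g p)\<^sup>2)"
      by (simp add: power2_sum power2_diff abs_le_iff)
  qed
qed measurable

lemma sq_integrable_mult:
  fixes f g :: "'p \<Rightarrow> real"
  assumes [measurable]: "f \<in> borel_measurable \<mu>" "g \<in> borel_measurable \<mu>"
    and int: "integrable \<mu> (\<lambda>p. (f p)\<^sup>2)" "integrable \<mu> (\<lambda>p. (g p)\<^sup>2)"
  shows "integrable \<mu> (\<lambda>p. f p * g p)"
proof (rule Bochner_Integration.integrable_bound)
  show "integrable \<mu> (\<lambda>p. (f p)\<^sup>2 + (g p)\<^sup>2)" using int by auto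
  show "AE p in \<mu>. norm (f p * g p) \<le> norm ((f p)\<^sup>2 + (g p)\<^sup>2)"
  proof (rule AE_I2)
    fix p
    have "2 * \<bar>f p * g p\<bar> \<le> (f p)\<^sup>2 + (g p)\<^sup>2"
      using sum_squares_bound[of "\<bar>f p\<bar>" "\<bar>g p\<bar>"] by (simp add: abs_mult mult.assoc)
    then show "norm (f p * g p) \<le> norm ((f p)\<^sup>2 + (g p)\<^sup>2)" unfolding real_norm_def by linarith
  qed
qed measurable

section \<open>Weighted energy and limits in the Sobolev space\<close>

definition energy :: "('p \<Rightarrow> real) \<Rightarrow> real" where
  "energy u = (\<integral>p. grad_norm_sq \<A> u p * \<sigma> p \<partial>\<mu>)"

lemma energy_nonneg: "smooth_fun \<A> u \<Longrightarrow> 0 \<le> energy u"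
  unfolding energy_def using grad_norm_sq_nonneg[OF atlas] \<sigma>
  by (intro integral_nonneg_AE AE_I2) (auto simp: space_\<mu> less_imp_le)

lemma energy_le: "smooth_fun \<A> u \<Longrightarrow> energy u \<le> (\<integral>p. grad_norm_sq \<A> u p \<partial>\<mu>)"
proof -
  assume u: "smooth_fun \<A> u"
  show ?thesis unfolding energy_def
  proof (rule integral_mono)
    fix p assume "p \<in> space \<mu>"
    then have "grad_norm_sq \<A> u p * \<sigma> p \<le> grad_norm_sq \<A> u p * 1"
      using \<sigma>[of p] grad_norm_sq_nonneg[OF atlas u] by (intro mult_left_mono) (auto simp: space_\<mu>)
    then show "grad_norm_sq \<A> u p * \<sigma> p \<le> grad_norm_sq \<A> u p" by simp
  qed (use u in \<open>auto intro!: integrable_\<sigma> gns_integrable\<close>)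
qed

lemma energy_scale: "smooth_fun \<A> u \<Longrightarrow> energy (\<lambda>p. a * u p) = a\<^sup>2 * energy u"
proof -
  assume u: "smooth_fun \<A> u"
  have "energy (\<lambda>p. a * u p) = (\<integral>p. a\<^sup>2 * (grad_norm_sq \<A> u p * \<sigma> p) \<partial>\<mu>)"
    unfolding energy_def by (rule Bochner_Integration.integral_cong) (auto simp: space_\<mu> grad_norm_sq_scale[OF atlas u])
  then show ?thesis by (simp add: energy_def)
qed

lemma energy_add_le:
  assumes u: "smooth_fun \<A> u" and w: "smooth_fun \<A> w" and e: "0 < e"
  shows "energy (\<lambda>p. u p + w p) \<le> (1 + e) * energy u + (1 + 1 / e) * energy w"
proof -
  note iu = integrable_\<sigma>[OF gns_integrable[OF u]] and iw = integrable_\<sigma>[OF gns_integrable[OF w]]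
  have "energy (\<lambda>p. u p + w p) \<le> (\<integral>p. (1 + e) * (grad_norm_sq \<A> u p * \<sigma> p) + (1 + 1 / e) * (grad_norm_sq \<A> w p * \<sigma> p) \<partial>\<mu>)"
    unfolding energy_def
  proof (rule integral_mono)
    fix p assume "p \<in> space \<mu>"
    then have p: "p \<in> M" by (simp add: space_\<mu>)
    have "grad_norm_sq \<A> (\<lambda>p. u p + w p) p * \<sigma> p \<le> ((1 + e) * grad_norm_sq \<A> u p + (1 + 1 / e) * grad_norm_sq \<A> w p) * \<sigma> p"
      using grad_norm_sq_add_le[OF atlas u w p e] \<sigma>[OF p] by (intro mult_right_mono) auto
    then show "grad_norm_sq \<A> (\<lambda>p. u p + w p) p * \<sigma> p \<le> (1 + e) * (grad_norm_sq \<A> u p * \<sigma> p) + (1 + 1 / e) * (grad_norm_sq \<A> w p * \<sigma> p)"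
      by (simp add: algebra_simps)
  qed (use iu iw smooth_fun_add[OF u w] in \<open>auto intro!: integrable_\<sigma> gns_integrable\<close>)
  also have "\<dots> = (1 + e) * energy u + (1 + 1 / e) * energy w"
    unfolding energy_def using iu iw by simp
  finally show ?thesis .
qed

lemma smooth_fun_diff: "smooth_fun \<A> u \<Longrightarrow> smooth_fun \<A> w \<Longrightarrow> smooth_fun \<A> (\<lambda>p. u p - w p)"
  using smooth_fun_add[OF _ smooth_fun_scale[of \<A> w "-1"], of u] by simp

lemma H1D:
  assumes "(u, v) \<in> H1 \<A> \<mu>"
  shows "u \<in> borel_measurable \<mu>" "integrable \<mu> (\<lambda>p. (u p)\<^sup>2)" "\<And>m. smooth_fun \<A> (v m)"
    "(\<lambda>m. \<integral>p. (v m p - u p)\<^sup>2 \<partial>\<mu>) \<longlonglongrightarrow> 0"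
    "\<And>\<epsilon>. 0 < \<epsilon> \<Longrightarrow> \<exists>m0. \<forall>m\<ge>m0. \<forall>l\<ge>m0. (\<integral>p. grad_norm_sq \<A> (\<lambda>q. v m q - v l q) p \<partial>\<mu>) < \<epsilon>"
  using assms unfolding H1_def by auto

text \<open>Ensures that the \<open>lim\<close> in \<open>rayleigh\<close> is a genuine
  limit.\<close>

lemma energy_convergent:
  assumes H: "(u, v) \<in> H1 \<A> \<mu>"
  shows "convergent (\<lambda>m. energy (v m))"
proof (rule quasi_subadditive_convergent)
  note sm = H1D(3)[OF H]
  show "0 \<le> energy (v m)" for m by (rule energy_nonneg[OF sm])
  show "0 \<le> energy (\<lambda>q. v m q - v l q)" for m l by (intro energy_nonneg smooth_fun_diff sm)
  show "energy (v m) \<le> (1 + e) * energy (v l) + (1 + 1 / e) * energy (\<lambda>q. v m q - v l q)" if "0 < e" for m l e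
    using energy_add_le[OF sm smooth_fun_diff[OF sm sm] that, of l m l] by simp
  show "\<exists>m0. \<forall>m\<ge>m0. \<forall>l\<ge>m0. energy (\<lambda>q. v m q - v l q) < \<epsilon>" if "0 < \<epsilon>" for \<epsilon>
    using H1D(5)[OF H that] energy_le[OF smooth_fun_diff[OF sm sm]] by (meson le_less_trans)
qed

definition pair_comb :: "real \<Rightarrow> real \<Rightarrow> ('p \<Rightarrow> real) \<times> (nat \<Rightarrow> 'p \<Rightarrow> real) \<Rightarrow> ('p \<Rightarrow> real) \<times> (nat \<Rightarrow> 'p \<Rightarrow> real) \<Rightarrow>
   ('p \<Rightarrow> real) \<times> (nat \<Rightarrow> 'p \<Rightarrow> real)" where
  "pair_comb a b x y = (\<lambda>p. a * fst x p + b * fst y p, \<lambda>m p. a * snd x m p + b * snd y m p)"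

lemma lin_comb_2: "lin_comb 2 a w = pair_comb (a 0) (a 1) (w 0) (w 1)"
proof -
  have "{..<2::nat} = {0, 1}" by auto
  then show ?thesis by (simp add: lin_comb_def pair_comb_def)
qed

lemma pair_comb_H1:
  assumes x: "(u, v) \<in> H1 \<A> \<mu>" and y: "(u', v') \<in> H1 \<A> \<mu>"
  shows "(\<lambda>p. a * u p + b * u' p, \<lambda>m p. a * v m p + b * v' m p) \<in> H1 \<A> \<mu>"
proof -
  note X = H1D[OF x] and Y = H1D[OF y]
  note [measurable] = X(1) Y(1) smooth_measurable[OF X(3)] smooth_measurable[OF Y(3)]
  have sm: "smooth_fun \<A> (\<lambda>p. a * v m p + b * v' m p)" for m
    by (intro smooth_fun_add smooth_fun_scale X(3) Y(3))
  have sq: "integrable \<mu> (\<lambda>p. (a * f p)\<^sup>2)" if "integrable \<mu> (\<lambda>p. (f p)\<^sup>2)" for a and f :: "'p \<Rightarrow> real"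
    using that by (simp add: power_mult_distrib)
  have df: "integrable \<mu> (\<lambda>p. (f p - g p)\<^sup>2)" if "f \<in> borel_measurable \<mu>" "g \<in> borel_measurable \<mu>"
     "integrable \<mu> (\<lambda>p. (f p)\<^sup>2)" "integrable \<mu> (\<lambda>p. (g p)\<^sup>2)" for f g :: "'p \<Rightarrow> real"
    using sq_integrable_add[OF that(1) _ that(3), of "\<lambda>p. - g p"] that by simp
  have L2: "(\<lambda>m. \<integral>p. (a * v m p + b * v' m p - (a * u p + b * u' p))\<^sup>2 \<partial>\<mu>) \<longlonglongrightarrow> 0"
  proof (rule tendsto_sandwich[OF _ _ tendsto_const])
    let ?B = "\<lambda>m. 2 * a\<^sup>2 * (\<integral>p. (v m p - u p)\<^sup>2 \<partial>\<mu>) + 2 * b\<^sup>2 * (\<integral>p. (v' m p - u' p)\<^sup>2 \<partial>\<mu>)"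
    have "?B \<longlonglongrightarrow> 2 * a\<^sup>2 * 0 + 2 * b\<^sup>2 * 0" by (intro tendsto_intros X(4) Y(4))
    then show "?B \<longlonglongrightarrow> 0" by simp
    show "\<forall>\<^sub>F m in sequentially. (\<integral>p. (a * v m p + b * v' m p - (a * u p + b * u' p))\<^sup>2 \<partial>\<mu>) \<le> ?B m"
    proof (rule always_eventually, rule allI)
      fix m
      have i: "integrable \<mu> (\<lambda>p. (v m p - u p)\<^sup>2)" "integrable \<mu> (\<lambda>p. (v' m p - u' p)\<^sup>2)"
        by (rule df; measurable; fact X(2) Y(2) smooth_sq_integrable[OF X(3)] smooth_sq_integrable[OF Y(3)])+
      have "(\<integral>p. (a * v m p + b * v' m p - (a * u p + b * u' p))\<^sup>2 \<partial>\<mu>)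
         \<le> (\<integral>p. 2 * a\<^sup>2 * (v m p - u p)\<^sup>2 + 2 * b\<^sup>2 * (v' m p - u' p)\<^sup>2 \<partial>\<mu>)"
      proof (rule integral_mono_AE')
        show "AE p in \<mu>. (a * v m p + b * v' m p - (a * u p + b * u' p))\<^sup>2 \<le> 2 * a\<^sup>2 * (v m p - u p)\<^sup>2 + 2 * b\<^sup>2 * (v' m p - u' p)\<^sup>2"
        proof (rule AE_I2)
          fix p
          have "0 \<le> (a * (v m p - u p) - b * (v' m p - u' p))\<^sup>2" by simp
          then show "(a * v m p + b * v' m p - (a * u p + b * u' p))\<^sup>2 \<le> 2 * a\<^sup>2 * (v m p - u p)\<^sup>2 + 2 * b\<^sup>2 * (v' m p - u' p)\<^sup>2"
            by (simp add: power2_eq_square algebra_simps)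
        qed
      qed (use i in auto)
      then show "(\<integral>p. (a * v m p + b * v' m p - (a * u p + b * u' p))\<^sup>2 \<partial>\<mu>) \<le> ?B m" using i by simp
    qed
  qed auto
  have C: "\<exists>m0. \<forall>m\<ge>m0. \<forall>l\<ge>m0. (\<integral>p. grad_norm_sq \<A> (\<lambda>q. a * v m q + b * v' m q - (a * v l q + b * v' l q)) p \<partial>\<mu>) < \<epsilon>"
    if \<epsilon>: "0 < \<epsilon>" for \<epsilon>
  proof -
    \<comment> \<open>The two gradient terms contribute \<open>2 (a^2 + b^2) \<delta>\<close>; the
      added 1 makes this strictly less than \<open>\<epsilon>\<close> and covers
      \<open>a = b = 0\<close>.\<close>
    define \<delta> where "\<delta> = \<epsilon> / (2 * (a\<^sup>2 + b\<^sup>2 + 1))"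
    have P: "0 < a\<^sup>2 + b\<^sup>2 + 1" by (simp add: add_nonneg_pos)
    have \<delta>: "0 < \<delta>" using \<epsilon> P by (simp add: \<delta>_def)
    obtain m1 where m1: "\<And>m l. m \<ge> m1 \<Longrightarrow> l \<ge> m1 \<Longrightarrow> (\<integral>p. grad_norm_sq \<A> (\<lambda>q. v m q - v l q) p \<partial>\<mu>) < \<delta>"
      using X(5)[OF \<delta>] by auto
    obtain m2 where m2: "\<And>m l. m \<ge> m2 \<Longrightarrow> l \<ge> m2 \<Longrightarrow> (\<integral>p. grad_norm_sq \<A> (\<lambda>q. v' m q - v' l q) p \<partial>\<mu>) < \<delta>"
      using Y(5)[OF \<delta>] by auto
    have "(\<integral>p. grad_norm_sq \<A> (\<lambda>q. a * v m q + b * v' m q - (a * v l q + b * v' l q)) p \<partial>\<mu>) < \<epsilon>"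
      if ml: "m \<ge> max m1 m2" "l \<ge> max m1 m2" for m l
    proof -
      have s: "smooth_fun \<A> (\<lambda>q. v m q - v l q)" "smooth_fun \<A> (\<lambda>q. v' m q - v' l q)"
        by (intro smooth_fun_diff X(3) Y(3))+
      have e: "(\<lambda>q. a * v m q + b * v' m q - (a * v l q + b * v' l q)) = (\<lambda>q. a * (v m q - v l q) + b * (v' m q - v' l q))"
        by (simp add: algebra_simps)
      have "(\<integral>p. grad_norm_sq \<A> (\<lambda>q. a * (v m q - v l q) + b * (v' m q - v' l q)) p \<partial>\<mu>)
        \<le> (\<integral>p. 2 * a\<^sup>2 * grad_norm_sq \<A> (\<lambda>q. v m q - v l q) p + 2 * b\<^sup>2 * grad_norm_sq \<A> (\<lambda>q. v' m q - v' l q) p \<partial>\<mu>)"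
      proof (rule integral_mono)
        fix p assume "p \<in> space \<mu>"
        then have p: "p \<in> M" by (simp add: space_\<mu>)
        show "grad_norm_sq \<A> (\<lambda>q. a * (v m q - v l q) + b * (v' m q - v' l q)) p
           \<le> 2 * a\<^sup>2 * grad_norm_sq \<A> (\<lambda>q. v m q - v l q) p + 2 * b\<^sup>2 * grad_norm_sq \<A> (\<lambda>q. v' m q - v' l q) p"
          using grad_norm_sq_add_le[OF atlas smooth_fun_scale[OF s(1), of a] smooth_fun_scale[OF s(2), of b] p, of 1]
          by (simp add: grad_norm_sq_scale[OF atlas s(1) p] grad_norm_sq_scale[OF atlas s(2) p])
      qed (auto intro!: gns_integrable smooth_fun_add smooth_fun_scale s Bochner_Integration.integrable_add integrable_mult_right)
      also have "\<dots> = 2 * a\<^sup>2 * (\<integral>p. grad_norm_sq \<A> (\<lambda>q. v m q - v l q) p \<partial>\<mu>) + 2 * b\<^sup>2 * (\<integral>p. grad_norm_sq \<A> (\<lambda>q. v' m q - v' l q) p \<partial>\<mu>)"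
        using gns_integrable[OF s(1)] gns_integrable[OF s(2)] by simp
      also have "\<dots> \<le> 2 * a\<^sup>2 * \<delta> + 2 * b\<^sup>2 * \<delta>"
        using m1[of m l] m2[of m l] ml by (intro add_mono mult_left_mono) auto
      also have "\<dots> < 2 * (a\<^sup>2 + b\<^sup>2 + 1) * \<delta>" using \<delta> by (simp add: algebra_simps)
      also have "\<dots> = \<epsilon>" using P by (simp add: \<delta>_def)
      finally show ?thesis unfolding e .
    qed
    then show ?thesis by blast
  qed
  show ?thesis unfolding H1_def
    using sm L2 C by (auto intro!: sq_integrable_add sq X(2) Y(2))
qed

text \<open>The constants \<open>c\<close> belonging to the approximants vary with \<open>m\<close>
  without any control. For mean zero, however, the integral of \<open>u^2 \<sigma>\<close> is the
  least among those of \<open>(u - c)^2 \<sigma>\<close>, so any \<open>c\<close> may be inserted on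
  the left. Young's inequality then exchanges \<open>u\<close> for \<open>v m\<close>; one lets
  \<open>m\<close> tend to infinity and finally \<open>e\<close> to 0.\<close>

lemma L2_poincare:
  assumes H: "(u, v) \<in> H1 \<A> \<mu>" and mean: "(\<integral>p. u p * \<sigma> p \<partial>\<mu>) = 0" and \<kappa>: "0 < \<kappa>"
    and PI: "\<And>f. smooth_fun \<A> f \<Longrightarrow> \<exists>c. \<kappa> * (\<integral>p. (f p - c)\<^sup>2 * \<sigma> p \<partial>\<mu>) \<le> energy f"
  shows "\<kappa> * (\<integral>p. (u p)\<^sup>2 * \<sigma> p \<partial>\<mu>) \<le> lim (\<lambda>m. energy (v m))"
proof -
  note X = H1D[OF H]
  note [measurable] = X(1) smooth_measurable[OF X(3)]
  let ?L = "lim (\<lambda>m. energy (v m))" and ?d = "\<lambda>m. \<integral>p. (v m p - u p)\<^sup>2 \<partial>\<mu>"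
  let ?u = "\<integral>p. (u p)\<^sup>2 * \<sigma> p \<partial>\<mu>"
  have lim: "(\<lambda>m. energy (v m)) \<longlonglongrightarrow> ?L" using energy_convergent[OF H] by (simp add: convergent_LIMSEQ_iff)
  have const: "integrable \<mu> (\<lambda>p. c)" for c :: real
    using bounded_integrable[of "\<lambda>p. c" "\<bar>c\<bar>"] by simp
  have sh: "integrable \<mu> (\<lambda>p. (f p - c)\<^sup>2)" if "f \<in> borel_measurable \<mu>" "integrable \<mu> (\<lambda>p. (f p)\<^sup>2)" for f :: "'p \<Rightarrow> real" and c :: real
    using sq_integrable_add[OF that(1) _ that(2), of "\<lambda>p. - c"] const by simp
  have iu: "integrable \<mu> u" using sq_integrable_mult[OF X(1) _ X(2), of "\<lambda>p. 1"] const by simp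
  have iD: "integrable \<mu> (\<lambda>p. (v m p - u p)\<^sup>2)" for m
    using sq_integrable_add[OF _ _ smooth_sq_integrable[OF X(3)], of m "\<lambda>p. - u p"] X(2) by simp
  have step: "\<kappa> * ?u \<le> (1 + e) * energy (v m) + \<kappa> * (1 + 1 / e) * ?d m" if e: "0 < e" for e m
  proof -
    obtain c where c: "\<kappa> * (\<integral>p. (v m p - c)\<^sup>2 * \<sigma> p \<partial>\<mu>) \<le> energy (v m)" using PI[OF X(3)] by blast
    note ic = integrable_\<sigma>[OF sh[OF smooth_measurable[OF X(3)[of m]] smooth_sq_integrable[OF X(3)[of m]], of c]]
    \<comment> \<open>The linear term vanishes by the mean condition, and the constant term is
      nonnegative.\<close>
    have "?u \<le> (\<integral>p. (u p)\<^sup>2 * \<sigma> p - 2 * c * (u p * \<sigma> p) + c\<^sup>2 * \<sigma> p \<partial>\<mu>)"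
    proof -
      have "0 \<le> (\<integral>p. \<sigma> p \<partial>\<mu>)" using \<sigma> by (intro integral_nonneg_AE AE_I2) (auto simp: space_\<mu> less_imp_le)
      then show ?thesis
        using integrable_\<sigma>[OF X(2)] integrable_\<sigma>[OF iu] integrable_\<sigma>[OF const[of 1]] mean by simp
    qed
    also have "\<dots> = (\<integral>p. (u p - c)\<^sup>2 * \<sigma> p \<partial>\<mu>)"
      by (rule Bochner_Integration.integral_cong) (auto simp: power2_eq_square algebra_simps)
    also have "\<dots> \<le> (\<integral>p. (1 + e) * ((v m p - c)\<^sup>2 * \<sigma> p) + (1 + 1 / e) * (v m p - u p)\<^sup>2 \<partial>\<mu>)"
    proof (rule integral_mono)
      fix p assume "p \<in> space \<mu>"
      then have p: "0 < \<sigma> p" "\<sigma> p \<le> 1" using \<sigma> by (auto simp: space_\<mu>)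
      let ?a = "v m p - c" and ?b = "v m p - u p"
      have "0 \<le> (e * ?a + ?b)\<^sup>2 / e" using e by simp
      then have "(?a - ?b)\<^sup>2 \<le> (1 + e) * ?a\<^sup>2 + (1 + 1 / e) * ?b\<^sup>2"
        using e by (simp add: power2_eq_square field_simps)
      then have "(u p - c)\<^sup>2 * \<sigma> p \<le> ((1 + e) * ?a\<^sup>2 + (1 + 1 / e) * ?b\<^sup>2) * \<sigma> p"
        using p by (intro mult_right_mono) auto
      also have "\<dots> = (1 + e) * (?a\<^sup>2 * \<sigma> p) + (1 + 1 / e) * ?b\<^sup>2 * \<sigma> p" by (simp add: algebra_simps)
      also have "(1 + 1 / e) * ?b\<^sup>2 * \<sigma> p \<le> (1 + 1 / e) * ?b\<^sup>2" using p e by (intro mult_left_le) auto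
      finally show "(u p - c)\<^sup>2 * \<sigma> p \<le> (1 + e) * (?a\<^sup>2 * \<sigma> p) + (1 + 1 / e) * ?b\<^sup>2" by simp
    qed (use ic iD integrable_\<sigma>[OF sh[OF X(1,2), of c]] in auto)
    also have "\<dots> = (1 + e) * (\<integral>p. (v m p - c)\<^sup>2 * \<sigma> p \<partial>\<mu>) + (1 + 1 / e) * ?d m"
      using ic iD by simp
    finally have "\<kappa> * ?u \<le> \<kappa> * ((1 + e) * (\<integral>p. (v m p - c)\<^sup>2 * \<sigma> p \<partial>\<mu>) + (1 + 1 / e) * ?d m)"
      using \<kappa> by (intro mult_left_mono) auto
    also have "\<dots> = (1 + e) * (\<kappa> * (\<integral>p. (v m p - c)\<^sup>2 * \<sigma> p \<partial>\<mu>)) + \<kappa> * (1 + 1 / e) * ?d m"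
      by (simp add: algebra_simps)
    also have "\<dots> \<le> (1 + e) * energy (v m) + \<kappa> * (1 + 1 / e) * ?d m"
      using c e by (intro add_right_mono mult_left_mono) auto
    finally show ?thesis .
  qed
  have "\<kappa> * ?u \<le> (1 + e) * ?L" if e: "0 < e" for e
  proof -
    have "(\<lambda>m. (1 + e) * energy (v m) + \<kappa> * (1 + 1 / e) * ?d m) \<longlonglongrightarrow> (1 + e) * ?L + \<kappa> * (1 + 1 / e) * 0"
      by (intro tendsto_intros lim X(4))
    then show ?thesis using step[OF e] by (intro LIMSEQ_le_const[of _ _ "\<kappa> * ?u"]) auto
  qed
  moreover have "0 \<le> ?L" using LIMSEQ_le_const[OF lim] energy_nonneg[OF X(3)] by blast
  ultimately show ?thesis
  proof -
    have "((\<lambda>e. (1 + e) * ?L) \<longlongrightarrow> (1 + 0) * ?L) (at_right 0)" by (intro tendsto_intros)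
    then have "\<kappa> * ?u \<le> (1 + 0) * ?L"
      using \<open>\<And>e. 0 < e \<Longrightarrow> \<kappa> * ?u \<le> (1 + e) * ?L\<close>
      by (intro tendsto_lowerbound[of _ _ "at_right 0"]) (auto simp: eventually_at_right_field intro!: exI[of _ 1])
    then show ?thesis by simp
  qed
qed

text \<open>\<open>G\<close> is the Gram form of the basis for the weighted product. Its uniform
  lower bound makes Rayleigh quotients bounded on the whole plane.\<close>

lemma H1_basis_gram:
  assumes w: "H1_basis \<A> \<mu> 2 w"
  defines "G \<equiv> \<lambda>a :: nat \<Rightarrow> real. \<integral>p. (a 0 * fst (w 0) p + a 1 * fst (w 1) p)\<^sup>2 * \<sigma> p \<partial>\<mu>"
  shows "\<And>a. a 0 \<noteq> 0 \<or> a 1 \<noteq> 0 \<Longrightarrow> 0 < G a"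
    and "\<exists>k>0. \<forall>a. k * ((a 0)\<^sup>2 + (a 1)\<^sup>2) \<le> G a"
proof -
  obtain u v u' v' where uv: "w 0 = (u, v)" "w 1 = (u', v')" by (meson surj_pair)
  note uv = uv uv(2)[unfolded One_nat_def]
  have H: "(u, v) \<in> H1 \<A> \<mu>" "(u', v') \<in> H1 \<A> \<mu>"
    using w uv(1,2) unfolding H1_basis_def by (metis one_less_numeral_iff semiring_norm(76) pos2)+
  note X = H1D[OF H(1)] and Y = H1D[OF H(2)]
  note [measurable] = X(1) Y(1)
  have int: "integrable \<mu> (\<lambda>p. (a * u p + b * u' p)\<^sup>2)" for a b
    using H1D(2)[OF pair_comb_H1[OF H, of a b]] .
  show pos: "0 < G a" if a: "a 0 \<noteq> 0 \<or> a 1 \<noteq> 0" for a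
  proof -
    have nn: "AE p in \<mu>. 0 \<le> (a 0 * u p + a 1 * u' p)\<^sup>2 * \<sigma> p"
      using \<sigma> by (intro AE_I2) (auto simp: space_\<mu> less_imp_le)
    have "G a \<noteq> 0"
    proof
      assume "G a = 0"
      then have "(\<integral>p. (a 0 * u p + a 1 * u' p)\<^sup>2 * \<sigma> p \<partial>\<mu>) = 0" by (simp add: G_def uv)
      then have "AE p in \<mu>. (a 0 * u p + a 1 * u' p)\<^sup>2 * \<sigma> p = 0"
        using integral_nonneg_eq_0_iff_AE[OF integrable_\<sigma>[OF int[of "a 0" "a 1"]] nn] by simp
      then have "AE p in \<mu>. fst (lin_comb 2 a w) p = 0"
        unfolding lin_comb_2 pair_comb_def uv using AE_space
        by eventually_elim (use \<sigma> in \<open>fastforce simp: space_\<mu>\<close>)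
      then have "\<forall>i<2. a i = 0" using w by (simp add: H1_basis_def)
      then show False using a by auto
    qed
    moreover have "0 \<le> G a" unfolding G_def uv fst_conv by (rule integral_nonneg_AE[OF nn])
    ultimately show ?thesis by simp
  qed
  define A B C where "A = (\<integral>p. (u p)\<^sup>2 * \<sigma> p \<partial>\<mu>)" and "B = (\<integral>p. u p * u' p * \<sigma> p \<partial>\<mu>)"
    and "C = (\<integral>p. (u' p)\<^sup>2 * \<sigma> p \<partial>\<mu>)"
  have Geq: "G a = (a 0)\<^sup>2 * A + 2 * a 0 * a 1 * B + (a 1)\<^sup>2 * C" for a
  proof -
    have "G a = (\<integral>p. (a 0)\<^sup>2 * ((u p)\<^sup>2 * \<sigma> p) + 2 * a 0 * a 1 * (u p * u' p * \<sigma> p) + (a 1)\<^sup>2 * ((u' p)\<^sup>2 * \<sigma> p) \<partial>\<mu>)"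
      unfolding G_def uv fst_conv
      by (rule Bochner_Integration.integral_cong) (auto simp: power2_eq_square algebra_simps)
    then show ?thesis
      using integrable_\<sigma>[OF X(2)] integrable_\<sigma>[OF Y(2)] integrable_\<sigma>[OF sq_integrable_mult[OF X(1) Y(1) X(2) Y(2)]]
      by (simp add: A_def B_def C_def)
  qed
  have Ap: "0 < A" using pos[of "\<lambda>i. if i = 0 then 1 else 0"] by (simp add: Geq)
  have Cp: "0 < C" using pos[of "\<lambda>i. if i = 0 then 0 else 1"] by (simp add: Geq)
  \<comment> \<open>The vector \<open>(- B, A)\<close> gives \<open>A\<close> times the determinant
    of the Gram matrix.\<close>
  have "0 < G (\<lambda>i. if i = 0 then - B else A)" by (rule pos) (use Ap in simp)
  also have "\<dots> = A * (A * C - B\<^sup>2)" by (simp add: Geq power2_eq_square algebra_simps)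
  finally have Dp: "0 < A * C - B\<^sup>2" using Ap by (simp add: zero_less_mult_iff)
  show "\<exists>k>0. \<forall>a. k * ((a 0)\<^sup>2 + (a 1)\<^sup>2) \<le> G a"
  proof (intro exI conjI allI)
    \<comment> \<open>Determinant over trace, a lower bound for the smaller eigenvalue of the Gram
      matrix.\<close>
    show "0 < (A * C - B\<^sup>2) / (A + C)" using Dp Ap Cp by simp
    fix a :: "nat \<Rightarrow> real"
    \<comment> \<open>The squared length of the Gram matrix applied to \<open>a\<close>; by the
      Cayley-Hamilton identity it is the trace times the form minus the determinant times the
      squared length of \<open>a\<close>.\<close>
    have "0 \<le> (A * a 0 + B * a 1)\<^sup>2 + (B * a 0 + C * a 1)\<^sup>2" by simp
    also have "\<dots> = G a * (A + C) - (A * C - B\<^sup>2) * ((a 0)\<^sup>2 + (a 1)\<^sup>2)"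
      by (simp add: Geq power2_eq_square algebra_simps)
    finally show "(A * C - B\<^sup>2) / (A + C) * ((a 0)\<^sup>2 + (a 1)\<^sup>2) \<le> G a"
      using Ap Cp by (simp add: field_simps)
  qed
qed

lemma rayleigh_lin_comb:
  "rayleigh \<A> \<mu> \<sigma> (lin_comb 2 a w) =
    lim (\<lambda>m. energy (\<lambda>p. a 0 * snd (w 0) m p + a 1 * snd (w 1) m p)) /
    (\<integral>p. (a 0 * fst (w 0) p + a 1 * fst (w 1) p)\<^sup>2 * \<sigma> p \<partial>\<mu>)"
  by (simp add: rayleigh_def lin_comb_2 pair_comb_def energy_def)

text \<open>A supremum of real numbers is meaningful for sets bounded above. Here the energies are
  at most, and the Gram form at least, a positive multiple of the squared length of the coefficient
  vector, up to enlarging the former multiple.\<close>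

lemma rayleigh_bdd_above:
  assumes w: "H1_basis \<A> \<mu> 2 w"
  shows "bdd_above ((\<lambda>a. rayleigh \<A> \<mu> \<sigma> (lin_comb 2 a w)) ` {a. \<exists>i<2. a i \<noteq> 0})"
proof -
  obtain u v u' v' where uv: "w 0 = (u, v)" "w 1 = (u', v')" by (meson surj_pair)
  note uv = uv uv(2)[unfolded One_nat_def]
  have H: "(u, v) \<in> H1 \<A> \<mu>" "(u', v') \<in> H1 \<A> \<mu>"
    using w uv(1,2) unfolding H1_basis_def by (metis one_less_numeral_iff semiring_norm(76) pos2)+
  note X = H1D[OF H(1)] and Y = H1D[OF H(2)]
  let ?G = "\<lambda>a :: nat \<Rightarrow> real. \<integral>p. (a 0 * fst (w 0) p + a 1 * fst (w 1) p)\<^sup>2 * \<sigma> p \<partial>\<mu>"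
  obtain k where k: "0 < k" "\<And>a. k * ((a 0)\<^sup>2 + (a 1)\<^sup>2) \<le> ?G a" using H1_basis_gram(2)[OF w] by blast
  define L L' where "L = lim (\<lambda>m. energy (v m))" and "L' = lim (\<lambda>m. energy (v' m))"
  have L: "(\<lambda>m. energy (v m)) \<longlonglongrightarrow> L" "(\<lambda>m. energy (v' m)) \<longlonglongrightarrow> L'"
    using energy_convergent[OF H(1)] energy_convergent[OF H(2)] by (simp_all add: convergent_LIMSEQ_iff L_def L'_def)
  have L0: "0 \<le> L" "0 \<le> L'"
    using LIMSEQ_le_const[OF L(1)] LIMSEQ_le_const[OF L(2)] energy_nonneg[OF X(3)] energy_nonneg[OF Y(3)] by blast+
  have "rayleigh \<A> \<mu> \<sigma> (lin_comb 2 a w) \<le> 2 * (L + L') / k" if a: "\<exists>i<2. a i \<noteq> 0" for a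
  proof -
    have a01: "a 0 \<noteq> 0 \<or> a 1 \<noteq> 0" using a by (auto simp: less_2_cases_iff)
    let ?E = "\<lambda>m. energy (\<lambda>p. a 0 * v m p + a 1 * v' m p)"
    have E: "?E \<longlonglongrightarrow> lim ?E"
      using energy_convergent[OF pair_comb_H1[OF H, of "a 0" "a 1"]] by (simp add: convergent_LIMSEQ_iff)
    have "(\<lambda>m. 2 * (a 0)\<^sup>2 * energy (v m) + 2 * (a 1)\<^sup>2 * energy (v' m)) \<longlonglongrightarrow> 2 * (a 0)\<^sup>2 * L + 2 * (a 1)\<^sup>2 * L'"
      by (intro tendsto_intros L)
    moreover have "?E m \<le> 2 * (a 0)\<^sup>2 * energy (v m) + 2 * (a 1)\<^sup>2 * energy (v' m)" for m
      using energy_add_le[OF smooth_fun_scale[OF X(3)[of m], of "a 0"] smooth_fun_scale[OF Y(3)[of m], of "a 1"], of 1]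
      by (simp add: energy_scale X(3) Y(3))
    ultimately have lE: "lim ?E \<le> 2 * (a 0)\<^sup>2 * L + 2 * (a 1)\<^sup>2 * L'"
      using LIMSEQ_le[OF E] by blast
    also have "\<dots> \<le> 2 * (L + L') * ((a 0)\<^sup>2 + (a 1)\<^sup>2)" using L0 by (simp add: algebra_simps)
    also have "\<dots> \<le> 2 * (L + L') * (?G a / k)"
      using k(1) k(2)[of a] L0 by (intro mult_left_mono) (auto simp: field_simps)
    finally have "lim ?E \<le> 2 * (L + L') / k * ?G a" by simp
    then show ?thesis
      unfolding rayleigh_lin_comb uv snd_conv using H1_basis_gram(1)[OF w, of a, OF a01]
      by (simp add: uv pos_divide_le_eq)
  qed
  then show ?thesis by (auto intro!: bdd_aboveI)
qed

text \<open>Every plane contains a nonzero element of weighted mean zero. \<open>L2_poincare\<close>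
  applies to it, and its quotient bounds the supremum from below.\<close>

lemma eigenvalue_basis_ge:
  assumes \<kappa>: "0 < \<kappa>"
    and PI: "\<And>f. smooth_fun \<A> f \<Longrightarrow> \<exists>c. \<kappa> * (\<integral>p. (f p - c)\<^sup>2 * \<sigma> p \<partial>\<mu>) \<le> energy f"
    and w: "H1_basis \<A> \<mu> 2 w"
  shows "\<kappa> \<le> (SUP a\<in>{a. \<exists>i<2. a i \<noteq> 0}. rayleigh \<A> \<mu> \<sigma> (lin_comb 2 a w))"
proof -
  obtain u v u' v' where uv: "w 0 = (u, v)" "w 1 = (u', v')" by (meson surj_pair)
  note uv = uv uv(2)[unfolded One_nat_def]
  have H: "(u, v) \<in> H1 \<A> \<mu>" "(u', v') \<in> H1 \<A> \<mu>"
    using w uv(1,2) unfolding H1_basis_def by (metis one_less_numeral_iff semiring_norm(76) pos2)+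
  note X = H1D[OF H(1)] and Y = H1D[OF H(2)]
  note [measurable] = X(1) Y(1)
  have const: "integrable \<mu> (\<lambda>p. c)" for c :: real
    using bounded_integrable[of "\<lambda>p. c" "\<bar>c\<bar>"] by simp
  have iu: "integrable \<mu> (\<lambda>p. u p * \<sigma> p)" "integrable \<mu> (\<lambda>p. u' p * \<sigma> p)"
    using integrable_\<sigma>[OF sq_integrable_mult[OF X(1) _ X(2), of "\<lambda>p. 1"]]
      integrable_\<sigma>[OF sq_integrable_mult[OF Y(1) _ Y(2), of "\<lambda>p. 1"]] const by simp_all
  define m m' where "m = (\<integral>p. u p * \<sigma> p \<partial>\<mu>)" and "m' = (\<integral>p. u' p * \<sigma> p \<partial>\<mu>)"
  \<comment> \<open>Orthogonal to the vector of the two means; if both means vanish, any nonzero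
    coefficients will do.\<close>
  define a :: "nat \<Rightarrow> real" where "a = (\<lambda>i. if m = 0 \<and> m' = 0 then 1 else if i = 0 then m' else - m)"
  have a01: "a 0 \<noteq> 0 \<or> a 1 \<noteq> 0" by (auto simp: a_def)
  have "(\<integral>p. (a 0 * u p + a 1 * u' p) * \<sigma> p \<partial>\<mu>) = (\<integral>p. a 0 * (u p * \<sigma> p) + a 1 * (u' p * \<sigma> p) \<partial>\<mu>)"
    by (rule Bochner_Integration.integral_cong) (auto simp: algebra_simps)
  also have "\<dots> = a 0 * m + a 1 * m'" using iu by (simp add: m_def m'_def)
  also have "\<dots> = 0" by (auto simp: a_def)
  finally have mean: "(\<integral>p. (a 0 * u p + a 1 * u' p) * \<sigma> p \<partial>\<mu>) = 0" .
  have "\<kappa> * (\<integral>p. (a 0 * u p + a 1 * u' p)\<^sup>2 * \<sigma> p \<partial>\<mu>) \<le> lim (\<lambda>m. energy (\<lambda>p. a 0 * v m p + a 1 * v' m p))"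
    by (rule L2_poincare[OF pair_comb_H1[OF H] mean \<kappa> PI])
  then have "\<kappa> \<le> rayleigh \<A> \<mu> \<sigma> (lin_comb 2 a w)"
    unfolding rayleigh_lin_comb uv snd_conv fst_conv using H1_basis_gram(1)[OF w, of a, OF a01]
    by (simp add: uv pos_le_divide_eq)
  also have "\<dots> \<le> (SUP a\<in>{a. \<exists>i<2. a i \<noteq> 0}. rayleigh \<A> \<mu> \<sigma> (lin_comb 2 a w))"
  proof (rule cSUP_upper[OF _ rayleigh_bdd_above[OF w]])
    show "a \<in> {a. \<exists>i<2. a i \<noteq> 0}" using a01 by (auto simp: less_2_cases_iff)
  qed
  finally show ?thesis .
qed

text \<open>Two functions with product zero span a plane on which the Rayleigh quotient is controlled by
  the two individual quotients.\<close>

lemma eigenvalue_bounds: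
  assumes \<kappa>: "0 < \<kappa>"
    and PI: "\<And>f. smooth_fun \<A> f \<Longrightarrow> \<exists>c. \<kappa> * (\<integral>p. (f p - c)\<^sup>2 * \<sigma> p \<partial>\<mu>) \<le> energy f"
    and f: "smooth_fun \<A> f" "0 < (\<integral>p. (f p)\<^sup>2 * \<sigma> p \<partial>\<mu>)" "energy f \<le> \<Lambda> * (\<integral>p. (f p)\<^sup>2 * \<sigma> p \<partial>\<mu>)"
    and g: "smooth_fun \<A> g" "0 < (\<integral>p. (g p)\<^sup>2 * \<sigma> p \<partial>\<mu>)" "energy g \<le> \<Lambda> * (\<integral>p. (g p)\<^sup>2 * \<sigma> p \<partial>\<mu>)"
    and fg: "\<And>p. f p * g p = 0"
  shows "\<kappa> \<le> eigenvalue \<A> \<mu> \<sigma> 2 \<and> eigenvalue \<A> \<mu> \<sigma> 2 \<le> 2 * \<Lambda>"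
proof -
  define w :: "nat \<Rightarrow> ('p \<Rightarrow> real) \<times> (nat \<Rightarrow> 'p \<Rightarrow> real)" where
    "w i = (if i = 0 then (f, \<lambda>m. f) else (g, \<lambda>m. g))" for i
  \<comment> \<open>A smooth function is represented by the constant sequence; the gradient of its
    differences vanishes by scaling with the factor 0.\<close>
  have const: "(u, \<lambda>m. u) \<in> H1 \<A> \<mu>" if u: "smooth_fun \<A> u" for u
  proof -
    have "grad_norm_sq \<A> (\<lambda>q. u q - u q) p = 0" if "p \<in> M" for p
      using grad_norm_sq_scale[OF atlas u that, of 0] by simp
    then have "(\<integral>p. grad_norm_sq \<A> (\<lambda>q. u q - u q) p \<partial>\<mu>) = (\<integral>p. 0 \<partial>\<mu>)"
      by (intro Bochner_Integration.integral_cong) (auto simp: space_\<mu>)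
    then show ?thesis unfolding H1_def using u by (simp add: smooth_measurable smooth_sq_integrable)
  qed
  note mf[measurable] = smooth_measurable[OF f(1)] smooth_measurable[OF g(1)]
  let ?F = "\<integral>p. (f p)\<^sup>2 * \<sigma> p \<partial>\<mu>" and ?G = "\<integral>p. (g p)\<^sup>2 * \<sigma> p \<partial>\<mu>"
  have D: "(\<integral>p. (a * f p + b * g p)\<^sup>2 * \<sigma> p \<partial>\<mu>) = a\<^sup>2 * ?F + b\<^sup>2 * ?G" for a b
  proof -
    have "(a * f p + b * g p)\<^sup>2 * \<sigma> p = a\<^sup>2 * ((f p)\<^sup>2 * \<sigma> p) + b\<^sup>2 * ((g p)\<^sup>2 * \<sigma> p)" for p
      using fg[of p] by (auto simp: power_mult_distrib)
    then have "(\<integral>p. (a * f p + b * g p)\<^sup>2 * \<sigma> p \<partial>\<mu>) = (\<integral>p. a\<^sup>2 * ((f p)\<^sup>2 * \<sigma> p) + b\<^sup>2 * ((g p)\<^sup>2 * \<sigma> p) \<partial>\<mu>)"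
      by simp
    then show ?thesis using integrable_\<sigma>[OF smooth_sq_integrable[OF f(1)]] integrable_\<sigma>[OF smooth_sq_integrable[OF g(1)]] by simp
  qed
  have Dpos: "0 < a\<^sup>2 * ?F + b\<^sup>2 * ?G" if "a \<noteq> 0 \<or> b \<noteq> 0" for a b :: real
    using that f(2) g(2) by (auto intro: add_pos_nonneg add_nonneg_pos)
  have w: "H1_basis \<A> \<mu> 2 w"
    unfolding H1_basis_def
  proof (intro conjI allI impI)
    show "w i \<in> H1 \<A> \<mu>" for i using const[OF f(1)] const[OF g(1)] by (simp add: w_def)
    fix a i assume ae: "AE p in \<mu>. fst (lin_comb 2 a w) p = 0" and i: "i < (2::nat)"
    have "AE p in \<mu>. (a 0 * f p + a 1 * g p)\<^sup>2 * \<sigma> p = 0"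
      using ae unfolding lin_comb_2 by eventually_elim (simp add: pair_comb_def w_def)
    then have "(\<integral>p. (a 0 * f p + a 1 * g p)\<^sup>2 * \<sigma> p \<partial>\<mu>) = 0"
      by (rule integral_eq_zero_AE)
    then have "(a 0)\<^sup>2 * ?F + (a 1)\<^sup>2 * ?G = 0" unfolding D .
    then have "a 0 = 0 \<and> a 1 = 0" using Dpos[of "a 0" "a 1"] by auto
    then show "a i = 0" using i by (auto simp: less_2_cases_iff)
  qed
  let ?S = "\<lambda>w. SUP a\<in>{a. \<exists>i<2. a i \<noteq> 0}. rayleigh \<A> \<mu> \<sigma> (lin_comb 2 a w)"
  have ge: "\<kappa> \<le> ?S w" if "w \<in> {w. H1_basis \<A> \<mu> 2 w}" for w
    using eigenvalue_basis_ge[OF \<kappa> PI] that by blast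
  have "\<kappa> \<le> eigenvalue \<A> \<mu> \<sigma> 2"
    unfolding eigenvalue_def using w by (intro cINF_greatest ge) auto
  moreover have "eigenvalue \<A> \<mu> \<sigma> 2 \<le> ?S w"
    unfolding eigenvalue_def using w ge by (intro cINF_lower bdd_belowI2[of _ \<kappa>]) auto
  moreover have "?S w \<le> 2 * \<Lambda>"
  proof (rule cSUP_least)
    show "{a. \<exists>i<(2::nat). a i \<noteq> (0::real)} \<noteq> {}" by (auto simp: less_2_cases_iff intro!: exI[of _ "\<lambda>i::nat. 1"])
    fix a :: "nat \<Rightarrow> real" assume "a \<in> {a. \<exists>i<2. a i \<noteq> 0}"
    then have a01: "a 0 \<noteq> 0 \<or> a 1 \<noteq> 0" by (auto simp: less_2_cases_iff)
    \<comment> \<open>The mixed term of the energy is absorbed by Young's inequality with parameter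
      1; this is the origin of the factor 2 in the upper bound.\<close>
    have "energy (\<lambda>p. a 0 * f p + a 1 * g p) \<le> 2 * ((a 0)\<^sup>2 * energy f) + 2 * ((a 1)\<^sup>2 * energy g)"
      using energy_add_le[OF smooth_fun_scale[OF f(1), of "a 0"] smooth_fun_scale[OF g(1), of "a 1"], of 1]
      by (simp add: energy_scale f(1) g(1))
    also have "\<dots> \<le> 2 * ((a 0)\<^sup>2 * (\<Lambda> * ?F)) + 2 * ((a 1)\<^sup>2 * (\<Lambda> * ?G))"
      using f(3) g(3) by (intro add_mono mult_left_mono) auto
    also have "\<dots> = 2 * \<Lambda> * ((a 0)\<^sup>2 * ?F + (a 1)\<^sup>2 * ?G)" by (simp add: algebra_simps)
    finally show "rayleigh \<A> \<mu> \<sigma> (lin_comb 2 a w) \<le> 2 * \<Lambda>"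
      unfolding rayleigh_lin_comb using Dpos[OF a01] by (simp add: w_def D pos_divide_le_eq)
  qed
  ultimately show ?thesis by linarith
qed

end

section \<open>Revolution manifolds in ball coordinates\<close>

lemma inner_sgn_sq_le: "(sgn x \<bullet> v)\<^sup>2 \<le> (norm v)\<^sup>2" for x v :: "'a::real_inner"
proof -
  have "\<bar>sgn x \<bullet> v\<bar> \<le> norm (sgn x) * norm v" by (rule Cauchy_Schwarz_ineq2)
  also have "\<dots> \<le> 1 * norm v" by (intro mult_right_mono) (auto simp: norm_sgn)
  finally show ?thesis by (simp add: abs_le_square_iff[symmetric])
qed

text \<open>The tangential part is nonnegative by Cauchy-Schwarz. This bounds gradients of radial
  functions independently of the profile.\<close>

lemma polar_form_ge: "(sgn x \<bullet> v)\<^sup>2 \<le> polar_form s x v v"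
  using inner_sgn_sq_le[of x v] by (simp add: polar_form_def power2_eq_square[symmetric] power2_norm_eq_inner)

lemma polar_form_le: "polar_form s x v v \<le> (1 + s\<^sup>2) * (norm v)\<^sup>2"
proof -
  have "s\<^sup>2 * (v \<bullet> v - (sgn x \<bullet> v)\<^sup>2) \<le> s\<^sup>2 * (norm v)\<^sup>2"
    by (intro mult_left_mono) (auto simp: power2_norm_eq_inner)
  then show ?thesis using inner_sgn_sq_le[of x v]
    by (simp add: polar_form_def power2_eq_square[symmetric] distrib_right)
qed

lemma polar_form_sgn: "x \<noteq> 0 \<Longrightarrow> polar_form s x (sgn x) (sgn x) = 1"
  by (simp add: polar_form_def dot_square_norm norm_sgn)

lemma polar_form_eq_0:
  assumes "polar_form s x v v = 0" and "s \<noteq> 0" shows "v = 0"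
proof -
  have 0: "(sgn x \<bullet> v)\<^sup>2 = 0" using polar_form_ge[of x v s] assms(1) by (simp add: order_antisym)
  then have "s\<^sup>2 * (v \<bullet> v) = 0" using assms(1) by (simp add: polar_form_def)
  then show ?thesis using assms(2) by simp
qed

context warped
begin

lemma open_punctured: "open {x :: real^'n. 0 < norm x \<and> norm x < R}"
  by (intro open_Collect_conj open_Collect_less continuous_intros)

lemma interior_Z: "0 < norm x \<Longrightarrow> norm x < R \<Longrightarrow> x \<in> Z"
  using I by auto

text \<open>The last conjunct says that \<open>|\<nabla>u|\<^sup>2\<close> is the least constant for which the Cauchy--Schwarz
  bound on \<open>du\<close> holds; it serves to bound gradients from above.\<close>

lemma polar_derivative:
  assumes u: "smooth_fun \<A> u" and x: "0 < norm x" "norm x < R"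
  shows "\<exists>D. ((\<lambda>y. u (polar_map \<Phi> y)) has_derivative D) (at x) \<and>
    (\<forall>v. (D v)\<^sup>2 \<le> grad_norm_sq \<A> u (polar_map \<Phi> x) * polar_form (\<theta> (norm x) / norm x) x v v) \<and>
    (\<forall>k\<ge>0. (\<forall>v. (D v)\<^sup>2 \<le> k * polar_form (\<theta> (norm x) / norm x) x v v) \<longrightarrow>
       grad_norm_sq \<A> u (polar_map \<Phi> x) \<le> k)"
proof -
  let ?p = "polar_map \<Phi> x"
  have xZ: "x \<in> Z" using interior_Z x by auto
  then have pM: "?p \<in> M" using polar_map_in by auto
  obtain c where c: "c \<in> \<A>" "?p \<in> cdom c" "is_rchart M c" using atlas_chart_at[OF atlas pM] by blast
  have sm: "smooth_on (cimg c) (u \<circ> cinv c)" using u c(1) by (simp add: smooth_fun_def)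
  have yc: "coord c ?p \<in> cimg c" using c(2) by auto
  let ?g = "gmat c (coord c ?p)" and ?e = "dcov c u (coord c ?p)" and ?s = "\<theta> (norm x) / norm x"
  have xV: "x \<in> {x. norm x \<in> I \<and> polar_map \<Phi> x \<in> cdom c}" using xZ c by auto
  have "I \<subseteq> {0<..}" using I_pos by auto
  from polar_map_chart_derivative[OF wi this c(1) xV] obtain L where
    L: "((coord c \<circ> polar_map \<Phi>) has_derivative L) (at x within {x. norm x \<in> I \<and> polar_map \<Phi> x \<in> cdom c})"
    "\<And>v w. L v \<bullet> (?g *v L w) = polar_form ?s x v w" by blast
  let ?V = "{x. norm x \<in> I \<and> polar_map \<Phi> x \<in> cdom c}"
  have "((\<lambda>y. (u \<circ> cinv c) ((coord c \<circ> polar_map \<Phi>) y)) has_derivative (\<lambda>v. ?e \<bullet> L v)) (at x within ?V)"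
  proof (rule has_derivative_in_compose[OF L(1)])
    show "((u \<circ> cinv c) has_derivative (\<lambda>v. ?e \<bullet> v)) (at ((coord c \<circ> polar_map \<Phi>) x) within (coord c \<circ> polar_map \<Phi>) ` ?V)"
      using has_derivative_subset[OF dcov_has_derivative[OF c(3) sm yc], of "(coord c \<circ> polar_map \<Phi>) ` ?V"] by auto
  qed
  then have "((\<lambda>y. u (polar_map \<Phi> y)) has_derivative (\<lambda>v. ?e \<bullet> L v)) (at x within ?V)"
    by (rule has_derivative_transform[OF xV, rotated]) (use chart_cinv[OF c(3)] in auto)
  \<comment> \<open>By continuity of the polar map the chart condition is open in the punctured open
    ball, so \<open>x\<close> is an interior point of \<open>?V\<close>.\<close>
  moreover have "at x within ?V = at x"
  proof -
    obtain W where W: "open W" "cdom c = M \<inter> W" using c(3) by (auto simp: is_rchart_def openin_open)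
    let ?B = "{x :: real^'n. 0 < norm x \<and> norm x < R}"
    have "continuous_on ?B (polar_map \<Phi>)"
      using continuous_on_polar_map by (rule continuous_on_subset) (use interior_Z in auto)
    then have o: "open (?B \<inter> polar_map \<Phi> -` W)" using open_punctured W(1) by (rule continuous_open_preimage)
    have "?B \<inter> polar_map \<Phi> -` W \<subseteq> ?V" using interior_Z polar_map_in W(2) by auto
    moreover have "x \<in> ?B \<inter> polar_map \<Phi> -` W" using x c(2) W(2) by auto
    ultimately have "x \<in> interior ?V" using o by (meson interiorI)
    then show ?thesis by (rule at_within_interior)
  qed
  ultimately have D: "((\<lambda>y. u (polar_map \<Phi> y)) has_derivative (\<lambda>v. ?e \<bullet> L v)) (at x)" by simp
  have gn: "grad_norm_sq \<A> u ?p = chart_gnorm c u (coord c ?p)" by (rule grad_norm_sq_chart[OF atlas u c(1,2)])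
  have lin: "linear L" using L(1) by (rule has_derivative_linear)
  have "?s \<noteq> 0" using \<theta>(1)[of "norm x"] x xZ by auto
  then have "v = 0" if "L v = 0" for v
    using polar_form_eq_0[of ?s x v] L(2)[of v v] that by simp
  \<comment> \<open>Nondegeneracy of the form gives injectivity, and surjectivity then allows every
    coordinate vector to be written as \<open>L v\<close> when the gradient is bounded from
    above.\<close>
  then have "inj L" using linear_injective_0[OF lin] by blast
  then have surj: "surj L" by (rule linear_injective_imp_surjective[OF lin]) simp
  show ?thesis
  proof (intro exI[of _ "\<lambda>v. ?e \<bullet> L v"] conjI allI impI D)
    show "(?e \<bullet> L v)\<^sup>2 \<le> grad_norm_sq \<A> u ?p * polar_form ?s x v v" for v
      unfolding gn L(2)[symmetric] by (rule chart_gnorm_ge[OF c(3) sm yc])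
    fix k :: real assume k: "0 \<le> k" "\<forall>v. (?e \<bullet> L v)\<^sup>2 \<le> k * polar_form ?s x v v"
    show "grad_norm_sq \<A> u ?p \<le> k" unfolding gn
    proof (rule chart_gnorm_le[OF c(3) sm yc k(1)])
      fix w obtain v where "w = L v" using surj by (metis surjD)
      then show "(?e \<bullet> w)\<^sup>2 \<le> k * (w \<bullet> (?g *v w))" using k(2) L(2) by simp
    qed
  qed
qed

text \<open>The support condition keeps the function away from the poles and from
  \<open>r = R\<close>. Near \<open>F\<close> it vanishes because the image of the closed shell
  between the radii \<open>a\<close> and \<open>b\<close> is compact, hence closed.\<close>

lemma radial_smooth_fun:
  assumes \<eta>: "\<And>k. Ck_on k UNIV \<eta>" and supp: "\<And>r. r < a \<or> b < r \<Longrightarrow> \<eta> r = 0" and ab: "0 < a" "b < R"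
  shows "smooth_fun \<A> (\<lambda>p. if p \<in> M - F then \<eta> (norm (inv_polar p)) else 0)" (is "smooth_fun \<A> ?f")
  unfolding smooth_fun_def smooth_on_def
proof (intro ballI)
  fix c y assume c: "c \<in> \<A>" and y: "y \<in> cimg c"
  note ch = chart[OF c]
  define p where "p = cinv c y"
  have p: "p \<in> cdom c" "coord c p = y" using chart_coord[OF ch y] by (auto simp: p_def)
  have hom: "homeomorphism (cdom c) (cimg c) (coord c) (cinv c)" using ch by (simp add: is_rchart_def)
  have cM: "cdom c \<subseteq> M" using ch by (auto simp: is_rchart_def dest: openin_imp_subset)
  \<comment> \<open>Translates a neighbourhood of \<open>p\<close> in \<open>M\<close> into an open
    set of coordinates around \<open>y\<close>.\<close>
  have shrink: "\<exists>W'. open W' \<and> y \<in> W' \<and> cimg c \<inter> W' \<subseteq> coord c ` (cdom c \<inter> X)"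
    if X: "openin (top_of_set M) X" "p \<in> X" for X
  proof -
    obtain X' where X': "open X'" "X = M \<inter> X'" using X(1) by (auto simp: openin_open)
    have "continuous_on (cimg c) (cinv c)" using hom by (simp add: homeomorphism_def)
    then have "openin (top_of_set (cimg c)) (cimg c \<inter> cinv c -` X')" using X'(1) by (rule continuous_openin_preimage_gen)
    then obtain W' where W': "open W'" "cimg c \<inter> cinv c -` X' = cimg c \<inter> W'" by (auto simp: openin_open)
    have "cimg c \<inter> W' \<subseteq> coord c ` (cdom c \<inter> X)"
    proof
      fix z assume "z \<in> cimg c \<inter> W'"
      then have "z \<in> cimg c" "cinv c z \<in> X'" using W'(2) by auto
      then show "z \<in> coord c ` (cdom c \<inter> X)"
        using chart_coord[OF ch] X'(2) cM by (intro image_eqI[of _ _ "cinv c z"]) auto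
    qed
    moreover have "y \<in> W'" using W'(2) X'(2) X(2) y by (auto simp: p_def)
    ultimately show ?thesis using W'(1) by blast
  qed
  show "\<exists>U G. open U \<and> y \<in> U \<and> (\<forall>k. Ck_on k U G) \<and> (\<forall>z\<in>cimg c \<inter> U. G z = (?f \<circ> cinv c) z)"
  proof (cases "p \<in> M - F")
    case True
    let ?S = "coord c ` (cdom c \<inter> (M - F))" and ?i = "inv_into (cyl I) \<Phi>"
    have "smooth_on ?S (?i \<circ> cinv c)" using wi c by (simp add: warped_isometry_def)
    moreover have "y \<in> ?S" using p True by auto
    ultimately obtain U G where U: "open U" "y \<in> U" "\<forall>k. Ck_on k U G" "\<forall>z\<in>?S \<inter> U. G z = (?i \<circ> cinv c) z"
      unfolding smooth_on_def by meson
    obtain W' where W': "open W'" "y \<in> W'" "cimg c \<inter> W' \<subseteq> ?S"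
      using shrink[OF openin_P True] by blast
    show ?thesis
    proof (rule exI[of _ "U \<inter> W'"], rule exI[of _ "\<lambda>z. \<eta> (fst (G z))"], intro conjI allI ballI)
      show "Ck_on k (U \<inter> W') (\<lambda>z. \<eta> (fst (G z)))" for k
      proof (rule Ck_on_compose_real[of "U \<inter> W'" k \<eta> "\<lambda>z. fst (G z)"])
        show "Ck_on k (U \<inter> W') (\<lambda>z. fst (G z))"
          by (rule Ck_on_bounded_linear[OF _ bounded_linear_fst Ck_on_subset[of k U]]) (use U W' in auto)
      qed (use U(1) W'(1) \<eta> in auto)
      fix z assume z: "z \<in> cimg c \<inter> (U \<inter> W')"
      then have "z \<in> ?S" using W'(3) by auto
      then obtain q where q: "q \<in> cdom c" "q \<in> M - F" "z = coord c q" by auto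
      then have "cinv c z = q" using chart_cinv[OF ch] by simp
      moreover have "G z = ?i (cinv c z)" using U(4) z \<open>z \<in> ?S\<close> by auto
      ultimately show "\<eta> (fst (G z)) = (?f \<circ> cinv c) z" using q norm_inv_polar[of q] by auto
    qed (use U(1,2) W'(1,2) in \<open>auto intro: open_Int\<close>)
  next
    case False
    let ?K = "\<Phi> ` ({a..b} \<times> sphere 0 1)"
    have sub: "{a..b} \<times> sphere 0 1 \<subseteq> cyl I" using ab I by auto
    have "continuous_on ({a..b} \<times> sphere 0 1) \<Phi>"
      using wi sub by (auto simp: warped_isometry_def intro: continuous_on_subset)
    then have "compact ?K" by (intro compact_continuous_image compact_Times) auto
    then have o: "openin (top_of_set M) (M - ?K)" by (auto simp: openin_open Diff_eq intro!: exI[of _ "- ?K"] compact_imp_closed)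
    have m: "p \<in> M - ?K"
      using False p cM bij_betw_imp_surj_on[OF bij_\<Phi>] sub by blast
    obtain W' where W': "open W'" "y \<in> W'" "cimg c \<inter> W' \<subseteq> coord c ` (cdom c \<inter> (M - ?K))"
      using shrink[OF o m] by (elim exE conjE)
    show ?thesis
    proof (rule exI[of _ W'], rule exI[of _ "\<lambda>z. 0"], intro conjI allI ballI)
      fix z assume "z \<in> cimg c \<inter> W'"
      then obtain q where q: "q \<in> cdom c" "q \<in> M - ?K" "z = coord c q" using W'(3) by auto
      then have cz: "cinv c z = q" using chart_cinv[OF ch] by simp
      have "?f q = 0"
      proof (cases "q \<in> M - F")
        case True
        have "inv_into (cyl I) \<Phi> q \<in> cyl I" "\<Phi> (inv_into (cyl I) \<Phi> q) = q" using inv_into_mem[OF True] by auto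
        have "fst (inv_into (cyl I) \<Phi> q) \<notin> {a..b}"
        proof
          assume "fst (inv_into (cyl I) \<Phi> q) \<in> {a..b}"
          then have "inv_into (cyl I) \<Phi> q \<in> {a..b} \<times> sphere 0 1"
            using \<open>inv_into (cyl I) \<Phi> q \<in> cyl I\<close> unfolding mem_Times_iff by blast
          then have "\<Phi> (inv_into (cyl I) \<Phi> q) \<in> ?K" by (rule imageI)
          then show False using \<open>\<Phi> (inv_into (cyl I) \<Phi> q) = q\<close> q(2) by simp
        qed
        then show ?thesis using supp[of "norm (inv_polar q)"] True by (auto simp: norm_inv_polar)
      qed auto
      then show "0 = (?f \<circ> cinv c) z" unfolding o_apply cz by (rule sym)
    qed (use W'(1,2) Ck_on_const in simp_all)
  qed
qed

end

text \<open>Adds linear bounds for the profile. The lower bound is asked for up to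
  \<open>R / 2\<close> only, since on a closed manifold \<open>\<theta>\<close> returns to 0 at
  \<open>R\<close>.\<close>

locale revolution = warped M \<A> \<mu> \<theta> I \<Phi> F R
  for M :: "'p::{t2_space, second_countable_topology} set" and \<A> :: "('p, 'n::finite) rchart set"
    and \<mu> :: "'p measure" and \<theta> :: "real \<Rightarrow> real" and I :: "real set"
    and \<Phi> :: "real \<times> (real^'n) \<Rightarrow> 'p" and F :: "'p set" and R :: real +
  fixes T t0 :: real and \<theta>' :: "real \<Rightarrow> real"
  assumes dim: "2 \<le> CARD('n)" and compactM: "compact M"
    and T: "0 < T" "\<And>r. 0 < r \<Longrightarrow> r < R \<Longrightarrow> \<theta> r \<le> T * r"
    and t0: "0 < t0" "\<And>r. 0 < r \<Longrightarrow> r \<le> R / 2 \<Longrightarrow> t0 * r \<le> \<theta> r"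
    and \<theta>': "\<And>r. 0 < r \<Longrightarrow> r < R \<Longrightarrow> (\<theta> has_real_derivative \<theta>' r) (at r)"
begin

lemma \<theta>_pos: "0 < r \<Longrightarrow> r < R \<Longrightarrow> 0 < \<theta> r" using \<theta>(1) I by auto

lemma dens_le: "0 < r \<Longrightarrow> r < R \<Longrightarrow> 0 \<le> (\<theta> r / r) ^ (CARD('n) - 1) \<and> (\<theta> r / r) ^ (CARD('n) - 1) \<le> T ^ (CARD('n) - 1)"
proof -
  assume r: "0 < r" "r < R"
  have "0 \<le> \<theta> r / r" "\<theta> r / r \<le> T" using T(2)[OF r] \<theta>_pos[OF r] r by (simp_all add: field_simps)
  then show ?thesis by (intro conjI zero_le_power power_mono)
qed

lemma dens_ge: "0 < r \<Longrightarrow> r \<le> R / 2 \<Longrightarrow> t0 ^ (CARD('n) - 1) \<le> (\<theta> r / r) ^ (CARD('n) - 1)"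
  using t0 by (intro power_mono) (auto simp: field_simps)

lemma nn_integral_upper:
  assumes [measurable]: "f \<in> borel_measurable \<mu>"
    and f: "\<And>x. 0 < norm x \<Longrightarrow> norm x < R \<Longrightarrow> f (polar_map \<Phi> x) \<le> ennreal m * indicator (ball 0 h) x"
    and m: "0 \<le> m" and h: "0 \<le> h"
  shows "(\<integral>\<^sup>+p. f p \<partial>\<mu>) \<le> ennreal (m * T ^ (CARD('n) - 1) * (unit_ball_vol (real CARD('n)) * h ^ CARD('n)))"
proof -
  have "(\<integral>\<^sup>+p. f p \<partial>\<mu>) \<le> (\<integral>\<^sup>+x. ennreal (m * T ^ (CARD('n) - 1)) * indicator (ball (0 :: real^'n) h) x \<partial>lborel)"
    unfolding nn_integral_\<mu>[OF assms(1)]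
  proof (rule nn_integral_mono)
    fix x :: "real^'n"
    show "indicator {0<..<R} (norm x) * (f (polar_map \<Phi> x) * ennreal ((\<theta> (norm x) / norm x) ^ (CARD('n) - 1))) \<le> ennreal (m * T ^ (CARD('n) - 1)) * indicator (ball 0 h) x"
    proof (cases "0 < norm x \<and> norm x < R")
      case True
      have "f (polar_map \<Phi> x) * ennreal ((\<theta> (norm x) / norm x) ^ (CARD('n) - 1)) \<le> (ennreal m * indicator (ball 0 h) x) * ennreal (T ^ (CARD('n) - 1))"
        using f[of x] dens_le[of "norm x"] True by (intro mult_mono ennreal_leI) auto
      then show ?thesis using True m T by (simp add: ennreal_mult mult_ac)
    qed auto
  qed
  also have "\<dots> = ennreal (m * T ^ (CARD('n) - 1)) * emeasure lborel (ball (0 :: real^'n) h)"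
    by (rule nn_integral_cmult_indicator) simp
  also have "\<dots> = ennreal (m * T ^ (CARD('n) - 1) * (unit_ball_vol (real CARD('n)) * h ^ CARD('n)))"
    using m h T by (simp add: emeasure_ball ennreal_mult)
  finally show ?thesis .
qed

lemma nn_integral_lower:
  assumes [measurable]: "f \<in> borel_measurable \<mu>"
    and h: "0 < h" "2 * h \<le> R / 2" and m: "0 \<le> m"
    and f: "\<And>x. 5 / 4 * h \<le> norm x \<Longrightarrow> norm x \<le> 7 / 4 * h \<Longrightarrow> ennreal m \<le> f (polar_map \<Phi> x)"
  shows "ennreal (m * t0 ^ (CARD('n) - 1) * (unit_ball_vol (real CARD('n)) * (h / 4) ^ CARD('n))) \<le> (\<integral>\<^sup>+p. f p \<partial>\<mu>)"
proof -
  obtain k :: 'n where True by auto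
  \<comment> \<open>A ball of radius \<open>h / 4\<close> around a point at distance
    \<open>3 h / 2\<close> fits into the shell between \<open>5 h / 4\<close> and
    \<open>7 h / 4\<close>, the plateau of the bump, and has a known volume.\<close>
  define y :: "real^'n" where "y = (3 / 2 * h) *\<^sub>R axis k 1"
  have ny: "norm y = 3 / 2 * h" using h by (simp add: y_def norm_axis_1)
  have nx: "5 / 4 * h \<le> norm x \<and> norm x \<le> 7 / 4 * h" if "x \<in> ball y (h / 4)" for x
  proof -
    have "dist y x < h / 4" using that by simp
    then show ?thesis using norm_triangle_ineq3[of y x] ny by (simp add: dist_norm abs_le_iff)
  qed
  have "ennreal (m * t0 ^ (CARD('n) - 1) * (unit_ball_vol (real CARD('n)) * (h / 4) ^ CARD('n))) = ennreal (m * t0 ^ (CARD('n) - 1)) * emeasure lborel (ball y (h / 4))"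
    using m h t0 by (simp add: emeasure_ball ennreal_mult)
  also have "\<dots> = (\<integral>\<^sup>+x. ennreal (m * t0 ^ (CARD('n) - 1)) * indicator (ball y (h / 4)) x \<partial>lborel)"
    by (rule nn_integral_cmult_indicator[symmetric]) simp
  also have "\<dots> \<le> (\<integral>\<^sup>+p. f p \<partial>\<mu>)"
    unfolding nn_integral_\<mu>[OF assms(1)]
  proof (rule nn_integral_mono)
    fix x :: "real^'n"
    show "ennreal (m * t0 ^ (CARD('n) - 1)) * indicator (ball y (h / 4)) x \<le> indicator {0<..<R} (norm x) * (f (polar_map \<Phi> x) * ennreal ((\<theta> (norm x) / norm x) ^ (CARD('n) - 1)))"
    proof (cases "x \<in> ball y (h / 4)")
      case True
      note b = nx[OF True]
      have r: "0 < norm x" "norm x \<le> R / 2" "norm x < R" using b h R by auto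
      have "ennreal m * ennreal (t0 ^ (CARD('n) - 1)) \<le> f (polar_map \<Phi> x) * ennreal ((\<theta> (norm x) / norm x) ^ (CARD('n) - 1))"
        using f[of x] b dens_ge[OF r(1,2)] by (intro mult_mono ennreal_leI) auto
      then show ?thesis using True r m t0 by (simp add: ennreal_mult)
    qed simp
  qed
  finally show ?thesis .
qed

text \<open>The radial density of the weighted measure. The value 0 outside of \<open>(0, R)\<close>
  makes it Borel on the whole line.\<close>

definition wt :: "(real \<Rightarrow> real) \<Rightarrow> real \<Rightarrow> real" where
  "wt s r = (if 0 < r \<and> r < R then s r * \<theta> r ^ (CARD('n) - 1) else 0)"

lemma wt_eq: "0 < r \<Longrightarrow> r < R \<Longrightarrow> wt s r / r ^ (CARD('n) - 1) = s r * (\<theta> r / r) ^ (CARD('n) - 1)"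
  by (simp add: wt_def power_divide)

text \<open>\<open>L1\<close> and \<open>L2\<close>: the logarithmic derivative of \<open>s \<theta>\<^sup>n\<^sup>-\<^sup>1\<close>, multiplied by \<open>r\<close>, is
  bounded near \<open>r = 0\<close> and sufficiently negative beyond \<open>\<rho>\<close>.\<close>

context
  fixes s s' :: "real \<Rightarrow> real" and E :: "real set" and \<rho> e C sl :: real and \<sigma> :: "'p \<Rightarrow> real"
  assumes fin: "finite E" and \<rho>: "0 < \<rho>" "\<rho> \<le> R / 2" and e: "0 < e" and C: "0 \<le> C"
    and s: "continuous_on {0<..<R} s" "\<And>r. 0 < r \<Longrightarrow> r < R \<Longrightarrow> 0 < s r \<and> s r \<le> 1"
    and s': "\<And>r. 0 < r \<Longrightarrow> r < R \<Longrightarrow> r \<notin> E \<Longrightarrow> (s has_real_derivative s' r) (at r)"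
    and sl: "0 < sl" "\<And>r. 0 < r \<Longrightarrow> r < \<rho> \<Longrightarrow> sl \<le> s r"
    and L1: "\<And>r. 0 < r \<Longrightarrow> r < \<rho> \<Longrightarrow> r \<notin> E \<Longrightarrow> r * (s' r * \<theta> r + real (CARD('n) - 1) * s r * \<theta>' r) \<le> (C - e * r\<^sup>2) * (s r * \<theta> r)"
    and L2: "\<And>r. \<rho> \<le> r \<Longrightarrow> r < R \<Longrightarrow> r \<notin> E \<Longrightarrow> r * (s' r * \<theta> r + real (CARD('n) - 1) * s r * \<theta>' r) \<le> (- 2 - e * r\<^sup>2) * (s r * \<theta> r)"
    and \<sigma>[measurable]: "\<sigma> \<in> borel_measurable \<mu>"
    and \<sigma>s: "\<And>x. 0 < norm x \<Longrightarrow> norm x < R \<Longrightarrow> \<sigma> (polar_map \<Phi> x) = s (norm x)"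
begin

text \<open>The derivative of \<open>s \<theta> ^ (n - 1)\<close> with the power
  \<open>\<theta> ^ (n - 2)\<close> extracted, so that \<open>L1\<close> and \<open>L2\<close> speak
  about the remaining factor.\<close>

definition wt' :: "real \<Rightarrow> real" where
  "wt' r = (s' r * \<theta> r + real (CARD('n) - 1) * s r * \<theta>' r) * \<theta> r ^ ((CARD('n) - 1) - 1)"

lemma N_Suc: "(CARD('n) - 1) = Suc ((CARD('n) - 1) - 1)" using dim by simp

lemma \<theta>_pow: "\<theta> r ^ (CARD('n) - 1) = \<theta> r * \<theta> r ^ ((CARD('n) - 1) - 1)"
  by (subst N_Suc) simp

lemma wt_derivative:
  assumes r: "0 < r" "r < R" "r \<notin> E" shows "(wt s has_real_derivative wt' r) (at r)"
proof -
  have "((\<lambda>r. s r * \<theta> r ^ (CARD('n) - 1)) has_real_derivative s' r * \<theta> r ^ (CARD('n) - 1) + (real (CARD('n) - 1) * (\<theta> r ^ ((CARD('n) - 1) - Suc 0)) * \<theta>' r) * s r) (at r)"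
    using s'[OF r] \<theta>'[OF r(1,2)] by (auto intro!: derivative_eq_intros simp: algebra_simps)
  moreover have "s' r * \<theta> r ^ (CARD('n) - 1) + (real (CARD('n) - 1) * (\<theta> r ^ ((CARD('n) - 1) - Suc 0)) * \<theta>' r) * s r = wt' r"
    unfolding wt'_def \<theta>_pow by (simp add: algebra_simps)
  ultimately have "((\<lambda>r. s r * \<theta> r ^ (CARD('n) - 1)) has_real_derivative wt' r) (at r)" by simp
  then show ?thesis
    by (rule has_field_derivative_transform_within_open[of _ _ _ "{0<..<R}"]) (use r in \<open>auto simp: wt_def\<close>)
qed

lemma wt_L:
  assumes r: "0 < r" "r < R" and le: "r * (s' r * \<theta> r + real (CARD('n) - 1) * s r * \<theta>' r) \<le> k * (s r * \<theta> r)"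
  shows "r * wt' r \<le> k * wt s r"
proof -
  have "r * (s' r * \<theta> r + real (CARD('n) - 1) * s r * \<theta>' r) * \<theta> r ^ ((CARD('n) - 1) - 1) \<le> k * (s r * \<theta> r) * \<theta> r ^ ((CARD('n) - 1) - 1)"
    using \<theta>_pos[OF r] by (intro mult_right_mono le) simp
  moreover have e: "wt s r = s r * \<theta> r ^ (CARD('n) - 1)" using r by (simp add: wt_def)
  ultimately show ?thesis unfolding e wt'_def \<theta>_pow by (simp only: mult.assoc)
qed

lemma wt_bounds:
  assumes r: "0 < r" "r < R" shows "0 < wt s r \<and> wt s r \<le> (T * R) ^ (CARD('n) - 1)"
proof -
  have "s r * \<theta> r ^ (CARD('n) - 1) \<le> 1 * (T * R) ^ (CARD('n) - 1)"
    using s(2)[OF r] \<theta>_pos[OF r] T(2)[OF r] r T(1)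
    by (intro mult_mono power_mono) (auto intro: order_trans[OF _ mult_left_mono[of r R T]])
  then show ?thesis using s(2)[OF r] \<theta>_pos[OF r] r by (simp add: wt_def)
qed

lemma wt_continuous: "continuous_on {0<..<R} (wt s)"
proof -
  have "continuous_on {0<..<R} \<theta>" using \<theta>(2) I by (auto intro: continuous_on_subset)
  then have "continuous_on {0<..<R} (\<lambda>r. s r * \<theta> r ^ (CARD('n) - 1))" using s(1) by (intro continuous_intros)
  then show ?thesis using continuous_on_cong[of "{0<..<R}" "{0<..<R}" "wt s" "\<lambda>r. s r * \<theta> r ^ (CARD('n) - 1)"] by (simp add: wt_def)
qed

lemma wt_measurable[measurable]: "wt s \<in> borel_measurable borel"
proof -
  have "(\<lambda>r. indicator {0<..<R} r *\<^sub>R wt s r) \<in> borel_measurable borel"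
    by (rule borel_measurable_continuous_on_indicator[OF _ wt_continuous]) simp
  moreover have "(\<lambda>r. indicator {0<..<R} r *\<^sub>R wt s r) = wt s" by (auto simp: fun_eq_iff wt_def indicator_def)
  ultimately show ?thesis by simp
qed

lemma nn_integral_weighted:
  assumes [measurable]: "g \<in> borel_measurable \<mu>" and g: "\<And>p. p \<in> M \<Longrightarrow> 0 \<le> g p"
  shows "(\<integral>\<^sup>+p. ennreal (g p * \<sigma> p) \<partial>\<mu>)
     = (\<integral>\<^sup>+x. indicator {0<..<R} (norm x) * ennreal (g (polar_map \<Phi> x) * (wt s (norm x) / norm x ^ (CARD('n) - 1))) \<partial>lborel)"
proof -
  have "(\<integral>\<^sup>+p. ennreal (g p * \<sigma> p) \<partial>\<mu>) = (\<integral>\<^sup>+x. indicator {0<..<R} (norm x) * (ennreal (g (polar_map \<Phi> x) * \<sigma> (polar_map \<Phi> x)) * ennreal ((\<theta> (norm x) / norm x) ^ (CARD('n) - 1))) \<partial>lborel)"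
    by (rule nn_integral_\<mu>) measurable
  also have "\<dots> = (\<integral>\<^sup>+x. indicator {0<..<R} (norm x) * ennreal (g (polar_map \<Phi> x) * (wt s (norm x) / norm x ^ (CARD('n) - 1))) \<partial>lborel)"
  proof (rule nn_integral_cong)
    fix x :: "real^'n"
    show "indicator {0<..<R} (norm x) * (ennreal (g (polar_map \<Phi> x) * \<sigma> (polar_map \<Phi> x)) * ennreal ((\<theta> (norm x) / norm x) ^ (CARD('n) - 1)))
      = indicator {0<..<R} (norm x) * ennreal (g (polar_map \<Phi> x) * (wt s (norm x) / norm x ^ (CARD('n) - 1)))"
    proof (cases "0 < norm x \<and> norm x < R")
      case True
      have "0 \<le> g (polar_map \<Phi> x)" using g polar_map_in interior_Z True by auto
      moreover have "0 \<le> s (norm x)" "0 \<le> (\<theta> (norm x) / norm x) ^ (CARD('n) - 1)"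
        using True dens_le[of "norm x"] s(2)[of "norm x"] by auto
      moreover have "wt s (norm x) / norm x ^ (CARD('n) - 1) = s (norm x) * (\<theta> (norm x) / norm x) ^ (CARD('n) - 1)"
        using True by (intro wt_eq) auto
      ultimately show ?thesis using True \<sigma>s[of x]
        by (simp only: ennreal_mult[symmetric] mult_nonneg_nonneg mult.assoc)
    qed auto
  qed
  finally show ?thesis .
qed

text \<open>The entries of \<open>K\<close> instantiate \<open>weighted_ball_poincare\<close>: the
  weight on the small ball lies between \<open>sl * t0 ^ (n - 1)\<close> and
  \<open>T ^ (n - 1)\<close>, and \<open>1 + T^2\<close> compares the warped with the Euclidean
  length.\<close>

lemma poincare:
  assumes u: "smooth_fun \<A> u"
  defines "K \<equiv> (2 + C) * (T ^ (CARD('n) - 1) / (sl * t0 ^ (CARD('n) - 1)) * (4 * \<rho>\<^sup>2 * (1 + T\<^sup>2) * 2 ^ CARD('n))) + 1 / e"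
  obtains c where "(\<integral>\<^sup>+p. ennreal ((u p - c)\<^sup>2 * \<sigma> p) \<partial>\<mu>) \<le> ennreal K * (\<integral>\<^sup>+p. ennreal (grad_norm_sq \<A> u p * \<sigma> p) \<partial>\<mu>)"
proof -
  let ?B = "{x :: real^'n. 0 < norm x \<and> norm x < R}"
  have Bb: "?B \<in> sets borel" using open_punctured by (rule borel_open)
  \<comment> \<open>Extension by zero from the open punctured ball, where continuity is known, gives
    Borel functions on the whole space.\<close>
  define U where "U x = indicator ?B x *\<^sub>R u (polar_map \<Phi> x)" for x
  define G where "G x = indicator ?B x *\<^sub>R grad_norm_sq \<A> u (polar_map \<Phi> x)" for x
  have cu: "continuous_on M u" by (rule smooth_fun_continuous_on[OF atlas u])
  have cg: "continuous_on M (grad_norm_sq \<A> u)" by (rule continuous_on_grad_norm_sq[OF atlas u])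
  have comp: "continuous_on ?B (\<lambda>x. f (polar_map \<Phi> x))" if "continuous_on M f" for f :: "'p \<Rightarrow> real"
    by (rule continuous_on_compose2[OF that continuous_on_subset[OF continuous_on_polar_map]])
      (use interior_Z polar_map_in in auto)
  have [measurable]: "U \<in> borel_measurable borel" "G \<in> borel_measurable borel"
    unfolding U_def G_def by (intro borel_measurable_continuous_on_indicator Bb comp cu cg)+
  have bd: "\<exists>Cf. \<forall>p\<in>M. \<bar>f p\<bar> \<le> Cf" if "continuous_on M f" for f :: "'p \<Rightarrow> real"
    using compact_imp_bounded[OF compact_continuous_image[OF that compactM]] by (auto simp: bounded_iff)
  obtain Cu where Cu: "\<And>p. p \<in> M \<Longrightarrow> \<bar>u p\<bar> \<le> Cu" using bd[OF cu] by blast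
  obtain Cg where Cg: "\<And>p. p \<in> M \<Longrightarrow> \<bar>grad_norm_sq \<A> u p\<bar> \<le> Cg" using bd[OF cg] by blast
  have pM: "polar_map \<Phi> x \<in> M" if "x \<in> ?B" for x using polar_map_in interior_Z that by auto
  have UB: "U x = u (polar_map \<Phi> x)" "G x = grad_norm_sq \<A> u (polar_map \<Phi> x)" if "0 < norm x" "norm x < R" for x
    using that by (auto simp: U_def G_def)
  let ?Q = "\<lambda>x D. ((\<lambda>y. u (polar_map \<Phi> y)) has_derivative D) (at x) \<and>
    (\<forall>v. (D v)\<^sup>2 \<le> grad_norm_sq \<A> u (polar_map \<Phi> x) * polar_form (\<theta> (norm x) / norm x) x v v)"
  have "\<forall>x. \<exists>D. 0 < norm x \<and> norm x < R \<longrightarrow> ?Q x D" using polar_derivative[OF u] by blast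
  then obtain D where D': "\<forall>x. 0 < norm x \<and> norm x < R \<longrightarrow> ?Q x (D x)" by (rule choice[THEN exE])
  then have D: "((\<lambda>y. u (polar_map \<Phi> y)) has_derivative D x) (at x)"
    "(D x v)\<^sup>2 \<le> grad_norm_sq \<A> u (polar_map \<Phi> x) * polar_form (\<theta> (norm x) / norm x) x v v"
    if "0 < norm x" "norm x < R" for x v
    using that by blast+
  have G0: "0 \<le> G x \<and> G x \<le> \<bar>Cg\<bar>" for x
  proof (cases "x \<in> ?B")
    case True
    then show ?thesis
      using grad_norm_sq_nonneg[OF atlas u pM[OF True]] Cg[OF pM[OF True]] UB(2)[of x] by auto
  next
    case False
    then have "indicator ?B x = (0 :: real)" by (rule indicator_simps(2))
    then show ?thesis unfolding G_def by (simp only: scaleR_zero_left abs_ge_zero order_refl simp_thms)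
  qed
  obtain c where c: "(\<integral>\<^sup>+x. indicator {0<..<R} (norm x) * ennreal ((U x - c)\<^sup>2 * (wt s (norm x) / norm x ^ (DIM(real^'n) - 1))) \<partial>lborel)
    \<le> ennreal ((2 + C) * (T ^ (CARD('n) - 1) / (sl * t0 ^ (CARD('n) - 1)) * (4 * \<rho>\<^sup>2 * (1 + T\<^sup>2) * 2 ^ DIM(real^'n))) + 1 / e) *
      (\<integral>\<^sup>+x. indicator {0<..<R} (norm x) * ennreal (G x * (wt s (norm x) / norm x ^ (DIM(real^'n) - 1))) \<partial>lborel)"
  proof (rule weighted_ball_poincare[of U "wt s" G E \<rho> R e C D Cu wt' "(T * R) ^ (CARD('n) - 1)" "\<bar>Cg\<bar>" "1 + T\<^sup>2" "sl * t0 ^ (CARD('n) - 1)" "T ^ (CARD('n) - 1)"])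
    show "2 \<le> DIM(real^'n)" using dim by simp
    show "\<rho> < R" using \<rho> R by simp
    show "(U has_derivative D x) (at x)" if "0 < norm x" "norm x < R" for x
      by (rule has_derivative_transform_within_open[OF D(1)[OF that] open_punctured]) (use that UB in auto)
    show "\<bar>U x\<bar> \<le> Cu" if "0 < norm x" "norm x < R" for x using UB[OF that] Cu[OF pM] that by simp
    show "(D x ((1 / norm x) *\<^sub>R x))\<^sup>2 \<le> G x" if "0 < norm x" "norm x < R" for x
    proof -
      have "(1 / norm x) *\<^sub>R x = sgn x" by (simp add: sgn_div_norm divide_inverse)
      then show ?thesis using D(2)[OF that, of "sgn x"] UB[OF that] that by (simp add: polar_form_sgn)
    qed
    show "(D x v)\<^sup>2 \<le> (1 + T\<^sup>2) * (norm v)\<^sup>2 * G x" if x: "0 < norm x" "norm x < \<rho>" for x v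
    proof -
      have xR: "norm x < R" using x \<rho> R by simp
      have "(\<theta> (norm x) / norm x)\<^sup>2 \<le> T\<^sup>2"
        using T(2)[OF x(1) xR] \<theta>_pos[OF x(1) xR] x by (intro power_mono) (auto simp: field_simps)
      then have "polar_form (\<theta> (norm x) / norm x) x v v \<le> (1 + T\<^sup>2) * (norm v)\<^sup>2"
        by (intro order_trans[OF polar_form_le] mult_right_mono) auto
      then have "G x * polar_form (\<theta> (norm x) / norm x) x v v \<le> G x * ((1 + T\<^sup>2) * (norm v)\<^sup>2)"
        using G0 by (intro mult_left_mono) auto
      then show ?thesis using D(2)[OF x(1) xR, of v] UB[OF x(1) xR] by (simp add: mult.commute)
    qed
    show "sl * t0 ^ (CARD('n) - 1) \<le> wt s (norm x) / norm x ^ (DIM(real^'n) - 1) \<and> wt s (norm x) / norm x ^ (DIM(real^'n) - 1) \<le> T ^ (CARD('n) - 1)"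
      if x: "0 < norm x" "norm x < \<rho>" for x :: "real^'n"
    proof -
      have xR: "norm x < R" "norm x \<le> R / 2" using x \<rho> R by simp_all
      have "sl * t0 ^ (CARD('n) - 1) \<le> s (norm x) * (\<theta> (norm x) / norm x) ^ (CARD('n) - 1)"
        using sl(2)[OF x] sl(1) dens_ge[OF x(1) xR(2)] t0 by (intro mult_mono) auto
      moreover have "s (norm x) * (\<theta> (norm x) / norm x) ^ (CARD('n) - 1) \<le> 1 * T ^ (CARD('n) - 1)"
        using s(2)[OF x(1) xR(1)] dens_le[OF x(1) xR(1)] by (intro mult_mono) auto
      ultimately show ?thesis using wt_eq[OF x(1) xR(1)] by simp
    qed
    show "r * wt' r \<le> (C - e * r\<^sup>2) * wt s r" if "0 < r" "r < \<rho>" "r \<notin> E" for r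
      using that \<rho> R by (intro wt_L L1) auto
    show "r * wt' r \<le> (- 2 - e * r\<^sup>2) * wt s r" if "\<rho> \<le> r" "r < R" "r \<notin> E" for r
      using that \<rho> by (intro wt_L L2) auto
  qed (use fin \<rho> e C wt_continuous wt_derivative wt_bounds G0 sl t0 T in auto)
  have eqU: "(\<integral>\<^sup>+x. indicator {0<..<R} (norm x) * ennreal ((U x - c)\<^sup>2 * (wt s (norm x) / norm x ^ (CARD('n) - 1))) \<partial>lborel)
    = (\<integral>\<^sup>+p. ennreal ((u p - c)\<^sup>2 * \<sigma> p) \<partial>\<mu>)"
  proof -
    have [measurable]: "u \<in> borel_measurable \<mu>"
      using borel_measurable_continuous_on_restrict[OF cu] measurable_cong_sets[OF sets_\<mu> refl] by blast
    show ?thesis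
      by (subst nn_integral_weighted) (auto intro!: nn_integral_cong simp: UB split: split_indicator)
  qed
  have eqG: "(\<integral>\<^sup>+x. indicator {0<..<R} (norm x) * ennreal (G x * (wt s (norm x) / norm x ^ (CARD('n) - 1))) \<partial>lborel)
    = (\<integral>\<^sup>+p. ennreal (grad_norm_sq \<A> u p * \<sigma> p) \<partial>\<mu>)"
  proof -
    have [measurable]: "grad_norm_sq \<A> u \<in> borel_measurable \<mu>"
      using borel_measurable_continuous_on_restrict[OF cg] measurable_cong_sets[OF sets_\<mu> refl] by blast
    show ?thesis
      by (subst nn_integral_weighted) (auto intro!: nn_integral_cong grad_norm_sq_nonneg[OF atlas u] simp: UB split: split_indicator)
  qed
  show ?thesis using c eqU eqG by (intro that[of c]) (simp add: K_def)
qed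

text \<open>The Lyapunov inequality for the constant function 1: its energy vanishes, so the outer
  mass is at most \<open>1 + C\<close> times the mass of the ball of radius
  \<open>\<rho>\<close>.\<close>

lemma mass_le:
  "(\<integral>\<^sup>+p. ennreal (\<sigma> p) \<partial>\<mu>) \<le> ennreal ((2 + C) * (T ^ (CARD('n) - 1) * (unit_ball_vol (real CARD('n)) * \<rho> ^ CARD('n))))"
proof -
  let ?W = "\<lambda>x :: real^'n. wt s (norm x) / norm x ^ (DIM(real^'n) - 1)"
  let ?J = "\<integral>\<^sup>+x. indicator {0<..<\<rho>} (norm x) * ennreal (?W x) \<partial>lborel"
  have out: "(\<integral>\<^sup>+x. indicator {\<rho>..<R} (norm x) * ennreal (((\<lambda>_. 1) x - 0)\<^sup>2 * ?W x) \<partial>lborel)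
    \<le> ennreal (1 + C) * (\<integral>\<^sup>+x. indicator {0<..<\<rho>} (norm x) * ennreal (((\<lambda>_. 1) x - 0)\<^sup>2 * ?W x) \<partial>lborel)
      + ennreal (1 / e) * (\<integral>\<^sup>+x. indicator {0<..<R} (norm x) * ennreal ((\<lambda>_. 0) x * ?W x) \<partial>lborel)"
  proof (rule ball_lyapunov_inequality[of "\<lambda>_. 1" "wt s" "\<lambda>_. 0" E \<rho> R e C "\<lambda>_ _. 0" 1 wt' "(T * R) ^ (CARD('n) - 1)" 0 0])
    show "\<rho> < R" using \<rho> R by simp
    show "r * wt' r \<le> (C - e * r\<^sup>2) * wt s r" if "0 < r" "r < \<rho>" "r \<notin> E" for r
      using that \<rho> R by (intro wt_L L1) auto
    show "r * wt' r \<le> (- 2 - e * r\<^sup>2) * wt s r" if "\<rho> \<le> r" "r < R" "r \<notin> E" for r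
      using that \<rho> by (intro wt_L L2) auto
  qed (use fin \<rho> e C wt_continuous wt_derivative wt_bounds in auto)
  have "(\<integral>\<^sup>+p. ennreal (\<sigma> p) \<partial>\<mu>) = (\<integral>\<^sup>+x. indicator {0<..<R} (norm x) * ennreal (?W x) \<partial>lborel)"
    using nn_integral_weighted[of "\<lambda>_. 1"] by simp
  also have "\<dots> = (\<integral>\<^sup>+x. indicator {0<..<\<rho>} (norm x) * ennreal (?W x) + indicator {\<rho>..<R} (norm x) * ennreal (?W x) \<partial>lborel)"
    using \<rho> R by (intro nn_integral_cong) (auto split: split_indicator)
  also have "\<dots> = ?J + (\<integral>\<^sup>+x. indicator {\<rho>..<R} (norm x) * ennreal (?W x) \<partial>lborel)"
    by (rule nn_integral_add) measurable
  also have "\<dots> \<le> ?J + ennreal (1 + C) * ?J" using out by (intro add_left_mono) simp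
  also have "\<dots> = ennreal (2 + C) * ?J"
  proof -
    have "ennreal (2 + C) = 1 + ennreal (1 + C)" using C by (simp add: ennreal_plus[symmetric] del: ennreal_plus flip: ennreal_1)
    then show ?thesis by (simp add: distrib_right)
  qed
  also have "?J \<le> (\<integral>\<^sup>+x. ennreal (T ^ (CARD('n) - 1)) * indicator (ball (0 :: real^'n) \<rho>) x \<partial>lborel)"
  proof (rule nn_integral_mono)
    fix x :: "real^'n"
    show "indicator {0<..<\<rho>} (norm x) * ennreal (?W x) \<le> ennreal (T ^ (CARD('n) - 1)) * indicator (ball 0 \<rho>) x"
    proof (cases "0 < norm x \<and> norm x < \<rho>")
      case True
      then have xR: "0 < norm x" "norm x < R" using \<rho> R by simp_all
      have "s (norm x) * (\<theta> (norm x) / norm x) ^ (CARD('n) - 1) \<le> 1 * T ^ (CARD('n) - 1)"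
        using s(2)[OF xR] dens_le[OF xR] by (intro mult_mono) auto
      then show ?thesis using True wt_eq[OF xR] by (auto intro!: ennreal_leI)
    qed auto
  qed
  also have "(\<integral>\<^sup>+x. ennreal (T ^ (CARD('n) - 1)) * indicator (ball (0 :: real^'n) \<rho>) x \<partial>lborel) = ennreal (T ^ (CARD('n) - 1)) * emeasure lborel (ball (0 :: real^'n) \<rho>)"
    by (rule nn_integral_cmult_indicator) simp
  finally have "(\<integral>\<^sup>+p. ennreal (\<sigma> p) \<partial>\<mu>) \<le> ennreal (2 + C) * (ennreal (T ^ (CARD('n) - 1)) * emeasure lborel (ball (0 :: real^'n) \<rho>))"
    by (simp add: mult_left_mono)
  also have "\<dots> = ennreal ((2 + C) * (T ^ (CARD('n) - 1) * (unit_ball_vol (real CARD('n)) * \<rho> ^ CARD('n))))"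
    using C T \<rho> by (simp add: emeasure_ball ennreal_mult)
  finally show ?thesis .
qed

end

end

section \<open>Radial densities\<close>

lemma Ck_on_ident: "Ck_on k UNIV (\<lambda>t::real. t)"
proof (cases k)
  case (Suc m)
  show ?thesis unfolding Suc by (rule Ck_on_SucI[of _ _ "\<lambda>x h. h"]) (auto intro!: Ck_on_const)
qed auto

lemma ennreal_integral_le:
  assumes "integrable M f" "\<And>x. x \<in> space M \<Longrightarrow> 0 \<le> f x" "(\<integral>\<^sup>+x. ennreal (f x) \<partial>M) \<le> ennreal b" "0 \<le> b"
  shows "(\<integral>x. f x \<partial>M) \<le> b"
  using assms nn_integral_eq_integral[OF assms(1)] by (simp add: AE_I2)

lemma ennreal_integral_ge:
  assumes "integrable M f" "\<And>x. x \<in> space M \<Longrightarrow> 0 \<le> f x" "ennreal b \<le> (\<integral>\<^sup>+x. ennreal (f x) \<partial>M)"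
  shows "b \<le> (\<integral>x. f x \<partial>M)"
proof -
  have "0 \<le> (\<integral>x. f x \<partial>M)" using assms(2) by (intro integral_nonneg_AE AE_I2)
  then show ?thesis using assms nn_integral_eq_integral[OF assms(1)] by (simp add: AE_I2)
qed

context revolution
begin

text \<open>Collects the hypotheses of the preceding context in one predicate that can be stated for
  every \<open>j\<close>; the exceptional points and the derivative of \<open>s\<close> are
  existentially quantified.\<close>

definition admissible :: "(real \<Rightarrow> real) \<Rightarrow> real \<Rightarrow> real \<Rightarrow> real \<Rightarrow> real \<Rightarrow> ('p \<Rightarrow> real) \<Rightarrow> bool" where
  "admissible s \<rho> e C sl \<sigma> \<longleftrightarrow>
    0 < \<rho> \<and> \<rho> \<le> R / 2 \<and> 0 < e \<and> 0 \<le> C \<and> continuous_on {0<..<R} s \<and>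
    (\<forall>r. 0 < r \<longrightarrow> r < R \<longrightarrow> 0 < s r \<and> s r \<le> 1) \<and> 0 < sl \<and> (\<forall>r. 0 < r \<longrightarrow> r < \<rho> \<longrightarrow> sl \<le> s r) \<and>
    (\<exists>E s'. finite E \<and> (\<forall>r. 0 < r \<longrightarrow> r < R \<longrightarrow> r \<notin> E \<longrightarrow> (s has_real_derivative s' r) (at r) \<and>
       r * (s' r * \<theta> r + real (CARD('n) - 1) * s r * \<theta>' r) \<le> (if r < \<rho> then C - e * r\<^sup>2 else - 2 - e * r\<^sup>2) * (s r * \<theta> r))) \<and>
    \<sigma> \<in> borel_measurable \<mu> \<and> (\<forall>x. 0 < norm x \<longrightarrow> norm x < R \<longrightarrow> \<sigma> (polar_map \<Phi> x) = s (norm x)) \<and>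
    (\<forall>p\<in>M. 0 < \<sigma> p \<and> \<sigma> p \<le> 1)"

lemma admissibleD:
  assumes "admissible s \<rho> e C sl \<sigma>"
  shows "0 < \<rho>" "\<rho> \<le> R / 2" "0 < e" "0 \<le> C" "continuous_on {0<..<R} s"
    "\<And>r. 0 < r \<Longrightarrow> r < R \<Longrightarrow> 0 < s r \<and> s r \<le> 1"
    "0 < sl" "\<And>r. 0 < r \<Longrightarrow> r < \<rho> \<Longrightarrow> sl \<le> s r" "\<sigma> \<in> borel_measurable \<mu>"
    "\<And>x. 0 < norm x \<Longrightarrow> norm x < R \<Longrightarrow> \<sigma> (polar_map \<Phi> x) = s (norm x)"
  using assms unfolding admissible_def by simp_all

lemma admissibleE:
  assumes "admissible s \<rho> e C sl \<sigma>"
  obtains E s' where "finite E" "\<And>r. 0 < r \<Longrightarrow> r < R \<Longrightarrow> r \<notin> E \<Longrightarrow> (s has_real_derivative s' r) (at r)"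
    "\<And>r. 0 < r \<Longrightarrow> r < \<rho> \<Longrightarrow> r \<notin> E \<Longrightarrow> r * (s' r * \<theta> r + real (CARD('n) - 1) * s r * \<theta>' r) \<le> (C - e * r\<^sup>2) * (s r * \<theta> r)"
    "\<And>r. \<rho> \<le> r \<Longrightarrow> r < R \<Longrightarrow> r \<notin> E \<Longrightarrow> r * (s' r * \<theta> r + real (CARD('n) - 1) * s r * \<theta>' r) \<le> (- 2 - e * r\<^sup>2) * (s r * \<theta> r)"
proof -
  have \<rho>: "0 < \<rho>" "\<rho> < R" using admissibleD(1,2)[OF assms] R by auto
  have "\<exists>E s'. finite E \<and> (\<forall>r. 0 < r \<longrightarrow> r < R \<longrightarrow> r \<notin> E \<longrightarrow> (s has_real_derivative s' r) (at r) \<and>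
       r * (s' r * \<theta> r + real (CARD('n) - 1) * s r * \<theta>' r) \<le> (if r < \<rho> then C - e * r\<^sup>2 else - 2 - e * r\<^sup>2) * (s r * \<theta> r))"
    using assms unfolding admissible_def by (elim conjE)
  then obtain E s' where E: "finite E" "\<forall>r. 0 < r \<longrightarrow> r < R \<longrightarrow> r \<notin> E \<longrightarrow> (s has_real_derivative s' r) (at r) \<and>
       r * (s' r * \<theta> r + real (CARD('n) - 1) * s r * \<theta>' r) \<le> (if r < \<rho> then C - e * r\<^sup>2 else - 2 - e * r\<^sup>2) * (s r * \<theta> r)"
    by (elim exE conjE)
  show ?thesis
  proof (rule that[OF E(1)])
    fix r
    show "(s has_real_derivative s' r) (at r)" if "0 < r" "r < R" "r \<notin> E" using E(2) that by simp
    show "r * (s' r * \<theta> r + real (CARD('n) - 1) * s r * \<theta>' r) \<le> (C - e * r\<^sup>2) * (s r * \<theta> r)" if "0 < r" "r < \<rho>" "r \<notin> E"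
      using E(2)[rule_format, of r] that \<rho> by simp
    show "r * (s' r * \<theta> r + real (CARD('n) - 1) * s r * \<theta>' r) \<le> (- 2 - e * r\<^sup>2) * (s r * \<theta> r)" if "\<rho> \<le> r" "r < R" "r \<notin> E"
      using E(2)[rule_format, of r] that \<rho> by simp
  qed
qed

lemma admissible_poincare:
  assumes adm: "admissible s \<rho> e C sl \<sigma>" and u: "smooth_fun \<A> u"
  obtains c where "(\<integral>\<^sup>+p. ennreal ((u p - c)\<^sup>2 * \<sigma> p) \<partial>\<mu>)
    \<le> ennreal ((2 + C) * (T ^ (CARD('n) - 1) / (sl * t0 ^ (CARD('n) - 1)) * (4 * \<rho>\<^sup>2 * (1 + T\<^sup>2) * 2 ^ CARD('n))) + 1 / e) *
      (\<integral>\<^sup>+p. ennreal (grad_norm_sq \<A> u p * \<sigma> p) \<partial>\<mu>)"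
proof (rule admissibleE[OF adm])
  fix E s' assume E: "finite E" "\<And>r. 0 < r \<Longrightarrow> r < R \<Longrightarrow> r \<notin> E \<Longrightarrow> (s has_real_derivative s' r) (at r)"
    "\<And>r. 0 < r \<Longrightarrow> r < \<rho> \<Longrightarrow> r \<notin> E \<Longrightarrow> r * (s' r * \<theta> r + real (CARD('n) - 1) * s r * \<theta>' r) \<le> (C - e * r\<^sup>2) * (s r * \<theta> r)"
    "\<And>r. \<rho> \<le> r \<Longrightarrow> r < R \<Longrightarrow> r \<notin> E \<Longrightarrow> r * (s' r * \<theta> r + real (CARD('n) - 1) * s r * \<theta>' r) \<le> (- 2 - e * r\<^sup>2) * (s r * \<theta> r)"
  show ?thesis
    by (rule poincare[OF E(1) admissibleD(1-6)[OF adm] E(2) admissibleD(7,8)[OF adm] E(3,4) admissibleD(9,10)[OF adm] u])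
      (simp_all add: that)
qed

lemma admissible_mass_le:
  assumes adm: "admissible s \<rho> e C sl \<sigma>"
  shows "(\<integral>\<^sup>+p. ennreal (\<sigma> p) \<partial>\<mu>) \<le> ennreal ((2 + C) * (T ^ (CARD('n) - 1) * (unit_ball_vol (real CARD('n)) * \<rho> ^ CARD('n))))"
proof (rule admissibleE[OF adm])
  fix E s' assume E: "finite E" "\<And>r. 0 < r \<Longrightarrow> r < R \<Longrightarrow> r \<notin> E \<Longrightarrow> (s has_real_derivative s' r) (at r)"
    "\<And>r. 0 < r \<Longrightarrow> r < \<rho> \<Longrightarrow> r \<notin> E \<Longrightarrow> r * (s' r * \<theta> r + real (CARD('n) - 1) * s r * \<theta>' r) \<le> (C - e * r\<^sup>2) * (s r * \<theta> r)"
    "\<And>r. \<rho> \<le> r \<Longrightarrow> r < R \<Longrightarrow> r \<notin> E \<Longrightarrow> r * (s' r * \<theta> r + real (CARD('n) - 1) * s r * \<theta>' r) \<le> (- 2 - e * r\<^sup>2) * (s r * \<theta> r)"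
  show ?thesis
    by (rule mass_le[OF E(1) admissibleD(1-6)[OF adm] E(2) admissibleD(7,8)[OF adm] E(3,4) admissibleD(9,10)[OF adm]])
qed

lemma finite_\<mu>: "finite_measure \<mu>"
proof
  have "(\<integral>\<^sup>+p. 1 \<partial>\<mu>) \<le> ennreal (1 * T ^ (CARD('n) - 1) * (unit_ball_vol (real CARD('n)) * R ^ CARD('n)))"
    using R by (intro nn_integral_upper) auto
  then show "emeasure \<mu> (space \<mu>) \<noteq> \<infinity>" by (auto simp: top_unique)
qed

lemma admissible_manifold:
  assumes "admissible s \<rho> e C sl \<sigma>" shows "weighted_manifold M \<A> \<mu> \<sigma>"
proof (rule weighted_manifold.intro[OF atlas compactM space_\<mu> sets_\<mu> finite_\<mu>])
  show "\<sigma> \<in> borel_measurable \<mu>" using assms by (simp add: admissible_def)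
  show "0 < \<sigma> p \<and> \<sigma> p \<le> 1" if "p \<in> M" for p using assms that unfolding admissible_def by blast
qed

text \<open>At scale \<open>h\<close> the gradient is at most \<open>L / h\<close> on a ball of
  radius \<open>3 h\<close>, while the mass is at least that of a ball of radius
  \<open>h / 4\<close>. Both volumes are of order \<open>h ^ n\<close>, which leaves
  \<open>1 / h^2\<close>.\<close>

lemma bump_test_function:
  assumes adm: "admissible s \<rho> e C sl \<sigma>"
    and \<beta>: "\<And>k. Ck_on k UNIV \<beta>" "\<And>t. t \<le> 1 \<or> 2 \<le> t \<Longrightarrow> \<beta> t = 0" "\<And>t. 5 / 4 \<le> t \<Longrightarrow> t \<le> 7 / 4 \<Longrightarrow> 1 \<le> \<beta> t"
      "\<And>t. \<exists>d. (\<beta> has_real_derivative d) (at t) \<and> \<bar>d\<bar> \<le> L" and L: "0 < L"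
    and h: "0 < h" "2 * h \<le> R / 2" and m: "0 < m" "\<And>r. 0 < r \<Longrightarrow> r \<le> 2 * h \<Longrightarrow> m \<le> s r"
  defines "f \<equiv> \<lambda>p. if p \<in> M - F then \<beta> (norm (inv_polar p) / h) else 0"
  shows "smooth_fun \<A> f \<and> 0 < (\<integral>p. (f p)\<^sup>2 * \<sigma> p \<partial>\<mu>) \<and>
    weighted_manifold.energy \<A> \<mu> \<sigma> f \<le> (L\<^sup>2 * T ^ (CARD('n) - 1) * 12 ^ CARD('n) / (m * t0 ^ (CARD('n) - 1))) / h\<^sup>2 * (\<integral>p. (f p)\<^sup>2 * \<sigma> p \<partial>\<mu>)"
proof -
  interpret W: weighted_manifold M \<A> \<mu> \<sigma> by (rule admissible_manifold[OF adm])
  have \<sigma>: "\<And>x. 0 < norm x \<Longrightarrow> norm x < R \<Longrightarrow> \<sigma> (polar_map \<Phi> x) = s (norm x)" "\<And>r. 0 < r \<Longrightarrow> r < R \<Longrightarrow> 0 < s r \<and> s r \<le> 1"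
    using admissibleD(10,6)[OF adm] by blast+
  have \<sigma>m[measurable]: "\<sigma> \<in> borel_measurable \<mu>" using adm by (simp add: admissible_def)
  let ?N = "CARD('n) - 1" and ?n = "CARD('n)" and ?vb = "unit_ball_vol (real CARD('n))"
  have vb: "0 < ?vb" by (rule unit_ball_vol_pos) simp
  have fx: "f (polar_map \<Phi> x) = \<beta> (norm x / h)" if "0 < norm x" "norm x < R" for x
    using polar_map_in[OF interior_Z[OF that]] inv_polar_polar_map[OF interior_Z[OF that]] by (simp add: f_def)
  have sf: "smooth_fun \<A> f" unfolding f_def
  proof (rule radial_smooth_fun[of "\<lambda>r. \<beta> (r / h)" h "2 * h"])
    have "Ck_on k UNIV (\<lambda>r. (1 / h) * r)" for k by (intro Ck_on_mult Ck_on_const Ck_on_ident) auto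
    then show "Ck_on k UNIV (\<lambda>r. \<beta> (r / h))" for k
      using Ck_on_compose_real[OF open_UNIV \<beta>(1), of k "\<lambda>r. (1 / h) * r"] by simp
    show "\<beta> (r / h) = 0" if "r < h \<or> 2 * h < r" for r
      using that h by (intro \<beta>(2)) (auto simp: field_simps)
  qed (use h R in auto)
  \<comment> \<open>The differential of a radial function sees the component along
    \<open>sgn x\<close> only, so \<open>polar_form_ge\<close> provides the constant
    \<open>(d / h)^2\<close>.\<close>
  have gn: "grad_norm_sq \<A> f (polar_map \<Phi> x) \<le> (L / h)\<^sup>2 * indicator (ball 0 (3 * h)) x" if x: "0 < norm x" "norm x < R" for x
  proof -
    obtain d where d: "(\<beta> has_real_derivative d) (at (norm x / h))" "\<bar>d\<bar> \<le> L" using \<beta>(4) by blast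
    obtain D where D: "((\<lambda>y. f (polar_map \<Phi> y)) has_derivative D) (at x)"
      "\<And>k. 0 \<le> k \<Longrightarrow> (\<And>v. (D v)\<^sup>2 \<le> k * polar_form (\<theta> (norm x) / norm x) x v v) \<Longrightarrow> grad_norm_sq \<A> f (polar_map \<Phi> x) \<le> k"
      using polar_derivative[OF sf x] by blast
    have x0: "x \<noteq> 0" using x by auto
    have n: "((\<lambda>y. norm y / h) has_derivative (\<lambda>v. (v \<bullet> sgn x) / h)) (at x)"
      using bounded_linear.has_derivative[OF bounded_linear_divide[of h] has_derivative_norm[OF x0]] by (simp add: inner_commute)
    have "((\<lambda>y. \<beta> (norm y / h)) has_derivative (\<lambda>v. d * ((v \<bullet> sgn x) / h))) (at x)"
      using has_derivative_compose[OF n d(1)[unfolded has_field_derivative_def]] by simp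
    then have "((\<lambda>y. f (polar_map \<Phi> y)) has_derivative (\<lambda>v. d * ((v \<bullet> sgn x) / h))) (at x)"
      by (rule has_derivative_transform_within_open[OF _ open_punctured]) (use x fx in auto)
    then have Dv: "D v = d * ((v \<bullet> sgn x) / h)" for v using has_derivative_unique[OF D(1)] by metis
    have le: "grad_norm_sq \<A> f (polar_map \<Phi> x) \<le> (d / h)\<^sup>2"
    proof (rule D(2))
      fix v
      have "(D v)\<^sup>2 = (d / h)\<^sup>2 * (sgn x \<bullet> v)\<^sup>2" by (simp add: Dv power_mult_distrib power_divide inner_commute)
      also have "\<dots> \<le> (d / h)\<^sup>2 * polar_form (\<theta> (norm x) / norm x) x v v"
        by (intro mult_left_mono polar_form_ge) simp
      finally show "(D v)\<^sup>2 \<le> (d / h)\<^sup>2 * polar_form (\<theta> (norm x) / norm x) x v v" .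
    qed simp
    show ?thesis
    proof (cases "norm x < 3 * h")
      case True
      have "(d / h)\<^sup>2 \<le> (L / h)\<^sup>2"
        using d(2) h(1) L by (simp add: power_divide divide_right_mono abs_le_square_iff[symmetric])
      then show ?thesis using le True by simp
    next
      case False
      \<comment> \<open>The argument is at least 3, so \<open>\<beta>\<close> vanishes in a whole
        neighbourhood; the radius \<open>3 h\<close> instead of \<open>2 h\<close> serves this
        purpose.\<close>
      have "(\<beta> has_real_derivative 0) (at (norm x / h))"
        by (rule has_field_derivative_transform_within_open[of "\<lambda>_. 0" _ _ "{2<..}"])
          (use False h \<beta>(2) in \<open>auto simp: field_simps\<close>)
      then have "d = 0" using DERIV_unique d(1) by blast
      then show ?thesis using le False by simp
    qed
  qed
  let ?I = "\<integral>p. (f p)\<^sup>2 * \<sigma> p \<partial>\<mu>"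
  have fm[measurable]: "f \<in> borel_measurable \<mu>" "grad_norm_sq \<A> f \<in> borel_measurable \<mu>"
    using W.smooth_measurable[OF sf] W.gns_measurable[OF sf] by auto
  have en: "W.energy f \<le> (L / h)\<^sup>2 * T ^ ?N * (?vb * (3 * h) ^ ?n)" unfolding W.energy_def
  proof (rule ennreal_integral_le)
    show "integrable \<mu> (\<lambda>p. grad_norm_sq \<A> f p * \<sigma> p)" by (intro W.integrable_\<sigma> W.gns_integrable sf)
    show "0 \<le> grad_norm_sq \<A> f p * \<sigma> p" if "p \<in> space \<mu>" for p
      using grad_norm_sq_nonneg[OF atlas sf] W.\<sigma> that by (simp add: space_\<mu> less_imp_le)
    show "(\<integral>\<^sup>+p. ennreal (grad_norm_sq \<A> f p * \<sigma> p) \<partial>\<mu>) \<le> ennreal ((L / h)\<^sup>2 * T ^ ?N * (?vb * (3 * h) ^ ?n))"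
    proof (rule nn_integral_upper)
      fix x :: "real^'n" assume x: "0 < norm x" "norm x < R"
      have "grad_norm_sq \<A> f (polar_map \<Phi> x) * \<sigma> (polar_map \<Phi> x) \<le> ((L / h)\<^sup>2 * indicator (ball 0 (3 * h)) x) * 1"
        using gn[OF x] \<sigma>(1)[OF x] \<sigma>(2)[OF x] by (intro mult_mono) auto
      then have "ennreal (grad_norm_sq \<A> f (polar_map \<Phi> x) * \<sigma> (polar_map \<Phi> x)) \<le> ennreal ((L / h)\<^sup>2 * indicator (ball 0 (3 * h)) x)"
        by (intro ennreal_leI) simp
      then show "ennreal (grad_norm_sq \<A> f (polar_map \<Phi> x) * \<sigma> (polar_map \<Phi> x)) \<le> ennreal ((L / h)\<^sup>2) * indicator (ball 0 (3 * h)) x"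
        by (simp add: ennreal_mult ennreal_indicator)
    qed (use h in auto)
    show "0 \<le> (L / h)\<^sup>2 * T ^ ?N * (?vb * (3 * h) ^ ?n)" using T h vb by simp
  qed
  have I: "m * t0 ^ ?N * (?vb * (h / 4) ^ ?n) \<le> ?I"
  proof (rule ennreal_integral_ge)
    show "integrable \<mu> (\<lambda>p. (f p)\<^sup>2 * \<sigma> p)" by (intro W.integrable_\<sigma> W.smooth_sq_integrable sf)
    show "0 \<le> (f p)\<^sup>2 * \<sigma> p" if "p \<in> space \<mu>" for p using W.\<sigma> that by (simp add: space_\<mu> less_imp_le)
    show "ennreal (m * t0 ^ ?N * (?vb * (h / 4) ^ ?n)) \<le> (\<integral>\<^sup>+p. ennreal ((f p)\<^sup>2 * \<sigma> p) \<partial>\<mu>)"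
    proof (rule nn_integral_lower[OF _ h])
      fix x :: "real^'n" assume x: "5 / 4 * h \<le> norm x" "norm x \<le> 7 / 4 * h"
      have xR: "0 < norm x" "norm x < R" "norm x \<le> 2 * h" using x h R by linarith+
      have "1 \<le> \<beta> (norm x / h)" using x h by (intro \<beta>(3)) (auto simp: field_simps)
      then have "1\<^sup>2 \<le> (\<beta> (norm x / h))\<^sup>2" by (intro power_mono) auto
      then have "1 * m \<le> (f (polar_map \<Phi> x))\<^sup>2 * \<sigma> (polar_map \<Phi> x)"
        unfolding fx[OF xR(1,2)] \<sigma>(1)[OF xR(1,2)] using m(2)[OF xR(1,3)] m(1) by (intro mult_mono) auto
      then show "ennreal m \<le> ennreal ((f (polar_map \<Phi> x))\<^sup>2 * \<sigma> (polar_map \<Phi> x))" by (intro ennreal_leI) simp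
    qed (use m in auto)
  qed
  \<comment> \<open>The number 12 is the ratio of the radii \<open>3 h\<close> and
    \<open>h / 4\<close>.\<close>
  have eq: "(L / h)\<^sup>2 * T ^ ?N * (?vb * (3 * h) ^ ?n) = (L\<^sup>2 * T ^ ?N * 12 ^ ?n / (m * t0 ^ ?N)) / h\<^sup>2 * (m * t0 ^ ?N * (?vb * (h / 4) ^ ?n))"
  proof -
    have e: "(3 * h) ^ ?n = 12 ^ ?n * (h / 4) ^ ?n" by (simp only: power_mult_distrib[symmetric]) simp
    have alg: "(L / h)\<^sup>2 * a * (v * (b * q)) = (L\<^sup>2 * a * b / (m * c)) / h\<^sup>2 * (m * c * (v * q))"
      if "c \<noteq> 0" for a b c v q :: real
      using m(1) h(1) that by (simp add: power_divide)
    have "t0 ^ ?N \<noteq> 0" using t0(1) by simp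
    then show ?thesis unfolding e by (rule alg)
  qed
  have le: "(L\<^sup>2 * T ^ ?N * 12 ^ ?n / (m * t0 ^ ?N)) / h\<^sup>2 * (m * t0 ^ ?N * (?vb * (h / 4) ^ ?n)) \<le> (L\<^sup>2 * T ^ ?N * 12 ^ ?n / (m * t0 ^ ?N)) / h\<^sup>2 * ?I"
    using m t0 T by (intro mult_left_mono I) simp
  have pos: "0 < m * t0 ^ ?N * (?vb * (h / 4) ^ ?n)" using m t0 vb h by simp
  show ?thesis using sf less_le_trans[OF pos I] order_trans[OF en[unfolded eq] le] by (intro conjI)
qed

text \<open>The scales \<open>h\<close> and \<open>2 h\<close> give bumps on the adjacent shells
  \<open>[h, 2 h]\<close> and \<open>[2 h, 4 h]\<close>, whose product vanishes; this explains the
  range \<open>4 h\<close> in the hypotheses.\<close>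

lemma admissible_eigenvalue:
  assumes adm: "admissible s \<rho> e C sl \<sigma>"
    and h: "0 < h" "4 * h \<le> R / 2" and m: "0 < m" "\<And>r. 0 < r \<Longrightarrow> r \<le> 4 * h \<Longrightarrow> m \<le> s r"
    and \<beta>: "\<And>k. Ck_on k UNIV \<beta>" "\<And>t. t \<le> 1 \<or> 2 \<le> t \<Longrightarrow> \<beta> t = 0" "\<And>t. 5 / 4 \<le> t \<Longrightarrow> t \<le> 7 / 4 \<Longrightarrow> 1 \<le> \<beta> t"
      "\<And>t. \<exists>d. (\<beta> has_real_derivative d) (at t) \<and> \<bar>d\<bar> \<le> L" and L: "0 < L"
  shows "inverse ((2 + C) * (T ^ (CARD('n) - 1) / (sl * t0 ^ (CARD('n) - 1)) * (4 * \<rho>\<^sup>2 * (1 + T\<^sup>2) * 2 ^ CARD('n))) + 1 / e)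
      \<le> eigenvalue \<A> \<mu> \<sigma> 2 \<and>
    eigenvalue \<A> \<mu> \<sigma> 2 \<le> 2 * ((L\<^sup>2 * T ^ (CARD('n) - 1) * 12 ^ CARD('n) / (m * t0 ^ (CARD('n) - 1))) / h\<^sup>2)"
    (is "inverse ?K \<le> _ \<and> _ \<le> 2 * (?\<Lambda> / h\<^sup>2)")
proof -
  interpret W: weighted_manifold M \<A> \<mu> \<sigma> by (rule admissible_manifold[OF adm])
  define f where "f h = (\<lambda>p. if p \<in> M - F then \<beta> (norm (inv_polar p) / h) else 0)" for h
  have K: "0 < ?K"
    using admissibleD(3,4,7)[OF adm] T(1) t0(1) by (intro add_nonneg_pos mult_nonneg_nonneg divide_nonneg_nonneg) auto
  have PI: "\<exists>c. inverse ?K * (\<integral>p. (u p - c)\<^sup>2 * \<sigma> p \<partial>\<mu>) \<le> W.energy u" if u: "smooth_fun \<A> u" for u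
  proof -
    obtain c where c: "(\<integral>\<^sup>+p. ennreal ((u p - c)\<^sup>2 * \<sigma> p) \<partial>\<mu>) \<le> ennreal ?K * (\<integral>\<^sup>+p. ennreal (grad_norm_sq \<A> u p * \<sigma> p) \<partial>\<mu>)"
      using admissible_poincare[OF adm u] by blast
    have g0: "\<And>p. p \<in> space \<mu> \<Longrightarrow> 0 \<le> grad_norm_sq \<A> u p * \<sigma> p"
      using grad_norm_sq_nonneg[OF atlas u] W.\<sigma> by (simp add: space_\<mu> less_imp_le)
    have gi: "integrable \<mu> (\<lambda>p. grad_norm_sq \<A> u p * \<sigma> p)" by (intro W.integrable_\<sigma> W.gns_integrable u)
    have "(\<integral>\<^sup>+p. ennreal (grad_norm_sq \<A> u p * \<sigma> p) \<partial>\<mu>) = ennreal (W.energy u)"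
      unfolding W.energy_def using g0 gi by (intro nn_integral_eq_integral AE_I2)
    then have c': "(\<integral>\<^sup>+p. ennreal ((u p - c)\<^sup>2 * \<sigma> p) \<partial>\<mu>) \<le> ennreal (?K * W.energy u)"
      using c K W.energy_nonneg[OF u] by (simp add: ennreal_mult del: ennreal_plus)
    have um: "u \<in> borel_measurable \<mu>" by (rule W.smooth_measurable[OF u])
    have "integrable \<mu> (\<lambda>p. (u p + (- c))\<^sup>2)"
      using W.bounded_integrable[of "\<lambda>p. (- c)\<^sup>2" "c\<^sup>2"]
      by (intro W.sq_integrable_add[OF um _ W.smooth_sq_integrable[OF u]]) auto
    then have "(\<integral>p. (u p - c)\<^sup>2 * \<sigma> p \<partial>\<mu>) \<le> ?K * W.energy u"
      using K W.energy_nonneg[OF u] W.\<sigma>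
      by (intro ennreal_integral_le W.integrable_\<sigma> c') (auto simp: space_\<mu> less_imp_le)
    then have "inverse ?K * (\<integral>p. (u p - c)\<^sup>2 * \<sigma> p \<partial>\<mu>) \<le> inverse ?K * (?K * W.energy u)"
      using K by (intro mult_left_mono) auto
    also have "\<dots> = W.energy u" using K by simp
    finally show ?thesis by blast
  qed
  have f1: "smooth_fun \<A> (f h) \<and> 0 < (\<integral>p. (f h p)\<^sup>2 * \<sigma> p \<partial>\<mu>) \<and> W.energy (f h) \<le> ?\<Lambda> / h\<^sup>2 * (\<integral>p. (f h p)\<^sup>2 * \<sigma> p \<partial>\<mu>)"
    unfolding f_def by (rule bump_test_function[OF adm \<beta> L]) (use h m in auto)
  have f2: "smooth_fun \<A> (f (2 * h)) \<and> 0 < (\<integral>p. (f (2 * h) p)\<^sup>2 * \<sigma> p \<partial>\<mu>) \<and> W.energy (f (2 * h)) \<le> ?\<Lambda> / (2 * h)\<^sup>2 * (\<integral>p. (f (2 * h) p)\<^sup>2 * \<sigma> p \<partial>\<mu>)"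
    unfolding f_def by (rule bump_test_function[OF adm \<beta> L]) (use h m in auto)
  have "?\<Lambda> / (2 * h)\<^sup>2 * (\<integral>p. (f (2 * h) p)\<^sup>2 * \<sigma> p \<partial>\<mu>) \<le> ?\<Lambda> / h\<^sup>2 * (\<integral>p. (f (2 * h) p)\<^sup>2 * \<sigma> p \<partial>\<mu>)"
    using f2 T t0 m h by (intro mult_right_mono divide_left_mono power_mono) auto
  then have f2': "W.energy (f (2 * h)) \<le> ?\<Lambda> / h\<^sup>2 * (\<integral>p. (f (2 * h) p)\<^sup>2 * \<sigma> p \<partial>\<mu>)" using f2 by linarith
  have prod: "f h p * f (2 * h) p = 0" for p
  proof -
    have "norm (inv_polar p) / h \<ge> 2 \<or> norm (inv_polar p) / (2 * h) \<le> 1" using h by (auto simp: field_simps)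
    then have "\<beta> (norm (inv_polar p) / h) = 0 \<or> \<beta> (norm (inv_polar p) / (2 * h)) = 0" using \<beta>(2) by blast
    then show ?thesis by (auto simp: f_def)
  qed
  have K': "0 < inverse ?K" using K by simp
  show ?thesis
    using f1 f2 by (intro W.eigenvalue_bounds[OF K' PI _ _ _ _ _ f2' prod]) blast+
qed

section \<open>Norms of admissible densities\<close>

lemma admissible_L1:
  assumes adm: "admissible s \<rho> e C sl \<sigma>"
    and h: "0 < h" "2 * h \<le> R / 2" and m: "0 < m" "\<And>r. 0 < r \<Longrightarrow> r \<le> 2 * h \<Longrightarrow> m \<le> s r"
  shows "m * t0 ^ (CARD('n) - 1) * (unit_ball_vol (real CARD('n)) * (h / 4) ^ CARD('n)) \<le> Lp_norm 1 \<mu> \<sigma> \<and>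
    Lp_norm 1 \<mu> \<sigma> \<le> (2 + C) * (T ^ (CARD('n) - 1) * (unit_ball_vol (real CARD('n)) * \<rho> ^ CARD('n)))"
proof -
  interpret W: weighted_manifold M \<A> \<mu> \<sigma> by (rule admissible_manifold[OF adm])
  have \<sigma>: "\<And>x. 0 < norm x \<Longrightarrow> norm x < R \<Longrightarrow> \<sigma> (polar_map \<Phi> x) = s (norm x)"
    by (rule admissibleD(10)[OF adm])
  have \<rho>C: "0 < \<rho>" "0 \<le> C" using admissibleD(1,4)[OF adm] by auto
  have \<sigma>0: "\<And>p. p \<in> space \<mu> \<Longrightarrow> 0 \<le> \<sigma> p" using W.\<sigma> by (auto simp: space_\<mu> less_imp_le)
  have int: "integrable \<mu> \<sigma>" using W.\<sigma> by (intro W.bounded_integrable[of _ 1]) (auto simp: abs_of_pos)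
  have vb: "0 < unit_ball_vol (real CARD('n))" by (rule unit_ball_vol_pos) simp
  have "Lp_norm 1 \<mu> \<sigma> = (\<integral>p. \<sigma> p \<partial>\<mu>)"
  proof -
    have "(\<integral>p. \<bar>\<sigma> p\<bar> powr 1 \<partial>\<mu>) = (\<integral>p. \<sigma> p \<partial>\<mu>)"
      by (rule Bochner_Integration.integral_cong) (use \<sigma>0 in auto)
    moreover have "0 \<le> (\<integral>p. \<sigma> p \<partial>\<mu>)" using \<sigma>0 by (intro integral_nonneg_AE AE_I2)
    ultimately show ?thesis by (simp add: Lp_norm_def)
  qed
  moreover have "m * t0 ^ (CARD('n) - 1) * (unit_ball_vol (real CARD('n)) * (h / 4) ^ CARD('n)) \<le> (\<integral>p. \<sigma> p \<partial>\<mu>)"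
  proof (rule ennreal_integral_ge[OF int \<sigma>0])
    show "ennreal (m * t0 ^ (CARD('n) - 1) * (unit_ball_vol (real CARD('n)) * (h / 4) ^ CARD('n))) \<le> (\<integral>\<^sup>+p. ennreal (\<sigma> p) \<partial>\<mu>)"
    proof (rule nn_integral_lower[OF _ h])
      fix x :: "real^'n" assume x: "5 / 4 * h \<le> norm x" "norm x \<le> 7 / 4 * h"
      have xR: "0 < norm x" "norm x < R" "norm x \<le> 2 * h" using x h R by linarith+
      show "ennreal m \<le> ennreal (\<sigma> (polar_map \<Phi> x))"
        unfolding \<sigma>[OF xR(1,2)] by (rule ennreal_leI[OF m(2)[OF xR(1,3)]])
    qed (use m in auto)
  qed
  moreover have "(\<integral>p. \<sigma> p \<partial>\<mu>) \<le> (2 + C) * (T ^ (CARD('n) - 1) * (unit_ball_vol (real CARD('n)) * \<rho> ^ CARD('n)))"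
    using T(1) \<rho>C vb by (intro ennreal_integral_le[OF int \<sigma>0 admissible_mass_le[OF adm]]) auto
  ultimately show ?thesis by simp
qed

text \<open>A shell around the radius \<open>3 h / 2\<close> has positive measure and
  \<open>\<sigma> \<ge> m\<close> there, so the essential supremum cannot be smaller than
  \<open>m\<close>.\<close>

lemma admissible_Linf:
  assumes adm: "admissible s \<rho> e C sl \<sigma>"
    and h: "0 < h" "2 * h \<le> R / 2" and m: "0 < m" "\<And>r. 0 < r \<Longrightarrow> r \<le> 2 * h \<Longrightarrow> m \<le> s r"
  shows "m \<le> Linf_norm \<mu> \<sigma> \<and> Linf_norm \<mu> \<sigma> \<le> 1"
proof -
  interpret W: weighted_manifold M \<A> \<mu> \<sigma> by (rule admissible_manifold[OF adm])
  have \<sigma>: "\<And>x. 0 < norm x \<Longrightarrow> norm x < R \<Longrightarrow> \<sigma> (polar_map \<Phi> x) = s (norm x)"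
    by (rule admissibleD(10)[OF adm])
  let ?S = "esssup \<mu> (\<lambda>p. ereal \<bar>\<sigma> p\<bar>)"
  have vb: "0 < unit_ball_vol (real CARD('n))" by (rule unit_ball_vol_pos) simp
  have up: "?S \<le> 1"
    by (rule esssup_I) (use W.\<sigma> in \<open>auto simp: space_\<mu> abs_of_pos\<close>)
  have lo: "ereal m \<le> ?S"
  proof (rule ccontr)
    assume "\<not> ereal m \<le> ?S"
    then have lt: "?S < ereal m" by simp
    have "AE p in \<mu>. ereal \<bar>\<sigma> p\<bar> \<le> ?S" by (rule esssup_AE)
    then have "AE p in \<mu>. \<sigma> p < m"
    proof eventually_elim
      case (elim p)
      then have "ereal \<bar>\<sigma> p\<bar> < ereal m" using lt by (rule le_less_trans)
      then show ?case by simp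
    qed
    then have "(\<integral>\<^sup>+p. indicator {p. m \<le> \<sigma> p} p \<partial>\<mu>) = (\<integral>\<^sup>+p. 0 \<partial>\<mu>)"
      by (intro nn_integral_cong_AE) (elim eventually_mono, auto)
    moreover have "ennreal (1 * t0 ^ (CARD('n) - 1) * (unit_ball_vol (real CARD('n)) * (h / 4) ^ CARD('n))) \<le> (\<integral>\<^sup>+p. indicator {p. m \<le> \<sigma> p} p \<partial>\<mu>)"
    proof (rule nn_integral_lower[OF _ h])
      have "(\<lambda>p. indicator {m..} (\<sigma> p)) \<in> borel_measurable \<mu>" by measurable
      then show "indicator {p. m \<le> \<sigma> p} \<in> borel_measurable \<mu>" by (simp add: indicator_def[abs_def])
      fix x :: "real^'n" assume x: "5 / 4 * h \<le> norm x" "norm x \<le> 7 / 4 * h"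
      have xR: "0 < norm x" "norm x < R" "norm x \<le> 2 * h" using x h R by linarith+
      show "ennreal 1 \<le> indicator {p. m \<le> \<sigma> p} (polar_map \<Phi> x)"
        using \<sigma>[OF xR(1,2)] m(2)[OF xR(1,3)] by simp
    qed auto
    moreover have "0 < t0 ^ (CARD('n) - 1) * (unit_ball_vol (real CARD('n)) * (h / 4) ^ CARD('n))" using t0 vb h by simp
    ultimately show False using t0(1) vb h(1) by auto
  qed
  show ?thesis using up lo unfolding Linf_norm_def
    by (cases ?S) (auto simp: one_ereal_def)
qed

text \<open>Since \<open>0 < \<sigma> \<le> 1\<close>, one has
  \<open>\<sigma> powr q \<le> \<sigma>\<close>, and the bound for the mass also serves for the
  higher power.\<close>

lemma admissible_Lp:
  assumes adm: "admissible s \<rho> e C sl \<sigma>" and q: "1 \<le> q"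
    and h: "0 < h" "2 * h \<le> R / 2" and m: "0 < m" "\<And>r. 0 < r \<Longrightarrow> r \<le> 2 * h \<Longrightarrow> m \<le> s r"
  shows "(m powr q * t0 ^ (CARD('n) - 1) * (unit_ball_vol (real CARD('n)) * (h / 4) ^ CARD('n))) powr (1 / q) \<le> Lp_norm q \<mu> \<sigma> \<and>
    Lp_norm q \<mu> \<sigma> \<le> ((2 + C) * (T ^ (CARD('n) - 1) * (unit_ball_vol (real CARD('n)) * \<rho> ^ CARD('n)))) powr (1 / q)"
proof -
  interpret W: weighted_manifold M \<A> \<mu> \<sigma> by (rule admissible_manifold[OF adm])
  have \<sigma>: "\<And>x. 0 < norm x \<Longrightarrow> norm x < R \<Longrightarrow> \<sigma> (polar_map \<Phi> x) = s (norm x)"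
    by (rule admissibleD(10)[OF adm])
  have \<rho>C: "0 < \<rho>" "0 \<le> C" using admissibleD(1,4)[OF adm] by auto
  have vb: "0 < unit_ball_vol (real CARD('n))" by (rule unit_ball_vol_pos) simp
  have pw: "\<bar>\<sigma> p\<bar> powr q \<le> \<sigma> p" if "p \<in> M" for p
    using powr_mono'[OF q, of "\<sigma> p"] W.\<sigma>[OF that] by simp
  have int: "integrable \<mu> (\<lambda>p. \<bar>\<sigma> p\<bar> powr q)"
    using pw W.\<sigma> by (intro W.bounded_integrable[of _ 1]) (force intro: order_trans)+
  let ?I = "\<integral>p. \<bar>\<sigma> p\<bar> powr q \<partial>\<mu>"
  have "m powr q * t0 ^ (CARD('n) - 1) * (unit_ball_vol (real CARD('n)) * (h / 4) ^ CARD('n)) \<le> ?I"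
  proof (rule ennreal_integral_ge[OF int])
    show "ennreal (m powr q * t0 ^ (CARD('n) - 1) * (unit_ball_vol (real CARD('n)) * (h / 4) ^ CARD('n))) \<le> (\<integral>\<^sup>+p. ennreal (\<bar>\<sigma> p\<bar> powr q) \<partial>\<mu>)"
    proof (rule nn_integral_lower[OF _ h])
      fix x :: "real^'n" assume x: "5 / 4 * h \<le> norm x" "norm x \<le> 7 / 4 * h"
      have xR: "0 < norm x" "norm x < R" "norm x \<le> 2 * h" using x h R by linarith+
      show "ennreal (m powr q) \<le> ennreal (\<bar>\<sigma> (polar_map \<Phi> x)\<bar> powr q)"
        unfolding \<sigma>[OF xR(1,2)] using m(2)[OF xR(1,3)] m(1) q by (intro ennreal_leI powr_mono2) auto
    qed auto
  qed simp
  moreover have "?I \<le> (2 + C) * (T ^ (CARD('n) - 1) * (unit_ball_vol (real CARD('n)) * \<rho> ^ CARD('n)))"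
  proof (rule ennreal_integral_le[OF int])
    have "(\<integral>\<^sup>+p. ennreal (\<bar>\<sigma> p\<bar> powr q) \<partial>\<mu>) \<le> (\<integral>\<^sup>+p. ennreal (\<sigma> p) \<partial>\<mu>)"
      using pw by (intro nn_integral_mono ennreal_leI) (simp add: space_\<mu>)
    also note admissible_mass_le[OF adm]
    finally show "(\<integral>\<^sup>+p. ennreal (\<bar>\<sigma> p\<bar> powr q) \<partial>\<mu>) \<le> ennreal ((2 + C) * (T ^ (CARD('n) - 1) * (unit_ball_vol (real CARD('n)) * \<rho> ^ CARD('n))))" .
  qed (use T(1) \<rho>C vb in auto)
  moreover have "0 \<le> m powr q * t0 ^ (CARD('n) - 1) * (unit_ball_vol (real CARD('n)) * (h / 4) ^ CARD('n))" using t0 vb h by simp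
  ultimately show ?thesis unfolding Lp_norm_def using q by (auto intro!: powr_mono2)
qed

end

section \<open>Gaussian densities\<close>

lemma derivative_continuous_on_interval:
  fixes \<theta> \<theta>' :: "real \<Rightarrow> real"
  assumes R: "0 < R" and sm: "smooth_on {0..R} \<theta>"
    and d: "\<And>r. r \<in> {0..R} \<Longrightarrow> (\<theta> has_real_derivative \<theta>' r) (at r within {0..R})"
  shows "continuous_on {0..R} \<theta>'"
  unfolding continuous_on_eq_continuous_within
proof
  fix x assume x: "x \<in> {0..R}"
  obtain W E where W: "open W" "x \<in> W"
    "\<And>y. y \<in> {0..R} \<inter> W \<Longrightarrow> (\<theta> has_derivative E y) (at y within {0..R})"
    "\<And>v. continuous_on W (\<lambda>y. E y v)"
    using smooth_on_C1[OF sm x] by metis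
  have eq: "\<theta>' y = E y 1" if y: "y \<in> {0..R} \<inter> W" for y
  proof -
    have "(*) (\<theta>' y) = E y"
    proof (rule frechet_derivative_unique_within)
      show "(\<theta> has_derivative (*) (\<theta>' y)) (at y within {0..R})"
        using d[of y] y by (simp add: has_field_derivative_def)
      show "(\<theta> has_derivative E y) (at y within {0..R})" by (rule W(3)[OF y])
      fix i e :: real assume i: "i \<in> Basis" and e: "0 < e"
      \<comment> \<open>A step that stays in the interval: to the right if \<open>y < R\<close>, to
        the left at \<open>y = R\<close>. Steps in one sense determine the derivative.\<close>
      define k where "k = (if y < R then min e (R - y) / 2 else - (min e R / 2))"
      have "0 < \<bar>k\<bar> \<and> \<bar>k\<bar> < e \<and> y + k *\<^sub>R i \<in> {0..R}"
      proof (cases "y < R")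
        case True
        then have "0 < k" "k < e" "k \<le> R - y" using e by (auto simp: k_def min_def field_simps)
        then show ?thesis using y i by simp
      next
        case False
        then have "k < 0" "- k < e" "- k \<le> R" using e R by (auto simp: k_def min_def)
        then show ?thesis using False y i by simp
      qed
      then show "\<exists>k. 0 < \<bar>k\<bar> \<and> \<bar>k\<bar> < e \<and> y + k *\<^sub>R i \<in> {0..R}" by blast
    qed
    then have "E y 1 = \<theta>' y * 1" by (rule fun_cong[OF sym])
    then show ?thesis by simp
  qed
  have "continuous (at x) (\<lambda>y. E y 1)" using W by (simp add: continuous_on_eq_continuous_at)
  then have c1: "continuous (at x within {0..R}) (\<lambda>y. E y 1)" by (rule continuous_at_imp_continuous_at_within)
  obtain e where e: "0 < e" "ball x e \<subseteq> W" using W by (meson open_contains_ball)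
  show "continuous (at x within {0..R}) \<theta>'"
    by (rule continuous_transform_within[OF c1 e(1) x])
      (use e eq in \<open>auto simp: dist_commute subset_iff\<close>)
qed

lemma profile_mvt:
  fixes \<theta> \<theta>' :: "real \<Rightarrow> real"
  assumes d: "\<And>r. r \<in> {0..R} \<Longrightarrow> (\<theta> has_real_derivative \<theta>' r) (at r within {0..R})"
    and ab: "0 \<le> a" "a < b" "b \<le> R"
  obtains z where "a < z" "z < b" "\<theta> b - \<theta> a = \<theta>' z * (b - a)"
proof -
  have "(\<theta> has_derivative (*) (\<theta>' x)) (at x within {a..b})" if "a \<le> x" "x \<le> b" for x
    by (rule has_derivative_subset[OF d[unfolded has_field_derivative_def]]) (use that ab in auto)
  from mvt_simple[OF ab(2), of \<theta> "\<lambda>x. (*) (\<theta>' x)", OF this] show ?thesis using that by auto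
qed

lemma profile_bounds:
  fixes \<theta> \<theta>' :: "real \<Rightarrow> real"
  assumes R: "0 < R" and d: "\<And>r. r \<in> {0..R} \<Longrightarrow> (\<theta> has_real_derivative \<theta>' r) (at r within {0..R})"
    and c: "continuous_on {0..R} \<theta>'" and at0: "\<theta> 0 = 0" "\<theta>' 0 = 1"
    and pos: "\<And>r. 0 < r \<Longrightarrow> r < R \<Longrightarrow> 0 < \<theta> r"
  obtains T t0 where "0 < T" "0 < t0" "\<And>r. 0 < r \<Longrightarrow> r < R \<Longrightarrow> \<theta> r \<le> T * r"
    "\<And>r. r \<in> {0..R} \<Longrightarrow> \<bar>\<theta>' r\<bar> \<le> T" "\<And>r. 0 < r \<Longrightarrow> r \<le> R / 2 \<Longrightarrow> t0 * r \<le> \<theta> r"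
proof -
  have "bounded (\<theta>' ` {0..R})" by (intro compact_imp_bounded compact_continuous_image c) simp
  then obtain B where B: "\<And>r. r \<in> {0..R} \<Longrightarrow> \<bar>\<theta>' r\<bar> \<le> B" by (fastforce simp: bounded_iff)
  define T where "T = \<bar>B\<bar> + 1"
  have T: "0 < T" "\<bar>\<theta>' r\<bar> \<le> T" if "r \<in> {0..R}" for r using B[OF that] by (auto simp: T_def)
  have T0: "0 < T" by (simp add: T_def)
  have up: "\<theta> r \<le> T * r" if r: "0 < r" "r < R" for r
  proof -
    obtain z where z: "0 < z" "z < r" "\<theta> r - \<theta> 0 = \<theta>' z * (r - 0)"
      by (rule profile_mvt[OF d, of 0 r]) (use r in auto)
    have "\<theta>' z * r \<le> T * r" using T(2)[of z] z r by (intro mult_right_mono) auto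
    then show ?thesis using z at0 by simp
  qed
  obtain \<delta> where \<delta>: "0 < \<delta>" "\<And>r. r \<in> {0..R} \<Longrightarrow> r < \<delta> \<Longrightarrow> 1 / 2 \<le> \<theta>' r"
  proof -
    have "0 \<in> {0..R}" using R by simp
    from c[unfolded continuous_on_iff, rule_format, OF this, of "1 / 2"] obtain \<delta> where
      "0 < \<delta>" and \<delta>': "\<And>r. r \<in> {0..R} \<Longrightarrow> dist r 0 < \<delta> \<Longrightarrow> dist (\<theta>' r) (\<theta>' 0) < 1 / 2" by auto
    show ?thesis
    proof (rule that[OF \<open>0 < \<delta>\<close>])
      fix r assume "r \<in> {0..R}" "r < \<delta>"
      then have "dist (\<theta>' r) (\<theta>' 0) < 1 / 2" using \<delta>' by simp
      then show "1 / 2 \<le> \<theta>' r" using at0 unfolding dist_real_def by linarith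
    qed
  qed
  define \<delta>' where "\<delta>' = min \<delta> (R / 2) / 2"
  have \<delta>': "0 < \<delta>'" "\<delta>' < \<delta>" "\<delta>' \<le> R / 2" using \<delta> R by (auto simp: \<delta>'_def min_def)
  have near: "(1 / 2) * r \<le> \<theta> r" if r: "0 < r" "r \<le> \<delta>'" for r
  proof -
    obtain z where z: "0 < z" "z < r" "\<theta> r - \<theta> 0 = \<theta>' z * (r - 0)"
      by (rule profile_mvt[OF d, of 0 r]) (use r \<delta>' R in auto)
    have "(1 / 2) * r \<le> \<theta>' z * r" using \<delta>(2)[of z] z r \<delta>' R by (intro mult_right_mono) auto
    then show ?thesis using z at0 by simp
  qed
  have "continuous_on {0..R} \<theta>" by (rule DERIV_continuous_on[OF d])
  then have "continuous_on {\<delta>'..R / 2} \<theta>" by (rule continuous_on_subset) (use \<delta>' R in auto)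
  then obtain r0 where r0: "r0 \<in> {\<delta>'..R / 2}" "\<And>r. r \<in> {\<delta>'..R / 2} \<Longrightarrow> \<theta> r0 \<le> \<theta> r"
    using continuous_attains_inf[of "{\<delta>'..R / 2}" \<theta>] \<delta>' by auto
  \<comment> \<open>Near 0 the derivative is at least \<open>1 / 2\<close>, hence
    \<open>\<theta> r \<ge> r / 2\<close>; on the rest of the range up to \<open>R / 2\<close> the
    minimum of \<open>\<theta>\<close> is positive, and \<open>r \<le> R\<close>.\<close>
  define t0 where "t0 = min (1 / 2) (\<theta> r0 / R)"
  have m: "0 < \<theta> r0" using pos[of r0] r0(1) \<delta>' R by auto
  have t0: "t0 \<le> 1 / 2" "t0 \<le> \<theta> r0 / R" unfolding t0_def by (rule min.cobounded1 min.cobounded2)+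
  have t00: "0 < t0" using m R by (simp add: t0_def)
  have lo: "t0 * r \<le> \<theta> r" if r: "0 < r" "r \<le> R / 2" for r
  proof (cases "r \<le> \<delta>'")
    case True
    have "t0 * r \<le> (1 / 2) * r" using t0(1) r by (intro mult_right_mono) auto
    then show ?thesis using near[OF r(1) True] by linarith
  next
    case False
    have "t0 * r \<le> \<theta> r0 / R * R" using t0(2) r R m by (intro mult_mono) auto
    also have "\<dots> = \<theta> r0" using R by simp
    also have "\<dots> \<le> \<theta> r" using r0(2)[of r] False r by auto
    finally show ?thesis .
  qed
  show ?thesis by (rule that[OF T0 t00 up T(2) lo])
qed

text \<open>Only an upper bound is claimed, as \<open>r \<theta>' / \<theta>\<close> tends to minus
  infinity at a second pole. It comes from the linear bounds up to \<open>R / 2\<close>, from the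
  minimum of \<open>\<theta>\<close> between \<open>R / 2\<close> and \<open>b\<close>, and from the
  sign of \<open>\<theta>'\<close> beyond \<open>b\<close>.\<close>

lemma profile_log_derivative:
  fixes \<theta> \<theta>' :: "real \<Rightarrow> real"
  assumes R: "0 < R" and ct: "continuous_on {0..R} \<theta>" and T: "0 < T" "\<And>r. r \<in> {0..R} \<Longrightarrow> \<bar>\<theta>' r\<bar> \<le> T"
    and t0: "0 < t0" "\<And>r. 0 < r \<Longrightarrow> r \<le> R / 2 \<Longrightarrow> t0 * r \<le> \<theta> r"
    and pos: "\<And>r. 0 < r \<Longrightarrow> r < R \<Longrightarrow> 0 < \<theta> r"
    and b: "R / 2 \<le> b" "b \<le> R" "\<And>r. R / 2 \<le> r \<Longrightarrow> r \<le> b \<Longrightarrow> 0 < \<theta> r" "\<And>r. b < r \<Longrightarrow> r < R \<Longrightarrow> \<theta>' r \<le> 0"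
  obtains k where "0 \<le> k" "\<And>r. 0 < r \<Longrightarrow> r < R \<Longrightarrow> r * \<theta>' r \<le> k * \<theta> r"
proof -
  have "continuous_on {R / 2..b} \<theta>" using ct by (rule continuous_on_subset) (use b R in auto)
  then obtain r0 where r0: "r0 \<in> {R / 2..b}" "\<And>r. r \<in> {R / 2..b} \<Longrightarrow> \<theta> r0 \<le> \<theta> r"
    using continuous_attains_inf[of "{R / 2..b}" \<theta>] b by auto
  have m: "0 < \<theta> r0" using b(3) r0(1) by auto
  define k where "k = T / t0 + R * T / \<theta> r0"
  have k: "0 \<le> T / t0" "0 \<le> R * T / \<theta> r0" using T t0 R m by auto
  show ?thesis
  proof (rule that[of k])
    show "0 \<le> k" using k by (simp add: k_def)
    fix r assume r: "0 < r" "r < R"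
    have th: "0 < \<theta> r" by (rule pos[OF r])
    have rT: "r * \<theta>' r \<le> r * T" using T(2)[of r] r by (intro mult_left_mono) auto
    consider "r \<le> R / 2" | "R / 2 \<le> r" "r \<le> b" | "b < r" by linarith
    then show "r * \<theta>' r \<le> k * \<theta> r"
    proof cases
      case 1
      have "r * T = T / t0 * (t0 * r)" using t0 by simp
      also have "\<dots> \<le> T / t0 * \<theta> r" using k t0(2)[OF r(1) 1] by (intro mult_left_mono) auto
      also have "\<dots> \<le> k * \<theta> r" using k th by (intro mult_right_mono) (auto simp: k_def)
      finally show ?thesis using rT by linarith
    next
      case 2
      have "r * T \<le> R * T" using r T by (intro mult_right_mono) auto
      also have "\<dots> = R * T / \<theta> r0 * \<theta> r0" using m by simp
      also have "\<dots> \<le> R * T / \<theta> r0 * \<theta> r" using k r0(2)[of r] 2 by (intro mult_left_mono) auto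
      also have "\<dots> \<le> k * \<theta> r" using k th by (intro mult_right_mono) (auto simp: k_def)
      finally show ?thesis using rT by linarith
    next
      case 3
      have "r * \<theta>' r \<le> 0" using b(4)[OF 3 r(2)] r by (simp add: mult_nonneg_nonpos)
      also have "0 \<le> k * \<theta> r" using k th by (simp add: k_def)
      finally show ?thesis .
    qed
  qed
qed

definition eigenvalue_asymptotics ::
    "('p, 'n::finite) rchart set \<Rightarrow> 'p measure \<Rightarrow> (nat \<Rightarrow> 'p \<Rightarrow> real) \<Rightarrow> bool" where
  "eigenvalue_asymptotics \<A> \<mu> \<sigma> \<longleftrightarrow>
     (\<exists>A B. 0 < A \<and> 0 < B \<and> (\<forall>\<^sub>F j in sequentially.
            A * (crit_norm CARD('n) \<mu> (\<sigma> j) / Lp_norm 1 \<mu> (\<sigma> j)) \<le> eigenvalue \<A> \<mu> (\<sigma> j) 2 \<and>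
            eigenvalue \<A> \<mu> (\<sigma> j) 2 \<le> B * (crit_norm CARD('n) \<mu> (\<sigma> j) / Lp_norm 1 \<mu> (\<sigma> j))))
       \<and> filterlim (\<lambda>j. eigenvalue \<A> \<mu> (\<sigma> j) 2) at_top sequentially
       \<and> (\<exists>C D. 0 < C \<and> 0 < D \<and> (\<forall>\<^sub>F j in sequentially.
            C * real j \<le> eigenvalue \<A> \<mu> (\<sigma> j) 2 \<and> eigenvalue \<A> \<mu> (\<sigma> j) 2 \<le> D * real j))"

text \<open>Scaling of the critical norm: a function of size one on a ball of radius
  \<open>h\<close> has norm of order \<open>h ^ (n - 2)\<close>, because
  \<open>n * ((n - 2) / n) = n - 2\<close>.\<close>

lemma powr_scaled_power:
  assumes "0 \<le> X" "0 < h" "2 < n"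
  shows "(X * h ^ n) powr (1 / (real n / (real n - 2))) = X powr (1 / (real n / (real n - 2))) * h ^ (n - 2)"
proof -
  have n: "real n - 2 = real (n - 2)" using assms(3) by simp
  have "(h ^ n) powr (1 / (real n / (real n - 2))) = h powr (real n * (1 / (real n / (real n - 2))))"
    using assms by (simp add: powr_realpow[symmetric] powr_powr)
  also have "real n * (1 / (real n / (real n - 2))) = real (n - 2)" using assms(3) n by simp
  also have "h powr real (n - 2) = h ^ (n - 2)" by (rule powr_realpow[OF assms(2)])
  finally show ?thesis using assms by (simp add: powr_mult)
qed

context revolution
begin

text \<open>Up to \<open>a\<close> the Gaussian drift \<open>- 2 J r^2\<close> is split: one half
  turns \<open>C\<close> into \<open>- 2\<close> once \<open>J r^2 \<ge> C + 2\<close>, the other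
  half provides \<open>- \<epsilon> J r^2\<close>. Beyond \<open>a\<close> the drift of the density
  is dropped on account of its sign, and \<open>far\<close> takes over.\<close>

lemma gaussian_weight_admissible:
  assumes k: "0 \<le> k" "\<And>r. 0 < r \<Longrightarrow> r < R \<Longrightarrow> r * \<theta>' r \<le> k * \<theta> r"
    and J: "0 < J" and \<epsilon>: "0 < \<epsilon>" "\<epsilon> \<le> 1"
  defines "C \<equiv> real (CARD('n) - 1) * k"
  defines "\<rho> \<equiv> sqrt (C + 2) / sqrt J"
  assumes \<rho>R: "\<rho> \<le> R / 2" and a: "\<rho> \<le> a"
    and h: "continuous_on {0<..<R} h" "\<And>r. r \<le> a \<Longrightarrow> h r = r"
      "\<And>r. a < r \<Longrightarrow> r < R \<Longrightarrow> (h has_real_derivative h' r) (at r) \<and> 0 \<le> h r \<and> 0 \<le> h' r"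
    and far: "\<And>r. a < r \<Longrightarrow> r < R \<Longrightarrow> real (CARD('n) - 1) * (r * \<theta>' r) \<le> - (2 + \<epsilon> * J * r\<^sup>2) * \<theta> r"
    and \<sigma>: "\<sigma> \<in> borel_measurable \<mu>" "\<And>p. p \<in> M \<Longrightarrow> 0 < \<sigma> p \<and> \<sigma> p \<le> 1"
      "\<And>x. 0 < norm x \<Longrightarrow> norm x < R \<Longrightarrow> \<sigma> (polar_map \<Phi> x) = exp (- (J * (h (norm x))\<^sup>2))"
  shows "admissible (\<lambda>r. exp (- (J * (h r)\<^sup>2))) \<rho> (\<epsilon> * J) C (exp (- (C + 2))) \<sigma>"
proof -
  let ?s = "\<lambda>r. exp (- (J * (h r)\<^sup>2))"
  \<comment> \<open>The derivative of \<open>h\<close>, equal to 1 as long as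
    \<open>h r = r\<close>; the point \<open>a\<close> itself goes into the exceptional set.\<close>
  define g where "g r = (if r \<le> a then 1 else h' r)" for r
  define s' where "s' r = - (2 * J * h r * g r) * ?s r" for r
  have C: "0 \<le> C" using k by (simp add: C_def)
  have \<rho>: "0 < \<rho>" using C J by (simp add: \<rho>_def)
  \<comment> \<open>The property for which \<open>\<rho>\<close> is chosen; it also makes
    \<open>exp (- (C + 2))\<close> a lower bound of the density on the ball of radius
    \<open>\<rho>\<close>.\<close>
  have \<rho>2: "J * \<rho>\<^sup>2 = C + 2" using C J by (simp add: \<rho>_def power_divide)
  have der: "(?s has_real_derivative s' r) (at r)" if r: "0 < r" "r < R" "r \<notin> {a}" for r
  proof -
    have "(h has_real_derivative g r) (at r)"
    proof (cases "r < a")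
      case True
      have "((\<lambda>r. r) has_real_derivative 1) (at r)" by simp
      then have "(h has_real_derivative 1) (at r)"
        by (rule has_field_derivative_transform_within_open[of _ _ _ "{..<a}"]) (use True h(2) in auto)
      then show ?thesis using True by (simp add: g_def)
    next
      case False
      then show ?thesis using h(3)[of r] r by (simp add: g_def)
    qed
    then show ?thesis unfolding s'_def by (auto intro!: derivative_eq_intros simp: algebra_simps)
  qed
  have main: "r * (s' r * \<theta> r + real (CARD('n) - 1) * ?s r * \<theta>' r) = (real (CARD('n) - 1) * (r * \<theta>' r) - 2 * J * r * h r * g r * \<theta> r) * ?s r" for r
    by (simp add: s'_def algebra_simps)
  have L: "real (CARD('n) - 1) * (r * \<theta>' r) - 2 * J * r * h r * g r * \<theta> r \<le> (if r < \<rho> then C - \<epsilon> * J * r\<^sup>2 else - 2 - \<epsilon> * J * r\<^sup>2) * \<theta> r"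
    if r: "0 < r" "r < R" for r
  proof (cases "r \<le> a")
    case True
    have "real (CARD('n) - 1) * (r * \<theta>' r) \<le> real (CARD('n) - 1) * (k * \<theta> r)" by (intro mult_left_mono k(2) r) simp
    then have "real (CARD('n) - 1) * (r * \<theta>' r) - 2 * J * r * h r * g r * \<theta> r \<le> (C - 2 * J * r\<^sup>2) * \<theta> r"
      using True h(2)[OF True] by (simp add: C_def g_def power2_eq_square algebra_simps)
    also have "\<dots> \<le> (if r < \<rho> then C - \<epsilon> * J * r\<^sup>2 else - 2 - \<epsilon> * J * r\<^sup>2) * \<theta> r"
    proof (rule mult_right_mono)
      have e: "\<epsilon> * J * r\<^sup>2 \<le> J * r\<^sup>2" using mult_right_mono[OF \<epsilon>(2), of "J * r\<^sup>2"] J by (simp add: mult.assoc)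
      have J2: "0 \<le> J * r\<^sup>2" using J by simp
      show "C - 2 * J * r\<^sup>2 \<le> (if r < \<rho> then C - \<epsilon> * J * r\<^sup>2 else - 2 - \<epsilon> * J * r\<^sup>2)"
      proof (cases "r < \<rho>")
        case True
        then show ?thesis using e J2 by simp
      next
        case False
        then have "J * \<rho>\<^sup>2 \<le> J * r\<^sup>2" using \<rho> J by (intro mult_left_mono power_mono) auto
        then show ?thesis using e J2 False \<rho>2 by simp
      qed
    qed (use \<theta>_pos[OF r] in simp)
    finally show ?thesis .
  next
    case False
    then have ra: "a < r" by simp
    have "0 \<le> 2 * J * r * h r * g r * \<theta> r"
      using h(3)[OF ra r(2)] J r \<theta>_pos[OF r] False by (simp add: g_def)
    then have "real (CARD('n) - 1) * (r * \<theta>' r) - 2 * J * r * h r * g r * \<theta> r \<le> - (2 + \<epsilon> * J * r\<^sup>2) * \<theta> r"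
      using far[OF ra r(2)] by linarith
    moreover have "\<not> r < \<rho>" using ra a by simp
    ultimately show ?thesis by (simp add: algebra_simps)
  qed
  have step: "r * (s' r * \<theta> r + real (CARD('n) - 1) * ?s r * \<theta>' r) \<le> (if r < \<rho> then C - \<epsilon> * J * r\<^sup>2 else - 2 - \<epsilon> * J * r\<^sup>2) * (?s r * \<theta> r)"
    if r: "0 < r" "r < R" for r
    unfolding main using mult_right_mono[OF L[OF r], of "?s r"] by (simp add: mult_ac)
  have sl: "exp (- (C + 2)) \<le> ?s r" if r: "0 < r" "r < \<rho>" for r
  proof -
    have "J * r\<^sup>2 \<le> J * \<rho>\<^sup>2" using r J by (intro mult_left_mono power_mono) auto
    then show ?thesis using h(2)[of r] r a \<rho>2 by simp
  qed
  have "continuous_on {0<..<R} ?s" using h(1) by (intro continuous_intros)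
  moreover have "\<exists>E s'. finite E \<and> (\<forall>r. 0 < r \<longrightarrow> r < R \<longrightarrow> r \<notin> E \<longrightarrow> (?s has_real_derivative s' r) (at r) \<and>
       r * (s' r * \<theta> r + real (CARD('n) - 1) * ?s r * \<theta>' r) \<le> (if r < \<rho> then C - \<epsilon> * J * r\<^sup>2 else - 2 - \<epsilon> * J * r\<^sup>2) * (?s r * \<theta> r))"
    by (rule exI[of _ "{a}"], rule exI[of _ s']) (use der step in blast)
  moreover have "0 < ?s r \<and> ?s r \<le> 1" for r using J by simp
  ultimately show ?thesis
    unfolding admissible_def using \<rho> \<rho>R \<epsilon> J C sl \<sigma> by (intro conjI) auto
qed

text \<open>With \<open>h = 1 / sqrt j\<close>, every quantity is a power of \<open>h\<close> up to
  constants fixed before \<open>j\<close>: the mass is of order \<open>h ^ n\<close>, the critical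
  norm of order \<open>h ^ (n - 2)\<close>, and the eigenvalue of order
  \<open>1 / h^2\<close>.\<close>

lemma asymptotics:
  fixes s :: "nat \<Rightarrow> real \<Rightarrow> real" and \<sigma> :: "nat \<Rightarrow> 'p \<Rightarrow> real"
  assumes pos: "0 \<le> C" "0 < K" "0 < \<epsilon>" "0 < sl" "0 < m" "0 < J"
    and adm: "\<And>j. J \<le> real j \<Longrightarrow> admissible (s j) (K / sqrt (real j)) (\<epsilon> * real j) C sl (\<sigma> j)"
    and near: "\<And>j r. J \<le> real j \<Longrightarrow> 0 < r \<Longrightarrow> r \<le> 4 / sqrt (real j) \<Longrightarrow> m \<le> s j r"
  shows "eigenvalue_asymptotics \<A> \<mu> \<sigma>"
proof -
  let ?n = "CARD('n)" and ?N = "CARD('n) - 1" and ?vb = "unit_ball_vol (real CARD('n))"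
  obtain \<beta> L where \<beta>: "\<And>k. Ck_on k UNIV \<beta>" "\<And>t. t \<le> 1 \<or> 2 \<le> t \<Longrightarrow> \<beta> t = 0"
    "\<And>t. 5 / 4 \<le> t \<Longrightarrow> t \<le> 7 / 4 \<Longrightarrow> 1 \<le> \<beta> t" "0 < (L :: real)"
    "\<And>t. \<exists>d. (\<beta> has_real_derivative d) (at t) \<and> \<bar>d\<bar> \<le> L"
    using smooth_bump_exists by metis
  have vb: "0 < ?vb" by (rule unit_ball_vol_pos) simp
  define Kc where "Kc = (2 + C) * (T ^ ?N / (sl * t0 ^ ?N) * (4 * K\<^sup>2 * (1 + T\<^sup>2) * 2 ^ ?n)) + 1 / \<epsilon>"
  define lo up where "lo = inverse Kc" and "up = 2 * (L\<^sup>2 * T ^ ?N * 12 ^ ?n / (m * t0 ^ ?N))"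
  define c1 c2 where "c1 = m * t0 ^ ?N * ?vb / 4 ^ ?n" and "c2 = (2 + C) * (T ^ ?N * (?vb * K ^ ?n))"
  define q where "q = real ?n / (real ?n - 2)"
  define A1 B1 where "A1 = (if ?n = 2 then m else (m powr q * t0 ^ ?N * ?vb / 4 ^ ?n) powr (1 / q))"
    and "B1 = (if ?n = 2 then 1 else c2 powr (1 / q))"
  have Kc: "0 < Kc"
    unfolding Kc_def using pos T(1) t0(1)
    by (intro add_nonneg_pos mult_nonneg_nonneg divide_nonneg_nonneg) auto
  have cpos: "0 < lo" "0 < up" "0 < c1" "0 < c2" "0 < A1" "0 < B1"
  proof -
    show "0 < lo" "0 < up" "0 < c1" "0 < c2" using Kc pos T(1) t0(1) vb \<beta>(4) by (simp_all add: lo_def up_def c1_def c2_def)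
    then have "c2 \<noteq> 0" by simp
    then show "0 < B1" by (simp add: B1_def)
    have "0 < m powr q * t0 ^ ?N * ?vb / 4 ^ ?n" using pos t0(1) vb by simp
    then have "0 < (m powr q * t0 ^ ?N * ?vb / 4 ^ ?n) powr (1 / q)" by (subst powr_gt_zero) (rule less_imp_neq[THEN not_sym])
    then show "0 < A1" unfolding A1_def using pos(5) by presburger
  qed
  \<comment> \<open>Guarantees \<open>4 h \<le> R / 2\<close>, the room for the two bumps.\<close>
  define J' where "J' = max J ((8 / R)\<^sup>2)"
  have key: "lo * real j \<le> eigenvalue \<A> \<mu> (\<sigma> j) 2 \<and> eigenvalue \<A> \<mu> (\<sigma> j) 2 \<le> up * real j \<and>
     (A1 / c2) * real j \<le> crit_norm ?n \<mu> (\<sigma> j) / Lp_norm 1 \<mu> (\<sigma> j) \<and>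
     crit_norm ?n \<mu> (\<sigma> j) / Lp_norm 1 \<mu> (\<sigma> j) \<le> (B1 / c1) * real j" if j': "J' \<le> real j" for j
  proof -
    have j: "J \<le> real j" "(8 / R)\<^sup>2 \<le> real j" using j' by (auto simp: J'_def)
    have j0: "0 < real j" using j(1) pos(6) by linarith
    note a = adm[OF j(1)]
    define h where "h = 1 / sqrt (real j)"
    have h: "0 < h" using j0 by (simp add: h_def)
    have h2: "1 / h\<^sup>2 = real j" using j0 by (simp add: h_def power_divide)
    have "8 / R \<le> sqrt (real j)" using real_sqrt_le_mono[OF j(2)] R by simp
    then have h4: "4 * h \<le> R / 2" using R j0 by (simp add: h_def field_simps)
    have Kh: "K / sqrt (real j) = K * h" by (simp add: h_def)
    have nr: "m \<le> s j r" if "0 < r" "r \<le> 4 * h" for r using near[OF j(1) that(1)] that(2) by (simp add: h_def)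
    have nr2: "m \<le> s j r" if "0 < r" "r \<le> 2 * h" for r using nr[of r] that h by simp
    \<comment> \<open>Both summands carry the factor \<open>1 / j\<close>: the first through the
      square of the radius, the second through the parameter \<open>\<epsilon> j\<close>.\<close>
    have "inverse ((2 + C) * (T ^ ?N / (sl * t0 ^ ?N) * (4 * (K / sqrt (real j))\<^sup>2 * (1 + T\<^sup>2) * 2 ^ ?n)) + 1 / (\<epsilon> * real j)) = lo * real j"
    proof -
      have "(2 + C) * (T ^ ?N / (sl * t0 ^ ?N) * (4 * (K / sqrt (real j))\<^sup>2 * (1 + T\<^sup>2) * 2 ^ ?n)) + 1 / (\<epsilon> * real j) = Kc / real j"
        using j0 by (simp add: Kc_def power_divide add_divide_distrib)
      then show ?thesis by (simp add: lo_def divide_inverse)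
    qed
    moreover have "2 * ((L\<^sup>2 * T ^ ?N * 12 ^ ?n / (m * t0 ^ ?N)) / h\<^sup>2) = up * real j"
      unfolding up_def h2[symmetric] by simp
    moreover note admissible_eigenvalue[OF a h h4 pos(5) nr \<beta>(1,2,3,5,4)]
    ultimately have eig: "lo * real j \<le> eigenvalue \<A> \<mu> (\<sigma> j) 2 \<and> eigenvalue \<A> \<mu> (\<sigma> j) 2 \<le> up * real j" by simp
    have h22: "2 * h \<le> R / 2" using h4 h by simp
    have L1: "c1 * h ^ ?n \<le> Lp_norm 1 \<mu> (\<sigma> j)" "Lp_norm 1 \<mu> (\<sigma> j) \<le> c2 * h ^ ?n"
      using admissible_L1[OF a h h22 pos(5) nr2] unfolding Kh
      by (simp_all add: c1_def c2_def power_divide power_mult_distrib mult_ac)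
    have cr: "A1 * h ^ (?n - 2) \<le> crit_norm ?n \<mu> (\<sigma> j) \<and> crit_norm ?n \<mu> (\<sigma> j) \<le> B1 * h ^ (?n - 2)"
    proof (cases "?n = 2")
      case True
      then show ?thesis using admissible_Linf[OF a h h22 pos(5) nr2] by (simp add: crit_norm_def A1_def B1_def)
    next
      case False
      then have n2: "2 < ?n" using dim by simp
      have q1: "1 \<le> q" using n2 by (simp add: q_def field_simps)
      have "m powr q * t0 ^ ?N * (?vb * (h / 4) ^ ?n) = (m powr q * t0 ^ ?N * ?vb / 4 ^ ?n) * h ^ ?n"
        by (simp add: power_divide)
      moreover have "(2 + C) * (T ^ ?N * (?vb * (K * h) ^ ?n)) = c2 * h ^ ?n"
        by (simp add: c2_def power_mult_distrib mult_ac)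
      moreover have "(m powr q * t0 ^ ?N * ?vb / 4 ^ ?n * h ^ ?n) powr (1 / q) = (m powr q * t0 ^ ?N * ?vb / 4 ^ ?n) powr (1 / q) * h ^ (?n - 2)"
        unfolding q_def using t0(1) vb h n2 by (intro powr_scaled_power) auto
      moreover have "(c2 * h ^ ?n) powr (1 / q) = c2 powr (1 / q) * h ^ (?n - 2)"
        unfolding q_def using cpos(4) h n2 by (intro powr_scaled_power) auto
      ultimately show ?thesis
        using admissible_Lp[OF a q1 h h22 pos(5) nr2] False unfolding Kh
        by (simp add: crit_norm_def A1_def B1_def q_def)
    qed
    have hn: "h ^ ?n = h ^ (?n - 2) * h\<^sup>2"
    proof -
      have "?n - 2 + 2 = ?n" using dim by simp
      then show ?thesis by (metis power_add)
    qed
    have hp: "0 < h ^ ?n" "0 < h ^ (?n - 2)" using h by auto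
    have L1p: "0 < Lp_norm 1 \<mu> (\<sigma> j)" using less_le_trans[OF mult_pos_pos[OF cpos(3) hp(1)] L1(1)] .
    have "(A1 / c2) * real j = A1 * h ^ (?n - 2) / (c2 * h ^ ?n)"
      unfolding h2[symmetric] hn using hp by simp
    also have "\<dots> \<le> crit_norm ?n \<mu> (\<sigma> j) / Lp_norm 1 \<mu> (\<sigma> j)"
    proof (rule frac_le)
      show "0 \<le> crit_norm ?n \<mu> (\<sigma> j)" using cr mult_pos_pos[OF cpos(5) hp(2)] by linarith
    qed (use cr L1 L1p in auto)
    finally have r1: "(A1 / c2) * real j \<le> crit_norm ?n \<mu> (\<sigma> j) / Lp_norm 1 \<mu> (\<sigma> j)" .
    have "crit_norm ?n \<mu> (\<sigma> j) / Lp_norm 1 \<mu> (\<sigma> j) \<le> B1 * h ^ (?n - 2) / (c1 * h ^ ?n)"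
    proof (rule frac_le)
      show "0 \<le> B1 * h ^ (?n - 2)" using mult_pos_pos[OF cpos(6) hp(2)] by linarith
      show "0 < c1 * h ^ ?n" by (rule mult_pos_pos[OF cpos(3) hp(1)])
    qed (use cr L1 in auto)
    also have "\<dots> = (B1 / c1) * real j"
      unfolding h2[symmetric] hn using hp by simp
    finally show ?thesis using eig r1 by blast
  qed
  have ev: "\<forall>\<^sub>F j in sequentially. J' \<le> real j"
    using filterlim_real_sequentially by (simp add: filterlim_at_top)
  have 1: "\<exists>A B. 0 < A \<and> 0 < B \<and> (\<forall>\<^sub>F j in sequentially.
            A * (crit_norm ?n \<mu> (\<sigma> j) / Lp_norm 1 \<mu> (\<sigma> j)) \<le> eigenvalue \<A> \<mu> (\<sigma> j) 2 \<and>
            eigenvalue \<A> \<mu> (\<sigma> j) 2 \<le> B * (crit_norm ?n \<mu> (\<sigma> j) / Lp_norm 1 \<mu> (\<sigma> j)))"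
  proof (intro exI conjI)
    \<comment> \<open>The eigenvalue and the quotient of norms are both comparable to
      \<open>j\<close>; the witnesses are quotients of the comparison constants.\<close>
    show "0 < lo / (B1 / c1)" "0 < up / (A1 / c2)" using cpos by auto
    show "\<forall>\<^sub>F j in sequentially. lo / (B1 / c1) * (crit_norm ?n \<mu> (\<sigma> j) / Lp_norm 1 \<mu> (\<sigma> j)) \<le> eigenvalue \<A> \<mu> (\<sigma> j) 2 \<and>
       eigenvalue \<A> \<mu> (\<sigma> j) 2 \<le> up / (A1 / c2) * (crit_norm ?n \<mu> (\<sigma> j) / Lp_norm 1 \<mu> (\<sigma> j))"
      using ev
    proof eventually_elim
      case (elim j)
      let ?r = "crit_norm ?n \<mu> (\<sigma> j) / Lp_norm 1 \<mu> (\<sigma> j)"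
      have "lo / (B1 / c1) * ?r \<le> lo / (B1 / c1) * ((B1 / c1) * real j)"
        using key[OF elim] cpos by (intro mult_left_mono) auto
      also have "\<dots> = lo * real j" using cpos by simp
      finally have a: "lo / (B1 / c1) * ?r \<le> lo * real j" .
      have "up * real j = up / (A1 / c2) * ((A1 / c2) * real j)" using cpos by simp
      also have "\<dots> \<le> up / (A1 / c2) * ?r" using key[OF elim] cpos by (intro mult_left_mono) auto
      finally show ?case using a key[OF elim] by linarith
    qed
  qed
  have 2: "filterlim (\<lambda>j. eigenvalue \<A> \<mu> (\<sigma> j) 2) at_top sequentially"
  proof (rule filterlim_at_top_mono)
    show "filterlim (\<lambda>j. lo * real j) at_top sequentially"
      using cpos(1) by (intro filterlim_tendsto_pos_mult_at_top[OF tendsto_const _ filterlim_real_sequentially])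
    show "\<forall>\<^sub>F j in sequentially. lo * real j \<le> eigenvalue \<A> \<mu> (\<sigma> j) 2"
      using ev by eventually_elim (use key in blast)
  qed
  have 3: "\<exists>C D. 0 < C \<and> 0 < D \<and> (\<forall>\<^sub>F j in sequentially.
            C * real j \<le> eigenvalue \<A> \<mu> (\<sigma> j) 2 \<and> eigenvalue \<A> \<mu> (\<sigma> j) 2 \<le> D * real j)"
  proof (intro exI conjI)
    show "\<forall>\<^sub>F j in sequentially. lo * real j \<le> eigenvalue \<A> \<mu> (\<sigma> j) 2 \<and> eigenvalue \<A> \<mu> (\<sigma> j) 2 \<le> up * real j"
      using ev by eventually_elim (use key in blast)
  qed (use cpos(1,2) in auto)
  show ?thesis unfolding eigenvalue_asymptotics_def using 1 2 3 by (intro conjI)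
qed

end

context warped
begin

text \<open>The preimage of an open set is the polar image of a Borel set together with finitely
  many points of \<open>F\<close>.\<close>

lemma radial_measurable:
  assumes \<phi>[measurable]: "\<phi> \<in> borel_measurable borel"
    and f: "\<And>p. p \<in> M - F \<Longrightarrow> f p = (\<phi> (norm (inv_polar p)) :: real)"
  shows "f \<in> borel_measurable \<mu>"
proof (rule borel_measurableI)
  fix S :: "real set" assume "open S"
  then have [measurable]: "S \<in> sets borel" by simp
  define B where "B = {x \<in> Z. \<phi> (norm x) \<in> S}"
  have "B = Z \<inter> ((\<lambda>x. \<phi> (norm x)) -` S \<inter> space borel)" by (auto simp: B_def)
  then have B: "B \<in> sets borel" "B \<subseteq> Z" by (auto simp: B_def intro!: sets.Int measurable_sets[of _ borel borel])
  have "f -` S \<inter> space \<mu> = polar_map \<Phi> ` B \<union> (\<Union>p\<in>f -` S \<inter> F. {p})"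
  proof (intro equalityI subsetI)
    fix p assume p: "p \<in> f -` S \<inter> space \<mu>"
    show "p \<in> polar_map \<Phi> ` B \<union> (\<Union>p\<in>f -` S \<inter> F. {p})"
    proof (cases "p \<in> F")
      case False
      then have pM: "p \<in> M - F" using p space_\<mu> by simp
      then have "inv_polar p \<in> B" using p f[OF pM] polar_map_inv_polar[OF pM] by (simp add: B_def)
      then show ?thesis using polar_map_inv_polar[OF pM] by (metis UnI1 image_eqI)
    qed (use p in auto)
  next
    fix p assume "p \<in> polar_map \<Phi> ` B \<union> (\<Union>p\<in>f -` S \<inter> F. {p})"
    then consider x where "x \<in> B" "p = polar_map \<Phi> x" | "p \<in> F" "f p \<in> S" by auto
    then show "p \<in> f -` S \<inter> space \<mu>"
    proof cases
      case 1
      then have x: "x \<in> Z" "\<phi> (norm x) \<in> S" by (auto simp: B_def)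
      then show ?thesis using f[OF polar_map_in[OF x(1)]] inv_polar_polar_map[OF x(1)] polar_map_in[OF x(1)] 1 space_\<mu> by simp
    next
      case 2
      then show ?thesis using F space_\<mu> by auto
    qed
  qed
  moreover have "{p} \<in> sets \<mu>" if "p \<in> F" for p
    using that F by (auto simp: sets_\<mu> sets_restrict_space intro!: image_eqI[of _ _ "{p}"])
  then have "(\<Union>p\<in>f -` S \<inter> F. {p}) \<in> sets \<mu>" using F by (intro sets.finite_UN) auto
  ultimately show "f -` S \<inter> space \<mu> \<in> sets \<mu>" using polar_image_sets[OF B] by simp
qed

end

text \<open>The positive part merges the two branches, which makes continuity immediate.\<close>

lemma h_fun_eq: "h_fun \<alpha> R j r = r - \<alpha> * real j / 2 * (max 0 (r - (R - 1 / (\<alpha> * real j))))\<^sup>2"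
  by (simp add: h_fun_def Let_def max_def)

lemma h_fun_id: "r \<le> R - 1 / (\<alpha> * real j) \<Longrightarrow> h_fun \<alpha> R j r = r"
  by (simp add: h_fun_def)

lemma continuous_on_h_fun: "continuous_on S (h_fun \<alpha> R j)"
  unfolding h_fun_eq[abs_def] by (intro continuous_intros)

text \<open>The derivative falls linearly from 1 at the start of the tail to 0 at \<open>R\<close>,
  since the tail has length \<open>1 / (\<alpha> j)\<close>. The condition
  \<open>1 \<le> \<alpha> * real j * R\<close> says that the tail starts at a nonnegative
  radius.\<close>

lemma h_fun_tail:
  assumes aj: "1 \<le> \<alpha> * real j * R" "0 < \<alpha> * real j" and R: "0 < R"
    and r: "R - 1 / (\<alpha> * real j) < r" "r < R"
  shows "(h_fun \<alpha> R j has_real_derivative 1 - \<alpha> * real j * (r - (R - 1 / (\<alpha> * real j)))) (at r)"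
    and "0 \<le> h_fun \<alpha> R j r" and "0 \<le> 1 - \<alpha> * real j * (r - (R - 1 / (\<alpha> * real j)))"
proof -
  define a rj where "a = \<alpha> * real j" and "rj = R - 1 / a"
  have a: "0 < a" "1 \<le> a * R" using aj by (auto simp: a_def)
  have r': "rj < r" "r < R" using r by (auto simp: a_def rj_def)
  have d: "r - rj < 1 / a" using r'(2) by (simp add: rj_def)
  have "a * (r - rj) \<le> a * (1 / a)" using d a by (intro mult_left_mono) auto
  then have ad: "a * (r - rj) \<le> 1" using a by simp
  then show "0 \<le> 1 - \<alpha> * real j * (r - (R - 1 / (\<alpha> * real j)))" by (simp add: a_def rj_def)
  have "((\<lambda>r. r - a / 2 * (r - rj)\<^sup>2) has_real_derivative 1 - a * (r - rj)) (at r)"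
    by (auto intro!: derivative_eq_intros)
  then have "(h_fun \<alpha> R j has_real_derivative 1 - a * (r - rj)) (at r)"
    by (rule has_field_derivative_transform_within_open[of _ _ _ "{rj<..}"]) (use r' in \<open>auto simp: h_fun_def a_def rj_def\<close>)
  then show "(h_fun \<alpha> R j has_real_derivative 1 - \<alpha> * real j * (r - (R - 1 / (\<alpha> * real j)))) (at r)"
    by (simp add: a_def rj_def)
  have "0 \<le> rj" using a R by (simp add: rj_def field_simps)
  have "a / 2 * (r - rj)\<^sup>2 = (a * (r - rj)) * (r - rj) / 2" by (simp add: power2_eq_square)
  also have "\<dots> \<le> 1 * (r - rj) / 2" using ad r' by (intro divide_right_mono mult_right_mono) auto
  also have "\<dots> \<le> r" using \<open>0 \<le> rj\<close> r' by simp
  finally show "0 \<le> h_fun \<alpha> R j r" using r' by (simp add: h_fun_def a_def rj_def)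
qed


context revolution
begin

text \<open>Separates the scaling argument from the geometry: \<open>a j\<close> is a radius up to
  which the exponent is exactly \<open>- j r^2\<close>, and \<open>lb\<close> keeps it away from 0
  uniformly in \<open>j\<close>.\<close>

lemma gaussian_asymptotics:
  fixes h h' :: "nat \<Rightarrow> real \<Rightarrow> real" and radius :: "'p \<Rightarrow> real"
  assumes k: "0 \<le> k" "\<And>r. 0 < r \<Longrightarrow> r < R \<Longrightarrow> r * \<theta>' r \<le> k * \<theta> r"
    and \<epsilon>: "0 < \<epsilon>" "\<epsilon> \<le> 1" and a: "0 < lb" "\<And>j. J \<le> real j \<Longrightarrow> lb \<le> a j"
    and h: "\<And>j. J \<le> real j \<Longrightarrow> continuous_on UNIV (h j)" "\<And>j r. J \<le> real j \<Longrightarrow> r \<le> a j \<Longrightarrow> h j r = r"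
      "\<And>j r. J \<le> real j \<Longrightarrow> a j < r \<Longrightarrow> r < R \<Longrightarrow> (h j has_real_derivative h' j r) (at r) \<and> 0 \<le> h j r \<and> 0 \<le> h' j r"
    and far: "\<And>j r. J \<le> real j \<Longrightarrow> a j < r \<Longrightarrow> r < R \<Longrightarrow>
      real (CARD('n) - 1) * (r * \<theta>' r) \<le> - (2 + \<epsilon> * real j * r\<^sup>2) * \<theta> r"
    and radius: "\<And>p. p \<in> M - F \<Longrightarrow> radius p = norm (inv_polar p)"
    and \<sigma>: "\<sigma> = (\<lambda>j p. exp (- (real j * (h j (radius p))\<^sup>2)))"
  shows "eigenvalue_asymptotics \<A> \<mu> \<sigma>"
proof -
  define C where "C = real (CARD('n) - 1) * k"
  define K where "K = sqrt (C + 2)"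
  have C: "0 \<le> C" unfolding C_def by (rule mult_nonneg_nonneg[OF of_nat_0_le_iff k(1)])
  then have K: "0 < K" by (simp add: K_def)
  define m where "m = min (R / 2) lb"
  have m: "0 < m" "m \<le> R / 2" "m \<le> lb" using a(1) R by (auto simp: m_def)
  \<comment> \<open>Puts the radii \<open>K / sqrt j\<close> and \<open>4 / sqrt j\<close> below
    \<open>R / 2\<close> and \<open>lb\<close>, hence into the range where
    \<open>h j r = r\<close>.\<close>
  define J' where "J' = max J ((max K 4 / m)\<^sup>2)"
  have J': "J \<le> J'" "0 < J'" using K m by (auto simp: J'_def less_max_iff_disj)
  have small: "K / sqrt (real j) \<le> m" "4 / sqrt (real j) \<le> m" if "J' \<le> real j" for j
  proof -
    have j: "0 < sqrt (real j)" using that J' by simp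
    have "max K 4 / m \<le> sqrt (real j)"
      using that K m by (intro real_le_rsqrt) (auto simp: J'_def)
    then have "max K 4 / sqrt (real j) \<le> m" using j m by (simp add: field_simps)
    moreover have "K / sqrt (real j) \<le> max K 4 / sqrt (real j)" "4 / sqrt (real j) \<le> max K 4 / sqrt (real j)"
      using j by (auto intro!: divide_right_mono)
    ultimately show "K / sqrt (real j) \<le> m" "4 / sqrt (real j) \<le> m" by linarith+
  qed
  show ?thesis
  proof (rule asymptotics[where s = "\<lambda>j r. exp (- (real j * (h j r)\<^sup>2))" and C = C and K = K and \<epsilon> = \<epsilon> and sl = "exp (- (C + 2))" and m = "exp (- 16)" and J = J'])
    fix j assume j: "J' \<le> real j"
    then have jJ: "J \<le> real j" and j0: "0 < real j" using J' by linarith+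
    have \<sigma>j: "\<sigma> j = (\<lambda>p. exp (- (real j * (h j (radius p))\<^sup>2)))" using \<sigma> by simp
    have hm: "h j \<in> borel_measurable borel" by (rule borel_measurable_continuous_onI[OF h(1)[OF jJ]])
    show "admissible (\<lambda>r. exp (- (real j * (h j r)\<^sup>2))) (K / sqrt (real j)) (\<epsilon> * real j) C (exp (- (C + 2))) (\<sigma> j)"
      unfolding K_def C_def
    proof (rule gaussian_weight_admissible[OF k j0 \<epsilon>, where a = "a j" and h' = "h' j"], unfold C_def[symmetric] K_def[symmetric])
      show "K / sqrt (real j) \<le> R / 2" "K / sqrt (real j) \<le> a j" using small[OF j] m a(2)[OF jJ] by linarith+
      show "continuous_on {0<..<R} (h j)" using h(1)[OF jJ] by (rule continuous_on_subset) simp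
      show "\<sigma> j \<in> borel_measurable \<mu>"
      proof (rule radial_measurable[where \<phi> = "\<lambda>r. exp (- (real j * (h j r)\<^sup>2))"])
        show "(\<lambda>r. exp (- (real j * (h j r)\<^sup>2))) \<in> borel_measurable borel" using hm by measurable
        show "\<sigma> j p = exp (- (real j * (h j (norm (inv_polar p)))\<^sup>2))" if "p \<in> M - F" for p
          using radius[OF that] by (simp add: \<sigma>j)
      qed
      show "0 < \<sigma> j p \<and> \<sigma> j p \<le> 1" for p by (simp add: \<sigma>j)
      fix x :: "real^'n" assume x: "0 < norm x" "norm x < R"
      have Zx: "x \<in> Z" by (rule interior_Z[OF x])
      show "\<sigma> j (polar_map \<Phi> x) = exp (- (real j * (h j (norm x))\<^sup>2))"
        using radius[OF polar_map_in[OF Zx]] inv_polar_polar_map[OF Zx] by (simp add: \<sigma>j)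
    qed (use h(2,3)[OF jJ] far[OF jJ] in blast)+
    fix r assume r: "0 < r" "r \<le> 4 / sqrt (real j)"
    have "r \<le> a j" using r small(2)[OF j] m a(2)[OF jJ] by linarith
    then have hr: "h j r = r" by (rule h(2)[OF jJ])
    \<comment> \<open>The number 16 is \<open>j r^2\<close> at the outermost radius
      \<open>4 / sqrt j\<close> of the bumps.\<close>
    have "r\<^sup>2 \<le> (4 / sqrt (real j))\<^sup>2" using r by (intro power_mono) auto
    also have "\<dots> = 16 / real j" using j0 by (simp add: power_divide)
    finally have "real j * r\<^sup>2 \<le> 16" using j0 by (simp add: field_simps)
    then show "exp (- 16) \<le> exp (- (real j * (h j r)\<^sup>2))" by (simp add: hr)
  qed (use C K \<epsilon> J' in auto)
qed

end

section \<open>The two kinds of revolution manifold\<close>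

lemma revolution_boundary_asymptotics:
  fixes M :: "'p::{t2_space, second_countable_topology} set"
    and \<A> :: "('p, 'n::finite) rchart set"
  assumes dim: "2 \<le> CARD('n)" and vol: "riemannian_volume M \<A> \<mu>"
    and rm: "revolution_manifold_boundary M \<A> N R \<theta> \<Phi>"
    and \<sigma>: "\<sigma> = (\<lambda>j p. exp (- (real j * (radius_boundary N R \<Phi> p)\<^sup>2)))"
  shows "eigenvalue_asymptotics \<A> \<mu> \<sigma>"
proof -
  have at: "riemannian_atlas M \<A>" and cM: "compact M" and N: "N \<in> M" and R: "0 < R"
    and sm: "smooth_on {0..R} \<theta>" and pos: "\<And>r. r \<in> {0<..R} \<Longrightarrow> 0 < \<theta> r" and z: "\<theta> 0 = 0"
    and wi: "warped_isometry \<A> \<theta> {0<..R} \<Phi> (M - {N})"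
    using rm by (auto simp: revolution_manifold_boundary_def riemannian_manifold_def)
  obtain \<theta>' where d: "\<And>r. r \<in> {0..R} \<Longrightarrow> (\<theta> has_real_derivative \<theta>' r) (at r within {0..R})" and d0: "\<theta>' 0 = 1"
    using rm unfolding revolution_manifold_boundary_def by blast
  have ct: "continuous_on {0..R} \<theta>" by (rule DERIV_continuous_on[OF d])
  have pos': "0 < \<theta> r" if "0 < r" "r < R" for r using pos[of r] that by simp
  obtain T t0 where T: "0 < T" and t0: "0 < t0" and Tr: "\<And>r. 0 < r \<Longrightarrow> r < R \<Longrightarrow> \<theta> r \<le> T * r"
    and T': "\<And>r. r \<in> {0..R} \<Longrightarrow> \<bar>\<theta>' r\<bar> \<le> T" and t0r: "\<And>r. 0 < r \<Longrightarrow> r \<le> R / 2 \<Longrightarrow> t0 * r \<le> \<theta> r"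
    using profile_bounds[OF R d derivative_continuous_on_interval[OF R sm d] z d0 pos'] by metis
  obtain k where k: "0 \<le> k" "\<And>r. 0 < r \<Longrightarrow> r < R \<Longrightarrow> r * \<theta>' r \<le> k * \<theta> r"
  proof (rule profile_log_derivative[OF R ct T T' t0 t0r pos', where b = R])
    show "R / 2 \<le> R" "R \<le> R" using R by auto
    show "0 < \<theta> r" if "R / 2 \<le> r" "r \<le> R" for r using pos[of r] that R by simp
  qed auto
  interpret revolution M \<A> \<mu> \<theta> "{0<..R}" \<Phi> "{N}" R T t0 \<theta>'
  proof
    show "continuous_on {0<..R} \<theta>" using ct by (rule continuous_on_subset) auto
    show "(\<theta> has_real_derivative \<theta>' r) (at r)" if "0 < r" "r < R" for r
      using d[of r] at_within_Icc_at[OF that] that by simp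
  qed (use dim vol at cM N R wi pos T Tr t0 t0r in auto)
  \<comment> \<open>With a boundary, \<open>\<theta>\<close> stays positive up to \<open>R\<close>;
    the choice \<open>a = R\<close> leaves no tail, and the conditions on the tail hold
    vacuously.\<close>
  show ?thesis
  proof (rule gaussian_asymptotics[where h = "\<lambda>j r. r" and h' = "\<lambda>j r. 1" and \<epsilon> = 1 and a = "\<lambda>j. R" and J = 0 and radius = "radius_boundary N R \<Phi>", OF k _ _ R])
    show "radius_boundary N R \<Phi> p = norm (inv_polar p)" if "p \<in> M - {N}" for p
      using norm_inv_polar[OF that] that by (simp add: radius_boundary_def)
  qed (auto simp: \<sigma>)
qed

lemma closed_revolution_asymptotics:
  fixes M :: "'p::{t2_space, second_countable_topology} set"
    and \<A> :: "('p, 'n::finite) rchart set"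
  assumes dim: "2 \<le> CARD('n)" and vol: "riemannian_volume M \<A> \<mu>"
    and rm: "closed_revolution_manifold M \<A> N S R \<theta> \<Phi>" and \<alpha>: "1 \<le> \<alpha>"
    and \<sigma>: "\<sigma> = (\<lambda>j p. exp (- (real j * (h_fun \<alpha> R j (radius_closed N S R \<Phi> p))\<^sup>2)))"
  shows "eigenvalue_asymptotics \<A> \<mu> \<sigma>"
proof -
  have at: "riemannian_atlas M \<A>" and cM: "compact M" and NS: "N \<in> M" "S \<in> M" and R: "0 < R"
    and sm: "smooth_on {0..R} \<theta>" and pos: "\<And>r. 0 < r \<Longrightarrow> r < R \<Longrightarrow> 0 < \<theta> r" and z: "\<theta> 0 = 0" "\<theta> R = 0"
    and wi: "warped_isometry \<A> \<theta> {0<..<R} \<Phi> (M - {N, S})"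
    using rm by (auto simp: closed_revolution_manifold_def riemannian_manifold_def)
  obtain \<theta>' where d: "\<And>r. r \<in> {0..R} \<Longrightarrow> (\<theta> has_real_derivative \<theta>' r) (at r within {0..R})"
    and d0: "\<theta>' 0 = 1" and dR: "- \<theta>' R = 1"
    using rm unfolding closed_revolution_manifold_def by blast
  have ct: "continuous_on {0..R} \<theta>" by (rule DERIV_continuous_on[OF d])
  have ct': "continuous_on {0..R} \<theta>'" by (rule derivative_continuous_on_interval[OF R sm d])
  obtain T t0 where T: "0 < T" and t0: "0 < t0" and Tr: "\<And>r. 0 < r \<Longrightarrow> r < R \<Longrightarrow> \<theta> r \<le> T * r"
    and T': "\<And>r. r \<in> {0..R} \<Longrightarrow> \<bar>\<theta>' r\<bar> \<le> T" and t0r: "\<And>r. 0 < r \<Longrightarrow> r \<le> R / 2 \<Longrightarrow> t0 * r \<le> \<theta> r"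
    using profile_bounds[OF R d ct' z(1) d0 pos] by metis
  have "R \<in> {0..R}" using R by simp
  from ct'[unfolded continuous_on_iff, rule_format, OF this, of "1 / 2"] obtain \<delta> where
    \<delta>: "0 < \<delta>" "\<And>r. r \<in> {0..R} \<Longrightarrow> dist r R < \<delta> \<Longrightarrow> dist (\<theta>' r) (\<theta>' R) < 1 / 2" by auto
  \<comment> \<open>Beyond \<open>b\<close> the derivative of the profile is at most
    \<open>- 1 / 2\<close>; the maximum with \<open>R / 2\<close> keeps radii on the tail comparable
    to \<open>R\<close>.\<close>
  define b where "b = max (R / 2) (R - \<delta> / 2)"
  have b: "R / 2 \<le> b" "b < R" "R - \<delta> < b" using \<delta>(1) R by (auto simp: b_def)
  have neg: "\<theta>' r \<le> - (1 / 2)" if r: "b < r" "r < R" for r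
  proof -
    have "dist r R < \<delta>" using r b by (simp add: dist_real_def)
    then have "dist (\<theta>' r) (\<theta>' R) < 1 / 2" using r b R by (intro \<delta>(2)) auto
    then show ?thesis using dR unfolding dist_real_def by linarith
  qed
  have up: "\<theta> r \<le> T * (R - r)" if r: "0 < r" "r < R" for r
  proof -
    obtain y where y: "r < y" "y < R" "\<theta> R - \<theta> r = \<theta>' y * (R - r)"
      by (rule profile_mvt[OF d, of r R]) (use r in auto)
    have "- \<theta>' y * (R - r) \<le> T * (R - r)" using T'[of y] y r by (intro mult_right_mono) auto
    then show ?thesis using y(3) z by simp
  qed
  obtain k where k: "0 \<le> k" "\<And>r. 0 < r \<Longrightarrow> r < R \<Longrightarrow> r * \<theta>' r \<le> k * \<theta> r"
  proof (rule profile_log_derivative[OF R ct T T' t0 t0r pos, where b = b])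
    show "R / 2 \<le> b" "b \<le> R" using b by auto
    show "0 < \<theta> r" if "R / 2 \<le> r" "r \<le> b" for r using pos[of r] that b R by simp
    show "\<theta>' r \<le> 0" if "b < r" "r < R" for r using neg[OF that] by simp
  qed auto
  interpret revolution M \<A> \<mu> \<theta> "{0<..<R}" \<Phi> "{N, S}" R T t0 \<theta>'
  proof
    show "continuous_on {0<..<R} \<theta>" using ct by (rule continuous_on_subset) auto
    show "(\<theta> has_real_derivative \<theta>' r) (at r)" if "0 < r" "r < R" for r
      using d[of r] at_within_Icc_at[OF that] that by simp
  qed (use dim vol at cM NS R wi pos T Tr t0 t0r in auto)
  \<comment> \<open>On the tail \<open>r \<ge> R / 2\<close> and
    \<open>\<theta>' \<le> - 1 / 2\<close>, so it suffices that
    \<open>2 \<theta> + \<epsilon> j r^2 \<theta> \<le> R / 4\<close>. As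
    \<open>\<theta> \<le> T / j\<close> there, the second entry of \<open>J\<close> makes the first
    term at most \<open>R / 8\<close>, and \<open>\<epsilon>\<close> does this for the second term.
    The first entry of \<open>J\<close> places the tail beyond \<open>b\<close>.\<close>
  define \<epsilon> where "\<epsilon> = min 1 (1 / (8 * R * T))"
  define J where "J = max (1 / (R - b)) (16 * T / R)"
  have \<epsilon>: "0 < \<epsilon>" "\<epsilon> \<le> 1" "\<epsilon> \<le> 1 / (8 * R * T)" using R T by (auto simp: \<epsilon>_def)
  let ?a = "\<lambda>j. R - 1 / (\<alpha> * real j)"
  have Jj: "0 < real j" "0 < \<alpha> * real j" "1 / (\<alpha> * real j) \<le> 1 / real j" "b \<le> ?a j" "1 \<le> \<alpha> * real j * R" "16 * T \<le> R * real j" if "J \<le> real j" for j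
  proof -
    have j: "1 / (R - b) \<le> real j" "16 * T / R \<le> real j" using that by (auto simp: J_def)
    have "0 < 1 / (R - b)" using b by simp
    then show j0: "0 < real j" using j(1) by linarith
    then show aj: "0 < \<alpha> * real j" using \<alpha> by simp
    have jj: "real j \<le> \<alpha> * real j" using mult_right_mono[OF \<alpha>, of "real j"] by simp
    then show le: "1 / (\<alpha> * real j) \<le> 1 / real j" using j0 by (intro divide_left_mono) auto
    have "1 / real j \<le> R - b" using j(1) j0 b by (simp add: field_simps)
    then show ba: "b \<le> ?a j" using le by linarith
    have "1 / (\<alpha> * real j) \<le> R" using ba b R by linarith
    then show "1 \<le> \<alpha> * real j * R" using aj by (simp add: field_simps)
    show "16 * T \<le> R * real j" using j(2) R by (simp add: field_simps)
  qed
  show ?thesis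
  proof (rule gaussian_asymptotics[where h = "h_fun \<alpha> R" and h' = "\<lambda>j r. 1 - \<alpha> * real j * (r - ?a j)" and a = ?a and J = J and lb = b and radius = "radius_closed N S R \<Phi>", OF k \<epsilon>(1,2)])
    show "0 < b" using b R by linarith
    show "radius_closed N S R \<Phi> p = norm (inv_polar p)" if "p \<in> M - {N, S}" for p
      using norm_inv_polar[OF that] that by (simp add: radius_closed_def)
    fix j assume j: "J \<le> real j"
    note j' = Jj[OF j]
    show "b \<le> ?a j" by (rule j'(4))
    show "continuous_on UNIV (h_fun \<alpha> R j)" by (rule continuous_on_h_fun)
    show "h_fun \<alpha> R j r = r" if "r \<le> ?a j" for r using that by (rule h_fun_id)
    fix r assume r: "?a j < r" "r < R"
    show "(h_fun \<alpha> R j has_real_derivative 1 - \<alpha> * real j * (r - ?a j)) (at r) \<and> 0 \<le> h_fun \<alpha> R j r \<and> 0 \<le> 1 - \<alpha> * real j * (r - ?a j)"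
      using h_fun_tail[OF j'(5,2) R r] by blast
    have rb: "b < r" "R / 2 \<le> r" "0 < r" using r j'(4) b R by linarith+
    \<comment> \<open>The tail has length at most \<open>1 / j\<close>, and \<open>\<theta>\<close>
      vanishes at \<open>R\<close> with slope bounded by \<open>T\<close>.\<close>
    have "\<theta> r \<le> T * (1 / real j)"
      using up[OF rb(3) r(2)] mult_left_mono[of "R - r" "1 / real j" T] r j'(3) T by linarith
    then have th: "real j * \<theta> r \<le> T" using j'(1) by (simp add: field_simps)
    have "16 * (real j * \<theta> r) \<le> R * real j" using th j'(6) by linarith
    then have t1: "2 * \<theta> r \<le> R / 8" using j'(1) by (simp add: field_simps)
    have "\<epsilon> * real j * r\<^sup>2 * \<theta> r = (\<epsilon> * r\<^sup>2) * (real j * \<theta> r)" by simp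
    also have "\<dots> \<le> ((1 / (8 * R * T)) * R\<^sup>2) * T"
      using th \<epsilon> r rb T pos[OF rb(3) r(2)] R by (intro mult_mono power_mono) auto
    also have "\<dots> = R / 8" using R T by (simp add: power2_eq_square)
    finally have t2: "\<epsilon> * real j * r\<^sup>2 * \<theta> r \<le> R / 8" .
    have rt: "r * \<theta>' r \<le> - (R / 4)"
      using mult_left_mono[OF neg[OF rb(1) r(2)], of r] rb by linarith
    \<comment> \<open>Multiplying the negative quantity \<open>r \<theta>'\<close> by
      \<open>n - 1 \<ge> 1\<close> can only decrease it; the dimension bound enters here.\<close>
    have "1 \<le> real (CARD('n) - 1)" using dim by simp
    then have "real (CARD('n) - 1) * (r * \<theta>' r) \<le> 1 * (r * \<theta>' r)"
      using rt R by (intro mult_right_mono_neg) auto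
    also have "\<dots> \<le> - (2 * \<theta> r + \<epsilon> * real j * r\<^sup>2 * \<theta> r)" using rt t1 t2 by linarith
    finally show "real (CARD('n) - 1) * (r * \<theta>' r) \<le> - (2 + \<epsilon> * real j * r\<^sup>2) * \<theta> r" by (simp add: algebra_simps)
  qed (use \<sigma> in auto)
qed

theorem theorem5p4:
  fixes M :: "'p::{t2_space, second_countable_topology} set"
    and \<A> :: "('p, 'n::finite) rchart set"
    and \<mu> :: "'p measure" and N S :: 'p and R \<alpha> :: real and \<theta> :: "real \<Rightarrow> real"
    and \<Phi> :: "real \<times> (real^'n) \<Rightarrow> 'p" and \<sigma> :: "nat \<Rightarrow> 'p \<Rightarrow> real"
  assumes dim: "2 \<le> CARD('n)"
    and vol: "riemannian_volume M \<A> \<mu>"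
    and cases:
      "revolution_manifold_boundary M \<A> N R \<theta> \<Phi> \<and>
         \<sigma> = (\<lambda>j p. exp (- (real j * (radius_boundary N R \<Phi> p)\<^sup>2)))
       \<or> closed_revolution_manifold M \<A> N S R \<theta> \<Phi> \<and>
         1 \<le> \<alpha> \<and> 2 \<le> (real CARD('n) - 1) * \<alpha>\<^sup>2 / 16 - 2 * \<alpha> * R \<and>
         \<sigma> = (\<lambda>j p. exp (- (real j * (h_fun \<alpha> R j (radius_closed N S R \<Phi> p))\<^sup>2)))"
  shows "(\<exists>A B. 0 < A \<and> 0 < B \<and> (\<forall>\<^sub>F j in sequentially.
            A * (crit_norm CARD('n) \<mu> (\<sigma> j) / Lp_norm 1 \<mu> (\<sigma> j)) \<le> eigenvalue \<A> \<mu> (\<sigma> j) 2 \<and>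
            eigenvalue \<A> \<mu> (\<sigma> j) 2 \<le> B * (crit_norm CARD('n) \<mu> (\<sigma> j) / Lp_norm 1 \<mu> (\<sigma> j))))
       \<and> filterlim (\<lambda>j. eigenvalue \<A> \<mu> (\<sigma> j) 2) at_top sequentially
       \<and> (\<exists>C D. 0 < C \<and> 0 < D \<and> (\<forall>\<^sub>F j in sequentially.
            C * real j \<le> eigenvalue \<A> \<mu> (\<sigma> j) 2 \<and> eigenvalue \<A> \<mu> (\<sigma> j) 2 \<le> D * real j))"
  using cases
  unfolding eigenvalue_asymptotics_def[symmetric]
  by (elim disjE conjE) (rule revolution_boundary_asymptotics[OF dim vol] closed_revolution_asymptotics[OF dim vol]; assumption)+

end
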